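(* Let $\Omega\subset\mathbb{R}^N$ be a bounded smooth domain and let $F:\overline{\Omega}\times\mathbb{R}^2\to\mathbb{R}$ satisfy the following conditions, where $\nabla F(x,u)$ denotes the gradient of $F$ with respect to $u\in\mathbb{R}^2$, $u\cdot v$ is the usual inner product of $\mathbb{R}^2$, and $2^\star:=2N/(N-2)$ if $N\ge 3$, $2^\star:=\infty$ if $N=1,2$: (F1) $F\in\mathcal{C}^1(\overline{\Omega}\times\mathbb{R}^2,\mathbb{R})$ and $F(x,0)=0$ for every $x\in\overline{\Omega}$. (F2) There are $a>0$ and $p\in(2,2^\star)$ such that $|\nabla F(x,u)|\le a(1+|u|^{p-1})$ for all $x\in\Omega$, $u\in\mathbb{R}^2$. (F3) $F(x,u)/|u|^2\to 0$ as $|u|\to 0$, uniformly in $x$. (F4) $F(x,u)/|u|^2\to\infty$ as $|u|\to\infty$, uniformly in $x$. (F5) $F(x,u)>0$ and $u\cdot\nabla F(x,u)>2F(x,u)$ for all $x\in\overline{\Omega}$ and all $u\in\mathbb{R}^2\setminus\{0\}$. (F6) $\big(v\cdot\nabla F(x,u)\big)(u\cdot v)\ge 0$ for all $x\in\overline{\Omega}$ and all $u,v\in\mathbb{R}^2$. (F7) For all $x\in\overline{\Omega}$ and $u,v\in\mathbb{R}^2$ with $|u|=|v|$: $F(x,u)=F(x,v)$ and $v\cdot\nabla F(x,u)\le u\cdot\nabla F(x,u)$, the latter inequality being strict if in addition $u\ne v$. (F8) For all $x\in\overline{\Omega}$ and $u,v\in\mathbb{R}^2$: if $|u|\ne|v|$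 and $u\cdot v\ne 0$, then $v\cdot\nabla F(x,u)\ne u\cdot\nabla F(x,v)$. Then the noncooperative elliptic system $$-\Delta u=F_u(x,u,v)\ \text{ in }\Omega,\qquad \Delta v=F_v(x,u,v)\ \text{ in }\Omega,\qquad u=v=0\ \text{ on }\partial\Omega,$$ has a ground state solution.
   Context: Here $F_u,F_v$ are the partial derivatives of $F(x,u,v)$ with respect to its second and third (scalar) variables. Solutions of the system are the critical points (solutions of $\Phi'(u,v)=0$, with $\Phi'$ the Fréchet derivative) of the functional $$\Phi(u,v)=\int_\Omega\Big(\tfrac12|\nabla u|^2-\tfrac12|\nabla v|^2-F(x,u,v)\Big)dx$$ on $H_0^1(\Omega)\times H_0^1(\Omega)$. A ground state solution is a nontrivial solution with least energy, i.e. a critical point $z_0\neq 0$ of $\Phi$ such that $\Phi(z_0)\le\Phi(z)$ for every critical point $z\ne 0$ of $\Phi$. *)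

theory Defs
  imports "HOL-Analysis.Analysis"
begin

section \<open>Classical differentiability\<close>

text \<open>Unique, hence meaningful, whenever \<open>f\<close> is differentiable at \<open>x\<close>.\<close>

definition gradient :: "('a::real_inner \<Rightarrow> real) \<Rightarrow> 'a \<Rightarrow> 'a" where
  "gradient f x = (THE D. GDERIV f x :> D)"

lemma gradient_eqI:
  assumes "GDERIV f x :> D"
  shows "gradient f x = D"
proof -
  have "D' = D" if "GDERIV f x :> D'" for D'
  proof -
    have "(\<lambda>h. inner h D') = (\<lambda>h. inner h D)"
      using that assms unfolding gderiv_def by (rule has_derivative_unique)
    hence "inner h D' = inner h D" for h by (rule fun_cong)
    hence "inner (D' - D) (D' - D) = 0" by (simp add: inner_diff_right)
    thus ?thesis by simp
  qed
  with assms show ?thesis unfolding gradient_def by blast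
qed

primrec ck_on :: "nat \<Rightarrow> 'a::euclidean_space set \<Rightarrow> ('a \<Rightarrow> real) \<Rightarrow> bool" where
  "ck_on 0 S f \<longleftrightarrow> continuous_on S f"
| "ck_on (Suc k) S f \<longleftrightarrow>
     (\<forall>x\<in>S. f differentiable (at x)) \<and> (\<forall>v. ck_on k S (\<lambda>x. frechet_derivative f (at x) v))"

definition smooth_on :: "'a::euclidean_space set \<Rightarrow> ('a \<Rightarrow> real) \<Rightarrow> bool" where
  "smooth_on S f \<longleftrightarrow> (\<forall>k. ck_on k S f)"

text \<open>For open \<open>S\<close>: the functions that are continuously differentiable in \<open>S\<close> and that, together
  with their first derivatives, extend continuously to the closure of \<open>S\<close>; the extension of
  \<open>f\<close> is given by the values of \<open>f\<close> on \<open>closure S\<close>.\<close>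

definition C1_up_to_boundary :: "'a::euclidean_space set \<Rightarrow> ('a \<Rightarrow> real) \<Rightarrow> bool" where
  "C1_up_to_boundary S f \<longleftrightarrow> continuous_on (closure S) f \<and>
     (\<exists>D. continuous_on (closure S) D \<and> (\<forall>x\<in>S. GDERIV f x :> D x))"

text \<open>Smoothness of the boundary is expressed by local defining functions.\<close>

definition bounded_smooth_domain :: "'a::euclidean_space set \<Rightarrow> bool" where
  "bounded_smooth_domain \<Omega> \<longleftrightarrow>
     open \<Omega> \<and> connected \<Omega> \<and> \<Omega> \<noteq> {} \<and> bounded \<Omega> \<and>
     (\<forall>x\<in>frontier \<Omega>. \<exists>U \<rho>. open U \<and> x \<in> U \<and> smooth_on U \<rho> \<and>
        (\<forall>y\<in>U. gradient \<rho> y \<noteq> 0) \<and> \<Omega> \<inter> U = {y\<in>U. \<rho> y < 0})"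

definition critical_exponent :: "nat \<Rightarrow> ereal" where
  "critical_exponent N = (if N \<ge> 3 then ereal (2 * real N / (real N - 2)) else \<infinity>)"


section \<open>Sobolev spaces\<close>

text \<open>Elements of the function spaces below are represented by functions on the whole space;
  only the values on \<open>\<Omega>\<close> matter, and functions that agree almost everywhere on \<open>\<Omega>\<close> represent
  the same element.\<close>

definition L2 :: "'a::euclidean_space set \<Rightarrow> ('a \<Rightarrow> 'b::euclidean_space) set" where
  "L2 \<Omega> = {f. f \<in> borel_measurable (lebesgue_on \<Omega>) \<and>
              integrable (lebesgue_on \<Omega>) (\<lambda>x. (norm (f x))\<^sup>2)}"

definition test_function :: "'a::euclidean_space set \<Rightarrow> ('a \<Rightarrow> real) \<Rightarrow> bool" where
  "test_function \<Omega> \<phi> \<longleftrightarrow> smooth_on UNIV \<phi> \<and>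
     compact (closure {x. \<phi> x \<noteq> 0}) \<and> closure {x. \<phi> x \<noteq> 0} \<subseteq> \<Omega>"

definition has_weak_gradient ::
  "'a::euclidean_space set \<Rightarrow> ('a \<Rightarrow> real) \<Rightarrow> ('a \<Rightarrow> 'a) \<Rightarrow> bool" where
  "has_weak_gradient \<Omega> u g \<longleftrightarrow> u \<in> L2 \<Omega> \<and> g \<in> L2 \<Omega> \<and>
     (\<forall>\<phi>. test_function \<Omega> \<phi> \<longrightarrow>
        (LINT x|lebesgue_on \<Omega>. u x *\<^sub>R gradient \<phi> x) = - (LINT x|lebesgue_on \<Omega>. \<phi> x *\<^sub>R g x))"

text \<open>Weak gradients are unique up to null sets, so the choice below affects none of the
  integrals in which it is used.\<close>

definition weak_gradient :: "'a::euclidean_space set \<Rightarrow> ('a \<Rightarrow> real) \<Rightarrow> 'a \<Rightarrow> 'a" where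
  "weak_gradient \<Omega> u = (SOME g. has_weak_gradient \<Omega> u g)"

definition H1 :: "'a::euclidean_space set \<Rightarrow> ('a \<Rightarrow> real) set" where
  "H1 \<Omega> = {u. \<exists>g. has_weak_gradient \<Omega> u g}"

definition H1_norm :: "'a::euclidean_space set \<Rightarrow> ('a \<Rightarrow> real) \<Rightarrow> real" where
  "H1_norm \<Omega> u = sqrt (LINT x|lebesgue_on \<Omega>. (u x)\<^sup>2 + (norm (weak_gradient \<Omega> u x))\<^sup>2)"

definition H10 :: "'a::euclidean_space set \<Rightarrow> ('a \<Rightarrow> real) set" where
  "H10 \<Omega> = {u \<in> H1 \<Omega>. \<exists>\<phi>. (\<forall>n. test_function \<Omega> (\<phi> n)) \<and>
                      (\<lambda>n. H1_norm \<Omega> (\<lambda>x. u x - \<phi> n x)) \<longlonglongrightarrow> 0}"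

text \<open>The product of two copies of \<open>H10 \<Omega>\<close>: a pair \<open>(u, v)\<close> of functions is encoded as the
  pair-valued function \<open>\<lambda>x. (u x, v x)\<close>.\<close>

definition H10_pair :: "'a::euclidean_space set \<Rightarrow> ('a \<Rightarrow> real \<times> real) set" where
  "H10_pair \<Omega> = {z. (\<lambda>x. fst (z x)) \<in> H10 \<Omega> \<and> (\<lambda>x. snd (z x)) \<in> H10 \<Omega>}"

definition H10_pair_norm :: "'a::euclidean_space set \<Rightarrow> ('a \<Rightarrow> real \<times> real) \<Rightarrow> real" where
  "H10_pair_norm \<Omega> z =
     sqrt ((H1_norm \<Omega> (\<lambda>x. fst (z x)))\<^sup>2 + (H1_norm \<Omega> (\<lambda>x. snd (z x)))\<^sup>2)"


section \<open>The functional and its critical points\<close>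

text \<open>Frechet derivative at \<open>z\<close> of a functional \<open>\<Phi>\<close> on a space \<open>E\<close> of functions (with pointwise
  operations) normed by \<open>N\<close>. The library's \<open>has_derivative\<close> needs a normed type, whereas here
  the space depends on the domain and \<open>N\<close> is a norm only modulo null sets.\<close>

definition has_frechet_derivative_in ::
  "('a \<Rightarrow> 'b::real_vector) set \<Rightarrow> (('a \<Rightarrow> 'b) \<Rightarrow> real) \<Rightarrow> (('a \<Rightarrow> 'b) \<Rightarrow> real) \<Rightarrow>
   (('a \<Rightarrow> 'b) \<Rightarrow> real) \<Rightarrow> ('a \<Rightarrow> 'b) \<Rightarrow> bool" where
  "has_frechet_derivative_in E N \<Phi> L z \<longleftrightarrow>
     (\<forall>h\<in>E. \<forall>k\<in>E. L (\<lambda>x. h x + k x) = L h + L k) \<and>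
     (\<forall>h\<in>E. \<forall>c. L (\<lambda>x. c *\<^sub>R h x) = c * L h) \<and>
     (\<exists>C. \<forall>h\<in>E. \<bar>L h\<bar> \<le> C * N h) \<and>
     (\<forall>\<epsilon>>0. \<exists>\<delta>>0. \<forall>h\<in>E. N h < \<delta> \<longrightarrow>
        \<bar>\<Phi> (\<lambda>x. z x + h x) - \<Phi> z - L h\<bar> \<le> \<epsilon> * N h)"

definition energy ::
  "'a::euclidean_space set \<Rightarrow> ('a \<Rightarrow> real \<times> real \<Rightarrow> real) \<Rightarrow> ('a \<Rightarrow> real \<times> real) \<Rightarrow> real" where
  "energy \<Omega> F z = (LINT x|lebesgue_on \<Omega>.
       (norm (weak_gradient \<Omega> (\<lambda>y. fst (z y)) x))\<^sup>2 / 2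
     - (norm (weak_gradient \<Omega> (\<lambda>y. snd (z y)) x))\<^sup>2 / 2
     - F x (z x))"

text \<open>The critical points of the energy are, by definition, the solutions of
  \<open>- \<Delta> u = F\<^sub>u(x,u,v)\<close>, \<open>\<Delta> v = F\<^sub>v(x,u,v)\<close> in \<open>\<Omega>\<close>, \<open>u = v = 0\<close> on the boundary.\<close>

definition solution ::
  "'a::euclidean_space set \<Rightarrow> ('a \<Rightarrow> real \<times> real \<Rightarrow> real) \<Rightarrow> ('a \<Rightarrow> real \<times> real) \<Rightarrow> bool" where
  "solution \<Omega> F z \<longleftrightarrow> z \<in> H10_pair \<Omega> \<and>
     has_frechet_derivative_in (H10_pair \<Omega>) (H10_pair_norm \<Omega>) (energy \<Omega> F) (\<lambda>h. 0) z"

definition nontrivial_solution ::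
  "'a::euclidean_space set \<Rightarrow> ('a \<Rightarrow> real \<times> real \<Rightarrow> real) \<Rightarrow> ('a \<Rightarrow> real \<times> real) \<Rightarrow> bool" where
  "nontrivial_solution \<Omega> F z \<longleftrightarrow> solution \<Omega> F z \<and> \<not> (AE x in lebesgue_on \<Omega>. z x = 0)"

definition ground_state_solution ::
  "'a::euclidean_space set \<Rightarrow> ('a \<Rightarrow> real \<times> real \<Rightarrow> real) \<Rightarrow> ('a \<Rightarrow> real \<times> real) \<Rightarrow> bool" where
  "ground_state_solution \<Omega> F z \<longleftrightarrow> nontrivial_solution \<Omega> F z \<and>
     (\<forall>w. nontrivial_solution \<Omega> F w \<longrightarrow> energy \<Omega> F z \<le> energy \<Omega> F w)"

end

theory Submission
  imports Defs
begin

text \<open>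
  The strongly indefinite system is a scalar problem in disguise. If \<open>(u, v)\<close> is a solution,
  testing the second equation with \<open>v\<close> gives \<open>\<integral> |\<nabla>v|\<^sup>2 + \<integral> v F\<^sub>v(x,u,v) = 0\<close>, and \<open>F6\<close>, applied to the
  vectors \<open>(u,v)\<close> and \<open>(0,v)\<close>, says that \<open>v F\<^sub>v(x,u,v) \<ge> 0\<close>; hence \<open>v = 0\<close>. Conversely, \<open>F x\<close> is
  radial by \<open>F7\<close>, so its gradient at \<open>(s,0)\<close> is a multiple \<open>(g x s, 0)\<close> of \<open>(1,0)\<close>, and every critical
  point \<open>u\<close> of \<open>I(u) = \<integral> |\<nabla>u|\<^sup>2/2 - \<integral> G(x,u)\<close> (\<open>scalar_energy\<close>), where
  \<open>G x s = F x (s,0)\<close>, yields the solution \<open>(u,0)\<close> with the same energy. What has to be found is therefore a nonzero critical point of \<open>I\<close> of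
  least energy.

  The scalar problem has a convex structure. By \<open>F8\<close> the quotient \<open>g x s / s\<close> is injective on the
  positive axis, so it is monotone, and \<open>F5\<close> rules out that it decreases. Equivalently,
  \<open>\<tau> \<mapsto> G x (sqrt \<tau>)\<close> is strictly convex (\<open>G_subgradient_strict\<close>). Along the ray through \<open>u\<close>,
  parametrised by \<open>\<tau> \<mapsto> I(sqrt \<tau> u)\<close>, the energy is therefore strictly concave. Three facts follow:
  every ray carries one maximum (\<open>Nehari_projection\<close>), a critical point maximises \<open>I\<close> on its own ray
  (\<open>scalar_energy_max_of_identity\<close>), and so all nontrivial solutions have energy at least
  \<open>ground_level\<close>, the infimum of these ray maxima (\<open>solution_energy_ge_ground_level\<close>).

  The infimum is attained (\<open>minimiser_exists\<close>). Scale a minimising sequence to gradient norm \<open>1\<close> and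
  let \<open>w\<close> be a limit in \<open>L\<^sup>p\<close> with gradient norm at most \<open>1\<close>. For each fixed \<open>t\<close> the inequality
  \<open>t\<^sup>2/2 - \<integral> G(x, t u\<^sub>n) \<le> ground_level + o(1)\<close> passes to the limit, so the ray through \<open>w\<close> stays below
  the level; and \<open>w\<close> does not vanish, since \<open>t\<^sup>2/2\<close> is unbounded.

  Minimisers are critical (\<open>minimiser_solution\<close>), although the Nehari set need not be a manifold. If
  the minimiser \<open>v\<close> is moved to \<open>v + \<sigma> \<phi>\<close>, the new ray must still reach the level, and strict concavity
  forces it to do so at a scaling \<open>\<tau>\<close> close to \<open>1\<close> (\<open>perturbed_maximum\<close>). The convexity of \<open>G x\<close> bounds
  the energy there from above by the level plus \<open>\<sigma>\<close> times the derivative at \<open>sqrt \<tau> v\<close> in direction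
  \<open>\<phi>\<close>, up to a term of order \<open>\<sigma>\<^sup>2\<close>. Hence the derivative at \<open>v\<close> is nonnegative in every direction, so
  it is zero.

  The analytic input is the compactness of \<open>H10 \<Omega>\<close> in \<open>L\<^sup>q\<close> for subcritical \<open>q\<close>. Everything is done for
  test functions, by comparing \<open>\<phi>\<close> with its averages over balls of radius \<open>\<epsilon>\<close>. These averages are
  uniformly bounded and equi-Lipschitz when the gradients are bounded in \<open>L\<^sup>2\<close>, and they differ from
  \<open>\<phi>\<close> in \<open>L\<^sup>q\<close> by a positive power of \<open>\<epsilon>\<close> (\<open>average_error\<close>); this gives both the Sobolev inequality
  (\<open>Sobolev_H10\<close>) and Cauchy subsequences (\<open>test_compactness\<close>). A limit whose gradient norm does not
  jump up is then obtained from the parallelogram law, applied to almost shortest elements of a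
  decreasing sequence of convex sets of test functions (\<open>weak_limit\<close>).
\<close>

section \<open>Smooth bump functions\<close>

text \<open>The functions \<open>exp (- 1/t) / t ^ k\<close> on the positive axis, extended by zero. Carrying all powers
  \<open>k\<close> along makes the family closed under differentiation up to linear combinations.\<close>

definition flat :: "nat \<Rightarrow> real \<Rightarrow> real" where
  "flat k t = (if t \<le> 0 then 0 else exp (- inverse t) * inverse t ^ k)"

lemma flat_tendsto_0: "(flat k \<longlongrightarrow> 0) (at 0)"
proof -
  have "((\<lambda>t. exp (- inverse t) * inverse t ^ k) \<longlongrightarrow> 0) (at_right (0::real))"
  proof -
    have "((\<lambda>t. (inverse t) ^ k / exp (inverse t)) \<longlongrightarrow> 0) (at_right (0::real))"
      by (rule filterlim_compose[OF tendsto_power_div_exp_0 filterlim_inverse_at_top_right])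
    thus ?thesis by (simp add: exp_minus field_simps)
  qed
  moreover have "eventually (\<lambda>t. exp (- inverse t) * inverse t ^ k = flat k t) (at_right (0::real))"
    by (auto simp: eventually_at_filter flat_def)
  ultimately have "(flat k \<longlongrightarrow> 0) (at_right 0)"
    by (rule Lim_transform_eventually)
  moreover have "(flat k \<longlongrightarrow> 0) (at_left 0)"
    by (rule Lim_transform_eventually[of "\<lambda>_. 0"]) (auto simp: eventually_at_filter flat_def)
  ultimately show ?thesis by (simp add: filterlim_at_split)
qed

lemma flat_has_real_derivative:
  "(flat k has_real_derivative (flat (k+2) t - real k * flat (k+1) t)) (at t)"
proof -
  consider "t < 0" | "t = 0" | "t > 0" by linarith
  thus ?thesis
  proof cases
    case 1
    have "((\<lambda>_. 0) has_real_derivative 0) (at t)" by simp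
    hence "(flat k has_real_derivative 0) (at t)"
      by (rule has_field_derivative_transform_within_open[where S="{..<0}"]) (use 1 in \<open>auto simp: flat_def\<close>)
    thus ?thesis using 1 by (simp add: flat_def)
  next
    case 2
    have "((\<lambda>y. flat (k+1) y) \<longlongrightarrow> 0) (at 0)" by (rule flat_tendsto_0)
    moreover have "flat (k+1) y = (flat k y - flat k 0) / (y - 0)" for y
      by (simp add: flat_def divide_inverse)
    ultimately have "((\<lambda>y. (flat k y - flat k 0) / (y - 0)) \<longlongrightarrow> 0) (at 0)" by simp
    thus ?thesis using 2 by (simp add: has_field_derivative_iff flat_def)
  next
    case 3
    have "((\<lambda>t. exp (- inverse t) * inverse t ^ k) has_real_derivative
        (exp (- inverse t) * inverse t ^ (k+2) - real k * (exp (- inverse t) * inverse t ^ (k+1)))) (at t)"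
    proof (cases k)
      case 0
      thus ?thesis using 3 by (auto intro!: derivative_eq_intros simp: field_simps power2_eq_square)
    next
      case (Suc n)
      thus ?thesis using 3
        by (auto intro!: derivative_eq_intros simp: field_simps power2_eq_square)
           (cases n; simp)
    qed
    hence "(flat k has_real_derivative 
        (exp (- inverse t) * inverse t ^ (k+2) - real k * (exp (- inverse t) * inverse t ^ (k+1)))) (at t)"
      by (rule has_field_derivative_transform_within_open[where S="{0<..}"]) (use 3 in \<open>auto simp: flat_def\<close>)
    thus ?thesis using 3 by (simp add: flat_def)
  qed
qed

text \<open>The algebra generated by the functions above composed with affine maps. It is closed under
  directional derivatives, so membership alone implies smoothness.\<close>

inductive flat_algebra :: "('a::euclidean_space \<Rightarrow> real) \<Rightarrow> bool" where
  const: "flat_algebra (\<lambda>x. c)"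
| flat: "flat_algebra (\<lambda>x. flat k (x \<bullet> a + c))"
| add: "flat_algebra f \<Longrightarrow> flat_algebra g \<Longrightarrow> flat_algebra (\<lambda>x. f x + g x)"
| mult: "flat_algebra f \<Longrightarrow> flat_algebra g \<Longrightarrow> flat_algebra (\<lambda>x. f x * g x)"

lemma flat_algebra_derivative:
  "flat_algebra f \<Longrightarrow>
    \<exists>f'. (\<forall>x. (f has_derivative f' x) (at x)) \<and> (\<forall>v. flat_algebra (\<lambda>x. f' x v))"
proof (induction rule: flat_algebra.induct)
  case (const c)
  show ?case by (rule exI[of _ "\<lambda>x v. 0"]) (auto intro: flat_algebra.const)
next
  case (flat k a c)
  have d: "((\<lambda>x. flat k (x \<bullet> a + c)) has_derivative
      (\<lambda>v. (v \<bullet> a) * (flat (k+2) (x \<bullet> a + c) - real k * flat (k+1) (x \<bullet> a + c)))) (at x)" for x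
  proof -
    have 1: "((\<lambda>x. x \<bullet> a + c) has_derivative (\<lambda>v. v \<bullet> a)) (at x)"
      by (auto intro!: derivative_eq_intros)
    show ?thesis
      by (rule has_derivative_eq_rhs[OF has_derivative_compose[OF 1
         flat_has_real_derivative[unfolded has_field_derivative_def]]]) (auto simp: mult.commute)
  qed
  have n: "flat_algebra (\<lambda>x. (v \<bullet> a) * (flat (k+2) (x \<bullet> a + c) - real k * flat (k+1) (x \<bullet> a + c)))" for v
  proof -
    have "flat_algebra (\<lambda>x. (v \<bullet> a) * (flat (k+2) (x \<bullet> a + c) + (- real k) * flat (k+1) (x \<bullet> a + c)))"
      by (intro flat_algebra.intros)
    thus ?thesis by simp
  qed
  show ?case by (intro exI conjI allI) (rule d, rule n)
next
  case (add f g)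
  then obtain f' g' where "\<And>x. (f has_derivative f' x) (at x)" "\<And>v. flat_algebra (\<lambda>x. f' x v)"
     "\<And>x. (g has_derivative g' x) (at x)" "\<And>v. flat_algebra (\<lambda>x. g' x v)" by blast
  thus ?case by (intro exI[of _ "\<lambda>x v. f' x v + g' x v"]) (auto intro!: flat_algebra.add derivative_intros)
next
  case (mult f g)
  then obtain f' g' where *: "\<And>x. (f has_derivative f' x) (at x)" "\<And>v. flat_algebra (\<lambda>x. f' x v)"
     "\<And>x. (g has_derivative g' x) (at x)" "\<And>v. flat_algebra (\<lambda>x. g' x v)" by blast
  show ?case
    by (rule exI[of _ "\<lambda>x v. f x * g' x v + f' x v * g x"])
       (auto intro!: flat_algebra.intros has_derivative_mult * mult.hyps)
qed

lemma flat_algebra_smooth: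
  assumes "flat_algebra f" shows "smooth_on UNIV f"
proof -
  have "ck_on k UNIV f" if "flat_algebra f" for k and f :: "'a \<Rightarrow> real"
    using that
  proof (induction k arbitrary: f)
    case 0
    obtain f' where "\<And>x. (f has_derivative f' x) (at x)"
      using flat_algebra_derivative[OF 0] by blast
    thus ?case using has_derivative_continuous continuous_at_imp_continuous_on by (metis ck_on.simps(1))
  next
    case (Suc k)
    obtain f' where f': "\<And>x. (f has_derivative f' x) (at x)" "\<And>v. flat_algebra (\<lambda>x. f' x v)"
      using flat_algebra_derivative[OF Suc.prems] by blast
    have "frechet_derivative f (at x) = f' x" for x
      using f'(1) by (metis frechet_derivative_at)
    thus ?case using f' Suc.IH by (auto simp: differentiable_def)
  qed
  thus ?thesis using assms by (auto simp: smooth_on_def)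
qed

text \<open>As \<open>n\<close> grows the factors are compressed towards the faces of the box, so these functions
  converge pointwise to its indicator while they stay below \<open>1\<close>.\<close>

definition box_bump :: "nat \<Rightarrow> 'a::euclidean_space \<Rightarrow> 'a \<Rightarrow> 'a \<Rightarrow> real" where
  "box_bump n a b x = (\<Prod>i\<in>Basis. flat 0 (x \<bullet> (real n *\<^sub>R i) + (- real n * (a \<bullet> i))) *
                                   flat 0 (x \<bullet> (- real n *\<^sub>R i) + real n * (b \<bullet> i)))"

lemma flat_algebra_prod: "finite A \<Longrightarrow> (\<And>i. i \<in> A \<Longrightarrow> flat_algebra (f i)) \<Longrightarrow> flat_algebra (\<lambda>x. \<Prod>i\<in>A. f i x)"
  by (induction A rule: finite_induct) (auto intro: flat_algebra.intros)

lemma flat_0_bounds: "0 \<le> flat 0 t" "flat 0 t \<le> 1"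
  by (auto simp: flat_def)

lemma box_bump_bounds: "0 \<le> box_bump n a b x" "box_bump n a b x \<le> 1"
  unfolding box_bump_def
  by (auto intro!: prod_nonneg prod_le_1 mult_nonneg_nonneg mult_le_one flat_0_bounds)

lemma box_bump_eq_0: "x \<notin> box a b \<Longrightarrow> box_bump n a b x = 0"
proof -
  assume "x \<notin> box a b"
  then obtain i where "i \<in> Basis" "x \<bullet> i \<le> a \<bullet> i \<or> b \<bullet> i \<le> x \<bullet> i" by (auto simp: box_def not_less)
  moreover have "real n * (x \<bullet> i) \<le> real n * (a \<bullet> i) \<or> real n * (b \<bullet> i) \<le> real n * (x \<bullet> i)"
    using calculation(2) by (auto intro: mult_left_mono)
  ultimately show ?thesis unfolding box_bump_def
    by (auto simp: flat_def intro!: bexI[of _ i])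
qed

lemma box_bump_tendsto: "(\<lambda>n. box_bump n a b x) \<longlonglongrightarrow> indicator (box a b) x"
proof (cases "x \<in> box a b")
  case True
  have 1: "(\<lambda>n. flat 0 (real n * d)) \<longlonglongrightarrow> 1" if "d > 0" for d
  proof -
    have "(\<lambda>n. exp (- inverse (real n * d))) \<longlonglongrightarrow> exp (- 0)"
      using that by (intro tendsto_intros tendsto_inverse_0_at_top filterlim_at_top_mult_tendsto_pos[OF tendsto_const]
          filterlim_tendsto_pos_mult_at_top filterlim_real_sequentially) auto
    moreover have "eventually (\<lambda>n. exp (- inverse (real n * d)) = flat 0 (real n * d)) sequentially"
      using eventually_gt_at_top[of 0] by eventually_elim (use that in \<open>auto simp: flat_def mult_le_0_iff\<close>)
    ultimately show ?thesis using Lim_transform_eventually by fastforce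
  qed
  have "(\<lambda>n. box_bump n a b x) \<longlonglongrightarrow> (\<Prod>i\<in>(Basis::'a set). 1 * 1)"
    unfolding box_bump_def
  proof (intro tendsto_prod tendsto_mult)
    fix i :: 'a assume i: "i \<in> Basis"
    show "(\<lambda>n. flat 0 (x \<bullet> real n *\<^sub>R i + - real n * (a \<bullet> i))) \<longlonglongrightarrow> 1"
      using 1[of "x \<bullet> i - a \<bullet> i"] True i by (auto simp: box_def algebra_simps)
    show "(\<lambda>n. flat 0 (x \<bullet> (- real n *\<^sub>R i) + real n * (b \<bullet> i))) \<longlonglongrightarrow> 1"
      using 1[of "b \<bullet> i - x \<bullet> i"] True i by (auto simp: box_def algebra_simps)
  qed
  thus ?thesis using True by simp
next
  case False thus ?thesis by (simp add: box_bump_eq_0)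
qed

lemma test_function_box_bump:
  assumes "cbox a b \<subseteq> \<Omega>" shows "test_function \<Omega> (box_bump n a b)"
proof -
  have "closure {x. box_bump n a b x \<noteq> 0} \<subseteq> cbox a b"
    using box_bump_eq_0 box_subset_cbox by (intro closure_minimal) (blast, auto)
  moreover have "smooth_on UNIV (box_bump n a b)"
    unfolding box_bump_def[abs_def]
    by (intro flat_algebra_smooth flat_algebra_prod flat_algebra.mult flat_algebra.flat) auto
  ultimately show ?thesis unfolding test_function_def using assms
    using bounded_subset[OF bounded_cbox] by (auto simp: compact_eq_bounded_closed)
qed

section \<open>Test functions\<close>

lemma ck_on_lincomb:
  assumes "ck_on k UNIV f" "ck_on k UNIV g"
  shows "ck_on k UNIV (\<lambda>x. a * f x + b * g x)"
  using assms
proof (induction k arbitrary: f g)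
  case 0 thus ?case by (auto intro!: continuous_intros)
next
  case (Suc k)
  have d: "f differentiable (at x)" "g differentiable (at x)" for x using Suc.prems by auto
  have "frechet_derivative (\<lambda>x. a * f x + b * g x) (at x) =
     (\<lambda>v. a * frechet_derivative f (at x) v + b * frechet_derivative g (at x) v)" for x
    by (rule frechet_derivative_at[symmetric])
       (auto intro!: derivative_eq_intros d[unfolded frechet_derivative_works])
  thus ?case using Suc d by (auto intro!: derivative_intros)
qed

lemma test_function_lincomb:
  assumes "test_function \<Omega> f" "test_function \<Omega> g"
  shows "test_function \<Omega> (\<lambda>x. a * f x + b * g x)"
proof -
  have "closure {x. a * f x + b * g x \<noteq> 0} \<subseteq> closure {x. f x \<noteq> 0} \<union> closure {x. g x \<noteq> 0}"
    by (subst closure_Un[symmetric], intro closure_mono) auto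
  moreover have "compact (closure {x. a * f x + b * g x \<noteq> 0})"
  proof -
    have "bounded (closure {x. f x \<noteq> 0} \<union> closure {x. g x \<noteq> 0})"
      using assms by (auto simp: test_function_def dest: compact_imp_bounded)
    from bounded_subset[OF this calculation] show ?thesis by (simp add: compact_eq_bounded_closed)
  qed
  moreover have "smooth_on UNIV (\<lambda>x. a * f x + b * g x)"
    unfolding smooth_on_def
  proof
    fix k
    have "ck_on k UNIV f" "ck_on k UNIV g" using assms unfolding test_function_def smooth_on_def by blast+
    thus "ck_on k UNIV (\<lambda>x. a * f x + b * g x)" by (rule ck_on_lincomb)
  qed
  ultimately show ?thesis using assms
    unfolding test_function_def by (meson Un_least order_trans)
qed

text \<open>The total derivative is recovered from its values on the standard basis.\<close>

lemma test_function_GDERIV: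
  assumes "test_function \<Omega> f"
  shows "GDERIV f x :> gradient f x"
proof -
  have "ck_on 1 UNIV f" using assms by (auto simp: test_function_def smooth_on_def simp del: ck_on.simps)
  hence "f differentiable (at x)" by simp
  hence d: "(f has_derivative frechet_derivative f (at x)) (at x)" using frechet_derivative_works by blast
  have "frechet_derivative f (at x) h = h \<bullet> (\<Sum>i\<in>Basis. frechet_derivative f (at x) i *\<^sub>R i)" for h
  proof -
    have l: "linear (frechet_derivative f (at x))" using d has_derivative_linear by blast
    have "frechet_derivative f (at x) h = frechet_derivative f (at x) (\<Sum>i\<in>Basis. (h \<bullet> i) *\<^sub>R i)"
      by (simp add: euclidean_representation)
    also have "\<dots> = (\<Sum>i\<in>Basis. (h \<bullet> i) * frechet_derivative f (at x) i)"
      using l by (simp add: linear_sum linear_scale)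
    finally show ?thesis by (simp add: inner_sum_right mult.commute)
  qed
  hence "frechet_derivative f (at x) = (\<lambda>h. h \<bullet> (\<Sum>i\<in>Basis. frechet_derivative f (at x) i *\<^sub>R i))"
    by (rule ext)
  hence "GDERIV f x :> (\<Sum>i\<in>Basis. frechet_derivative f (at x) i *\<^sub>R i)"
    unfolding gderiv_def using d by metis
  thus ?thesis using gradient_eqI[of f x] by simp
qed

lemma test_function_has_derivative:
  assumes "test_function \<Omega> f"
  shows "(f has_derivative (\<lambda>h. h \<bullet> gradient f x)) (at x)"
  using test_function_GDERIV[OF assms] by (simp add: gderiv_def)

lemma test_function_continuous:
  assumes "test_function \<Omega> f" shows "continuous_on S f"
  using has_derivative_continuous[OF test_function_has_derivative[OF assms]]
  by (intro continuous_at_imp_continuous_on) auto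

lemma test_function_continuous_gradient:
  assumes "test_function \<Omega> f" shows "continuous_on S (gradient f)"
proof -
  have "ck_on 1 UNIV f" using assms by (auto simp: test_function_def smooth_on_def simp del: ck_on.simps)
  hence c: "continuous_on UNIV (\<lambda>x. frechet_derivative f (at x) v)" for v by simp
  have "frechet_derivative f (at x) v = v \<bullet> gradient f x" for x v
    by (rule frechet_derivative_at[OF test_function_has_derivative[OF assms, of x], symmetric, THEN fun_cong])
  hence "continuous_on UNIV (\<lambda>x. v \<bullet> gradient f x)" for v using c by simp
  hence "continuous_on UNIV (\<lambda>x. \<Sum>i\<in>Basis. (i \<bullet> gradient f x) *\<^sub>R i)"
    by (intro continuous_on_sum continuous_on_scaleR continuous_on_const)
  hence "continuous_on UNIV (\<lambda>x. \<Sum>i\<in>Basis. (gradient f x \<bullet> i) *\<^sub>R i)" by (simp add: inner_commute)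
  thus ?thesis by (simp add: euclidean_representation continuous_on_subset[of UNIV])
qed

lemma gradient_lincomb:
  assumes "test_function \<Omega> f" "test_function \<Omega> g"
  shows "gradient (\<lambda>x. a * f x + b * g x) x = a *\<^sub>R gradient f x + b *\<^sub>R gradient g x"
proof (rule gradient_eqI)
  note f = test_function_has_derivative[OF assms(1), of x] and g = test_function_has_derivative[OF assms(2), of x]
  have "((\<lambda>x. a * f x + b * g x) has_derivative (\<lambda>h. a * (h \<bullet> gradient f x) + b * (h \<bullet> gradient g x))) (at x)"
    by (intro has_derivative_add has_derivative_mult_right f g)
  thus "GDERIV (\<lambda>x. a * f x + b * g x) x :> a *\<^sub>R gradient f x + b *\<^sub>R gradient g x"
    by (simp add: gderiv_def inner_add_right)
qed

lemma test_function_support: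
  assumes "test_function \<Omega> f" 
  obtains K where "compact K" "K \<subseteq> \<Omega>" "\<And>x. x \<notin> K \<Longrightarrow> f x = 0" "\<And>x. x \<notin> K \<Longrightarrow> gradient f x = 0"
proof -
  let ?K = "closure {x. f x \<noteq> 0}"
  have 1: "compact ?K" "?K \<subseteq> \<Omega>" using assms by (auto simp: test_function_def)
  have f0: "f x = 0" if "x \<notin> ?K" for x using that closure_subset[of "{x. f x \<noteq> 0}"] by blast
  have "gradient f x = 0" if x: "x \<notin> ?K" for x
  proof (rule gradient_eqI)
    have "((\<lambda>_. 0) has_derivative (\<lambda>h. 0)) (at x)" by simp
    hence "(f has_derivative (\<lambda>h. 0)) (at x)"
    proof (rule has_derivative_transform_within_open)
      show "open (- ?K)" by (simp add: open_Compl)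
      show "x \<in> - ?K" using x by simp
      show "0 = f y" if "y \<in> - ?K" for y using f0[of y] that by simp
    qed
    thus "GDERIV f x :> 0" by (simp add: gderiv_def)
  qed
  with 1 f0 show ?thesis by (intro that)
qed

section \<open>Integral inequalities and completeness of \<open>L2\<close>\<close>

text \<open>Young's inequality for \<open>\<bar>f\<bar> / A\<close> and \<open>\<bar>g\<bar> / B\<close>, where \<open>A\<close> and \<open>B\<close> are the two norms,
  integrates to \<open>1/p + 1/q = 1\<close>; if a norm vanishes, so does the product almost everywhere.\<close>

lemma Holder_integral:
  fixes f g :: "'a \<Rightarrow> real"
  assumes pq: "p > 1" "q > 1" "1/p + 1/q = 1"
    and f[measurable]: "f \<in> borel_measurable M" and g[measurable]: "g \<in> borel_measurable M"
    and fi: "integrable M (\<lambda>x. \<bar>f x\<bar> powr p)" and gi: "integrable M (\<lambda>x. \<bar>g x\<bar> powr q)"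
  shows "integrable M (\<lambda>x. f x * g x)"
    and "(LINT x|M. \<bar>f x * g x\<bar>) \<le> (LINT x|M. \<bar>f x\<bar> powr p) powr (1/p) * (LINT x|M. \<bar>g x\<bar> powr q) powr (1/q)"
proof -
  have Y: "\<bar>f x * g x\<bar> \<le> \<bar>f x\<bar> powr p / p + \<bar>g x\<bar> powr q / q" for x
    using Youngs_inequality[OF pq, of "\<bar>f x\<bar>" "\<bar>g x\<bar>"] by (simp add: abs_mult)
  show fg: "integrable M (\<lambda>x. f x * g x)"
    by (rule Bochner_Integration.integrable_bound[of _ "\<lambda>x. \<bar>f x\<bar> powr p / p + \<bar>g x\<bar> powr q / q"])
      (use fi gi Y pq in auto)
  define A where "A = (LINT x|M. \<bar>f x\<bar> powr p) powr (1/p)"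
  define B where "B = (LINT x|M. \<bar>g x\<bar> powr q) powr (1/q)"
  have nn: "(LINT x|M. \<bar>f x\<bar> powr p) \<ge> 0" "(LINT x|M. \<bar>g x\<bar> powr q) \<ge> 0" by auto
  have "(LINT x|M. \<bar>f x * g x\<bar>) \<le> A * B"
  proof (cases "A = 0 \<or> B = 0")
    case True
    hence "AE x in M. \<bar>f x\<bar> powr p = 0 \<or> \<bar>g x\<bar> powr q = 0"
    proof
      assume "A = 0"
      hence "(LINT x|M. \<bar>f x\<bar> powr p) = 0" by (simp add: A_def)
      hence "AE x in M. \<bar>f x\<bar> powr p = 0" by (subst (asm) integral_nonneg_eq_0_iff_AE[OF fi]) auto
      thus ?thesis by eventually_elim simp
    next
      assume "B = 0"
      hence "(LINT x|M. \<bar>g x\<bar> powr q) = 0" by (simp add: B_def)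
      hence "AE x in M. \<bar>g x\<bar> powr q = 0" by (subst (asm) integral_nonneg_eq_0_iff_AE[OF gi]) auto
      thus ?thesis by eventually_elim simp
    qed
    hence "AE x in M. \<bar>f x * g x\<bar> = 0" by eventually_elim auto
    hence "(LINT x|M. \<bar>f x * g x\<bar>) = (LINT x|M. 0)" by (intro integral_cong_AE) auto
    thus ?thesis using True by auto
  next
    case False
    hence A: "A > 0" and B: "B > 0" by (auto simp: A_def B_def)
    have Ap: "A powr p = (LINT x|M. \<bar>f x\<bar> powr p)" and Bq: "B powr q = (LINT x|M. \<bar>g x\<bar> powr q)"
      using pq nn by (auto simp: A_def B_def powr_powr)
    have Y2: "\<bar>f x * g x\<bar> / (A * B) \<le> \<bar>f x\<bar> powr p / (p * A powr p) + \<bar>g x\<bar> powr q / (q * B powr q)" for x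
      using Youngs_inequality[OF pq, of "\<bar>f x\<bar> / A" "\<bar>g x\<bar> / B"] A B
      by (simp add: abs_mult powr_divide mult.commute)
    have "(LINT x|M. \<bar>f x * g x\<bar> / (A * B)) \<le>
        (LINT x|M. \<bar>f x\<bar> powr p / (p * A powr p) + \<bar>g x\<bar> powr q / (q * B powr q))"
      by (rule integral_mono) (use fg fi gi Y2 in auto)
    also have "\<dots> = (LINT x|M. \<bar>f x\<bar> powr p) / (p * A powr p) + (LINT x|M. \<bar>g x\<bar> powr q) / (q * B powr q)"
      using fi gi by simp
    also have "\<dots> = 1/p + 1/q" unfolding Ap[symmetric] Bq[symmetric] using A B by simp
    finally show ?thesis using A B pq by (simp add: divide_le_eq)
  qed
  thus "(LINT x|M. \<bar>f x * g x\<bar>) \<le> (LINT x|M. \<bar>f x\<bar> powr p) powr (1/p) * (LINT x|M. \<bar>g x\<bar> powr q) powr (1/q)"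
    by (simp add: A_def B_def)
qed

lemma Cauchy_Schwarz_integral:
  fixes f g :: "'a \<Rightarrow> real"
  assumes "f \<in> borel_measurable M" "g \<in> borel_measurable M"
    and fi: "integrable M (\<lambda>x. (f x)\<^sup>2)" and gi: "integrable M (\<lambda>x. (g x)\<^sup>2)"
  shows "integrable M (\<lambda>x. f x * g x)"
    and "(LINT x|M. \<bar>f x * g x\<bar>) \<le> sqrt (LINT x|M. (f x)\<^sup>2) * sqrt (LINT x|M. (g x)\<^sup>2)"
proof -
  have s: "\<bar>t\<bar> powr 2 = t\<^sup>2" for t :: real by (simp add: powr_numeral)
  show "integrable M (\<lambda>x. f x * g x)"
    using Holder_integral(1)[of 2 2 f M g] assms by (simp add: s)
  show "(LINT x|M. \<bar>f x * g x\<bar>) \<le> sqrt (LINT x|M. (f x)\<^sup>2) * sqrt (LINT x|M. (g x)\<^sup>2)"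
    using Holder_integral(2)[of 2 2 f M g] assms by (simp add: s powr_half_sqrt)
qed

lemma norm_add_sq: "(norm (a + b))\<^sup>2 \<le> 2 * (norm a)\<^sup>2 + 2 * (norm b)\<^sup>2" for a b :: "'b::real_normed_vector"
proof -
  have "(norm (a + b))\<^sup>2 \<le> (norm a + norm b)\<^sup>2" by (intro power_mono norm_triangle_ineq) auto
  also have "\<dots> \<le> 2 * (norm a)\<^sup>2 + 2 * (norm b)\<^sup>2"
    using sum_squares_bound[of "norm a" "norm b"] by (simp add: power2_sum)
  finally show ?thesis .
qed

text \<open>A subsequence with differences of norm at most \<open>(1/2) ^ k\<close> has summable differences almost
  everywhere, because on a finite measure space the \<open>L\<^sup>1\<close> norm is controlled by the \<open>L\<^sup>2\<close> norm. Its
  pointwise limit is the limit of the whole sequence by Fatou's lemma.\<close>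

lemma Riesz_Fischer_L2:
  fixes f :: "nat \<Rightarrow> 'a \<Rightarrow> 'b::euclidean_space"
  assumes fin: "finite_measure M"
    and f[measurable]: "\<And>n. f n \<in> borel_measurable M"
    and fi: "\<And>n. integrable M (\<lambda>x. (norm (f n x))\<^sup>2)"
    and Cauchy: "\<And>e. e > 0 \<Longrightarrow> \<exists>N. \<forall>m\<ge>N. \<forall>n\<ge>N. (LINT x|M. (norm (f m x - f n x))\<^sup>2) < e"
  obtains g where "g \<in> borel_measurable M" "integrable M (\<lambda>x. (norm (g x))\<^sup>2)"
    "(\<lambda>n. LINT x|M. (norm (f n x - g x))\<^sup>2) \<longlonglongrightarrow> 0"
proof -
  interpret finite_measure M by fact
  have di: "integrable M (\<lambda>x. (norm (f m x - f n x))\<^sup>2)" for m n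
  proof (rule Bochner_Integration.integrable_bound[of _ "\<lambda>x. 2 * (norm (f m x))\<^sup>2 + 2 * (norm (f n x))\<^sup>2"])
    show "AE x in M. norm ((norm (f m x - f n x))\<^sup>2) \<le> norm (2 * (norm (f m x))\<^sup>2 + 2 * (norm (f n x))\<^sup>2)"
      using norm_add_sq[of "f m x" "- f n x" for x] by auto
  qed (use fi in auto)
  have "\<exists>N. \<forall>m\<ge>N. \<forall>n\<ge>N. (LINT x|M. (norm (f m x - f n x))\<^sup>2) < ((1/2)^k)\<^sup>2" for k :: nat
    by (rule Cauchy) simp
  then obtain N where N: "\<And>k m n. m \<ge> N k \<Longrightarrow> n \<ge> N k \<Longrightarrow> (LINT x|M. (norm (f m x - f n x))\<^sup>2) < ((1/2)^k)\<^sup>2"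
    by metis
  define r where "r k = Max (N ` {..k})" for k
  have rN: "r k \<ge> N k" "r (Suc k) \<ge> r k" for k
    unfolding r_def by (auto intro!: Max_ge Max_mono)
  define d where "d k x = norm (f (r (Suc k)) x - f (r k) x)" for k x
  have [measurable]: "d k \<in> borel_measurable M" for k unfolding d_def by measurable
  have d2: "integrable M (\<lambda>x. (d k x)\<^sup>2)" for k unfolding d_def by (rule di)
  have di1: "integrable M (d k)" and dle: "(LINT x|M. d k x) \<le> (1/2)^k * sqrt (measure M (space M))" for k
  proof -
    show "integrable M (d k)" using Cauchy_Schwarz_integral(1)[of "d k" M "\<lambda>_. 1"] d2 by simp
    have "(LINT x|M. \<bar>d k x * 1\<bar>) \<le> sqrt (LINT x|M. (d k x)\<^sup>2) * sqrt (LINT x|M. 1\<^sup>2)"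
      by (rule Cauchy_Schwarz_integral(2)) (use d2 in auto)
    also have "sqrt (LINT x|M. (d k x)\<^sup>2) \<le> (1/2)^k"
      using N[of k "r (Suc k)" "r k"] rN[of k] by (intro real_le_lsqrt) (auto simp: d_def)
    finally show "(LINT x|M. d k x) \<le> (1/2)^k * sqrt (measure M (space M))"
      by (auto simp: d_def mult_right_mono)
  qed
  have "(\<integral>\<^sup>+x. (\<Sum>k. ennreal (d k x)) \<partial>M) = (\<Sum>k. \<integral>\<^sup>+x. ennreal (d k x) \<partial>M)"
    by (rule nn_integral_suminf) auto
  also have "\<dots> \<le> (\<Sum>k. ennreal ((1/2)^k * sqrt (measure M (space M))))"
    by (intro suminf_le) (auto simp: nn_integral_eq_integral[OF di1] d_def[abs_def] intro!: ennreal_leI dle[unfolded d_def[abs_def]] di1[unfolded d_def[abs_def]]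
        nn_integral_eq_integral[THEN eq_refl, THEN order_trans])
  also have "\<dots> < \<infinity>"
    by (subst suminf_ennreal2) (auto intro!: summable_mult2 summable_geometric)
  finally have "AE x in M. (\<Sum>k. ennreal (d k x)) \<noteq> \<infinity>"
    by (intro nn_integral_PInf_AE) auto
  hence conv: "AE x in M. convergent (\<lambda>k. f (r k) x)"
  proof eventually_elim
    case (elim x)
    hence "summable (\<lambda>k. d k x)" by (intro summable_suminf_not_top) (auto simp: d_def top.not_eq_extremum)
    hence "summable (\<lambda>k. f (r (Suc k)) x - f (r k) x)" unfolding d_def by (rule summable_norm_cancel)
    hence "convergent (\<lambda>n. \<Sum>k<n. f (r (Suc k)) x - f (r k) x)" by (simp add: summable_iff_convergent)
    hence "convergent (\<lambda>n. f (r n) x - f (r 0) x)" by (simp add: sum_lessThan_telescope[of "\<lambda>k. f (r k) x"])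
    from convergent_add[OF this convergent_const[of "f (r 0) x"]] show ?case by simp
  qed
  define g where "g x = lim (\<lambda>k. f (r k) x)" for x
  have [measurable]: "g \<in> borel_measurable M" unfolding g_def by measurable
  have lim: "AE x in M. (\<lambda>k. f (r k) x) \<longlonglongrightarrow> g x"
    using conv by eventually_elim (simp add: g_def convergent_LIMSEQ_iff)
  have key: "(\<integral>\<^sup>+x. ennreal ((norm (f n x - g x))\<^sup>2) \<partial>M) \<le> ennreal (((1/2)^k)\<^sup>2)" if "n \<ge> N k" for n k
  proof -
    have "(\<integral>\<^sup>+x. ennreal ((norm (f n x - g x))\<^sup>2) \<partial>M) = (\<integral>\<^sup>+x. liminf (\<lambda>j. ennreal ((norm (f n x - f (r j) x))\<^sup>2)) \<partial>M)"
    proof (rule nn_integral_cong_AE)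
      show "AE x in M. ennreal ((norm (f n x - g x))\<^sup>2) = liminf (\<lambda>j. ennreal ((norm (f n x - f (r j) x))\<^sup>2))"
        using lim
      proof eventually_elim
        case (elim x)
        have "(\<lambda>j. ennreal ((norm (f n x - f (r j) x))\<^sup>2)) \<longlonglongrightarrow> ennreal ((norm (f n x - g x))\<^sup>2)"
          by (intro tendsto_intros elim)
        from lim_imp_Liminf[OF _ this] show ?case by simp
      qed
    qed
    also have "\<dots> \<le> liminf (\<lambda>j. \<integral>\<^sup>+x. ennreal ((norm (f n x - f (r j) x))\<^sup>2) \<partial>M)"
      by (rule nn_integral_liminf) auto
    also have "\<dots> \<le> ennreal (((1/2)^k)\<^sup>2)"
    proof (rule Liminf_le)
      show "\<forall>\<^sub>F j in sequentially. (\<integral>\<^sup>+x. ennreal ((norm (f n x - f (r j) x))\<^sup>2) \<partial>M) \<le> ennreal (((1/2)^k)\<^sup>2)"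
        using eventually_ge_at_top[of k]
      proof eventually_elim
        case (elim j)
        have "r j \<ge> N k" unfolding r_def using elim by (intro Max_ge) auto
        from N[OF that this] show ?case by (subst nn_integral_eq_integral) (auto intro!: di ennreal_leI)
      qed
    qed simp
    finally show ?thesis .
  qed
  have gi': "integrable M (\<lambda>x. (norm (f n x - g x))\<^sup>2)" if "n \<ge> N k" for n k
  proof (rule integrableI_bounded)
    have "(\<integral>\<^sup>+x. ennreal (norm ((norm (f n x - g x))\<^sup>2)) \<partial>M) \<le> ennreal (((1/2)^k)\<^sup>2)" using key[OF that] by simp
    thus "(\<integral>\<^sup>+x. ennreal (norm ((norm (f n x - g x))\<^sup>2)) \<partial>M) < \<infinity>" by (rule le_less_trans) simp
  qed simp
  show ?thesis
  proof
    show "g \<in> borel_measurable M" by fact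
    show "integrable M (\<lambda>x. (norm (g x))\<^sup>2)"
    proof (rule Bochner_Integration.integrable_bound[of _ "\<lambda>x. 2 * (norm (f (N 0) x))\<^sup>2 + 2 * (norm (f (N 0) x - g x))\<^sup>2"])
      show "AE x in M. norm ((norm (g x))\<^sup>2) \<le> norm (2 * (norm (f (N 0) x))\<^sup>2 + 2 * (norm (f (N 0) x - g x))\<^sup>2)"
        using norm_add_sq[of "f (N 0) x" "g x - f (N 0) x" for x] by (auto simp: norm_minus_commute)
    qed (use fi gi'[of 0 "N 0"] in auto)
    show "(\<lambda>n. LINT x|M. (norm (f n x - g x))\<^sup>2) \<longlonglongrightarrow> 0"
    proof (rule LIMSEQ_I)
      fix e :: real assume "e > 0"
      have "(\<lambda>k. ((1/2::real)^k)\<^sup>2) \<longlonglongrightarrow> 0\<^sup>2" by (intro tendsto_power LIMSEQ_power_zero) auto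
      hence "\<forall>\<^sub>F k in sequentially. ((1/2::real)^k)\<^sup>2 < e" using \<open>e > 0\<close> order_tendstoD(2) by fastforce
      then obtain k where k: "((1/2::real)^k)\<^sup>2 < e" by (auto simp: eventually_sequentially)
      have "(LINT x|M. (norm (f n x - g x))\<^sup>2) \<le> ((1/2)^k)\<^sup>2" if "n \<ge> N k" for n
        using key[OF that] by (subst (asm) nn_integral_eq_integral[OF gi'[OF that]]) auto
      thus "\<exists>no. \<forall>n\<ge>no. norm ((LINT x|M. (norm (f n x - g x))\<^sup>2) - 0) < e"
        using k by (intro exI[of _ "N k"]) fastforce
    qed
  qed
qed

section \<open>Localisation on a bounded open set and integration by parts\<close>

locale bounded_open =
  fixes \<Omega> :: "'a::euclidean_space set"
  assumes open_dom: "open \<Omega>" and bounded_dom: "bounded \<Omega>"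
begin

lemma dom_lmeasurable: "\<Omega> \<in> lmeasurable"
  using lmeasurable_open bounded_dom open_dom by blast

lemma dom_sets: "\<Omega> \<in> sets lebesgue"
  using dom_lmeasurable by blast

sublocale dom: finite_measure "lebesgue_on \<Omega>"
  by (rule finite_measure_lebesgue_on[OF dom_lmeasurable])

lemma integral_dom_eq_lborel:
  fixes f :: "'a \<Rightarrow> 'b::euclidean_space"
  assumes "f \<in> borel_measurable borel" "\<And>x. x \<notin> \<Omega> \<Longrightarrow> f x = 0"
  shows "(LINT x|lebesgue_on \<Omega>. f x) = (LINT x|lborel. f x)"
proof -
  have "(LINT x|lebesgue_on \<Omega>. f x) = (LINT x|lebesgue. (if x \<in> \<Omega> then f x else 0))"
    by (simp add: Lebesgue_Measure.integral_restrict_UNIV dom_sets)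
  also have "(\<lambda>x. if x \<in> \<Omega> then f x else 0) = f" using assms by auto
  finally show ?thesis using assms by (simp add: integral_completion)
qed

lemma continuous_measurable_dom:
  fixes f :: "'a \<Rightarrow> 'b::euclidean_space"
  assumes "continuous_on UNIV f" shows "f \<in> borel_measurable (lebesgue_on \<Omega>)"
proof -
  have "f \<in> borel_measurable lborel" using borel_measurable_continuous_onI[OF assms] by simp
  thus ?thesis by (intro measurable_restrict_space1 measurable_completion)
qed

text \<open>The fundamental lemma of the calculus of variations. The bumps of a box exhaust its
  indicator, so \<open>g\<close> has integral zero over every box in \<open>\<Omega>\<close>, and almost every value of \<open>g\<close> is a limit
  of averages over small boxes.\<close>

lemma AE_zero_if_test_orthogonal:
  fixes g :: "'a \<Rightarrow> 'b::euclidean_space"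
  assumes gi: "integrable (lebesgue_on \<Omega>) g"
    and orth: "\<And>\<phi>. test_function \<Omega> \<phi> \<Longrightarrow> (LINT x|lebesgue_on \<Omega>. \<phi> x *\<^sub>R g x) = 0"
  shows "AE x in lebesgue_on \<Omega>. g x = 0"
proof -
  have [measurable]: "g \<in> borel_measurable (lebesgue_on \<Omega>)" using gi by (rule borel_measurable_integrable)
  define f where "f x = (if x \<in> \<Omega> then g x else 0)" for x
  have fi: "integrable lebesgue f"
    unfolding f_def using gi by (simp add: Lebesgue_Measure.integrable_restrict_UNIV dom_sets)
  have bump_measurable[measurable]: "box_bump n a b \<in> borel_measurable (lebesgue_on \<Omega>)" if "cbox a b \<subseteq> \<Omega>" for n a b
    using test_function_continuous[OF test_function_box_bump[OF that]] by (rule continuous_measurable_dom)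
  have box0: "(LINT x|lebesgue_on \<Omega>. indicator (box a b) x *\<^sub>R g x) = 0" if ab: "cbox a b \<subseteq> \<Omega>" for a b
  proof -
    have "(\<lambda>n. LINT x|lebesgue_on \<Omega>. box_bump n a b x *\<^sub>R g x) \<longlonglongrightarrow> (LINT x|lebesgue_on \<Omega>. indicator (box a b) x *\<^sub>R g x)"
    proof (rule integral_dominated_convergence[where w="\<lambda>x. norm (g x)"])
      have "indicator (box a b) \<in> borel_measurable (lebesgue_on \<Omega>)"
        by (intro measurable_restrict_space1 borel_measurable_indicator) simp
      thus "(\<lambda>x. indicat_real (box a b) x *\<^sub>R g x) \<in> borel_measurable (lebesgue_on \<Omega>)" by measurable
      show "AE x in lebesgue_on \<Omega>. (\<lambda>n. box_bump n a b x *\<^sub>R g x) \<longlonglongrightarrow> indicat_real (box a b) x *\<^sub>R g x"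
        by (intro AE_I2 tendsto_scaleR box_bump_tendsto tendsto_const)
      show "AE x in lebesgue_on \<Omega>. norm (box_bump n a b x *\<^sub>R g x) \<le> norm (g x)" for n
        using box_bump_bounds[of n a b] by (auto intro!: AE_I2 mult_left_le_one_le)
    qed (use gi bump_measurable[OF ab] in auto)
    moreover have "(LINT x|lebesgue_on \<Omega>. box_bump n a b x *\<^sub>R g x) = 0" for n
      by (rule orth[OF test_function_box_bump[OF ab]])
    ultimately show ?thesis by (simp add: LIMSEQ_const_iff)
  qed
  have cbox0: "integral (cbox a b) f = 0" if "cbox a b \<subseteq> \<Omega>" for a b
  proof -
    have "integral (cbox a b) f = integral (box a b) f" by (simp add: integral_open_interval)
    also have "\<dots> = set_lebesgue_integral lebesgue (box a b) f"
      by (rule set_lebesgue_integral_eq_integral(2)[symmetric])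
         (use fi in \<open>auto simp: set_integrable_def intro!: integrable_mult_indicator\<close>)
    also have "\<dots> = (LINT x|lebesgue. (if x \<in> \<Omega> then indicator (box a b) x *\<^sub>R g x else 0))"
      unfolding set_lebesgue_integral_def f_def by (intro Bochner_Integration.integral_cong) auto
    also have "\<dots> = 0" by (simp add: Lebesgue_Measure.integral_restrict_UNIV dom_sets box0[OF that])
    finally show ?thesis .
  qed
  have "f integrable_on UNIV"
    using fi by (simp add: integrable_on_lebesgue)
  hence "f integrable_on cbox a b" for a b using integrable_on_subcbox by blast
  then obtain N where N: "negligible N" "\<And>x e. x \<notin> N \<Longrightarrow> 0 < e \<Longrightarrow>
      \<exists>d>0. \<forall>h. 0 < h \<and> h < d \<longrightarrow> norm (integral (cbox x (x + h *\<^sub>R One)) f /\<^sub>R h ^ DIM('a) - f x) < e"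
    using integrable_ccontinuous_explicit[of f] by metis
  have g0: "g x = 0" if "x \<in> \<Omega>" "x \<notin> N" for x
  proof (rule ccontr)
    assume "g x \<noteq> 0"
    then obtain d where d: "d > 0" "\<And>h. 0 < h \<Longrightarrow> h < d \<Longrightarrow> norm (integral (cbox x (x + h *\<^sub>R One)) f /\<^sub>R h ^ DIM('a) - f x) < norm (g x)"
      using N(2)[OF \<open>x \<notin> N\<close>, of "norm (g x)"] by auto
    obtain e where e: "e > 0" "ball x e \<subseteq> \<Omega>" using openE[OF open_dom \<open>x \<in> \<Omega>\<close>] by auto
    \<comment> \<open>The cube with corner \<open>x\<close> and side \<open>h\<close> has diameter at most \<open>h DIM\<close>, so it stays in the ball.\<close>
    define h where "h = min (d/2) (e / (2 * real DIM('a)))"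
    have D: "real DIM('a) > 0" by simp
    have h: "0 < h" "h < d" using d(1) e(1) D by (auto simp: h_def min_less_iff_disj)
    have "h * real DIM('a) \<le> e / (2 * real DIM('a)) * real DIM('a)"
      using D by (intro mult_right_mono) (auto simp: h_def)
    also have "\<dots> < e" using e(1) D by simp
    finally have hD: "h * real DIM('a) < e" .
    have "cbox x (x + h *\<^sub>R One) \<subseteq> ball x e"
    proof
      fix y assume y: "y \<in> cbox x (x + h *\<^sub>R One)"
      have "norm (y - x) \<le> (\<Sum>i\<in>Basis. \<bar>(y - x) \<bullet> i\<bar>)" by (rule norm_le_l1)
      also have "\<dots> \<le> (\<Sum>i\<in>(Basis::'a set). h)"
        using y by (intro sum_mono) (auto simp: mem_box inner_simps)
      also have "\<dots> < e" using hD by (simp add: mult.commute)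
      finally show "y \<in> ball x e" by (simp add: dist_norm norm_minus_commute)
    qed
    hence "integral (cbox x (x + h *\<^sub>R One)) f = 0" using cbox0 e by blast
    thus False using d(2)[OF h(1,2)] that by (simp add: f_def)
  qed
  have "AE x in lebesgue_on \<Omega>. x \<notin> N"
  proof -
    have "AE x in lebesgue. x \<notin> N"
      using N(1) by (intro AE_not_in) (simp add: negligible_iff_null_sets)
    hence "AE x in lebesgue. x \<in> \<Omega> \<longrightarrow> x \<notin> N" by eventually_elim simp
    thus ?thesis by (simp add: AE_restrict_space_iff dom_sets)
  qed
  moreover have "AE x in lebesgue_on \<Omega>. x \<in> \<Omega>" using AE_space[of "lebesgue_on \<Omega>"] by simp
  ultimately show ?thesis by eventually_elim (rule g0)
qed

end

text \<open>The difference quotients of \<open>f\<close> have integral zero by translation invariance; they converge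
  boundedly and with supports in a common compact set.\<close>

lemma integral_gradient_eq_0:
  fixes f :: "'a::euclidean_space \<Rightarrow> real"
  assumes d: "\<And>x. (f has_derivative (\<lambda>h. h \<bullet> G x)) (at x)" and G: "continuous_on UNIV G"
    and K: "compact K" and f0: "\<And>x. x \<notin> K \<Longrightarrow> f x = 0" and G0: "\<And>x. x \<notin> K \<Longrightarrow> G x = 0"
  shows "integrable lborel G" "(LINT x|lborel. G x) = 0"
proof -
  have fc: "continuous_on UNIV f" by (intro continuous_at_imp_continuous_on ballI has_derivative_continuous[OF d])
  have [measurable]: "f \<in> borel_measurable borel" "G \<in> borel_measurable borel"
    using fc G by (auto intro: borel_measurable_continuous_onI)
  have "compact (G ` K)" using K G by (intro compact_continuous_image) (auto intro: continuous_on_subset)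
  then obtain B where B0: "B > 0" "\<And>x. x \<in> K \<Longrightarrow> norm (G x) \<le> B"
    by (metis bounded_pos compact_imp_bounded image_eqI)
  hence B: "norm (G x) \<le> B" for x using G0[of x] by (cases "x \<in> K") auto
  have "compact (f ` K)" using K fc by (intro compact_continuous_image) (auto intro: continuous_on_subset)
  then obtain C where C0: "C > 0" "\<And>x. x \<in> K \<Longrightarrow> norm (f x) \<le> C"
    by (metis bounded_pos compact_imp_bounded image_eqI)
  hence C: "norm (f x) \<le> C * indicator K x" for x using f0[of x] by (cases "x \<in> K") auto
  have Ki: "integrable lborel (\<lambda>x. c * indicator K' x :: real)" if "compact K'" for c and K' :: "'a set"
    using that by (auto intro!: integrable_real_indicator emeasure_compact_finite borel_compact)
  show Gi: "integrable lborel G"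
    by (rule Bochner_Integration.integrable_bound[OF Ki[OF K, of B]])
       (use B B0 G0 in \<open>auto simp: indicator_def intro!: AE_I2\<close>)
  have fi: "integrable lborel f"
    by (rule Bochner_Integration.integrable_bound[OF Ki[OF K, of C]]) (use C C0 in \<open>auto intro!: AE_I2 simp: abs_mult\<close>)
  have "(LINT x|lborel. v \<bullet> G x) = 0" for v
  proof -
    define t :: "nat \<Rightarrow> real" where "t n = inverse (real (Suc n))" for n
    have t: "t n > 0" "t n \<le> 1" for n by (auto simp: t_def field_simps)
    have t0: "t \<longlonglongrightarrow> 0" unfolding t_def by (rule LIMSEQ_inverse_real_of_nat)
    define q where "q n x = (f (t n *\<^sub>R v + x) - f x) / t n" for n x
    define K' where "K' = (\<lambda>(s, x). x - s *\<^sub>R v) ` ({0..1} \<times> K)"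
    have K': "compact K'" unfolding K'_def
      by (intro compact_continuous_image compact_Times K) (auto intro!: continuous_intros simp: case_prod_unfold)
    have qb: "norm (q n x) \<le> (B * norm v) * indicator K' x" for n x
    proof (cases "x \<in> K'")
      case True
      have "norm (f (t n *\<^sub>R v + x) - f x) \<le> B * norm (t n *\<^sub>R v + x - x)"
      proof (rule differentiable_bound[OF convex_UNIV])
        show "(f has_derivative (\<lambda>h. h \<bullet> G x)) (at x within UNIV)" for x using d by simp
        show "onorm (\<lambda>h. h \<bullet> G x) \<le> B" for x
          using B[of x] by (intro onorm_le) (metis Cauchy_Schwarz_ineq2 mult.commute mult_left_mono norm_ge_zero order_trans real_norm_def)
      qed auto
      also have "\<dots> = B * norm v * t n" using t[of n] by simp
      finally show ?thesis using True t[of n] by (simp add: q_def field_simps)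
    next
      case False
      have "x \<notin> K"
      proof
        assume "x \<in> K" hence "x \<in> K'" unfolding K'_def by (intro image_eqI[of _ _ "(0, x)"]) auto
        thus False using False by simp
      qed
      moreover have "t n *\<^sub>R v + x \<notin> K"
      proof
        assume "t n *\<^sub>R v + x \<in> K" hence "x \<in> K'" unfolding K'_def using t[of n]
          by (intro image_eqI[of _ _ "(t n, t n *\<^sub>R v + x)"]) auto
        thus False using False by simp
      qed
      ultimately show ?thesis using f0 False by (simp add: q_def)
    qed
    have lim: "(\<lambda>n. q n x) \<longlonglongrightarrow> v \<bullet> G x" for x
    proof -
      have "((\<lambda>s. f (x + s *\<^sub>R v)) has_derivative (\<lambda>s. (s *\<^sub>R v) \<bullet> G x)) (at 0)"
        by (rule has_derivative_compose[where g=f and f="\<lambda>s. x + s *\<^sub>R v"]) (auto intro!: derivative_eq_intros d)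
      hence "((\<lambda>s. f (x + s *\<^sub>R v)) has_real_derivative (v \<bullet> G x)) (at 0)"
        by (simp add: has_field_derivative_def mult_commute_abs)
      hence "((\<lambda>s. (f (x + s *\<^sub>R v) - f x) / s) \<longlongrightarrow> v \<bullet> G x) (at 0)"
        by (simp add: has_field_derivative_iff)
      moreover have "filterlim t (at 0) sequentially"
      proof -
        have "t n \<noteq> 0" for n using t(1)[of n] by simp
        thus ?thesis by (simp add: filterlim_at t0)
      qed
      ultimately have "(\<lambda>n. (f (x + t n *\<^sub>R v) - f x) / t n) \<longlonglongrightarrow> v \<bullet> G x"
        by (rule filterlim_compose)
      thus ?thesis by (simp add: q_def add.commute)
    qed
    have shift: "integrable lborel (\<lambda>x. f (c + x))" "(LINT x|lborel. f (c + x)) = (LINT x|lborel. f x)" for c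
    proof -
      have "integrable (distr lborel borel ((+) c)) f" using fi by (simp add: lborel_distr_plus)
      thus "integrable lborel (\<lambda>x. f (c + x))" by (simp add: integrable_distr_eq)
      have "(LINT x|lborel. f x) = (LINT x|distr lborel borel ((+) c). f x)" by (simp add: lborel_distr_plus)
      also have "\<dots> = (LINT x|lborel. f (c + x))" by (simp add: integral_distr)
      finally show "(LINT x|lborel. f (c + x)) = (LINT x|lborel. f x)" by simp
    qed
    have "(LINT x|lborel. q n x) = 0" for n
      unfolding q_def using shift fi by simp
    moreover have "(\<lambda>n. LINT x|lborel. q n x) \<longlonglongrightarrow> (LINT x|lborel. v \<bullet> G x)"
      by (rule integral_dominated_convergence[where w="\<lambda>x. (B * norm v) * indicator K' x"])
         (use lim qb Ki[OF K'] in \<open>auto simp: q_def intro!: AE_I2\<close>)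
    ultimately show ?thesis by (simp add: LIMSEQ_const_iff)
  qed
  hence "v \<bullet> (LINT x|lborel. G x) = 0" for v using Gi by simp
  thus "(LINT x|lborel. G x) = 0" using inner_eq_zero_iff by blast
qed

section \<open>Averages over balls\<close>

abbreviation unit_interval :: "real measure" where
  "unit_interval \<equiv> restrict_space lborel {0..1}"

abbreviation unit_ball :: "'a::euclidean_space measure" where
  "unit_ball \<equiv> restrict_space lborel (ball 0 1)"

interpretation unit_interval: finite_measure unit_interval
  by (rule finite_measureI) (simp add: emeasure_restrict_space)

interpretation unit_ball: finite_measure "unit_ball :: 'a::euclidean_space measure"
  by (rule finite_measureI) (use emeasure_lborel_ball_finite[of "0::'a" 1] in \<open>simp add: emeasure_restrict_space less_top\<close>)

definition ball_volume :: "'a::euclidean_space itself \<Rightarrow> real" where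
  "ball_volume _ = measure (lborel :: 'a measure) (ball 0 1)"

lemma ball_volume_pos: "ball_volume TYPE('a::euclidean_space) > 0"
  using content_ball_pos[of 1 "0::'a"] by (simp add: ball_volume_def)

lemma measure_unit_ball: "measure unit_ball (space unit_ball :: 'a::euclidean_space set) = ball_volume TYPE('a)"
  by (simp add: ball_volume_def measure_restrict_space space_restrict_space)

lemma measure_unit_interval: "measure unit_interval (space unit_interval) = 1"
  by (simp add: measure_restrict_space space_restrict_space)

lemma measurable_unit_interval[measurable]: "(\<lambda>s. s) \<in> borel_measurable unit_interval"
  by (intro measurable_restrict_space1) simp

lemma measurable_unit_ball[measurable]: "(\<lambda>s. s) \<in> borel_measurable unit_ball"
  by (intro measurable_restrict_space1) simp

text \<open>The change of variables \<open>y \<mapsto> x + c y\<close>.\<close>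

lemma nn_integral_lborel_affine:
  fixes h :: "'a::euclidean_space \<Rightarrow> ennreal"
  assumes [measurable]: "h \<in> borel_measurable borel" and "c > 0"
  shows "(\<integral>\<^sup>+y. h y \<partial>lborel) = ennreal (c ^ DIM('a)) * (\<integral>\<^sup>+y. h (x + c *\<^sub>R y) \<partial>lborel)"
  using \<open>c > 0\<close>
  by (subst lborel_affine[of c x])
     (simp_all add: nn_integral_density nn_integral_distr nn_integral_cmult ennreal_power)

lemma nn_integral_lborel_translate:
  fixes h :: "'a::euclidean_space \<Rightarrow> ennreal"
  assumes [measurable]: "h \<in> borel_measurable borel"
  shows "(\<integral>\<^sup>+x. h (x + c) \<partial>lborel) = (\<integral>\<^sup>+x. h x \<partial>lborel)"
  using nn_integral_lborel_affine[OF assms, of 1 c] by (simp add: add.commute)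

definition ball_average :: "real \<Rightarrow> ('a::euclidean_space \<Rightarrow> real) \<Rightarrow> 'a \<Rightarrow> real" where
  "ball_average \<epsilon> f x = (LINT y|unit_ball. f (x + \<epsilon> *\<^sub>R y)) / ball_volume TYPE('a)"

text \<open>Boundedness makes every integral over the unit ball finite; square integrability on the whole
  space controls these integrals.\<close>

locale bounded_continuous_L2 =
  fixes f :: "'a::euclidean_space \<Rightarrow> real" and b :: real
  assumes cont: "continuous_on UNIV f" and bound: "\<And>x. \<bar>f x\<bar> \<le> b"
    and sq: "integrable lborel (\<lambda>x. (f x)\<^sup>2)"
begin

lemma meas[measurable]: "f \<in> borel_measurable borel"
  using cont by (rule borel_measurable_continuous_onI)

lemma integrable_ball: "integrable unit_ball (\<lambda>y. f (x + c *\<^sub>R y))"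
  by (rule unit_ball.integrable_const_bound[of _ b]) (use bound in auto)

lemma integrable_ball_sq: "integrable unit_ball (\<lambda>y. (f (x + c *\<^sub>R y))\<^sup>2)"
proof (rule unit_ball.integrable_const_bound[of _ "b\<^sup>2"])
  show "AE y in unit_ball. norm ((f (x + c *\<^sub>R y))\<^sup>2) \<le> b\<^sup>2"
    using power_mono[OF bound abs_ge_zero, of _ 2] by auto
qed measurable

text \<open>After the substitution \<open>y \<mapsto> x + c y\<close> the integral runs over a ball of radius \<open>c\<close> instead of
  the whole space. The factor \<open>c ^ (- DIM)\<close> is the source of the critical exponent.\<close>

lemma ball_sq_le:
  assumes "c > 0"
  shows "(LINT y|unit_ball. (f (x + c *\<^sub>R y))\<^sup>2) \<le> (LINT y|lborel. (f y)\<^sup>2) / c ^ DIM('a)"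
proof -
  let ?I = "LINT y|lborel. (f y)\<^sup>2"
  have "ennreal (LINT y|unit_ball. (f (x + c *\<^sub>R y))\<^sup>2) = (\<integral>\<^sup>+y. ennreal ((f (x + c *\<^sub>R y))\<^sup>2) \<partial>unit_ball)"
    by (rule nn_integral_eq_integral[symmetric, OF integrable_ball_sq]) auto
  also have "\<dots> = (\<integral>\<^sup>+y. ennreal ((f (x + c *\<^sub>R y))\<^sup>2) * indicator (ball 0 1) y \<partial>lborel)"
    by (rule nn_integral_restrict_space) auto
  also have "\<dots> \<le> (\<integral>\<^sup>+y. ennreal ((f (x + c *\<^sub>R y))\<^sup>2) \<partial>lborel)"
    by (intro nn_integral_mono) (auto simp: indicator_def)
  finally have 1: "ennreal (LINT y|unit_ball. (f (x + c *\<^sub>R y))\<^sup>2) \<le> (\<integral>\<^sup>+y. ennreal ((f (x + c *\<^sub>R y))\<^sup>2) \<partial>lborel)" .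
  have "ennreal (c ^ DIM('a) * (LINT y|unit_ball. (f (x + c *\<^sub>R y))\<^sup>2)) \<le>
      ennreal (c ^ DIM('a)) * (\<integral>\<^sup>+y. ennreal ((f (x + c *\<^sub>R y))\<^sup>2) \<partial>lborel)"
    using 1 assms by (subst ennreal_mult) (auto intro!: mult_left_mono)
  also have "\<dots> = (\<integral>\<^sup>+y. ennreal ((f y)\<^sup>2) \<partial>lborel)"
    by (rule nn_integral_lborel_affine[symmetric]) (use assms in auto)
  also have "\<dots> = ennreal ?I" by (rule nn_integral_eq_integral[OF sq]) auto
  finally have "c ^ DIM('a) * (LINT y|unit_ball. (f (x + c *\<^sub>R y))\<^sup>2) \<le> ?I"
    by (subst (asm) ennreal_le_iff) auto
  thus ?thesis using assms by (simp add: field_simps)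
qed

lemma ball_abs_le:
  "(LINT y|unit_ball. \<bar>f (x + c *\<^sub>R y)\<bar>) \<le>
     sqrt (ball_volume TYPE('a)) * sqrt (LINT y|unit_ball. (f (x + c *\<^sub>R y))\<^sup>2)"
  using Cauchy_Schwarz_integral(2)[of "\<lambda>_. 1" unit_ball "\<lambda>y. f (x + c *\<^sub>R y)"]
    integrable_ball_sq measure_unit_ball[where ?'a='a] by simp

lemma ball_average_bound:
  assumes "\<epsilon> > 0"
  shows "\<bar>ball_average \<epsilon> f x\<bar> \<le> sqrt ((LINT y|lborel. (f y)\<^sup>2) / \<epsilon> ^ DIM('a) / ball_volume TYPE('a))"
proof -
  let ?w = "ball_volume TYPE('a)"
  have w: "?w > 0" by (rule ball_volume_pos)
  have "\<bar>LINT y|unit_ball. f (x + \<epsilon> *\<^sub>R y)\<bar> \<le> (LINT y|unit_ball. \<bar>f (x + \<epsilon> *\<^sub>R y)\<bar>)"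
    by (rule integral_abs_bound)
  also have "\<dots> \<le> sqrt ?w * sqrt (LINT y|unit_ball. (f (x + \<epsilon> *\<^sub>R y))\<^sup>2)" by (rule ball_abs_le)
  also have "\<dots> \<le> sqrt ?w * sqrt ((LINT y|lborel. (f y)\<^sup>2) / \<epsilon> ^ DIM('a))"
    using ball_sq_le[OF assms] w by (intro mult_left_mono real_sqrt_le_mono) auto
  finally have "\<bar>ball_average \<epsilon> f x\<bar> \<le> sqrt ?w / ?w * sqrt ((LINT y|lborel. (f y)\<^sup>2) / \<epsilon> ^ DIM('a))"
    using w by (simp add: ball_average_def divide_le_eq mult.commute abs_divide)
  also have "sqrt ?w / ?w = 1 / sqrt ?w" using w by (simp add: real_div_sqrt field_simps)
  finally show ?thesis by (simp add: real_sqrt_divide real_sqrt_mult mult.commute)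
qed

end

text \<open>Test functions are used only through these properties. They are shared by the differences
  \<open>f (x + k) - f x\<close>, which are in general not test functions on \<open>\<Omega>\<close>.\<close>

locale compactly_supported_C1 =
  fixes f :: "'a::euclidean_space \<Rightarrow> real" and G :: "'a \<Rightarrow> 'a" and K :: "'a set"
  assumes deriv: "\<And>x. (f has_derivative (\<lambda>h. h \<bullet> G x)) (at x)" and G_cont: "continuous_on UNIV G"
    and K: "compact K" and f0: "\<And>x. x \<notin> K \<Longrightarrow> f x = 0" and G0: "\<And>x. x \<notin> K \<Longrightarrow> G x = 0"
begin

lemma f_cont: "continuous_on UNIV f"
  by (intro continuous_at_imp_continuous_on ballI has_derivative_continuous[OF deriv])

lemma f_meas[measurable]: "f \<in> borel_measurable borel" and G_meas[measurable]: "G \<in> borel_measurable borel"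
  using f_cont G_cont by (auto intro: borel_measurable_continuous_onI)

lemma compact_bound:
  fixes h :: "'a \<Rightarrow> real"
  assumes "continuous_on UNIV h" "\<And>x. x \<notin> K \<Longrightarrow> h x = 0"
  shows "\<exists>b>0. \<forall>x. \<bar>h x\<bar> \<le> b"
proof -
  have "compact (h ` K)" using K assms by (intro compact_continuous_image) (auto intro: continuous_on_subset)
  then obtain B where "B > 0" "\<And>x. x \<in> K \<Longrightarrow> norm (h x) \<le> B"
    by (metis bounded_pos compact_imp_bounded image_eqI)
  thus ?thesis using assms(2) by (metis abs_zero less_eq_real_def real_norm_def)
qed

lemma compact_integrable:
  fixes h :: "'a \<Rightarrow> real"
  assumes "continuous_on UNIV h" "\<And>x. x \<notin> K \<Longrightarrow> h x = 0"
  shows "integrable lborel h"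
proof -
  obtain b where b: "b > 0" "\<And>x. \<bar>h x\<bar> \<le> b" using compact_bound[OF assms] by blast
  have 1: "integrable lborel (\<lambda>x. b * indicator K x)"
    using K by (auto intro!: integrable_real_indicator emeasure_compact_finite borel_compact)
  have [measurable]: "h \<in> borel_measurable borel" using assms by (auto intro: borel_measurable_continuous_onI)
  show ?thesis
    by (rule Bochner_Integration.integrable_bound[OF 1]) (use b assms in \<open>auto simp: indicator_def\<close>)
qed

lemma G_L2: "\<exists>b. bounded_continuous_L2 (\<lambda>x. norm (G x)) b"
proof -
  have c: "continuous_on UNIV (\<lambda>x. norm (G x))" "continuous_on UNIV (\<lambda>x. (norm (G x))\<^sup>2)"
    by (auto intro!: continuous_intros G_cont)
  obtain b where "\<And>x. \<bar>norm (G x)\<bar> \<le> b" using compact_bound[OF c(1)] G0 by auto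
  thus ?thesis using compact_integrable[OF c(2)] G0 c by (auto simp: bounded_continuous_L2_def)
qed

lemma f_L2: "\<exists>b. bounded_continuous_L2 f b"
proof -
  have c: "continuous_on UNIV (\<lambda>x. (f x)\<^sup>2)" by (auto intro!: continuous_intros f_cont)
  obtain b where "\<And>x. \<bar>f x\<bar> \<le> b" using compact_bound[OF f_cont] f0 by auto
  thus ?thesis using compact_integrable[OF c] f0 f_cont by (auto simp: bounded_continuous_L2_def)
qed

definition dirichlet :: real where "dirichlet = (LINT x|lborel. (norm (G x))\<^sup>2)"

lemma dirichlet_nonneg: "dirichlet \<ge> 0" by (simp add: dirichlet_def)

lemma G_sq_integrable: "integrable lborel (\<lambda>x. (norm (G x))\<^sup>2)"
  using G_L2 by (auto simp: bounded_continuous_L2_def)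

lemma G_interval_integrable: "integrable unit_interval (\<lambda>s. norm (G (x + s *\<^sub>R y)))"
proof -
  obtain b where "bounded_continuous_L2 (\<lambda>x. norm (G x)) b" using G_L2 by blast
  then interpret g: bounded_continuous_L2 "\<lambda>x. norm (G x)" b .
  show ?thesis by (rule unit_interval.integrable_const_bound[of _ b]) (use g.bound in auto)
qed

text \<open>The fundamental theorem of calculus on the segment from \<open>x\<close> to \<open>x + y\<close>.\<close>

lemma segment_bound:
  "\<bar>f (x + y) - f x\<bar> \<le> norm y * (LINT s|unit_interval. norm (G (x + s *\<^sub>R y)))"
proof -
  have 1: "((\<lambda>s. y \<bullet> G (x + s *\<^sub>R y)) has_integral (f (x + 1 *\<^sub>R y) - f (x + 0 *\<^sub>R y))) {0..1}"
  proof (rule fundamental_theorem_of_calculus)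
    fix s :: real
    have "((\<lambda>s. f (x + s *\<^sub>R y)) has_derivative (\<lambda>t. (t *\<^sub>R y) \<bullet> G (x + s *\<^sub>R y))) (at s)"
      by (rule has_derivative_compose[where g=f and f="\<lambda>s. x + s *\<^sub>R y"]) (auto intro!: derivative_eq_intros deriv)
    thus "((\<lambda>s. f (x + s *\<^sub>R y)) has_vector_derivative y \<bullet> G (x + s *\<^sub>R y)) (at s within {0..1})"
      by (auto simp: has_vector_derivative_def intro: has_derivative_at_withinI)
  qed simp
  have c: "continuous_on {0..1} (\<lambda>s. norm (G (x + s *\<^sub>R y)))"
    by (intro continuous_intros continuous_on_compose2[OF G_cont]) auto
  have "norm (integral {0..1} (\<lambda>s. y \<bullet> G (x + s *\<^sub>R y))) \<le> integral {0..1} (\<lambda>s. norm y * norm (G (x + s *\<^sub>R y)))"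
    using 1 c by (intro integral_norm_bound_integral)
      (auto intro!: integrable_continuous_interval continuous_intros Cauchy_Schwarz_ineq2 simp: has_integral_integrable)
  also have "\<dots> = norm y * integral {0..1} (\<lambda>s. norm (G (x + s *\<^sub>R y)))" by simp
  also have "integral {0..1} (\<lambda>s. norm (G (x + s *\<^sub>R y))) = (LINT s|unit_interval. norm (G (x + s *\<^sub>R y)))"
  proof -
    have "set_integrable lborel {0..1} (\<lambda>s. norm (G (x + s *\<^sub>R y)))"
      using G_interval_integrable by (simp add: set_integrable_def integrable_restrict_space)
    from set_borel_integral_eq_integral(2)[OF this] show ?thesis
      by (simp add: integral_restrict_space set_lebesgue_integral_def)
  qed
  finally show ?thesis using 1 by (simp add: integral_unique)
qed

lemma G_interval_sq_integrable: "integrable unit_interval (\<lambda>s. (norm (G (x + s *\<^sub>R y)))\<^sup>2)"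
proof -
  obtain b where "bounded_continuous_L2 (\<lambda>x. norm (G x)) b" using G_L2 by blast
  then interpret g: bounded_continuous_L2 "\<lambda>x. norm (G x)" b .
  have "(norm (G x))\<^sup>2 \<le> b\<^sup>2" for x using power_mono[OF g.bound abs_ge_zero, of x 2] by simp
  thus ?thesis by (intro unit_interval.integrable_const_bound[of _ "b\<^sup>2"]) auto
qed

lemma nn_dirichlet: "(\<integral>\<^sup>+x. ennreal ((norm (G x))\<^sup>2) \<partial>lborel) = ennreal dirichlet"
  unfolding dirichlet_def by (rule nn_integral_eq_integral[OF G_sq_integrable]) auto

text \<open>Square the bound on the segment, exchange the integrals, and use that the integral of
  \<open>|G(x + s k)|\<^sup>2\<close> over \<open>x\<close> does not depend on \<open>s\<close>.\<close>

lemma translation_estimate_nn: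
  "(\<integral>\<^sup>+x. ennreal ((f (x + k) - f x)\<^sup>2) \<partial>lborel) \<le> ennreal ((norm k)\<^sup>2 * dirichlet)"
proof -
  have pw: "ennreal ((f (x + k) - f x)\<^sup>2) \<le> ennreal ((norm k)\<^sup>2) * (\<integral>\<^sup>+s. ennreal ((norm (G (x + s *\<^sub>R k)))\<^sup>2) \<partial>unit_interval)" for x
  proof -
    let ?L = "LINT s|unit_interval. (norm (G (x + s *\<^sub>R k)))\<^sup>2"
    have "(LINT s|unit_interval. norm (G (x + s *\<^sub>R k))) \<le> sqrt ?L"
      using Cauchy_Schwarz_integral(2)[of "\<lambda>_. 1" unit_interval "\<lambda>s. norm (G (x + s *\<^sub>R k))"]
        G_interval_sq_integrable measure_unit_interval by simp
    hence "\<bar>f (x + k) - f x\<bar> \<le> norm k * sqrt ?L"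
      by (intro order_trans[OF segment_bound] mult_left_mono) auto
    hence "\<bar>f (x + k) - f x\<bar>\<^sup>2 \<le> (norm k * sqrt ?L)\<^sup>2" by (intro power_mono) auto
    hence "(f (x + k) - f x)\<^sup>2 \<le> (norm k)\<^sup>2 * ?L" by (simp add: power_mult_distrib)
    hence "ennreal ((f (x + k) - f x)\<^sup>2) \<le> ennreal ((norm k)\<^sup>2) * ennreal ?L"
      by (simp add: ennreal_mult[symmetric] ennreal_leI)
    also have "ennreal ?L = (\<integral>\<^sup>+s. ennreal ((norm (G (x + s *\<^sub>R k)))\<^sup>2) \<partial>unit_interval)"
      by (rule nn_integral_eq_integral[symmetric, OF G_interval_sq_integrable]) auto
    finally show ?thesis .
  qed
  interpret P: pair_sigma_finite "lborel :: 'a measure" unit_interval ..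
  have "(\<integral>\<^sup>+x. ennreal ((f (x + k) - f x)\<^sup>2) \<partial>lborel) \<le>
     (\<integral>\<^sup>+x. ennreal ((norm k)\<^sup>2) * (\<integral>\<^sup>+s. ennreal ((norm (G (x + s *\<^sub>R k)))\<^sup>2) \<partial>unit_interval) \<partial>lborel)"
    by (intro nn_integral_mono pw)
  also have "\<dots> = ennreal ((norm k)\<^sup>2) * (\<integral>\<^sup>+x. (\<integral>\<^sup>+s. ennreal ((norm (G (x + s *\<^sub>R k)))\<^sup>2) \<partial>unit_interval) \<partial>lborel)"
    by (rule nn_integral_cmult) measurable
  also have "(\<integral>\<^sup>+x. (\<integral>\<^sup>+s. ennreal ((norm (G (x + s *\<^sub>R k)))\<^sup>2) \<partial>unit_interval) \<partial>lborel) =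
     (\<integral>\<^sup>+s. (\<integral>\<^sup>+x. ennreal ((norm (G (x + s *\<^sub>R k)))\<^sup>2) \<partial>lborel) \<partial>unit_interval)"
    by (rule P.Fubini'[symmetric]) measurable
  also have "\<dots> = (\<integral>\<^sup>+s. ennreal dirichlet \<partial>unit_interval)"
    by (subst nn_integral_lborel_translate[where h="\<lambda>x. ennreal ((norm (G x))\<^sup>2)"]) (auto simp: nn_dirichlet)
  also have "\<dots> = ennreal dirichlet"
    by (simp add: emeasure_restrict_space space_restrict_space)
  finally show ?thesis by (simp add: ennreal_mult dirichlet_nonneg)
qed

lemma translate_C1: "compactly_supported_C1 (\<lambda>x. f (x + k) - f x) (\<lambda>x. G (x + k) - G x) (K \<union> (\<lambda>x. x - k) ` K)"
proof
  fix x
  have "((\<lambda>x. f (x + k)) has_derivative (\<lambda>h. h \<bullet> G (x + k))) (at x)"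
    by (rule has_derivative_compose[where g=f and f="\<lambda>x. x + k"]) (auto intro!: derivative_eq_intros deriv)
  thus "((\<lambda>x. f (x + k) - f x) has_derivative (\<lambda>h. h \<bullet> (G (x + k) - G x))) (at x)"
    using has_derivative_diff[OF _ deriv] by (auto simp: inner_diff_right)
  have im: "x + k \<notin> K" if "x \<notin> (\<lambda>x. x - k) ` K" using that by (metis add_diff_cancel image_eqI)
  show "f (x + k) - f x = 0" "G (x + k) - G x = 0" if "x \<notin> K \<union> (\<lambda>x. x - k) ` K"
    using that im f0 G0 by auto
next
  show "continuous_on UNIV (\<lambda>x. G (x + k) - G x)"
    by (intro continuous_intros continuous_on_compose2[OF G_cont]) auto
  show "compact (K \<union> (\<lambda>x. x - k) ` K)"
    using K by (intro compact_Un compact_continuous_image continuous_intros) auto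
qed

lemma f_sq_integrable: "integrable lborel (\<lambda>x. (f x)\<^sup>2)"
  using f_L2 by (auto simp: bounded_continuous_L2_def)

lemma translation_estimate:
  "(LINT x|lborel. (f (x + k) - f x)\<^sup>2) \<le> (norm k)\<^sup>2 * dirichlet"
proof -
  interpret t: compactly_supported_C1 "\<lambda>x. f (x + k) - f x" "\<lambda>x. G (x + k) - G x" "K \<union> (\<lambda>x. x - k) ` K"
    by (rule translate_C1)
  show ?thesis using translation_estimate_nn[of k] dirichlet_nonneg
    by (subst (asm) nn_integral_eq_integral[OF t.f_sq_integrable]) auto
qed

text \<open>The difference of two averages is the average of the difference \<open>f (x + k) - f x\<close>, whose
  \<open>L\<^sup>2\<close> norm is at most \<open>|k|\<close> times that of the gradient.\<close>

lemma ball_average_Lipschitz: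
  assumes "\<epsilon> > 0"
  shows "\<bar>ball_average \<epsilon> f x - ball_average \<epsilon> f x'\<bar> \<le>
     norm (x - x') * sqrt (dirichlet / \<epsilon> ^ DIM('a) / ball_volume TYPE('a))"
proof -
  let ?w = "ball_volume TYPE('a)"
  define k where "k = x - x'"
  interpret t: compactly_supported_C1 "\<lambda>x. f (x + k) - f x" "\<lambda>x. G (x + k) - G x" "K \<union> (\<lambda>x. x - k) ` K"
    by (rule translate_C1)
  obtain b where "bounded_continuous_L2 (\<lambda>x. f (x + k) - f x) b" using t.f_L2 by blast
  then interpret tb: bounded_continuous_L2 "\<lambda>x. f (x + k) - f x" b .
  obtain b' where "bounded_continuous_L2 f b'" using f_L2 by blast
  then interpret fb: bounded_continuous_L2 f b' .
  have "ball_average \<epsilon> f x - ball_average \<epsilon> f x' = ball_average \<epsilon> (\<lambda>x. f (x + k) - f x) x'"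
  proof -
    have eq: "x' + \<epsilon> *\<^sub>R y + k = x + \<epsilon> *\<^sub>R y" for y by (simp add: k_def)
    thus ?thesis unfolding ball_average_def diff_divide_distrib[symmetric]
      by (subst Bochner_Integration.integral_diff[OF fb.integrable_ball fb.integrable_ball, symmetric]) (simp only: eq)
  qed
  also have "\<bar>\<dots>\<bar> \<le> sqrt ((LINT y|lborel. (f (y + k) - f y)\<^sup>2) / \<epsilon> ^ DIM('a) / ?w)"
    by (rule tb.ball_average_bound[OF assms])
  also have "\<dots> \<le> sqrt ((norm k)\<^sup>2 * dirichlet / \<epsilon> ^ DIM('a) / ?w)"
    using translation_estimate[of k] assms ball_volume_pos[where ?'a='a]
    by (intro real_sqrt_le_mono divide_right_mono) auto
  also have "\<dots> = norm k * sqrt (dirichlet / \<epsilon> ^ DIM('a) / ?w)"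
    by (simp add: real_sqrt_mult real_sqrt_divide)
  finally show ?thesis by (simp add: k_def)
qed

text \<open>A translation by \<open>2R\<close> moves the support off itself, so on the support \<open>f\<close> agrees up to sign
  with its difference under that translation.\<close>

lemma Poincare_inequality:
  assumes R: "K \<subseteq> ball 0 R"
  shows "(LINT x|lborel. (f x)\<^sup>2) \<le> (2 * R)\<^sup>2 * dirichlet"
proof -
  obtain i :: 'a where i: "i \<in> Basis" using nonempty_Basis by blast
  define k where "k = (2 * \<bar>R\<bar>) *\<^sub>R i"
  have nk: "norm k = 2 * \<bar>R\<bar>" using i by (simp add: k_def)
  interpret t: compactly_supported_C1 "\<lambda>x. f (x + k) - f x" "\<lambda>x. G (x + k) - G x" "K \<union> (\<lambda>x. x - k) ` K"
    by (rule translate_C1)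
  have "(f x)\<^sup>2 \<le> (f (x + k) - f x)\<^sup>2" for x
  proof (cases "x \<in> K")
    case True
    hence "norm x < R" using R by auto
    hence "x + k \<notin> ball 0 R" using nk norm_triangle_ineq2[of k "- x"] by (auto simp: add.commute)
    hence "f (x + k) = 0" using R f0 by blast
    thus ?thesis by simp
  qed (simp add: f0)
  hence "(LINT x|lborel. (f x)\<^sup>2) \<le> (LINT x|lborel. (f (x + k) - f x)\<^sup>2)"
    by (intro integral_mono f_sq_integrable t.f_sq_integrable)
  also have "\<dots> \<le> (norm k)\<^sup>2 * dirichlet" by (rule translation_estimate)
  finally show ?thesis by (simp add: nk power_mult_distrib)
qed

end

lemma measure_unit_ball_ball: "measure unit_ball (ball 0 1 :: 'a::euclidean_space set) = ball_volume TYPE('a)"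
  using measure_unit_ball[where ?'a='a] by (simp add: space_restrict_space)

lemma unit_interval_powr:
  assumes "\<beta> < 1"
  shows "integrable unit_interval (\<lambda>s. s powr - \<beta>)" "(LINT s|unit_interval. s powr - \<beta>) = 1 / (1 - \<beta>)"
proof -
  have hi: "((\<lambda>s. s powr - \<beta>) has_integral (1 powr (- \<beta> + 1) / (- \<beta> + 1))) {0..1::real}"
    using assms by (intro has_integral_powr_from_0) auto
  hence nn: "(\<integral>\<^sup>+s. ennreal (s powr - \<beta>) \<partial>unit_interval) = ennreal (1 / (1 - \<beta>))"
    by (subst nn_integral_restrict_space, simp, subst nn_integral_has_integral_lebesgue'[OF _ hi]) (auto simp: add.commute)
  have [measurable]: "(\<lambda>s::real. s powr - \<beta>) \<in> borel_measurable unit_interval" by measurable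
  show i: "integrable unit_interval (\<lambda>s. s powr - \<beta>)"
    by (rule integrableI_bounded) (auto simp: nn)
  show "(LINT s|unit_interval. s powr - \<beta>) = 1 / (1 - \<beta>)"
    using nn assms by (subst (asm) nn_integral_eq_integral[OF i]) auto
qed

text \<open>The number of derivatives that the embedding of \<open>H\<^sup>1\<close> into \<open>L\<^sup>q\<close> costs. It is below \<open>1\<close> exactly
  for \<open>q\<close> below the critical exponent.\<close>

definition sobolev_defect :: "'a::euclidean_space itself \<Rightarrow> real \<Rightarrow> real" where
  "sobolev_defect _ q = real DIM('a) * (1/2 - 1/q)"

text \<open>The first factor comes from averaging over the unit ball, the second from the integral of
  \<open>s powr - \<beta>\<close> over the unit interval, where \<open>\<beta>\<close> is the defect.\<close>

definition average_constant :: "'a::euclidean_space itself \<Rightarrow> real \<Rightarrow> real" where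
  "average_constant T q = ball_volume T powr (1 - q/2) * (1 / (1 - sobolev_defect T q)) powr q"

context compactly_supported_C1
begin

text \<open>The mean square of the gradient near \<open>x\<close> at scale \<open>s \<epsilon>\<close>, before normalisation.\<close>

definition spread :: "real \<Rightarrow> 'a \<Rightarrow> real \<Rightarrow> real" where
  "spread \<epsilon> x s = (LINT y|unit_ball. (norm (G (x + (s * \<epsilon>) *\<^sub>R y)))\<^sup>2)"

text \<open>Write \<open>f x - f (x + \<epsilon> y)\<close> as an integral over the segment, average over \<open>y\<close>, exchange the two
  integrations, and apply the Cauchy-Schwarz inequality in \<open>y\<close>.\<close>

lemma average_error_pointwise:
  assumes \<epsilon>: "\<epsilon> > 0"
  shows "\<bar>f x - ball_average \<epsilon> f x\<bar> \<le> \<epsilon> / sqrt (ball_volume TYPE('a)) * (LINT s|unit_interval. sqrt (spread \<epsilon> x s))"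
    "spread \<epsilon> x \<in> borel_measurable unit_interval" "\<exists>b. \<forall>s. \<bar>spread \<epsilon> x s\<bar> \<le> b"
proof -
  let ?w = "ball_volume TYPE('a)"
  have w: "?w > 0" by (rule ball_volume_pos)
  obtain b where "bounded_continuous_L2 (\<lambda>x. norm (G x)) b" using G_L2 by blast
  then interpret g: bounded_continuous_L2 "\<lambda>x. norm (G x)" b .
  obtain b' where "bounded_continuous_L2 f b'" using f_L2 by blast
  then interpret fb: bounded_continuous_L2 f b' .
  interpret P: pair_sigma_finite unit_interval "unit_ball :: 'a measure" ..
  interpret PF: finite_measure "unit_interval \<Otimes>\<^sub>M (unit_ball :: 'a measure)"
    by (rule finite_measure_pair_measure) unfold_locales
  have b: "b \<ge> 0" using g.bound[of 0] by linarith
  have abs_g: "norm (G z) \<le> b" for z using g.bound[of z] by simp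
  show m: "spread \<epsilon> x \<in> borel_measurable unit_interval"
    unfolding spread_def by measurable
  have "\<bar>spread \<epsilon> x s\<bar> \<le> b\<^sup>2 * ?w" for s
  proof -
    have "spread \<epsilon> x s \<le> (LINT y|(unit_ball :: 'a measure). b\<^sup>2)"
      unfolding spread_def by (intro integral_mono g.integrable_ball_sq) (auto intro!: power_mono abs_g)
    moreover have "spread \<epsilon> x s \<ge> 0" unfolding spread_def by simp
    ultimately show ?thesis using measure_unit_ball[where ?'a='a] by (simp add: mult.commute)
  qed
  thus bnd: "\<exists>b. \<forall>s. \<bar>spread \<epsilon> x s\<bar> \<le> b" by blast
  have "f x - ball_average \<epsilon> f x = (LINT y|unit_ball. f x - f (x + \<epsilon> *\<^sub>R y)) / ?w"
    using fb.integrable_ball[of x \<epsilon>] w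
    by (simp add: ball_average_def diff_divide_distrib space_restrict_space measure_unit_ball_ball)
  hence "\<bar>f x - ball_average \<epsilon> f x\<bar> = \<bar>LINT y|unit_ball. f x - f (x + \<epsilon> *\<^sub>R y)\<bar> / ?w"
    using w by (simp add: abs_divide)
  also have "\<dots> \<le> (LINT y|unit_ball. \<bar>f x - f (x + \<epsilon> *\<^sub>R y)\<bar>) / ?w"
    using w by (intro divide_right_mono integral_abs_bound) auto
  also have "\<dots> \<le> (LINT y|unit_ball. \<epsilon> * (LINT s|unit_interval. norm (G (x + (s * \<epsilon>) *\<^sub>R y)))) / ?w"
  proof (intro divide_right_mono integral_mono)
    show "integrable unit_ball (\<lambda>y. \<bar>f x - f (x + \<epsilon> *\<^sub>R y)\<bar>)"
      using fb.integrable_ball[of x \<epsilon>] by auto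
    show "integrable unit_ball (\<lambda>y. \<epsilon> * (LINT s|unit_interval. norm (G (x + (s * \<epsilon>) *\<^sub>R y))))"
    proof (intro integrable_mult_right unit_ball.integrable_const_bound[of _ b] AE_I2)
      fix y :: 'a
      have "(LINT s|unit_interval. norm (G (x + (s * \<epsilon>) *\<^sub>R y))) \<le> (LINT s|unit_interval. b)"
        using G_interval_integrable[of x "\<epsilon> *\<^sub>R y"] by (intro integral_mono) (auto intro: abs_g)
      thus "norm (LINT s|unit_interval. norm (G (x + (s * \<epsilon>) *\<^sub>R y))) \<le> b"
        using measure_unit_interval by simp
    qed measurable
    fix y assume "y \<in> space (unit_ball :: 'a measure)"
    hence y: "norm y \<le> 1" by (simp add: space_restrict_space)
    have "\<bar>f x - f (x + \<epsilon> *\<^sub>R y)\<bar> \<le> norm (\<epsilon> *\<^sub>R y) * (LINT s|unit_interval. norm (G (x + s *\<^sub>R \<epsilon> *\<^sub>R y)))"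
      using segment_bound[of x "\<epsilon> *\<^sub>R y"] by (simp add: abs_minus_commute)
    also have "\<dots> \<le> \<epsilon> * (LINT s|unit_interval. norm (G (x + (s * \<epsilon>) *\<^sub>R y)))"
      using y \<epsilon> by (auto intro!: mult_left_le_one_le)
    finally show "\<bar>f x - f (x + \<epsilon> *\<^sub>R y)\<bar> \<le> \<epsilon> * (LINT s|unit_interval. norm (G (x + (s * \<epsilon>) *\<^sub>R y)))" .
  qed (use w in auto)
  also have "\<dots> = \<epsilon> / ?w * (LINT y|unit_ball. (LINT s|unit_interval. norm (G (x + (s * \<epsilon>) *\<^sub>R y))))" by simp
  also have "(LINT y|unit_ball. (LINT s|unit_interval. norm (G (x + (s * \<epsilon>) *\<^sub>R y)))) =
      (LINT s|unit_interval. (LINT y|unit_ball. norm (G (x + (s * \<epsilon>) *\<^sub>R y))))"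
    by (rule P.Fubini_integral, rule PF.integrable_const_bound[of _ b]) (auto simp: abs_g)
  also have "\<epsilon> / ?w * \<dots> \<le> \<epsilon> / ?w * (LINT s|unit_interval. sqrt ?w * sqrt (spread \<epsilon> x s))"
  proof (intro mult_left_mono integral_mono)
    show "integrable unit_interval (\<lambda>s. LINT y|unit_ball. norm (G (x + (s * \<epsilon>) *\<^sub>R y)))"
    proof (intro unit_interval.integrable_const_bound[of _ "b * ?w"] AE_I2)
      fix s :: real
      have "(LINT y|unit_ball. norm (G (x + (s * \<epsilon>) *\<^sub>R y))) \<le> (LINT y|(unit_ball :: 'a measure). b)"
        by (intro integral_mono g.integrable_ball) (auto intro: abs_g)
      thus "norm (LINT y|unit_ball. norm (G (x + (s * \<epsilon>) *\<^sub>R y))) \<le> b * ?w"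
        using measure_unit_ball[where ?'a='a] by (simp add: mult.commute)
    qed measurable
    from bnd obtain c where c: "\<And>s. \<bar>spread \<epsilon> x s\<bar> \<le> c" by blast
    have "integrable unit_interval (\<lambda>s. sqrt (spread \<epsilon> x s))"
    proof (rule unit_interval.integrable_const_bound[of _ "sqrt c"], intro AE_I2)
      fix s
      show "norm (sqrt (spread \<epsilon> x s)) \<le> sqrt c" using c[of s] by (simp add: real_sqrt_abs2 flip: real_sqrt_abs) (auto simp: real_sqrt_abs2 spread_def)
    qed (use m in measurable)
    thus "integrable unit_interval (\<lambda>s. sqrt ?w * sqrt (spread \<epsilon> x s))" by simp
    show "(LINT y|unit_ball. norm (G (x + (s * \<epsilon>) *\<^sub>R y))) \<le> sqrt ?w * sqrt (spread \<epsilon> x s)" for s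
      using g.ball_abs_le[of x "s * \<epsilon>"] by (simp add: spread_def)
  qed (use w \<epsilon> in auto)
  also have "\<dots> = \<epsilon> * (sqrt ?w / ?w) * (LINT s|unit_interval. sqrt (spread \<epsilon> x s))" by simp
  also have "sqrt ?w / ?w = 1 / sqrt ?w" using w by (simp add: real_div_sqrt field_simps)
  finally show "\<bar>f x - ball_average \<epsilon> f x\<bar> \<le> \<epsilon> / sqrt ?w * (LINT s|unit_interval. sqrt (spread \<epsilon> x s))" by simp
qed

text \<open>The square root of the spread \<open>T s\<close> splits into \<open>T s powr (1/q)\<close>, which is kept because it
  is integrable in \<open>x\<close>, and \<open>T s powr (1/2 - 1/q)\<close>, which is bounded by a multiple of \<open>s powr - \<beta>\<close>
  through \<open>ball_sq_le\<close>. The weight \<open>s powr - \<beta>\<close> is integrable at \<open>0\<close> precisely since \<open>\<beta> < 1\<close>, so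
  Holder's inequality in \<open>s\<close> applies.\<close>

lemma average_error_powr:
  assumes \<epsilon>: "\<epsilon> > 0" and q: "q > 2" and \<beta>: "sobolev_defect TYPE('a) q < 1"
  defines "\<beta> \<equiv> sobolev_defect TYPE('a) q"
  shows "integrable unit_interval (\<lambda>s. spread \<epsilon> x s * s powr - \<beta>)"
    "\<bar>f x - ball_average \<epsilon> f x\<bar> powr q \<le>
      (ball_volume TYPE('a) powr (- q/2) * \<epsilon> powr (q - \<beta> * q) * dirichlet powr (q/2 - 1) * (1 / (1 - \<beta>)) powr (q - 1)) *
        (LINT s|unit_interval. spread \<epsilon> x s * s powr - \<beta>)"
proof -
  let ?w = "ball_volume TYPE('a)" and ?D = dirichlet
  define T where "T = spread \<epsilon> x"
  define \<kappa> where "\<kappa> = 1 / (1 - \<beta>)"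
  have \<beta>1: "\<beta> < 1" using \<beta> by (simp add: \<beta>_def)
  have \<kappa>: "\<kappa> > 0" using \<beta>1 by (simp add: \<kappa>_def)
  have w: "?w > 0" by (rule ball_volume_pos)
  have D: "?D \<ge> 0" by (rule dirichlet_nonneg)
  have T0: "T s \<ge> 0" for s by (simp add: T_def spread_def)
  have [measurable]: "T \<in> borel_measurable unit_interval" unfolding T_def by (rule average_error_pointwise(2)[OF \<epsilon>])
  obtain c where c: "\<And>s. \<bar>T s\<bar> \<le> c" using average_error_pointwise(3)[OF \<epsilon>] unfolding T_def by blast
  have c0: "c \<ge> 0" using c[of 0] by linarith
  obtain b where "bounded_continuous_L2 (\<lambda>x. norm (G x)) b" using G_L2 by blast
  then interpret g: bounded_continuous_L2 "\<lambda>x. norm (G x)" b .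
  note pw = unit_interval_powr[OF \<beta>1]
  have Tint: "integrable unit_interval (\<lambda>s. T s * s powr - \<beta>)"
    by (rule Bochner_Integration.integrable_bound[of _ "\<lambda>s. c * s powr - \<beta>"])
       (use pw(1) c c0 in \<open>auto simp: abs_mult intro!: mult_right_mono AE_I2\<close>)
  thus "integrable unit_interval (\<lambda>s. spread \<epsilon> x s * s powr - \<beta>)" by (simp add: T_def)
  define q' where "q' = q / (q - 1)"
  have q': "q' > 1" "1/q + 1/q' = 1" using q by (auto simp: q'_def field_simps)
  define h1 where "h1 s = T s powr (1/q) * s powr (- \<beta>/q)" for s
  define h2 where "h2 s = s powr (- \<beta> / q')" for s :: real
  have h1q: "\<bar>h1 s\<bar> powr q = T s * s powr - \<beta>" for s
    using q T0[of s] by (simp add: h1_def abs_mult powr_mult powr_powr)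
  have h2q: "\<bar>h2 s\<bar> powr q' = s powr - \<beta>" for s
    using q' by (simp add: h2_def powr_powr)
  have [measurable]: "h1 \<in> borel_measurable unit_interval" "h2 \<in> borel_measurable unit_interval"
    unfolding h1_def h2_def by measurable
  have Hol: "integrable unit_interval (\<lambda>s. h1 s * h2 s)"
    "(LINT s|unit_interval. \<bar>h1 s * h2 s\<bar>) \<le> (LINT s|unit_interval. T s * s powr - \<beta>) powr (1/q) * \<kappa> powr (1/q')"
    using Holder_integral[of q q' h1 unit_interval h2] q q' Tint pw by (auto simp: h1q h2q \<kappa>_def)
  have h12: "h1 s * h2 s = T s powr (1/q) * s powr - \<beta>" if "s > 0" for s
  proof -
    have "- \<beta> / q + - \<beta> / q' = - \<beta> * (1/q + 1/q')" by (simp add: field_simps)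
    thus ?thesis using q'(2) by (simp add: h1_def h2_def powr_add[symmetric])
  qed
  \<comment> \<open>\<open>A s powr - \<beta>\<close> bounds the discarded power of the spread.\<close>
  define A where "A = ?D powr (1/2 - 1/q) * \<epsilon> powr - \<beta>"
  have A0: "A \<ge> 0" by (simp add: A_def)
  have le: "sqrt (T s) \<le> A * (h1 s * h2 s)" if s: "s > 0" for s
  proof -
    have e: "1/2 - 1/q \<ge> 0" using q by (simp add: field_simps)
    have "T s \<le> ?D / (s * \<epsilon>) ^ DIM('a)"
      using g.ball_sq_le[of "s * \<epsilon>" x] s \<epsilon> by (simp add: T_def spread_def dirichlet_def)
    also have "\<dots> = ?D * (s * \<epsilon>) powr - real DIM('a)"
      using s \<epsilon> by (simp add: powr_minus powr_realpow divide_inverse)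
    finally have "T s powr (1/2 - 1/q) \<le> (?D * (s * \<epsilon>) powr - real DIM('a)) powr (1/2 - 1/q)"
      using T0 e by (intro powr_mono2) auto
    also have "\<dots> = ?D powr (1/2 - 1/q) * (s * \<epsilon>) powr - \<beta>"
      using D s \<epsilon> by (simp add: powr_mult powr_powr \<beta>_def sobolev_defect_def)
    also have "\<dots> = A * s powr - \<beta>"
      using s \<epsilon> by (simp add: powr_mult A_def)
    finally have 1: "T s powr (1/2 - 1/q) \<le> A * s powr - \<beta>" .
    have "sqrt (T s) = T s powr (1/q) * T s powr (1/2 - 1/q)"
      using T0[of s] by (simp add: powr_add[symmetric] powr_half_sqrt)
    also have "\<dots> \<le> T s powr (1/q) * (A * s powr - \<beta>)" by (intro mult_left_mono 1) auto
    finally show ?thesis using h12[OF s] by (simp add: mult_ac)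
  qed
  have AEpos: "AE s in unit_interval. s > 0"
  proof -
    have "AE s in lborel. s \<noteq> (0::real)" by (rule AE_lborel_singleton)
    hence "AE s in lborel. s \<in> {0..1} \<longrightarrow> s > (0::real)" by eventually_elim auto
    thus ?thesis by (simp add: AE_restrict_space_iff)
  qed
  have "(LINT s|unit_interval. sqrt (T s)) \<le> (LINT s|unit_interval. A * (h1 s * h2 s))"
  proof (rule integral_mono_AE)
    show "integrable unit_interval (\<lambda>s. sqrt (T s))"
      by (rule unit_interval.integrable_const_bound[of _ "sqrt c"])
         (use c T0 in \<open>auto intro!: AE_I2 simp: abs_le_iff\<close>)
    show "AE s in unit_interval. sqrt (T s) \<le> A * (h1 s * h2 s)"
      using AEpos by eventually_elim (rule le)
  qed (use Hol(1) in auto)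
  also have "\<dots> = A * (LINT s|unit_interval. h1 s * h2 s)" by simp
  also have "\<dots> \<le> A * ((LINT s|unit_interval. T s * s powr - \<beta>) powr (1/q) * \<kappa> powr (1/q'))"
    using A0 Hol by (intro mult_left_mono order_trans[OF _ Hol(2)] integral_mono) auto
  finally have fin: "(LINT s|unit_interval. sqrt (T s)) \<le> A * ((LINT s|unit_interval. T s * s powr - \<beta>) powr (1/q) * \<kappa> powr (1/q'))" .
  let ?W = "LINT s|unit_interval. T s * s powr - \<beta>"
  have W0: "?W \<ge> 0" using T0 by (intro Bochner_Integration.integral_nonneg) auto
  have "\<bar>f x - ball_average \<epsilon> f x\<bar> \<le> \<epsilon> / sqrt ?w * (A * (?W powr (1/q) * \<kappa> powr (1/q')))"
    using fin \<epsilon> w unfolding T_def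
    by (intro order_trans[OF average_error_pointwise(1)[OF \<epsilon>]] mult_left_mono) auto
  also have "\<epsilon> / sqrt ?w = \<epsilon> * ?w powr (- 1/2)" using w by (simp add: powr_minus_divide powr_half_sqrt)
  finally have "\<bar>f x - ball_average \<epsilon> f x\<bar> powr q \<le> (\<epsilon> * ?w powr (- 1/2) * (A * (?W powr (1/q) * \<kappa> powr (1/q')))) powr q"
    using q by (intro powr_mono2) auto
  also have "\<dots> = \<epsilon> powr q * ?w powr (- q/2) * ((?D powr (q/2 - 1) * \<epsilon> powr (- \<beta> * q)) * (?W * \<kappa> powr (q - 1)))"
  proof -
    have "q / q' = q - 1" "(1/2 - 1/q) * q = q/2 - 1" using q by (auto simp: q'_def field_simps)
    thus ?thesis using \<epsilon> w A0 D W0 \<kappa> q by (simp add: powr_mult powr_powr A_def)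
  qed
  also have "\<dots> = (?w powr (- q/2) * (\<epsilon> powr q * \<epsilon> powr (- \<beta> * q)) * ?D powr (q/2 - 1) * \<kappa> powr (q - 1)) * ?W" by simp
  also have "\<epsilon> powr q * \<epsilon> powr (- \<beta> * q) = \<epsilon> powr (q - \<beta> * q)" by (simp add: powr_add[symmetric])
  finally show "\<bar>f x - ball_average \<epsilon> f x\<bar> powr q \<le>
      (ball_volume TYPE('a) powr (- q/2) * \<epsilon> powr (q - \<beta> * q) * dirichlet powr (q/2 - 1) * (1 / (1 - \<beta>)) powr (q - 1)) *
        (LINT s|unit_interval. spread \<epsilon> x s * s powr - \<beta>)"
    by (simp add: T_def \<kappa>_def)
qed

lemma nn_spread:
  assumes "\<beta> < 1" "integrable unit_interval (\<lambda>s. spread \<epsilon> x s * s powr - \<beta>)"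
  shows "ennreal (LINT s|unit_interval. spread \<epsilon> x s * s powr - \<beta>) =
     (\<integral>\<^sup>+s. ennreal (s powr - \<beta>) * (\<integral>\<^sup>+y. ennreal ((norm (G (x + (s * \<epsilon>) *\<^sub>R y)))\<^sup>2) \<partial>unit_ball) \<partial>unit_interval)"
proof -
  obtain b where "bounded_continuous_L2 (\<lambda>x. norm (G x)) b" using G_L2 by blast
  then interpret g: bounded_continuous_L2 "\<lambda>x. norm (G x)" b .
  have "ennreal (LINT s|unit_interval. spread \<epsilon> x s * s powr - \<beta>) = (\<integral>\<^sup>+s. ennreal (spread \<epsilon> x s * s powr - \<beta>) \<partial>unit_interval)"
    by (rule nn_integral_eq_integral[symmetric, OF assms(2)]) (auto simp: spread_def)
  also have "\<dots> = (\<integral>\<^sup>+s. ennreal (s powr - \<beta>) * (\<integral>\<^sup>+y. ennreal ((norm (G (x + (s * \<epsilon>) *\<^sub>R y)))\<^sup>2) \<partial>unit_ball) \<partial>unit_interval)"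
    by (intro nn_integral_cong, subst nn_integral_eq_integral[OF g.integrable_ball_sq])
       (auto simp: spread_def ennreal_mult mult.commute)
  finally show ?thesis .
qed

text \<open>Integrating the pointwise estimate over \<open>x\<close> turns the spread into the Dirichlet integral, by
  translation invariance. The exponent of \<open>\<epsilon>\<close> is positive in the subcritical range, so averages
  approximate functions of bounded gradient norm uniformly in \<open>L\<^sup>q\<close>.\<close>

theorem average_error:
  assumes \<epsilon>: "\<epsilon> > 0" and q: "q > 2" and \<beta>: "sobolev_defect TYPE('a) q < 1"
  shows "(\<integral>\<^sup>+x. ennreal (\<bar>f x - ball_average \<epsilon> f x\<bar> powr q) \<partial>lborel) \<le>
    ennreal (average_constant TYPE('a) q * \<epsilon> powr (q - sobolev_defect TYPE('a) q * q) * dirichlet powr (q/2))"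
proof -
  let ?w = "ball_volume TYPE('a)" and ?D = dirichlet
  define \<beta> where "\<beta> = sobolev_defect TYPE('a) q"
  have \<beta>1: "\<beta> < 1" using \<beta> by (simp add: \<beta>_def)
  define \<kappa> where "\<kappa> = 1 / (1 - \<beta>)"
  have \<kappa>: "\<kappa> > 0" using \<beta>1 by (simp add: \<kappa>_def)
  have w: "?w > 0" by (rule ball_volume_pos)
  have D: "?D \<ge> 0" by (rule dirichlet_nonneg)
  define C where "C = ?w powr (- q/2) * \<epsilon> powr (q - \<beta> * q) * ?D powr (q/2 - 1) * \<kappa> powr (q - 1)"
  have C: "C \<ge> 0" by (simp add: C_def)
  have err: "integrable unit_interval (\<lambda>s. spread \<epsilon> x s * s powr - \<beta>)"
      "\<bar>f x - ball_average \<epsilon> f x\<bar> powr q \<le> C * (LINT s|unit_interval. spread \<epsilon> x s * s powr - \<beta>)" for x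
    using average_error_powr[OF \<epsilon> q \<beta>, of x] by (auto simp: C_def \<beta>_def \<kappa>_def)
  define H where "H s = ennreal (s powr - \<beta>)" for s :: real
  have [measurable]: "H \<in> borel_measurable unit_interval" unfolding H_def by measurable
  interpret P: pair_sigma_finite "lborel :: 'a measure" unit_interval ..
  interpret Q: pair_sigma_finite "lborel :: 'a measure" "unit_ball :: 'a measure" ..
  have "(\<integral>\<^sup>+x. ennreal (\<bar>f x - ball_average \<epsilon> f x\<bar> powr q) \<partial>lborel) \<le>
     (\<integral>\<^sup>+x. ennreal C * (\<integral>\<^sup>+s. H s * (\<integral>\<^sup>+y. ennreal ((norm (G (x + (s * \<epsilon>) *\<^sub>R y)))\<^sup>2) \<partial>unit_ball) \<partial>unit_interval) \<partial>lborel)"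
  proof (rule nn_integral_mono)
    fix x
    have "ennreal (\<bar>f x - ball_average \<epsilon> f x\<bar> powr q) \<le> ennreal C * ennreal (LINT s|unit_interval. spread \<epsilon> x s * s powr - \<beta>)"
      using err(2)[of x] C by (subst ennreal_mult'[symmetric]) (auto intro: ennreal_leI)
    also have "ennreal (LINT s|unit_interval. spread \<epsilon> x s * s powr - \<beta>) =
       (\<integral>\<^sup>+s. H s * (\<integral>\<^sup>+y. ennreal ((norm (G (x + (s * \<epsilon>) *\<^sub>R y)))\<^sup>2) \<partial>unit_ball) \<partial>unit_interval)"
      unfolding H_def by (rule nn_spread[OF \<beta>1 err(1)])
    finally show "ennreal (\<bar>f x - ball_average \<epsilon> f x\<bar> powr q) \<le>
       ennreal C * (\<integral>\<^sup>+s. H s * (\<integral>\<^sup>+y. ennreal ((norm (G (x + (s * \<epsilon>) *\<^sub>R y)))\<^sup>2) \<partial>unit_ball) \<partial>unit_interval)" .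
  qed
  also have "\<dots> = ennreal C * (\<integral>\<^sup>+x. (\<integral>\<^sup>+s. H s * (\<integral>\<^sup>+y. ennreal ((norm (G (x + (s * \<epsilon>) *\<^sub>R y)))\<^sup>2) \<partial>unit_ball) \<partial>unit_interval) \<partial>lborel)"
    by (rule nn_integral_cmult) measurable
  also have "(\<integral>\<^sup>+x. (\<integral>\<^sup>+s. H s * (\<integral>\<^sup>+y. ennreal ((norm (G (x + (s * \<epsilon>) *\<^sub>R y)))\<^sup>2) \<partial>unit_ball) \<partial>unit_interval) \<partial>lborel)
     = (\<integral>\<^sup>+s. (\<integral>\<^sup>+x. H s * (\<integral>\<^sup>+y. ennreal ((norm (G (x + (s * \<epsilon>) *\<^sub>R y)))\<^sup>2) \<partial>unit_ball) \<partial>lborel) \<partial>unit_interval)"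
    by (rule P.Fubini'[symmetric]) measurable
  also have "\<dots> = (\<integral>\<^sup>+s. H s * (\<integral>\<^sup>+x. (\<integral>\<^sup>+y. ennreal ((norm (G (x + (s * \<epsilon>) *\<^sub>R y)))\<^sup>2) \<partial>unit_ball) \<partial>lborel) \<partial>unit_interval)"
    by (intro nn_integral_cong nn_integral_cmult) measurable
  also have "\<dots> = (\<integral>\<^sup>+s. H s * (\<integral>\<^sup>+y. (\<integral>\<^sup>+x. ennreal ((norm (G (x + (s * \<epsilon>) *\<^sub>R y)))\<^sup>2) \<partial>lborel) \<partial>unit_ball) \<partial>unit_interval)"
    by (intro nn_integral_cong arg_cong2[where f="(*)"] refl Q.Fubini'[symmetric]) measurable
  also have "\<dots> = (\<integral>\<^sup>+s. H s * (\<integral>\<^sup>+y. ennreal ?D \<partial>(unit_ball :: 'a measure)) \<partial>unit_interval)"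
    by (subst nn_integral_lborel_translate[where h="\<lambda>x. ennreal ((norm (G x))\<^sup>2)"]) (auto simp: nn_dirichlet)
  also have "\<dots> = (\<integral>\<^sup>+s. H s * ennreal (?D * ?w) \<partial>unit_interval)"
    using measure_unit_ball[where ?'a='a] D w
    by (simp add: unit_ball.emeasure_eq_measure ennreal_mult)
  also have "\<dots> = (\<integral>\<^sup>+s. H s \<partial>unit_interval) * ennreal (?D * ?w)"
    by (rule nn_integral_multc) measurable
  also have "(\<integral>\<^sup>+s. H s \<partial>unit_interval) = ennreal \<kappa>"
    unfolding H_def \<kappa>_def using unit_interval_powr[OF \<beta>1] by (subst nn_integral_eq_integral) auto
  also have "ennreal C * (ennreal \<kappa> * ennreal (?D * ?w)) = ennreal (C * (\<kappa> * (?D * ?w)))"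
    using C \<kappa> D w by (simp add: ennreal_mult)
  also have "C * (\<kappa> * (?D * ?w)) = (?w powr (- q/2) * ?w) * \<epsilon> powr (q - \<beta> * q) * (?D powr (q/2 - 1) * ?D) * (\<kappa> powr (q - 1) * \<kappa>)"
    by (simp add: C_def)
  also have "?w powr (- q/2) * ?w = ?w powr (1 - q/2)"
    using w powr_add[of ?w "- q/2" 1] by simp
  also have "?D powr (q/2 - 1) * ?D = ?D powr (q/2)"
    using D powr_add[of ?D "q/2 - 1" 1] by (cases "?D = 0") auto
  also have "\<kappa> powr (q - 1) * \<kappa> = \<kappa> powr q"
    using \<kappa> powr_add[of \<kappa> "q - 1" 1] by simp
  finally show ?thesis by (simp add: average_constant_def \<beta>_def \<kappa>_def mult_ac)
qed

end

section \<open>Square integrable functions on the domain\<close>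

context bounded_open
begin

abbreviation dom :: "'a measure" where "dom \<equiv> lebesgue_on \<Omega>"

definition L2_norm :: "('a \<Rightarrow> 'b::euclidean_space) \<Rightarrow> real" where
  "L2_norm f = sqrt (LINT x|dom. (norm (f x))\<^sup>2)"

lemma L2_norm_nonneg[simp]: "L2_norm f \<ge> 0" by (simp add: L2_norm_def)

lemma L2_norm_sq: "(L2_norm f)\<^sup>2 = (LINT x|dom. (norm (f x))\<^sup>2)" by (simp add: L2_norm_def)

lemma L2D: 
  assumes "f \<in> L2 \<Omega>"
  shows "f \<in> borel_measurable dom" "integrable dom (\<lambda>x. (norm (f x))\<^sup>2)"
  using assms by (auto simp: L2_def)

lemma L2_scaleR: "f \<in> L2 \<Omega> \<Longrightarrow> (\<lambda>x. a *\<^sub>R f x) \<in> L2 \<Omega>"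
  by (auto simp: L2_def power_mult_distrib)

lemma L2_add: 
  assumes f: "f \<in> L2 \<Omega>" and g: "g \<in> L2 \<Omega>" shows "(\<lambda>x. f x + g x) \<in> L2 \<Omega>"
  unfolding L2_def
proof (intro CollectI conjI)
  show m: "(\<lambda>x. f x + g x) \<in> borel_measurable dom" using L2D[OF f] L2D[OF g] by measurable
  show "integrable dom (\<lambda>x. (norm (f x + g x))\<^sup>2)"
    by (rule Bochner_Integration.integrable_bound[of _ "\<lambda>x. 2 * (norm (f x))\<^sup>2 + 2 * (norm (g x))\<^sup>2"])
       (use L2D[OF f] L2D[OF g] norm_add_sq in auto)
qed

lemma L2_lincomb: "f \<in> L2 \<Omega> \<Longrightarrow> g \<in> L2 \<Omega> \<Longrightarrow> (\<lambda>x. a *\<^sub>R f x + b *\<^sub>R g x) \<in> L2 \<Omega>"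
  by (intro L2_add L2_scaleR)

lemma L2_diff: "f \<in> L2 \<Omega> \<Longrightarrow> g \<in> L2 \<Omega> \<Longrightarrow> (\<lambda>x. f x - g x) \<in> L2 \<Omega>"
  using L2_lincomb[of f g 1 "-1"] by simp

lemma L2_mult:
  assumes f: "f \<in> L2 \<Omega>" and g: "g \<in> L2 \<Omega>"
  shows "integrable dom (\<lambda>x. norm (f x) * norm (g x))"
    "(LINT x|dom. norm (f x) * norm (g x)) \<le> L2_norm f * L2_norm g"
proof -
  note m = L2D[OF f] L2D[OF g]
  note [measurable] = m(1,3)
  show 1: "integrable dom (\<lambda>x. norm (f x) * norm (g x))"
    using Cauchy_Schwarz_integral(1)[of "\<lambda>x. norm (f x)" dom "\<lambda>x. norm (g x)"] m by simp
  show 3: "(LINT x|dom. norm (f x) * norm (g x)) \<le> L2_norm f * L2_norm g"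
    using Cauchy_Schwarz_integral(2)[of "\<lambda>x. norm (f x)" dom "\<lambda>x. norm (g x)"] m by (simp add: L2_norm_def abs_mult)
qed

lemma L2_inner:
  assumes f: "f \<in> L2 \<Omega>" and g: "g \<in> L2 \<Omega>"
  shows "integrable dom (\<lambda>x. f x \<bullet> g x)" "\<bar>LINT x|dom. f x \<bullet> g x\<bar> \<le> L2_norm f * L2_norm g"
proof -
  note [measurable] = L2D(1)[OF f] L2D(1)[OF g]
  show 2: "integrable dom (\<lambda>x. f x \<bullet> g x)"
    by (rule Bochner_Integration.integrable_bound[OF L2_mult(1)[OF f g]]) (auto simp: Cauchy_Schwarz_ineq2)
  have "\<bar>LINT x|dom. f x \<bullet> g x\<bar> \<le> (LINT x|dom. \<bar>f x \<bullet> g x\<bar>)" by (rule integral_abs_bound)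
  also have "\<dots> \<le> (LINT x|dom. norm (f x) * norm (g x))"
    by (intro integral_mono L2_mult(1)[OF f g] integrable_abs 2 Cauchy_Schwarz_ineq2)
  finally show "\<bar>LINT x|dom. f x \<bullet> g x\<bar> \<le> L2_norm f * L2_norm g" using L2_mult(2)[OF f g] by linarith
qed

lemma L2_integrable: assumes "f \<in> L2 \<Omega>" shows "integrable dom f"
proof -
  have "(\<lambda>x. 1::real) \<in> L2 \<Omega>" by (simp add: L2_def)
  from L2_mult(1)[OF assms this] have "integrable dom (\<lambda>x. norm (f x))" by simp
  thus ?thesis using L2D(1)[OF assms] by (simp add: integrable_norm_iff)
qed

lemma L2_norm_cong: "AE x in dom. norm (f x) = norm (g x) \<Longrightarrow> f \<in> L2 \<Omega> \<Longrightarrow> g \<in> L2 \<Omega> \<Longrightarrow> L2_norm f = L2_norm g"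
  unfolding L2_norm_def by (intro arg_cong[where f=sqrt] integral_cong_AE) (auto simp: L2_def)

lemma L2_norm_scaleR: "L2_norm (\<lambda>x. a *\<^sub>R f x) = \<bar>a\<bar> * L2_norm f"
  by (simp add: L2_norm_def power_mult_distrib real_sqrt_mult)

lemma L2_norm_minus: "L2_norm (\<lambda>x. f x - g x) = L2_norm (\<lambda>x. g x - f x)"
  by (simp add: L2_norm_def norm_minus_commute)

lemma L2_norm_add_sq:
  assumes f: "f \<in> L2 \<Omega>" and g: "g \<in> L2 \<Omega>"
  shows "(L2_norm (\<lambda>x. f x + g x))\<^sup>2 = (L2_norm f)\<^sup>2 + 2 * (LINT x|dom. f x \<bullet> g x) + (L2_norm g)\<^sup>2"
proof -
  have "(norm (f x + g x))\<^sup>2 = (norm (f x))\<^sup>2 + 2 * (f x \<bullet> g x) + (norm (g x))\<^sup>2" for x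
    by (simp add: power2_norm_eq_inner inner_simps inner_commute)
  thus ?thesis using L2D[OF f] L2D[OF g] L2_inner[OF f g] by (simp add: L2_norm_sq)
qed

lemma L2_norm_triangle:
  assumes f: "f \<in> L2 \<Omega>" and g: "g \<in> L2 \<Omega>"
  shows "L2_norm (\<lambda>x. f x + g x) \<le> L2_norm f + L2_norm g"
proof (rule power2_le_imp_le)
  show "(L2_norm (\<lambda>x. f x + g x))\<^sup>2 \<le> (L2_norm f + L2_norm g)\<^sup>2"
    using L2_inner(2)[OF f g] by (simp add: L2_norm_add_sq[OF f g] power2_sum)
qed simp

text \<open>Stated with the midpoint, the form in which nearly shortest elements of a convex set are
  seen to be close to each other.\<close>

lemma L2_norm_parallelogram:
  assumes f: "f \<in> L2 \<Omega>" and g: "g \<in> L2 \<Omega>"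
  shows "(L2_norm (\<lambda>x. f x - g x))\<^sup>2 = 2 * (L2_norm f)\<^sup>2 + 2 * (L2_norm g)\<^sup>2 - 4 * (L2_norm (\<lambda>x. (1/2) *\<^sub>R f x + (1/2) *\<^sub>R g x))\<^sup>2"
proof -
  have "(L2_norm (\<lambda>x. f x + g x))\<^sup>2 = (L2_norm f)\<^sup>2 + 2 * (LINT x|dom. f x \<bullet> g x) + (L2_norm g)\<^sup>2"
    by (rule L2_norm_add_sq[OF f g])
  moreover have "(L2_norm (\<lambda>x. f x + (-1) *\<^sub>R g x))\<^sup>2 = (L2_norm f)\<^sup>2 + 2 * (LINT x|dom. f x \<bullet> ((-1) *\<^sub>R g x)) + (L2_norm (\<lambda>x. (-1) *\<^sub>R g x))\<^sup>2"
    by (rule L2_norm_add_sq[OF f L2_scaleR[OF g]])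
  moreover have "4 * (L2_norm (\<lambda>x. (1/2) *\<^sub>R f x + (1/2) *\<^sub>R g x))\<^sup>2 = (L2_norm (\<lambda>x. f x + g x))\<^sup>2"
  proof -
    have "L2_norm (\<lambda>x. (1/2) *\<^sub>R f x + (1/2) *\<^sub>R g x) = 1/2 * L2_norm (\<lambda>x. f x + g x)"
      using L2_norm_scaleR[of "1/2" "\<lambda>x. f x + g x"] by (simp only: scaleR_add_right abs_of_pos half_gt_zero zero_less_one)
    thus ?thesis by (simp only: power_mult_distrib) (simp add: power_divide)
  qed
  moreover have "L2_norm (\<lambda>x. (-1) *\<^sub>R g x) = L2_norm g" using L2_norm_scaleR[of "-1" g] by simp
  ultimately show ?thesis by simp
qed

lemma L2_norm_zero_AE:
  assumes "f \<in> L2 \<Omega>" "L2_norm f = 0" shows "AE x in dom. f x = 0"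
proof -
  have "(LINT x|dom. (norm (f x))\<^sup>2) = 0" using assms(2) by (simp add: L2_norm_def)
  hence "AE x in dom. (norm (f x))\<^sup>2 = 0"
    by (subst (asm) integral_nonneg_eq_0_iff_AE[OF L2D(2)[OF assms(1)]]) auto
  thus ?thesis by eventually_elim simp
qed

section \<open>Weak gradients of test functions\<close>

lemma test_measurable:
  assumes "test_function \<Omega> \<phi>"
  shows "\<phi> \<in> borel_measurable borel" "gradient \<phi> \<in> borel_measurable borel"
  using assms by (auto intro!: borel_measurable_continuous_onI test_function_continuous test_function_continuous_gradient)

lemma test_zero_outside:
  assumes "test_function \<Omega> \<phi>" "x \<notin> \<Omega>" shows "\<phi> x = 0" "gradient \<phi> x = 0"
  using test_function_support[OF assms(1)] assms(2) by (metis subsetD)+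

lemma test_C1:
  assumes "test_function \<Omega> \<phi>"
  obtains K where "K \<subseteq> \<Omega>" "compactly_supported_C1 \<phi> (gradient \<phi>) K"
proof -
  obtain K where K: "compact K" "K \<subseteq> \<Omega>" "\<And>x. x \<notin> K \<Longrightarrow> \<phi> x = 0" "\<And>x. x \<notin> K \<Longrightarrow> gradient \<phi> x = 0"
    using test_function_support[OF assms] by metis
  have "compactly_supported_C1 \<phi> (gradient \<phi>) K"
    by unfold_locales (use K assms in \<open>auto intro: test_function_has_derivative test_function_continuous_gradient\<close>)
  thus ?thesis using K(2) that by blast
qed

lemma test_bounded:
  assumes "test_function \<Omega> \<phi>"
  shows "\<exists>b. \<forall>x. \<bar>\<phi> x\<bar> \<le> b" "\<exists>b. \<forall>x. norm (gradient \<phi> x) \<le> b"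
proof -
  obtain K where "compactly_supported_C1 \<phi> (gradient \<phi>) K" using test_C1[OF assms] by blast
  then interpret c: compactly_supported_C1 \<phi> "gradient \<phi>" K .
  obtain b where "bounded_continuous_L2 \<phi> b" using c.f_L2 by blast
  then interpret b: bounded_continuous_L2 \<phi> b .
  obtain b' where "bounded_continuous_L2 (\<lambda>x. norm (gradient \<phi> x)) b'" using c.G_L2 by blast
  then interpret b': bounded_continuous_L2 "\<lambda>x. norm (gradient \<phi> x)" b' .
  show "\<exists>b. \<forall>x. \<bar>\<phi> x\<bar> \<le> b" using b.bound by blast
  show "\<exists>b. \<forall>x. norm (gradient \<phi> x) \<le> b" using b'.bound by (intro exI[of _ b']) auto
qed

lemma measurable_domI: "f \<in> borel_measurable borel \<Longrightarrow> f \<in> borel_measurable dom"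
  by (intro measurable_restrict_space1 measurable_completion) simp

lemma bounded_L2:
  assumes "f \<in> borel_measurable borel" "\<And>x. norm (f x) \<le> b"
  shows "f \<in> L2 \<Omega>"
proof -
  have [measurable]: "f \<in> borel_measurable dom" using assms by (intro measurable_domI) auto
  show ?thesis unfolding L2_def using assms
    by (auto intro!: dom.integrable_const_bound[of _ "b\<^sup>2"] AE_I2 power_mono)
qed

lemma test_L2:
  assumes "test_function \<Omega> \<phi>" shows "\<phi> \<in> L2 \<Omega>" "gradient \<phi> \<in> L2 \<Omega>"
proof -
  obtain b where "\<And>x. \<bar>\<phi> x\<bar> \<le> b" using test_bounded(1)[OF assms] by blast
  thus "\<phi> \<in> L2 \<Omega>" by (intro bounded_L2[of _ b] test_measurable[OF assms]) auto
  obtain b where "\<And>x. norm (gradient \<phi> x) \<le> b" using test_bounded(2)[OF assms] by blast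
  thus "gradient \<phi> \<in> L2 \<Omega>" by (intro bounded_L2[of _ b] test_measurable[OF assms]) auto
qed

lemma L2_scaleR_product:
  assumes f: "f \<in> L2 \<Omega>" and g: "g \<in> L2 \<Omega>"
  shows "integrable dom (\<lambda>x. f x *\<^sub>R g x)" "norm (LINT x|dom. f x *\<^sub>R g x) \<le> L2_norm f * L2_norm g"
proof -
  note [measurable] = L2D(1)[OF f] L2D(1)[OF g]
  show "integrable dom (\<lambda>x. f x *\<^sub>R g x)"
    by (rule Bochner_Integration.integrable_bound[OF L2_mult(1)[OF f g]]) auto
  have "norm (LINT x|dom. f x *\<^sub>R g x) \<le> (LINT x|dom. norm (f x *\<^sub>R g x))" by (rule integral_norm_bound)
  also have "\<dots> = (LINT x|dom. norm (f x) * norm (g x))" by simp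
  finally show "norm (LINT x|dom. f x *\<^sub>R g x) \<le> L2_norm f * L2_norm g" using L2_mult(2)[OF f g] by linarith
qed

text \<open>Integration by parts: the gradient of the product \<open>\<phi> \<psi>\<close> has integral zero.\<close>

lemma test_has_weak_gradient:
  assumes "test_function \<Omega> \<phi>" shows "has_weak_gradient \<Omega> \<phi> (gradient \<phi>)"
  unfolding has_weak_gradient_def
proof (intro conjI allI impI test_L2[OF assms])
  fix \<psi> assume \<psi>: "test_function \<Omega> \<psi>"
  obtain K where K: "K \<subseteq> \<Omega>" "compactly_supported_C1 \<phi> (gradient \<phi>) K" using test_C1[OF assms] by blast
  interpret c: compactly_supported_C1 \<phi> "gradient \<phi>" K by fact
  let ?G = "\<lambda>x. \<phi> x *\<^sub>R gradient \<psi> x + \<psi> x *\<^sub>R gradient \<phi> x"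
  have [measurable]: "\<phi> \<in> borel_measurable borel" "gradient \<phi> \<in> borel_measurable borel"
     "\<psi> \<in> borel_measurable borel" "gradient \<psi> \<in> borel_measurable borel"
    using test_measurable assms \<psi> by auto
  have "(LINT x|lborel. ?G x) = 0"
  proof (rule integral_gradient_eq_0(2)[where f="\<lambda>x. \<phi> x * \<psi> x" and K=K])
    show "((\<lambda>x. \<phi> x * \<psi> x) has_derivative (\<lambda>h. h \<bullet> ?G x)) (at x)" for x
      by (rule has_derivative_eq_rhs[OF has_derivative_mult[OF test_function_has_derivative[OF assms] test_function_has_derivative[OF \<psi>]]])
         (auto simp: inner_add_right mult.commute)
    show "continuous_on UNIV ?G"
      by (intro continuous_intros test_function_continuous[OF assms] test_function_continuous[OF \<psi>]
           test_function_continuous_gradient[OF assms] test_function_continuous_gradient[OF \<psi>])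
  qed (use c.K c.f0 c.G0 in auto)
  moreover have "(LINT x|dom. ?G x) = (LINT x|lborel. ?G x)"
    by (rule integral_dom_eq_lborel) (use test_zero_outside[OF assms] in auto)
  moreover have "(LINT x|dom. ?G x) = (LINT x|dom. \<phi> x *\<^sub>R gradient \<psi> x) + (LINT x|dom. \<psi> x *\<^sub>R gradient \<phi> x)"
    by (intro Bochner_Integration.integral_add L2_scaleR_product(1) test_L2 assms \<psi>)
  ultimately show "(LINT x|dom. \<phi> x *\<^sub>R gradient \<psi> x) = - (LINT x|dom. \<psi> x *\<^sub>R gradient \<phi> x)"
    by (simp add: eq_neg_iff_add_eq_0)
qed

lemma has_weak_gradient_unique:
  assumes g: "has_weak_gradient \<Omega> u g" and h: "has_weak_gradient \<Omega> u h"
  shows "AE x in dom. g x = h x"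
proof -
  have L: "g \<in> L2 \<Omega>" "h \<in> L2 \<Omega>" using assms by (auto simp: has_weak_gradient_def)
  have "AE x in dom. g x - h x = 0"
  proof (rule AE_zero_if_test_orthogonal)
    show "integrable dom (\<lambda>x. g x - h x)" by (intro L2_integrable L2_diff L)
    fix \<phi> assume \<phi>: "test_function \<Omega> \<phi>"
    have "(LINT x|dom. \<phi> x *\<^sub>R (g x - h x)) = (LINT x|dom. \<phi> x *\<^sub>R g x) - (LINT x|dom. \<phi> x *\<^sub>R h x)"
      using L2_scaleR_product(1)[OF test_L2(1)[OF \<phi>] L(1)] L2_scaleR_product(1)[OF test_L2(1)[OF \<phi>] L(2)]
      by (simp add: scaleR_diff_right)
    also have "- (LINT x|dom. \<phi> x *\<^sub>R g x) = - (LINT x|dom. \<phi> x *\<^sub>R h x)"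
      using g h \<phi> unfolding has_weak_gradient_def by metis
    hence "(LINT x|dom. \<phi> x *\<^sub>R g x) - (LINT x|dom. \<phi> x *\<^sub>R h x) = 0" by simp
    finally show "(LINT x|dom. \<phi> x *\<^sub>R (g x - h x)) = 0" .
  qed
  thus ?thesis by eventually_elim simp
qed

lemma weak_gradient_eq:
  assumes "has_weak_gradient \<Omega> u g"
  shows "has_weak_gradient \<Omega> u (weak_gradient \<Omega> u)" "AE x in dom. weak_gradient \<Omega> u x = g x"
proof -
  show 1: "has_weak_gradient \<Omega> u (weak_gradient \<Omega> u)"
    unfolding weak_gradient_def by (rule someI[of _ g]) (rule assms)
  show "AE x in dom. weak_gradient \<Omega> u x = g x" by (rule has_weak_gradient_unique[OF 1 assms])
qed

lemma has_weak_gradient_lincomb: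
  assumes u: "has_weak_gradient \<Omega> u g" and v: "has_weak_gradient \<Omega> v h"
  shows "has_weak_gradient \<Omega> (\<lambda>x. a * u x + b * v x) (\<lambda>x. a *\<^sub>R g x + b *\<^sub>R h x)"
proof -
  have L: "u \<in> L2 \<Omega>" "g \<in> L2 \<Omega>" "v \<in> L2 \<Omega>" "h \<in> L2 \<Omega>" using assms by (auto simp: has_weak_gradient_def)
  show ?thesis unfolding has_weak_gradient_def
  proof (intro conjI allI impI)
    show "(\<lambda>x. a * u x + b * v x) \<in> L2 \<Omega>" using L2_lincomb[OF L(1,3), of a b] by simp
    show "(\<lambda>x. a *\<^sub>R g x + b *\<^sub>R h x) \<in> L2 \<Omega>" by (rule L2_lincomb[OF L(2,4)])
    fix \<phi> assume \<phi>: "test_function \<Omega> \<phi>"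
    have "(LINT x|dom. (a * u x + b * v x) *\<^sub>R gradient \<phi> x) =
       a *\<^sub>R (LINT x|dom. u x *\<^sub>R gradient \<phi> x) + b *\<^sub>R (LINT x|dom. v x *\<^sub>R gradient \<phi> x)"
      using L2_scaleR_product(1)[OF L(1) test_L2(2)[OF \<phi>]] L2_scaleR_product(1)[OF L(3) test_L2(2)[OF \<phi>]]
      by (simp add: scaleR_add_left flip: scaleR_scaleR)
    also have "(LINT x|dom. u x *\<^sub>R gradient \<phi> x) = - (LINT x|dom. \<phi> x *\<^sub>R g x)"
      using u \<phi> by (simp add: has_weak_gradient_def)
    also have "(LINT x|dom. v x *\<^sub>R gradient \<phi> x) = - (LINT x|dom. \<phi> x *\<^sub>R h x)"
      using v \<phi> by (simp add: has_weak_gradient_def)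
    also have "a *\<^sub>R - (LINT x|dom. \<phi> x *\<^sub>R g x) + b *\<^sub>R - (LINT x|dom. \<phi> x *\<^sub>R h x) =
       - ((LINT x|dom. a *\<^sub>R (\<phi> x *\<^sub>R g x)) + (LINT x|dom. b *\<^sub>R (\<phi> x *\<^sub>R h x)))"
      by (simp only: integral_scaleR_right scaleR_minus_right minus_add_distrib)
    also have "(LINT x|dom. a *\<^sub>R (\<phi> x *\<^sub>R g x)) + (LINT x|dom. b *\<^sub>R (\<phi> x *\<^sub>R h x)) =
        (LINT x|dom. a *\<^sub>R (\<phi> x *\<^sub>R g x) + b *\<^sub>R (\<phi> x *\<^sub>R h x))"
      by (intro Bochner_Integration.integral_add[symmetric] integrable_scaleR_right
          L2_scaleR_product(1)[OF test_L2(1)[OF \<phi>] L(2)] L2_scaleR_product(1)[OF test_L2(1)[OF \<phi>] L(4)])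
    also have "\<dots> = (LINT x|dom. \<phi> x *\<^sub>R (a *\<^sub>R g x + b *\<^sub>R h x))"
      by (simp add: scaleR_add_right mult.commute)
    finally show "(LINT x|dom. (a * u x + b * v x) *\<^sub>R gradient \<phi> x) = - (LINT x|dom. \<phi> x *\<^sub>R (a *\<^sub>R g x + b *\<^sub>R h x))" .
  qed
qed

section \<open>The space \<open>H10\<close>\<close>

abbreviation wg where "wg \<equiv> weak_gradient \<Omega>"

text \<open>The defining identity of a weak gradient is continuous under \<open>L\<^sup>2\<close> convergence of the
  function and of the gradient. Hence limits of test functions lie in \<open>H10 \<Omega>\<close> and their weak gradient
  is the limit of the gradients. All closure properties of \<open>H10 \<Omega>\<close> are derived from this.\<close>

lemma H10_limit:
  assumes u: "u \<in> L2 \<Omega>" and g: "g \<in> L2 \<Omega>" and \<phi>: "\<And>n. test_function \<Omega> (\<phi> n)"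
    and lu: "(\<lambda>n. L2_norm (\<lambda>x. u x - \<phi> n x)) \<longlonglongrightarrow> 0"
    and lg: "(\<lambda>n. L2_norm (\<lambda>x. g x - gradient (\<phi> n) x)) \<longlonglongrightarrow> 0"
  shows "u \<in> H10 \<Omega>" "AE x in dom. wg u x = g x"
proof -
  have hw: "has_weak_gradient \<Omega> u g"
    unfolding has_weak_gradient_def
  proof (intro conjI allI impI u g)
    fix \<psi> assume \<psi>: "test_function \<Omega> \<psi>"
    have 1: "(\<lambda>n. LINT x|dom. \<phi> n x *\<^sub>R gradient \<psi> x) \<longlonglongrightarrow> (LINT x|dom. u x *\<^sub>R gradient \<psi> x)"
    proof (rule Lim_null_comparison[THEN LIM_zero_cancel])
      have "norm ((LINT x|dom. \<phi> n x *\<^sub>R gradient \<psi> x) - (LINT x|dom. u x *\<^sub>R gradient \<psi> x)) \<le> L2_norm (\<lambda>x. u x - \<phi> n x) * L2_norm (gradient \<psi>)" for n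
      proof -
        have "(LINT x|dom. \<phi> n x *\<^sub>R gradient \<psi> x) - (LINT x|dom. u x *\<^sub>R gradient \<psi> x) = (LINT x|dom. (\<phi> n x - u x) *\<^sub>R gradient \<psi> x)"
          using L2_scaleR_product(1)[OF u test_L2(2)[OF \<psi>]] L2_scaleR_product(1)[OF test_L2(1)[OF \<phi>[of n]] test_L2(2)[OF \<psi>]]
          by (simp add: scaleR_diff_left)
        also have "norm \<dots> \<le> L2_norm (\<lambda>x. \<phi> n x - u x) * L2_norm (gradient \<psi>)"
          by (rule L2_scaleR_product(2)[OF L2_diff[OF test_L2(1)[OF \<phi>] u] test_L2(2)[OF \<psi>]])
        finally show ?thesis by (simp add: L2_norm_minus)
      qed
      thus "\<forall>\<^sub>F n in sequentially. norm ((LINT x|dom. \<phi> n x *\<^sub>R gradient \<psi> x) - (LINT x|dom. u x *\<^sub>R gradient \<psi> x)) \<le> L2_norm (\<lambda>x. u x - \<phi> n x) * L2_norm (gradient \<psi>)"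
        by simp
      show "(\<lambda>n. L2_norm (\<lambda>x. u x - \<phi> n x) * L2_norm (gradient \<psi>)) \<longlonglongrightarrow> 0"
        by (rule tendsto_mult_left_zero[OF lu])
    qed
    have 2: "(\<lambda>n. LINT x|dom. \<psi> x *\<^sub>R gradient (\<phi> n) x) \<longlonglongrightarrow> (LINT x|dom. \<psi> x *\<^sub>R g x)"
    proof (rule Lim_null_comparison[THEN LIM_zero_cancel])
      have "norm ((LINT x|dom. \<psi> x *\<^sub>R gradient (\<phi> n) x) - (LINT x|dom. \<psi> x *\<^sub>R g x)) \<le> L2_norm \<psi> * L2_norm (\<lambda>x. g x - gradient (\<phi> n) x)" for n
      proof -
        have "(LINT x|dom. \<psi> x *\<^sub>R gradient (\<phi> n) x) - (LINT x|dom. \<psi> x *\<^sub>R g x) = (LINT x|dom. \<psi> x *\<^sub>R (gradient (\<phi> n) x - g x))"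
          using L2_scaleR_product(1)[OF test_L2(1)[OF \<psi>] g] L2_scaleR_product(1)[OF test_L2(1)[OF \<psi>] test_L2(2)[OF \<phi>[of n]]]
          by (simp add: scaleR_diff_right)
        also have "norm \<dots> \<le> L2_norm \<psi> * L2_norm (\<lambda>x. gradient (\<phi> n) x - g x)"
          by (rule L2_scaleR_product(2)[OF test_L2(1)[OF \<psi>] L2_diff[OF test_L2(2)[OF \<phi>] g]])
        finally show ?thesis by (simp add: L2_norm_minus)
      qed
      thus "\<forall>\<^sub>F n in sequentially. norm ((LINT x|dom. \<psi> x *\<^sub>R gradient (\<phi> n) x) - (LINT x|dom. \<psi> x *\<^sub>R g x)) \<le> L2_norm \<psi> * L2_norm (\<lambda>x. g x - gradient (\<phi> n) x)"
        by simp
      show "(\<lambda>n. L2_norm \<psi> * L2_norm (\<lambda>x. g x - gradient (\<phi> n) x)) \<longlonglongrightarrow> 0"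
        by (rule tendsto_mult_right_zero[OF lg])
    qed
    have "(LINT x|dom. \<phi> n x *\<^sub>R gradient \<psi> x) = - (LINT x|dom. \<psi> x *\<^sub>R gradient (\<phi> n) x)" for n
      using test_has_weak_gradient[OF \<phi>[of n]] \<psi> by (simp add: has_weak_gradient_def)
    with 1 have "(\<lambda>n. - (LINT x|dom. \<psi> x *\<^sub>R gradient (\<phi> n) x)) \<longlonglongrightarrow> (LINT x|dom. u x *\<^sub>R gradient \<psi> x)" by simp
    from LIMSEQ_unique[OF this tendsto_minus[OF 2]]
    show "(LINT x|dom. u x *\<^sub>R gradient \<psi> x) = - (LINT x|dom. \<psi> x *\<^sub>R g x)" .
  qed
  show "AE x in dom. wg u x = g x" by (rule weak_gradient_eq(2)[OF hw])
  have "(\<lambda>n. H1_norm \<Omega> (\<lambda>x. u x - \<phi> n x)) = (\<lambda>n. sqrt ((L2_norm (\<lambda>x. u x - \<phi> n x))\<^sup>2 + (L2_norm (\<lambda>x. g x - gradient (\<phi> n) x))\<^sup>2))"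
  proof
    fix n
    have w: "has_weak_gradient \<Omega> (\<lambda>x. u x - \<phi> n x) (\<lambda>x. g x - gradient (\<phi> n) x)"
      using has_weak_gradient_lincomb[OF hw test_has_weak_gradient[OF \<phi>[of n]], of 1 "-1"] by simp
    have L: "(\<lambda>x. u x - \<phi> n x) \<in> L2 \<Omega>" "(\<lambda>x. g x - gradient (\<phi> n) x) \<in> L2 \<Omega>"
      using w by (auto simp: has_weak_gradient_def)
    have Lw: "wg (\<lambda>x. u x - \<phi> n x) \<in> L2 \<Omega>"
      using weak_gradient_eq(1)[OF w] by (auto simp: has_weak_gradient_def)
    have "(LINT x|dom. (u x - \<phi> n x)\<^sup>2 + (norm (wg (\<lambda>x. u x - \<phi> n x) x))\<^sup>2) =
        (L2_norm (\<lambda>x. u x - \<phi> n x))\<^sup>2 + (L2_norm (wg (\<lambda>x. u x - \<phi> n x)))\<^sup>2"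
      using L2D[OF L(1)] L2D[OF Lw] by (simp add: L2_norm_sq)
    also have "L2_norm (wg (\<lambda>x. u x - \<phi> n x)) = L2_norm (\<lambda>x. g x - gradient (\<phi> n) x)"
      by (rule L2_norm_cong[OF _ Lw L(2)]) (use weak_gradient_eq(2)[OF w] in \<open>auto elim: AE_mp\<close>)
    finally show "H1_norm \<Omega> (\<lambda>x. u x - \<phi> n x) = sqrt ((L2_norm (\<lambda>x. u x - \<phi> n x))\<^sup>2 + (L2_norm (\<lambda>x. g x - gradient (\<phi> n) x))\<^sup>2)"
      by (simp add: H1_norm_def)
  qed
  moreover have "(\<lambda>n. sqrt ((L2_norm (\<lambda>x. u x - \<phi> n x))\<^sup>2 + (L2_norm (\<lambda>x. g x - gradient (\<phi> n) x))\<^sup>2)) \<longlonglongrightarrow> sqrt (0\<^sup>2 + 0\<^sup>2)"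
    by (intro tendsto_intros lu lg)
  ultimately have "(\<lambda>n. H1_norm \<Omega> (\<lambda>x. u x - \<phi> n x)) \<longlonglongrightarrow> 0" by simp
  thus "u \<in> H10 \<Omega>" using \<phi> hw by (auto simp: H10_def H1_def)
qed

lemma H10D:
  assumes "u \<in> H10 \<Omega>"
  shows "u \<in> L2 \<Omega>" "wg u \<in> L2 \<Omega>" "has_weak_gradient \<Omega> u (wg u)"
proof -
  obtain g where "has_weak_gradient \<Omega> u g" using assms by (auto simp: H10_def H1_def)
  from weak_gradient_eq(1)[OF this]
  show "u \<in> L2 \<Omega>" "wg u \<in> L2 \<Omega>" "has_weak_gradient \<Omega> u (wg u)" by (auto simp: has_weak_gradient_def)
qed

lemma H1_norm_sq:
  assumes "u \<in> L2 \<Omega>" "wg u \<in> L2 \<Omega>"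
  shows "(H1_norm \<Omega> u)\<^sup>2 = (L2_norm u)\<^sup>2 + (L2_norm (wg u))\<^sup>2"
  using L2D[OF assms(1)] L2D[OF assms(2)] by (simp add: H1_norm_def L2_norm_sq)

lemma H1_norm_nonneg[simp]: "H1_norm \<Omega> u \<ge> 0"
  by (simp add: H1_norm_def)

lemma H10_approx:
  assumes "u \<in> H10 \<Omega>"
  obtains \<phi> where "\<And>n. test_function \<Omega> (\<phi> n)" "(\<lambda>n. L2_norm (\<lambda>x. u x - \<phi> n x)) \<longlonglongrightarrow> 0"
    "(\<lambda>n. L2_norm (\<lambda>x. wg u x - gradient (\<phi> n) x)) \<longlonglongrightarrow> 0"
proof -
  obtain \<phi> where \<phi>: "\<And>n. test_function \<Omega> (\<phi> n)" "(\<lambda>n. H1_norm \<Omega> (\<lambda>x. u x - \<phi> n x)) \<longlonglongrightarrow> 0"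
    using assms by (auto simp: H10_def)
  note hw = H10D(3)[OF assms]
  have le: "L2_norm (\<lambda>x. u x - \<phi> n x) \<le> H1_norm \<Omega> (\<lambda>x. u x - \<phi> n x)"
    "L2_norm (\<lambda>x. wg u x - gradient (\<phi> n) x) \<le> H1_norm \<Omega> (\<lambda>x. u x - \<phi> n x)" for n
  proof -
    have w: "has_weak_gradient \<Omega> (\<lambda>x. u x - \<phi> n x) (\<lambda>x. wg u x - gradient (\<phi> n) x)"
      using has_weak_gradient_lincomb[OF hw test_has_weak_gradient[OF \<phi>(1)[of n]], of 1 "-1"] by simp
    have L: "(\<lambda>x. u x - \<phi> n x) \<in> L2 \<Omega>" "(\<lambda>x. wg u x - gradient (\<phi> n) x) \<in> L2 \<Omega>"
      using w by (auto simp: has_weak_gradient_def)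
    have Lw: "wg (\<lambda>x. u x - \<phi> n x) \<in> L2 \<Omega>"
      using weak_gradient_eq(1)[OF w] by (auto simp: has_weak_gradient_def)
    have eq: "L2_norm (wg (\<lambda>x. u x - \<phi> n x)) = L2_norm (\<lambda>x. wg u x - gradient (\<phi> n) x)"
      by (rule L2_norm_cong[OF _ Lw L(2)]) (use weak_gradient_eq(2)[OF w] in \<open>auto elim: AE_mp\<close>)
    have H: "(H1_norm \<Omega> (\<lambda>x. u x - \<phi> n x))\<^sup>2 = (L2_norm (\<lambda>x. u x - \<phi> n x))\<^sup>2 + (L2_norm (\<lambda>x. wg u x - gradient (\<phi> n) x))\<^sup>2"
      using H1_norm_sq[OF L(1) Lw] eq by simp
    show "L2_norm (\<lambda>x. u x - \<phi> n x) \<le> H1_norm \<Omega> (\<lambda>x. u x - \<phi> n x)"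
      by (rule power2_le_imp_le) (use H in auto)
    show "L2_norm (\<lambda>x. wg u x - gradient (\<phi> n) x) \<le> H1_norm \<Omega> (\<lambda>x. u x - \<phi> n x)"
      by (rule power2_le_imp_le) (use H in auto)
  qed
  show ?thesis
  proof (rule that[OF \<phi>(1)])
    show "(\<lambda>n. L2_norm (\<lambda>x. u x - \<phi> n x)) \<longlonglongrightarrow> 0"
      by (rule tendsto_sandwich[OF _ _ tendsto_const \<phi>(2)]) (use le in auto)
    show "(\<lambda>n. L2_norm (\<lambda>x. wg u x - gradient (\<phi> n) x)) \<longlonglongrightarrow> 0"
      by (rule tendsto_sandwich[OF _ _ tendsto_const \<phi>(2)]) (use le in auto)
  qed
qed

lemma test_H10:
  assumes "test_function \<Omega> \<phi>" shows "\<phi> \<in> H10 \<Omega>" "AE x in dom. wg \<phi> x = gradient \<phi> x"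
  using H10_limit[OF test_L2[OF assms], of "\<lambda>_. \<phi>"] assms by (auto simp: L2_norm_def)

lemma H10_lincomb:
  assumes u: "u \<in> H10 \<Omega>" and v: "v \<in> H10 \<Omega>"
  shows "(\<lambda>x. a * u x + b * v x) \<in> H10 \<Omega>"
    "AE x in dom. wg (\<lambda>x. a * u x + b * v x) x = a *\<^sub>R wg u x + b *\<^sub>R wg v x"
proof -
  obtain \<phi> where \<phi>: "\<And>n. test_function \<Omega> (\<phi> n)" "(\<lambda>n. L2_norm (\<lambda>x. u x - \<phi> n x)) \<longlonglongrightarrow> 0"
    "(\<lambda>n. L2_norm (\<lambda>x. wg u x - gradient (\<phi> n) x)) \<longlonglongrightarrow> 0" using H10_approx[OF u] by blast
  obtain \<psi> where \<psi>: "\<And>n. test_function \<Omega> (\<psi> n)" "(\<lambda>n. L2_norm (\<lambda>x. v x - \<psi> n x)) \<longlonglongrightarrow> 0"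
    "(\<lambda>n. L2_norm (\<lambda>x. wg v x - gradient (\<psi> n) x)) \<longlonglongrightarrow> 0" using H10_approx[OF v] by blast
  note L = H10D(1,2)[OF u] H10D(1,2)[OF v]
  have lim: "(\<lambda>n. L2_norm (\<lambda>x. (a *\<^sub>R f x + b *\<^sub>R g x) - (a *\<^sub>R F n x + b *\<^sub>R G n x))) \<longlonglongrightarrow> 0"
    if "f \<in> L2 \<Omega>" "g \<in> L2 \<Omega>" "\<And>n. F n \<in> L2 \<Omega>" "\<And>n. G n \<in> L2 \<Omega>"
      "(\<lambda>n. L2_norm (\<lambda>x. f x - F n x)) \<longlonglongrightarrow> 0" "(\<lambda>n. L2_norm (\<lambda>x. g x - G n x)) \<longlonglongrightarrow> 0"
    for f g :: "'a \<Rightarrow> 'c::euclidean_space" and F G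
  proof (rule tendsto_sandwich[OF _ _ tendsto_const])
    have "L2_norm (\<lambda>x. (a *\<^sub>R f x + b *\<^sub>R g x) - (a *\<^sub>R F n x + b *\<^sub>R G n x)) \<le>
        \<bar>a\<bar> * L2_norm (\<lambda>x. f x - F n x) + \<bar>b\<bar> * L2_norm (\<lambda>x. g x - G n x)" for n
    proof -
      have "(\<lambda>x. (a *\<^sub>R f x + b *\<^sub>R g x) - (a *\<^sub>R F n x + b *\<^sub>R G n x)) = (\<lambda>x. a *\<^sub>R (f x - F n x) + b *\<^sub>R (g x - G n x))"
        by (simp add: algebra_simps)
      thus ?thesis using L2_norm_triangle[OF L2_scaleR[OF L2_diff[OF that(1) that(3)[of n]], of a] L2_scaleR[OF L2_diff[OF that(2) that(4)[of n]], of b]]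
        by (simp add: L2_norm_scaleR)
    qed
    thus "\<forall>\<^sub>F n in sequentially. L2_norm (\<lambda>x. (a *\<^sub>R f x + b *\<^sub>R g x) - (a *\<^sub>R F n x + b *\<^sub>R G n x)) \<le>
        \<bar>a\<bar> * L2_norm (\<lambda>x. f x - F n x) + \<bar>b\<bar> * L2_norm (\<lambda>x. g x - G n x)" by simp
    have "(\<lambda>n. \<bar>a\<bar> * L2_norm (\<lambda>x. f x - F n x) + \<bar>b\<bar> * L2_norm (\<lambda>x. g x - G n x)) \<longlonglongrightarrow> \<bar>a\<bar> * 0 + \<bar>b\<bar> * 0"
      by (intro tendsto_intros that)
    thus "(\<lambda>n. \<bar>a\<bar> * L2_norm (\<lambda>x. f x - F n x) + \<bar>b\<bar> * L2_norm (\<lambda>x. g x - G n x)) \<longlonglongrightarrow> 0" by simp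
  qed simp
  have 1: "(\<lambda>x. a * u x + b * v x) \<in> L2 \<Omega>" using L2_lincomb[OF L(1,3), of a b] by simp
  have 2: "(\<lambda>n. L2_norm (\<lambda>x. (a * u x + b * v x) - (a * \<phi> n x + b * \<psi> n x))) \<longlonglongrightarrow> 0"
    using lim[OF L(1,3) test_L2(1)[OF \<phi>(1)] test_L2(1)[OF \<psi>(1)] \<phi>(2) \<psi>(2)] by simp
  have 3: "(\<lambda>n. L2_norm (\<lambda>x. (a *\<^sub>R wg u x + b *\<^sub>R wg v x) - gradient (\<lambda>x. a * \<phi> n x + b * \<psi> n x) x)) \<longlonglongrightarrow> 0"
    using lim[OF L(2,4) test_L2(2)[OF \<phi>(1)] test_L2(2)[OF \<psi>(1)] \<phi>(3) \<psi>(3)]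
    by (simp add: gradient_lincomb[OF \<phi>(1) \<psi>(1)])
  note H10_limit[OF 1 L2_lincomb[OF L(2,4)] test_function_lincomb[OF \<phi>(1) \<psi>(1)] 2 3]
  thus "(\<lambda>x. a * u x + b * v x) \<in> H10 \<Omega>"
    "AE x in dom. wg (\<lambda>x. a * u x + b * v x) x = a *\<^sub>R wg u x + b *\<^sub>R wg v x" by auto
qed

end

section \<open>The Poincare and Sobolev inequalities\<close>

lemma powr_sum_le:
  assumes "q > 0" "a \<ge> 0" "b \<ge> 0"
  shows "(a + b) powr q \<le> 2 powr q * (a powr q + b powr (q::real))"
proof -
  have "(a + b) powr q \<le> (2 * max a b) powr q" using assms by (intro powr_mono2) auto
  also have "\<dots> = 2 powr q * (max a b powr q)" using assms by (simp add: powr_mult)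
  also have "\<dots> \<le> 2 powr q * (a powr q + b powr q)" by (intro mult_left_mono) (auto simp: max_def)
  finally show ?thesis .
qed

lemma abs_powr_add_le:
  assumes "q > 0" shows "\<bar>a + b\<bar> powr q \<le> 2 powr q * (\<bar>a\<bar> powr q + \<bar>b\<bar> powr (q::real))"
  using powr_sum_le[OF assms, of "\<bar>a\<bar>" "\<bar>b\<bar>"] abs_triangle_ineq[of a b] assms
  by (smt (verit) powr_mono2)

text \<open>The norm of \<open>ball_average \<epsilon>\<close> as a map from \<open>L\<^sup>2\<close> into bounded functions is at most this
  number.\<close>

definition average_bound :: "'a::euclidean_space itself \<Rightarrow> real \<Rightarrow> real" where
  "average_bound T \<epsilon> = sqrt (1 / \<epsilon> ^ DIM('a) / ball_volume T)"

context bounded_open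
begin

lemma test_L2_norm:
  assumes "test_function \<Omega> \<phi>"
  shows "(L2_norm \<phi>)\<^sup>2 = (LINT x|lborel. (\<phi> x)\<^sup>2)"
    "(L2_norm (gradient \<phi>))\<^sup>2 = (LINT x|lborel. (norm (gradient \<phi> x))\<^sup>2)"
proof -
  have [measurable]: "\<phi> \<in> borel_measurable borel" "gradient \<phi> \<in> borel_measurable borel"
    using test_measurable assms by auto
  show "(L2_norm \<phi>)\<^sup>2 = (LINT x|lborel. (\<phi> x)\<^sup>2)"
    unfolding L2_norm_sq by (subst integral_dom_eq_lborel) (use test_zero_outside[OF assms] in auto)
  show "(L2_norm (gradient \<phi>))\<^sup>2 = (LINT x|lborel. (norm (gradient \<phi> x))\<^sup>2)"
    unfolding L2_norm_sq by (subst integral_dom_eq_lborel) (use test_zero_outside[OF assms] in auto)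
qed

lemma test_average_bound:
  assumes "test_function \<Omega> \<phi>" "\<epsilon> > 0"
  shows "\<bar>ball_average \<epsilon> \<phi> x\<bar> \<le> L2_norm \<phi> * average_bound TYPE('a) \<epsilon>"
proof -
  obtain K where "compactly_supported_C1 \<phi> (gradient \<phi>) K" using test_C1[OF assms(1)] by blast
  then interpret c: compactly_supported_C1 \<phi> "gradient \<phi>" K .
  obtain b where "bounded_continuous_L2 \<phi> b" using c.f_L2 by blast
  then interpret b: bounded_continuous_L2 \<phi> b .
  show ?thesis using b.ball_average_bound[OF assms(2), of x]
    by (simp add: test_L2_norm(1)[OF assms(1), symmetric] real_sqrt_divide average_bound_def)
qed

lemma test_average_Lipschitz:
  assumes "test_function \<Omega> \<phi>" "\<epsilon> > 0"
  shows "\<bar>ball_average \<epsilon> \<phi> x - ball_average \<epsilon> \<phi> x'\<bar> \<le> norm (x - x') * (L2_norm (gradient \<phi>) * average_bound TYPE('a) \<epsilon>)"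
proof -
  obtain K where "compactly_supported_C1 \<phi> (gradient \<phi>) K" using test_C1[OF assms(1)] by blast
  then interpret c: compactly_supported_C1 \<phi> "gradient \<phi>" K .
  show ?thesis using c.ball_average_Lipschitz[OF assms(2), of x x']
    by (simp add: c.dirichlet_def test_L2_norm(2)[OF assms(1), symmetric] real_sqrt_divide average_bound_def)
qed

lemma test_average_measurable:
  assumes "test_function \<Omega> \<phi>" "\<epsilon> > 0"
  shows "ball_average \<epsilon> \<phi> \<in> borel_measurable borel"
proof (rule borel_measurable_continuous_onI)
  have "(L2_norm (gradient \<phi>) * average_bound TYPE('a) \<epsilon>)-lipschitz_on UNIV (ball_average \<epsilon> \<phi>)"
  proof (rule lipschitz_onI)
    show "dist (ball_average \<epsilon> \<phi> x) (ball_average \<epsilon> \<phi> y) \<le> L2_norm (gradient \<phi>) * average_bound TYPE('a) \<epsilon> * dist x y" for x y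
      using test_average_Lipschitz[OF assms, of x y] by (simp add: dist_norm mult_ac)
    show "0 \<le> L2_norm (gradient \<phi>) * average_bound TYPE('a) \<epsilon>"
      using assms ball_volume_pos[where ?'a='a] by (simp add: average_bound_def)
  qed
  thus "continuous_on UNIV (ball_average \<epsilon> \<phi>)" by (rule lipschitz_on_continuous_on)
qed

lemma nn_integral_dom_le:
  assumes [measurable]: "h \<in> borel_measurable borel"
  shows "(\<integral>\<^sup>+x. h x \<partial>dom) \<le> (\<integral>\<^sup>+x. h x \<partial>lborel)"
proof -
  have "(\<integral>\<^sup>+x. h x \<partial>dom) = (\<integral>\<^sup>+x. h x * indicator \<Omega> x \<partial>lebesgue)"
    by (rule nn_integral_restrict_space) (simp add: dom_sets)
  also have "\<dots> \<le> (\<integral>\<^sup>+x. h x \<partial>lebesgue)" by (intro nn_integral_mono) (auto simp: indicator_def)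
  finally show ?thesis by (simp add: nn_integral_completion)
qed

lemma test_average_error:
  assumes \<phi>: "test_function \<Omega> \<phi>" and \<epsilon>: "\<epsilon> > 0" and q: "q > 2" and d: "sobolev_defect TYPE('a) q < 1"
  shows "integrable dom (\<lambda>x. \<bar>\<phi> x - ball_average \<epsilon> \<phi> x\<bar> powr q)"
    "(LINT x|dom. \<bar>\<phi> x - ball_average \<epsilon> \<phi> x\<bar> powr q) \<le>
       average_constant TYPE('a) q * \<epsilon> powr (q - sobolev_defect TYPE('a) q * q) * L2_norm (gradient \<phi>) powr q"
proof -
  obtain K where "compactly_supported_C1 \<phi> (gradient \<phi>) K" using test_C1[OF \<phi>] by blast
  then interpret c: compactly_supported_C1 \<phi> "gradient \<phi>" K .
  let ?B = "average_constant TYPE('a) q * \<epsilon> powr (q - sobolev_defect TYPE('a) q * q) * L2_norm (gradient \<phi>) powr q"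
  have m[measurable]: "\<phi> \<in> borel_measurable borel" "ball_average \<epsilon> \<phi> \<in> borel_measurable borel"
    using test_measurable(1)[OF \<phi>] test_average_measurable[OF \<phi> \<epsilon>] by auto
  have m': "\<phi> \<in> borel_measurable dom" "ball_average \<epsilon> \<phi> \<in> borel_measurable dom"
    using m by (auto intro: measurable_domI)
  have "c.dirichlet powr (q/2) = L2_norm (gradient \<phi>) powr q"
    unfolding c.dirichlet_def test_L2_norm(2)[OF \<phi>, symmetric] by (simp add: powr_powr flip: powr_numeral)
  hence 1: "(\<integral>\<^sup>+x. ennreal (\<bar>\<phi> x - ball_average \<epsilon> \<phi> x\<bar> powr q) \<partial>dom) \<le> ennreal ?B"
    using c.average_error[OF \<epsilon> q d] by (intro order_trans[OF nn_integral_dom_le]) auto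
  show i: "integrable dom (\<lambda>x. \<bar>\<phi> x - ball_average \<epsilon> \<phi> x\<bar> powr q)"
  proof (rule integrableI_bounded)
    show "(\<lambda>x. \<bar>\<phi> x - ball_average \<epsilon> \<phi> x\<bar> powr q) \<in> borel_measurable dom" using m' by measurable
    show "(\<integral>\<^sup>+x. ennreal (norm (\<bar>\<phi> x - ball_average \<epsilon> \<phi> x\<bar> powr q)) \<partial>dom) < \<infinity>"
      using le_less_trans[OF 1] by simp
  qed
  have B: "?B \<ge> 0" using ball_volume_pos[where ?'a='a] by (simp add: average_constant_def)
  show "(LINT x|dom. \<bar>\<phi> x - ball_average \<epsilon> \<phi> x\<bar> powr q) \<le> ?B"
    using 1 B by (subst (asm) nn_integral_eq_integral[OF i]) auto
qed

text \<open>The inequality for test functions passes to the limit.\<close>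

lemma Poincare_H10: "\<exists>C>0. \<forall>u\<in>H10 \<Omega>. L2_norm u \<le> C * L2_norm (wg u)"
proof -
  obtain R where R: "R > 0" "\<Omega> \<subseteq> ball 0 R" using bounded_subset_ballD[OF bounded_dom, of 0] by auto
  have test: "L2_norm \<phi> \<le> (2 * R) * L2_norm (gradient \<phi>)" if \<phi>: "test_function \<Omega> \<phi>" for \<phi>
  proof (rule power2_le_imp_le)
    obtain K where K: "K \<subseteq> \<Omega>" "compactly_supported_C1 \<phi> (gradient \<phi>) K" using test_C1[OF \<phi>] by blast
    interpret c: compactly_supported_C1 \<phi> "gradient \<phi>" K by fact
    have "K \<subseteq> ball 0 R" using K R by blast
    from c.Poincare_inequality[OF this] show "(L2_norm \<phi>)\<^sup>2 \<le> ((2 * R) * L2_norm (gradient \<phi>))\<^sup>2"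
      by (simp add: test_L2_norm[OF \<phi>] c.dirichlet_def power_mult_distrib)
  qed (use R in auto)
  have "L2_norm u \<le> (2 * R) * L2_norm (wg u)" if u: "u \<in> H10 \<Omega>" for u
  proof -
    obtain \<phi> where \<phi>: "\<And>n. test_function \<Omega> (\<phi> n)" "(\<lambda>n. L2_norm (\<lambda>x. u x - \<phi> n x)) \<longlonglongrightarrow> 0"
      "(\<lambda>n. L2_norm (\<lambda>x. wg u x - gradient (\<phi> n) x)) \<longlonglongrightarrow> 0" using H10_approx[OF u] by blast
    have "L2_norm u \<le> L2_norm (\<lambda>x. u x - \<phi> n x) + 2 * R * (L2_norm (\<lambda>x. wg u x - gradient (\<phi> n) x) + L2_norm (wg u))" for n
    proof -
      have "L2_norm u \<le> L2_norm (\<lambda>x. u x - \<phi> n x) + L2_norm (\<phi> n)"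
        using L2_norm_triangle[OF L2_diff[OF H10D(1)[OF u] test_L2(1)[OF \<phi>(1)[of n]]] test_L2(1)[OF \<phi>(1)[of n]]] by simp
      moreover have "L2_norm (gradient (\<phi> n)) \<le> L2_norm (\<lambda>x. wg u x - gradient (\<phi> n) x) + L2_norm (wg u)"
        using L2_norm_triangle[OF L2_diff[OF test_L2(2)[OF \<phi>(1)[of n]] H10D(2)[OF u]] H10D(2)[OF u]] L2_norm_minus[of "wg u"] by simp
      hence "2 * R * L2_norm (gradient (\<phi> n)) \<le> 2 * R * (L2_norm (\<lambda>x. wg u x - gradient (\<phi> n) x) + L2_norm (wg u))"
        using R by (intro mult_left_mono) auto
      ultimately show ?thesis using test[OF \<phi>(1)[of n]] by linarith
    qed
    moreover have "(\<lambda>n. L2_norm (\<lambda>x. u x - \<phi> n x) + 2 * R * (L2_norm (\<lambda>x. wg u x - gradient (\<phi> n) x) + L2_norm (wg u))) \<longlonglongrightarrow> 0 + 2 * R * (0 + L2_norm (wg u))"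
      by (intro tendsto_intros \<phi>)
    ultimately show ?thesis using LIMSEQ_le_const by fastforce
  qed
  thus ?thesis using R by (intro exI[of _ "2 * R"]) auto
qed

lemma bounded_powr_integrable:
  fixes f :: "'a \<Rightarrow> real"
  assumes "f \<in> borel_measurable dom" "\<And>x. \<bar>f x\<bar> \<le> b" "q > 0"
  shows "integrable dom (\<lambda>x. \<bar>f x\<bar> powr q)"
  by (rule dom.integrable_const_bound[of _ "b powr q"]) (use assms in \<open>auto intro!: AE_I2 powr_mono2\<close>)

text \<open>Compare \<open>\<phi>\<close> with its averages at scale \<open>1\<close>: the error is controlled by \<open>average_error\<close>, and
  the averages are bounded by the \<open>L\<^sup>2\<close> norm, hence by the gradient.\<close>

lemma Sobolev_test:
  assumes q: "q > 2" and d: "sobolev_defect TYPE('a) q < 1"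
  shows "\<exists>C>0. \<forall>\<phi>. test_function \<Omega> \<phi> \<longrightarrow> (LINT x|dom. \<bar>\<phi> x\<bar> powr q) \<le> C * L2_norm (gradient \<phi>) powr q"
proof -
  obtain P where P: "P > 0" "\<And>u. u \<in> H10 \<Omega> \<Longrightarrow> L2_norm u \<le> P * L2_norm (wg u)" using Poincare_H10 by blast
  have Pt: "L2_norm \<phi> \<le> P * L2_norm (gradient \<phi>)" if "test_function \<Omega> \<phi>" for \<phi>
  proof -
    have "L2_norm (wg \<phi>) = L2_norm (gradient \<phi>)"
      by (rule L2_norm_cong[OF _ H10D(2)[OF test_H10(1)[OF that]] test_L2(2)[OF that]]) (use test_H10(2)[OF that] in \<open>auto elim: AE_mp\<close>)
    thus ?thesis using P(2)[OF test_H10(1)[OF that]] by simp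
  qed
  define b where "b = average_bound TYPE('a) 1"
  have b: "b \<ge> 0" using ball_volume_pos[where ?'a='a] by (simp add: b_def average_bound_def)
  define vol where "vol = measure dom (space dom)"
  define C where "C = 2 powr q * (average_constant TYPE('a) q + (P * b) powr q * vol) + 1"
  have ac: "average_constant TYPE('a) q \<ge> 0" using ball_volume_pos[where ?'a='a] by (simp add: average_constant_def)
  have "(LINT x|dom. \<bar>\<phi> x\<bar> powr q) \<le> C * L2_norm (gradient \<phi>) powr q" if \<phi>: "test_function \<Omega> \<phi>" for \<phi>
  proof -
    let ?A = "ball_average 1 \<phi>" and ?g = "L2_norm (gradient \<phi>)"
    have Ab: "\<bar>?A x\<bar> \<le> P * b * ?g" for x
    proof -
      have "\<bar>?A x\<bar> \<le> L2_norm \<phi> * b" using test_average_bound[OF \<phi>, of 1 x] by (simp add: b_def)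
      also have "\<dots> \<le> P * ?g * b" using Pt[OF \<phi>] b by (intro mult_right_mono)
      finally show ?thesis by (simp add: mult_ac)
    qed
    have [measurable]: "?A \<in> borel_measurable dom" by (intro measurable_domI test_average_measurable[OF \<phi>]) simp
    note err = test_average_error[OF \<phi> _ q d, of 1, simplified]
    have Ai: "integrable dom (\<lambda>x. \<bar>?A x\<bar> powr q)" by (rule bounded_powr_integrable[OF _ Ab]) (use q in auto)
    obtain c where c: "\<And>x. \<bar>\<phi> x\<bar> \<le> c" using test_bounded(1)[OF \<phi>] by blast
    have "(LINT x|dom. \<bar>\<phi> x\<bar> powr q) \<le> (LINT x|dom. 2 powr q * (\<bar>\<phi> x - ?A x\<bar> powr q + \<bar>?A x\<bar> powr q))"
    proof (rule integral_mono)
      show "integrable dom (\<lambda>x. \<bar>\<phi> x\<bar> powr q)"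
        by (rule bounded_powr_integrable[OF _ c]) (use q L2D(1)[OF test_L2(1)[OF \<phi>]] in auto)
      show "\<bar>\<phi> x\<bar> powr q \<le> 2 powr q * (\<bar>\<phi> x - ?A x\<bar> powr q + \<bar>?A x\<bar> powr q)" for x
        using abs_powr_add_le[of q "\<phi> x - ?A x" "?A x"] q by simp
    qed (use err Ai in auto)
    also have "\<dots> = 2 powr q * ((LINT x|dom. \<bar>\<phi> x - ?A x\<bar> powr q) + (LINT x|dom. \<bar>?A x\<bar> powr q))"
      using err Ai by simp
    also have "\<dots> \<le> 2 powr q * (average_constant TYPE('a) q * ?g powr q + (P * b * ?g) powr q * vol)"
    proof (intro mult_left_mono add_mono err(2))
      have "(LINT x|dom. \<bar>?A x\<bar> powr q) \<le> (LINT x|dom. (P * b * ?g) powr q)"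
        by (rule integral_mono[OF Ai]) (use Ab q in \<open>auto intro!: powr_mono2\<close>)
      thus "(LINT x|dom. \<bar>?A x\<bar> powr q) \<le> (P * b * ?g) powr q * vol" by (simp add: vol_def mult.commute)
    qed simp
    also have "\<dots> = (2 powr q * (average_constant TYPE('a) q + (P * b) powr q * vol)) * ?g powr q"
      using P b by (simp add: powr_mult algebra_simps)
    also have "\<dots> \<le> C * ?g powr q" by (intro mult_right_mono) (auto simp: C_def)
    finally show ?thesis .
  qed
  moreover have "C > 0" using ac by (auto simp: C_def vol_def intro!: add_nonneg_pos)
  ultimately show ?thesis by blast
qed

lemma L2_AE_subseq:
  fixes f :: "nat \<Rightarrow> 'a \<Rightarrow> 'b::euclidean_space"
  assumes "\<And>n. f n \<in> L2 \<Omega>" "(\<lambda>n. L2_norm (f n)) \<longlonglongrightarrow> 0"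
  obtains r where "strict_mono (r :: nat \<Rightarrow> nat)" "AE x in dom. (\<lambda>n. f (r n) x) \<longlonglongrightarrow> 0"
proof -
  have "(\<lambda>n. LINT x|dom. norm (f n x)) \<longlonglongrightarrow> 0"
  proof (rule tendsto_sandwich[OF _ _ tendsto_const])
    have one: "(\<lambda>x. 1::real) \<in> L2 \<Omega>" by (simp add: L2_def)
    show "\<forall>\<^sub>F n in sequentially. (LINT x|dom. norm (f n x)) \<le> L2_norm (f n) * L2_norm (\<lambda>x. 1::real)"
      using L2_mult(2)[OF assms(1) one] by simp
    show "(\<lambda>n. L2_norm (f n) * L2_norm (\<lambda>x. 1::real)) \<longlonglongrightarrow> 0" by (rule tendsto_mult_left_zero[OF assms(2)])
  qed simp
  from tendsto_L1_AE_subseq[OF L2_integrable[OF assms(1)] this] show ?thesis using that by blast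
qed

text \<open>Fatou's lemma along approximating test functions that converge almost everywhere.\<close>

lemma Sobolev_H10:
  assumes q: "q > 2" and d: "sobolev_defect TYPE('a) q < 1"
  shows "\<exists>C>0. \<forall>u\<in>H10 \<Omega>. integrable dom (\<lambda>x. \<bar>u x\<bar> powr q) \<and> (LINT x|dom. \<bar>u x\<bar> powr q) \<le> C * L2_norm (wg u) powr q"
proof -
  obtain C where C: "C > 0" "\<And>\<phi>. test_function \<Omega> \<phi> \<Longrightarrow> (LINT x|dom. \<bar>\<phi> x\<bar> powr q) \<le> C * L2_norm (gradient \<phi>) powr q"
    using Sobolev_test[OF assms] by blast
  have "integrable dom (\<lambda>x. \<bar>u x\<bar> powr q) \<and> (LINT x|dom. \<bar>u x\<bar> powr q) \<le> C * L2_norm (wg u) powr q" if u: "u \<in> H10 \<Omega>" for u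
  proof -
    obtain \<phi>0 where \<phi>0: "\<And>n. test_function \<Omega> (\<phi>0 n)" "(\<lambda>n. L2_norm (\<lambda>x. u x - \<phi>0 n x)) \<longlonglongrightarrow> 0"
      "(\<lambda>n. L2_norm (\<lambda>x. wg u x - gradient (\<phi>0 n) x)) \<longlonglongrightarrow> 0" using H10_approx[OF u] by blast
    obtain r where r: "strict_mono (r :: nat \<Rightarrow> nat)" "AE x in dom. (\<lambda>n. u x - \<phi>0 (r n) x) \<longlonglongrightarrow> 0"
      using L2_AE_subseq[OF L2_diff[OF H10D(1)[OF u] test_L2(1)[OF \<phi>0(1)]] \<phi>0(2)] by blast
    define \<phi> where "\<phi> n = \<phi>0 (r n)" for n
    have \<phi>: "test_function \<Omega> (\<phi> n)" for n using \<phi>0 by (simp add: \<phi>_def)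
    have lim: "AE x in dom. (\<lambda>n. \<phi> n x) \<longlonglongrightarrow> u x"
      using r(2)
    proof eventually_elim
      case (elim x)
      from tendsto_diff[OF tendsto_const[of "u x"] elim] show ?case by (simp add: \<phi>_def)
    qed
    have g: "(\<lambda>n. L2_norm (gradient (\<phi> n))) \<longlonglongrightarrow> L2_norm (wg u)"
    proof (rule LIM_zero_cancel, rule Lim_null_comparison)
      have "norm (L2_norm (gradient (\<phi> n)) - L2_norm (wg u)) \<le> L2_norm (\<lambda>x. wg u x - gradient (\<phi> n) x)" for n
        using L2_norm_triangle[OF L2_diff[OF test_L2(2)[OF \<phi>[of n]] H10D(2)[OF u]] H10D(2)[OF u]]
          L2_norm_triangle[OF L2_diff[OF H10D(2)[OF u] test_L2(2)[OF \<phi>[of n]]] test_L2(2)[OF \<phi>[of n]]] L2_norm_minus[of "wg u" "gradient (\<phi> n)"]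
        by simp
      thus "\<forall>\<^sub>F n in sequentially. norm (L2_norm (gradient (\<phi> n)) - L2_norm (wg u)) \<le> L2_norm (\<lambda>x. wg u x - gradient (\<phi> n) x)" by simp
      show "(\<lambda>n. L2_norm (\<lambda>x. wg u x - gradient (\<phi> n) x)) \<longlonglongrightarrow> 0"
        unfolding \<phi>_def using LIMSEQ_subseq_LIMSEQ[OF \<phi>0(3) r(1)] by (simp add: o_def)
    qed
    note um = L2D(1)[OF H10D(1)[OF u]]
    note \<phi>m = L2D(1)[OF test_L2(1)[OF \<phi>]]
    note [measurable] = um \<phi>m
    have "(\<integral>\<^sup>+x. ennreal (\<bar>u x\<bar> powr q) \<partial>dom) = (\<integral>\<^sup>+x. liminf (\<lambda>n. ennreal (\<bar>\<phi> n x\<bar> powr q)) \<partial>dom)"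
    proof (rule nn_integral_cong_AE)
      show "AE x in dom. ennreal (\<bar>u x\<bar> powr q) = liminf (\<lambda>n. ennreal (\<bar>\<phi> n x\<bar> powr q))"
        using lim
      proof eventually_elim
        case (elim x)
        have "(\<lambda>n. ennreal (\<bar>\<phi> n x\<bar> powr q)) \<longlonglongrightarrow> ennreal (\<bar>u x\<bar> powr q)"
          using q by (intro tendsto_ennrealI tendsto_powr' tendsto_rabs elim tendsto_const) auto
        from lim_imp_Liminf[OF _ this] show ?case by simp
      qed
    qed
    also have "\<dots> \<le> liminf (\<lambda>n. \<integral>\<^sup>+x. ennreal (\<bar>\<phi> n x\<bar> powr q) \<partial>dom)"
      by (rule nn_integral_liminf) measurable
    also have "\<dots> \<le> liminf (\<lambda>n. ennreal (C * L2_norm (gradient (\<phi> n)) powr q))"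
    proof (intro Liminf_mono always_eventually allI)
      fix n
      obtain c where c: "\<And>x. \<bar>\<phi> n x\<bar> \<le> c" using test_bounded(1)[OF \<phi>] by blast
      have "integrable dom (\<lambda>x. \<bar>\<phi> n x\<bar> powr q)"
        by (rule bounded_powr_integrable[OF _ c]) (use q in auto)
      thus "(\<integral>\<^sup>+x. ennreal (\<bar>\<phi> n x\<bar> powr q) \<partial>dom) \<le> ennreal (C * L2_norm (gradient (\<phi> n)) powr q)"
        using C(2)[OF \<phi>[of n]] by (subst nn_integral_eq_integral) (auto intro: ennreal_leI)
    qed
    also have "\<dots> = ennreal (C * L2_norm (wg u) powr q)"
    proof (rule lim_imp_Liminf)
      show "(\<lambda>n. ennreal (C * L2_norm (gradient (\<phi> n)) powr q)) \<longlonglongrightarrow> ennreal (C * L2_norm (wg u) powr q)"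
        using q by (intro tendsto_ennrealI tendsto_mult tendsto_const tendsto_powr' g) auto
    qed simp
    finally have le: "(\<integral>\<^sup>+x. ennreal (\<bar>u x\<bar> powr q) \<partial>dom) \<le> ennreal (C * L2_norm (wg u) powr q)" .
    have i: "integrable dom (\<lambda>x. \<bar>u x\<bar> powr q)"
      by (rule integrableI_bounded) (use le_less_trans[OF le] in auto)
    show ?thesis using i le C by (subst (asm) nn_integral_eq_integral[OF i]) auto
  qed
  thus ?thesis using C(1) by blast
qed

end

section \<open>Compactness\<close>

lemma powr_midpoint_le:
  assumes "q \<ge> 1" "x \<ge> 0" "y \<ge> 0"
  shows "((x + y) / 2) powr q \<le> (x powr q + y powr q) / (2::real)"
proof -
  have z: "(t / 2) powr q \<le> t powr q / 2" if "t \<ge> 0" for t :: real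
  proof -
    have "(1/2) powr q \<le> (1/2::real) powr 1" using assms by (intro powr_mono') auto
    hence "t powr q * (1/2) powr q \<le> t powr q * (1/2)" by (intro mult_left_mono) auto
    thus ?thesis using that powr_mult[of t "1/2" q] by simp
  qed
  consider "x = 0" | "y = 0" | "x > 0" "y > 0" using assms by linarith
  thus ?thesis
  proof cases
    case 1 thus ?thesis using z[OF assms(3)] by simp
  next
    case 2 thus ?thesis using z[OF assms(2)] by simp
  next
    case 3
    have "((1 - 1/2) *\<^sub>R x + (1/2) *\<^sub>R y) powr q \<le> (1 - 1/2) * x powr q + (1/2) * y powr q"
      by (rule convex_onD[OF powr_convex[OF assms(1)]]) (use 3 in auto)
    thus ?thesis by (simp add: add_divide_distrib)
  qed
qed

lemma abs_powr_midpoint_le: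
  assumes "q \<ge> 1" shows "\<bar>(a + b) / 2\<bar> powr q \<le> (\<bar>a\<bar> powr q + \<bar>b\<bar> powr q) / (2::real)"
proof -
  have "\<bar>(a + b) / 2\<bar> powr q \<le> ((\<bar>a\<bar> + \<bar>b\<bar>) / 2) powr q" using assms by (intro powr_mono2) auto
  also have "\<dots> \<le> (\<bar>a\<bar> powr q + \<bar>b\<bar> powr q) / 2" by (rule powr_midpoint_le[OF assms]) auto
  finally show ?thesis .
qed

text \<open>Tychonoff's theorem in the metrisable product over a countable index type replaces a
  diagonal argument.\<close>

lemma bounded_functions_convergent_subseq:
  fixes X :: "nat \<Rightarrow> 'i::countable \<Rightarrow> real"
  assumes "\<And>n i. \<bar>X n i\<bar> \<le> M i"
  obtains r l where "strict_mono (r :: nat \<Rightarrow> nat)" "\<And>i. (\<lambda>n. X (r n) i) \<longlonglongrightarrow> l i"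
proof -
  have "compactin (product_topology (\<lambda>i. euclidean) UNIV) (PiE UNIV (\<lambda>i. {- M i..M i}))"
    by (subst compactin_PiE) auto
  hence "compact (PiE UNIV (\<lambda>i. {- M i..M i}))"
    by (simp add: euclidean_product_topology)
  hence "seq_compact (PiE UNIV (\<lambda>i. {- M i..M i}))" by (rule compact_imp_seq_compact)
  moreover have "\<forall>n. X n \<in> PiE UNIV (\<lambda>i. {- M i..M i})" using assms by (auto simp: abs_le_iff minus_le_iff)
  ultimately have "\<exists>l r. strict_mono (r :: nat \<Rightarrow> nat) \<and> (X \<circ> r) \<longlonglongrightarrow> l"
    unfolding seq_compact_def by blast
  then obtain l r where "strict_mono (r :: nat \<Rightarrow> nat)" "(X \<circ> r) \<longlonglongrightarrow> l" by blast
  moreover have "(\<lambda>n. X (r n) i) \<longlonglongrightarrow> l i" for i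
  proof -
    have "continuous_on UNIV (\<lambda>f :: 'i \<Rightarrow> real. f i)" by (rule continuous_on_product_coordinates)
    hence "isCont (\<lambda>f. f i) l" by (rule continuous_on_interior) simp
    from isCont_tendsto_compose[OF this calculation(2)] show ?thesis by (simp add: o_def)
  qed
  ultimately show ?thesis using that by blast
qed

context bounded_open
begin

lemma test_diff: "test_function \<Omega> f \<Longrightarrow> test_function \<Omega> g \<Longrightarrow> test_function \<Omega> (\<lambda>x. f x - g x)"
  using test_function_lincomb[of \<Omega> f g 1 "-1"] by simp

lemma gradient_diff: "test_function \<Omega> f \<Longrightarrow> test_function \<Omega> g \<Longrightarrow>
  gradient (\<lambda>x. f x - g x) x = gradient f x - gradient g x"
  using gradient_lincomb[of \<Omega> f g 1 "-1"] by simp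

lemma L2_norm_wg_test:
  assumes "test_function \<Omega> \<phi>" shows "L2_norm (wg \<phi>) = L2_norm (gradient \<phi>)"
  by (rule L2_norm_cong[OF _ H10D(2)[OF test_H10(1)[OF assms]] test_L2(2)[OF assms]])
     (use test_H10(2)[OF assms] in \<open>auto elim: AE_mp\<close>)

lemma test_powr_integrable:
  assumes "test_function \<Omega> \<phi>" "q > 0" shows "integrable dom (\<lambda>x. \<bar>\<phi> x\<bar> powr q)"
proof -
  obtain c where c: "\<And>x. \<bar>\<phi> x\<bar> \<le> c" using test_bounded(1)[OF assms(1)] by blast
  show ?thesis by (rule bounded_powr_integrable[OF L2D(1)[OF test_L2(1)[OF assms(1)]] c assms(2)])
qed

text \<open>Along a subsequence the averages at all scales \<open>1/(k+1)\<close> converge at the points of a countable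
  dense set, hence everywhere since they are equi-Lipschitz, hence in \<open>L\<^sup>q\<close> since they are bounded.
  The functions inherit the Cauchy property because averages at small scales are uniformly close to
  them.\<close>

theorem test_compactness:
  assumes q: "q > 2" and d: "sobolev_defect TYPE('a) q < 1"
    and \<phi>: "\<And>n. test_function \<Omega> (\<phi> n)" and B: "\<And>n. L2_norm (gradient (\<phi> n)) \<le> B"
  obtains r where "strict_mono (r :: nat \<Rightarrow> nat)"
    "\<And>e. e > 0 \<Longrightarrow> \<exists>N. \<forall>m\<ge>N. \<forall>n\<ge>N. (LINT x|dom. \<bar>\<phi> (r m) x - \<phi> (r n) x\<bar> powr q) < e"
proof -
  obtain P where P: "P > 0" "\<And>u. u \<in> H10 \<Omega> \<Longrightarrow> L2_norm u \<le> P * L2_norm (wg u)" using Poincare_H10 by blast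
  have B0: "B \<ge> 0" using B[of 0] L2_norm_nonneg order_trans by blast
  have L: "L2_norm (\<phi> n) \<le> P * B" for n
  proof -
    have "L2_norm (\<phi> n) \<le> P * L2_norm (gradient (\<phi> n))" using P(2)[OF test_H10(1)[OF \<phi>]] by (simp add: L2_norm_wg_test[OF \<phi>])
    also have "\<dots> \<le> P * B" using P B by (intro mult_left_mono) auto
    finally show ?thesis .
  qed
  define \<epsilon> where "\<epsilon> k = inverse (real (Suc k))" for k
  have \<epsilon>: "\<epsilon> k > 0" for k by (simp add: \<epsilon>_def)
  define A where "A k n = ball_average (\<epsilon> k) (\<phi> n)" for k n
  define M where "M k = P * B * average_bound TYPE('a) (\<epsilon> k)" for k
  define Lp where "Lp k = B * average_bound TYPE('a) (\<epsilon> k)" for k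
  have ab: "average_bound TYPE('a) (\<epsilon> k) \<ge> 0" for k
    using ball_volume_pos[where ?'a='a] \<epsilon>[of k] by (simp add: average_bound_def)
  have AM: "\<bar>A k n x\<bar> \<le> M k" for k n x
    using test_average_bound[OF \<phi>[of n] \<epsilon>[of k], of x] mult_right_mono[OF L[of n] ab[of k]] by (simp add: A_def M_def)
  have AL: "\<bar>A k n x - A k n y\<bar> \<le> norm (x - y) * Lp k" for k n x y
    using test_average_Lipschitz[OF \<phi>[of n] \<epsilon>[of k], of x y]
      mult_left_mono[OF mult_right_mono[OF B[of n] ab[of k]], of "norm (x - y)"] by (simp add: A_def Lp_def)
  have Lp0: "Lp k \<ge> 0" for k using B0 ab by (simp add: Lp_def)
  obtain D :: "'a set" where D: "countable D" "\<And>X. open X \<Longrightarrow> X \<noteq> {} \<Longrightarrow> \<exists>d\<in>D. d \<in> X"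
    using countable_dense_setE by blast
  hence "D \<noteq> {}" using open_UNIV by blast
  define dd where "dd = from_nat_into D"
  obtain r l where r: "strict_mono (r :: nat \<Rightarrow> nat)"
    and l: "\<And>p. (\<lambda>n. A (fst p) (r n) (dd (snd p))) \<longlonglongrightarrow> l p"
    using bounded_functions_convergent_subseq[of "\<lambda>n p. A (fst p) n (dd (snd p))" "\<lambda>p. M (fst p)"] AM by auto
  have conv: "convergent (\<lambda>n. A k (r n) x)" for k x
  proof (rule Cauchy_convergent, rule CauchyI)
    fix e :: real assume e: "e > 0"
    define \<delta> where "\<delta> = e / 3 / (Lp k + 1)"
    have Lp1: "Lp k + 1 > 0" using Lp0[of k] by linarith
    have \<delta>: "\<delta> > 0" using e Lp1 by (simp add: \<delta>_def)
    have "ball x \<delta> \<noteq> {}" using \<delta> by auto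
    then obtain z where z: "z \<in> D" "z \<in> ball x \<delta>" using D(2)[of "ball x \<delta>"] by auto
    obtain i where i: "dd i = z" using from_nat_into_surj[OF D(1) z(1)] by (auto simp: dd_def)
    have "Cauchy (\<lambda>n. A k (r n) z)" using LIMSEQ_imp_Cauchy[OF l[of "(k, i)"]] i by simp
    then obtain N where N: "\<And>m n. m \<ge> N \<Longrightarrow> n \<ge> N \<Longrightarrow> norm (A k (r m) z - A k (r n) z) < e/3"
      using CauchyD[of "\<lambda>n. A k (r n) z" "e/3"] e by auto
    have close: "\<bar>A k n x - A k n z\<bar> \<le> e/3" for n
    proof -
      have "\<bar>A k n x - A k n z\<bar> \<le> norm (x - z) * Lp k" by (rule AL)
      also have "\<dots> \<le> \<delta> * (Lp k + 1)" using z Lp0[of k] \<delta> by (intro mult_mono) (auto simp: dist_norm)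
      also have "\<dots> = e/3" unfolding \<delta>_def using Lp1 by (intro nonzero_eq_divide_eq[THEN iffD1]) auto
      finally show ?thesis .
    qed
    have "norm (A k (r m) x - A k (r n) x) < e" if "m \<ge> N" "n \<ge> N" for m n
      using N[OF that] close[of "r m"] close[of "r n"] unfolding real_norm_def by linarith
    thus "\<exists>M. \<forall>m\<ge>M. \<forall>n\<ge>M. norm (A k (r m) x - A k (r n) x) < e" by blast
  qed
  define a where "a k x = lim (\<lambda>n. A k (r n) x)" for k x
  have lim: "(\<lambda>n. A k (r n) x) \<longlonglongrightarrow> a k x" for k x using conv[of k x] by (simp add: a_def convergent_LIMSEQ_iff)
  have Am[measurable]: "A k n \<in> borel_measurable dom" for k n
    unfolding A_def by (intro measurable_domI test_average_measurable \<phi> \<epsilon>)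
  have am[measurable]: "a k \<in> borel_measurable dom" for k
    by (rule borel_measurable_LIMSEQ_real[OF _ Am]) (rule lim)
  have aM: "\<bar>a k x\<bar> \<le> M k" for k x
    by (rule LIMSEQ_le_const2[OF tendsto_rabs[OF lim]]) (use AM in auto)
  have Aa: "\<bar>A k n x - a k x\<bar> \<le> 2 * M k" for k n x
    using AM[of k n x] aM[of k x] by linarith
  have Aai: "integrable dom (\<lambda>x. \<bar>A k n x - a k x\<bar> powr q)" for k n
    by (rule bounded_powr_integrable[OF _ Aa]) (use q in auto)
  have LA: "(\<lambda>n. LINT x|dom. \<bar>A k (r n) x - a k x\<bar> powr q) \<longlonglongrightarrow> 0" for k
  proof -
    have "(\<lambda>n. LINT x|dom. \<bar>A k (r n) x - a k x\<bar> powr q) \<longlonglongrightarrow> (LINT x|dom. 0)"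
    proof (rule integral_dominated_convergence[where w="\<lambda>x. (2 * M k) powr q"])
      show "AE x in dom. (\<lambda>n. \<bar>A k (r n) x - a k x\<bar> powr q) \<longlonglongrightarrow> 0"
      proof (intro AE_I2)
        fix x
        have "(\<lambda>n. \<bar>A k (r n) x - a k x\<bar> powr q) \<longlonglongrightarrow> \<bar>a k x - a k x\<bar> powr q"
          using q by (intro tendsto_powr' tendsto_intros lim) auto
        thus "(\<lambda>n. \<bar>A k (r n) x - a k x\<bar> powr q) \<longlonglongrightarrow> 0" by simp
      qed
      show "AE x in dom. norm (\<bar>A k (r n) x - a k x\<bar> powr q) \<le> (2 * M k) powr q" for n
        using Aa q by (auto intro!: AE_I2 powr_mono2)
    qed auto
    thus ?thesis by simp
  qed
  define s where "s = q - sobolev_defect TYPE('a) q * q"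
  have s: "s > 0"
  proof -
    have "sobolev_defect TYPE('a) q * q < 1 * q" using d q by (intro mult_strict_right_mono) auto
    thus ?thesis by (simp add: s_def)
  qed
  define E where "E k = average_constant TYPE('a) q * \<epsilon> k powr s * B powr q" for k
  have err: "integrable dom (\<lambda>x. \<bar>\<phi> n x - A k n x\<bar> powr q)" "(LINT x|dom. \<bar>\<phi> n x - A k n x\<bar> powr q) \<le> E k" for n k
  proof -
    show "integrable dom (\<lambda>x. \<bar>\<phi> n x - A k n x\<bar> powr q)"
      unfolding A_def by (rule test_average_error(1)[OF \<phi> \<epsilon> q d])
    have ac: "average_constant TYPE('a) q \<ge> 0" using ball_volume_pos[where ?'a='a] by (simp add: average_constant_def)
    have "(LINT x|dom. \<bar>\<phi> n x - A k n x\<bar> powr q) \<le> average_constant TYPE('a) q * \<epsilon> k powr s * L2_norm (gradient (\<phi> n)) powr q"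
      unfolding A_def s_def by (rule test_average_error(2)[OF \<phi> \<epsilon> q d])
    also have "\<dots> \<le> E k" unfolding E_def using ac B q by (intro mult_left_mono powr_mono2) auto
    finally show "(LINT x|dom. \<bar>\<phi> n x - A k n x\<bar> powr q) \<le> E k" .
  qed
  have E0: "E \<longlonglongrightarrow> 0"
  proof -
    have "(\<lambda>k. average_constant TYPE('a) q * \<epsilon> k powr s * B powr q) \<longlonglongrightarrow> average_constant TYPE('a) q * 0 powr s * B powr q"
      unfolding \<epsilon>_def using s by (intro tendsto_mult tendsto_const tendsto_powr' LIMSEQ_inverse_real_of_nat) auto
    thus ?thesis using s by (simp add: E_def[abs_def])
  qed
  show ?thesis
  proof (rule that[OF r])
    fix e :: real assume e: "e > 0"
    define c where "c = 2 powr q * 2 powr q"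
    have c: "c > 0" by (simp add: c_def)
    have "\<forall>\<^sub>F k in sequentially. E k < e / (5 * c)" using order_tendstoD(2)[OF E0] e c by simp
    then obtain k where k: "E k < e / (5 * c)" by (auto simp: eventually_sequentially)
    have "\<forall>\<^sub>F n in sequentially. (LINT x|dom. \<bar>A k (r n) x - a k x\<bar> powr q) < e / (5 * c)"
      using order_tendstoD(2)[OF LA[of k]] e c by simp
    then obtain N where N: "\<And>n. n \<ge> N \<Longrightarrow> (LINT x|dom. \<bar>A k (r n) x - a k x\<bar> powr q) < e / (5 * c)"
      by (auto simp: eventually_sequentially)
    have "(LINT x|dom. \<bar>\<phi> (r m) x - \<phi> (r n) x\<bar> powr q) < e" if mn: "m \<ge> N" "n \<ge> N" for m n
    proof -
      let ?f = "\<lambda>x. \<bar>\<phi> (r m) x - A k (r m) x\<bar> powr q" and ?g = "\<lambda>x. \<bar>A k (r m) x - a k x\<bar> powr q"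
      let ?f' = "\<lambda>x. \<bar>\<phi> (r n) x - A k (r n) x\<bar> powr q" and ?g' = "\<lambda>x. \<bar>A k (r n) x - a k x\<bar> powr q"
      have "(LINT x|dom. \<bar>\<phi> (r m) x - \<phi> (r n) x\<bar> powr q) \<le> (LINT x|dom. c * (?f x + ?g x + (?f' x + ?g' x)))"
      proof (rule integral_mono)
        show "integrable dom (\<lambda>x. \<bar>\<phi> (r m) x - \<phi> (r n) x\<bar> powr q)"
          by (rule test_powr_integrable[OF test_diff[OF \<phi> \<phi>]]) (use q in auto)
        show "integrable dom (\<lambda>x. c * (?f x + ?g x + (?f' x + ?g' x)))"
          by (intro integrable_mult_right Bochner_Integration.integrable_add err(1) Aai)
        fix x
        have q0: "q > 0" using q by simp
        have 1: "\<bar>\<phi> (r m) x - a k x\<bar> powr q \<le> 2 powr q * (?f x + ?g x)"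
          using abs_powr_add_le[OF q0, of "\<phi> (r m) x - A k (r m) x" "A k (r m) x - a k x"] by simp
        have 2: "\<bar>a k x - \<phi> (r n) x\<bar> powr q \<le> 2 powr q * (?f' x + ?g' x)"
          using abs_powr_add_le[OF q0, of "\<phi> (r n) x - A k (r n) x" "A k (r n) x - a k x"] by (simp add: abs_minus_commute)
        have "\<bar>\<phi> (r m) x - \<phi> (r n) x\<bar> powr q \<le> 2 powr q * (\<bar>\<phi> (r m) x - a k x\<bar> powr q + \<bar>a k x - \<phi> (r n) x\<bar> powr q)"
          using abs_powr_add_le[OF q0, of "\<phi> (r m) x - a k x" "a k x - \<phi> (r n) x"] by simp
        also have "\<dots> \<le> 2 powr q * (2 powr q * (?f x + ?g x) + 2 powr q * (?f' x + ?g' x))"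
          by (intro mult_left_mono add_mono 1 2) auto
        finally show "\<bar>\<phi> (r m) x - \<phi> (r n) x\<bar> powr q \<le> c * (?f x + ?g x + (?f' x + ?g' x))"
          by (simp add: c_def algebra_simps)
      qed
      also have "\<dots> = c * ((LINT x|dom. ?f x) + (LINT x|dom. ?g x) + ((LINT x|dom. ?f' x) + (LINT x|dom. ?g' x)))"
        using err(1) Aai by simp
      also have "\<dots> \<le> c * (4 * (e / (5 * c)))"
        using err(2)[of "r m" k] err(2)[of "r n" k] N[OF mn(1)] N[OF mn(2)] k c
        by (intro mult_left_mono) auto
      also have "\<dots> < e" using c e by simp
      finally show ?thesis .
    qed
    thus "\<exists>N. \<forall>m\<ge>N. \<forall>n\<ge>N. (LINT x|dom. \<bar>\<phi> (r m) x - \<phi> (r n) x\<bar> powr q) < e" by blast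
  qed
qed

text \<open>By the Poincare inequality the functions are Cauchy along with their gradients.\<close>

lemma H10_complete:
  assumes w: "\<And>n. test_function \<Omega> (w n)"
    and Cauchy: "\<And>e. e > 0 \<Longrightarrow> \<exists>N. \<forall>m\<ge>N. \<forall>n\<ge>N. L2_norm (\<lambda>x. gradient (w m) x - gradient (w n) x) < e"
  obtains u where "u \<in> H10 \<Omega>" "(\<lambda>n. L2_norm (\<lambda>x. wg u x - gradient (w n) x)) \<longlonglongrightarrow> 0"
proof -
  obtain P where P: "P > 0" "\<And>u. u \<in> H10 \<Omega> \<Longrightarrow> L2_norm u \<le> P * L2_norm (wg u)" using Poincare_H10 by blast
  have Cs: "\<exists>N. \<forall>m\<ge>N. \<forall>n\<ge>N. (LINT x|dom. (norm (f m x - f n x))\<^sup>2) < e"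
    if C: "\<And>e. e > 0 \<Longrightarrow> \<exists>N. \<forall>m\<ge>N. \<forall>n\<ge>N. L2_norm (\<lambda>x. f m x - f n x) < e" and "e > 0"
    for f :: "nat \<Rightarrow> 'a \<Rightarrow> 'c::euclidean_space" and e
  proof -
    obtain N where N: "\<And>m n. m \<ge> N \<Longrightarrow> n \<ge> N \<Longrightarrow> L2_norm (\<lambda>x. f m x - f n x) < sqrt e" using C[of "sqrt e"] \<open>e > 0\<close> by auto
    thus ?thesis unfolding L2_norm_def by (intro exI[of _ N]) auto
  qed
  have Cauchy0: "\<exists>N. \<forall>m\<ge>N. \<forall>n\<ge>N. L2_norm (\<lambda>x. w m x - w n x) < e" if "e > 0" for e
  proof -
    obtain N where N: "\<And>m n. m \<ge> N \<Longrightarrow> n \<ge> N \<Longrightarrow> L2_norm (\<lambda>x. gradient (w m) x - gradient (w n) x) < e / P"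
      using Cauchy[OF divide_pos_pos[OF \<open>e > 0\<close> P(1)]] by blast
    have "L2_norm (\<lambda>x. w m x - w n x) < e" if "m \<ge> N" "n \<ge> N" for m n
    proof -
      have "gradient (\<lambda>x. w m x - w n x) = (\<lambda>x. gradient (w m) x - gradient (w n) x)"
        by (rule ext, rule gradient_diff[OF w w])
      hence "L2_norm (\<lambda>x. w m x - w n x) \<le> P * L2_norm (\<lambda>x. gradient (w m) x - gradient (w n) x)"
        using P(2)[OF test_H10(1)[OF test_diff[OF w w]], of m n]
        by (simp add: L2_norm_wg_test[OF test_diff[OF w w]])
      also have "\<dots> < P * (e / P)" using N[OF that] P by (intro mult_strict_left_mono) auto
      finally show ?thesis using P by simp
    qed
    thus ?thesis by blast
  qed
  obtain u where u: "u \<in> borel_measurable dom" "integrable dom (\<lambda>x. (norm (u x))\<^sup>2)"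
    "(\<lambda>n. LINT x|dom. (norm (w n x - u x))\<^sup>2) \<longlonglongrightarrow> 0"
    using Riesz_Fischer_L2[OF dom.finite_measure_axioms L2D(1)[OF test_L2(1)[OF w]] L2D(2)[OF test_L2(1)[OF w]] Cs[OF Cauchy0]] by blast
  obtain g where g: "g \<in> borel_measurable dom" "integrable dom (\<lambda>x. (norm (g x))\<^sup>2)"
    "(\<lambda>n. LINT x|dom. (norm (gradient (w n) x - g x))\<^sup>2) \<longlonglongrightarrow> 0"
    using Riesz_Fischer_L2[OF dom.finite_measure_axioms L2D(1)[OF test_L2(2)[OF w]] L2D(2)[OF test_L2(2)[OF w]] Cs[OF Cauchy]] by blast
  have uL: "u \<in> L2 \<Omega>" "g \<in> L2 \<Omega>" using u g by (auto simp: L2_def)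
  have 1: "(\<lambda>n. L2_norm (\<lambda>x. u x - w n x)) \<longlonglongrightarrow> 0"
    using tendsto_real_sqrt[OF u(3)] by (simp add: L2_norm_def abs_minus_commute power2_commute)
  have 2: "(\<lambda>n. L2_norm (\<lambda>x. g x - gradient (w n) x)) \<longlonglongrightarrow> 0"
    using tendsto_real_sqrt[OF g(3)] by (simp add: L2_norm_def norm_minus_commute)
  note lim = H10_limit[OF uL w 1 2]
  have "L2_norm (\<lambda>x. wg u x - gradient (w n) x) = L2_norm (\<lambda>x. g x - gradient (w n) x)" for n
    by (rule L2_norm_cong) (use lim H10D(2)[OF lim(1)] uL test_L2(2)[OF w] in \<open>auto intro!: L2_diff elim: AE_mp\<close>)
  with 2 lim(1) show ?thesis using that by auto
qed

text \<open>This plays the role of weak compactness together with weak lower semicontinuity of the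
  gradient norm. The sets \<open>C n\<close> of test functions that obey the gradient bound \<open>b n\<close> and are close
  in \<open>L\<^sup>q\<close> to selected members of the Cauchy subsequence decrease with \<open>n\<close> and are closed under
  midpoints. Almost shortest elements \<open>w n\<close> of \<open>C n\<close> therefore have Cauchy gradients, by the
  parallelogram law; their limit in \<open>H10 \<Omega>\<close> obeys the limiting gradient bound, and membership in the
  sets \<open>C n\<close> identifies it with the \<open>L\<^sup>q\<close> limit.\<close>

theorem weak_limit:
  assumes q: "q > 2" and d: "sobolev_defect TYPE('a) q < 1"
    and \<phi>: "\<And>n. test_function \<Omega> (\<phi> n)" and b: "\<And>n. L2_norm (gradient (\<phi> n)) \<le> b n"
    and dec: "decseq b" and lim: "b \<longlonglongrightarrow> \<beta>"
  obtains r u where "\<And>n. r n \<ge> n" "u \<in> H10 \<Omega>" "L2_norm (wg u) \<le> \<beta>"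
    "(\<lambda>n. LINT x|dom. \<bar>u x - \<phi> (r n) x\<bar> powr q) \<longlonglongrightarrow> 0"
proof -
  have bB: "L2_norm (gradient (\<phi> n)) \<le> b 0" for n using b[of n] dec[unfolded decseq_def] by (meson le0 order_trans)
  have "\<exists>r0. strict_mono (r0 :: nat \<Rightarrow> nat) \<and>
    (\<forall>e>0. \<exists>N. \<forall>m\<ge>N. \<forall>n\<ge>N. (LINT x|dom. \<bar>\<phi> (r0 m) x - \<phi> (r0 n) x\<bar> powr q) < e)"
  proof (rule test_compactness[OF q d, of "\<phi>" "b 0", OF \<phi> bB])
    fix r :: "nat \<Rightarrow> nat"
    assume "strict_mono r" "\<And>e. e > 0 \<Longrightarrow> \<exists>N. \<forall>m\<ge>N. \<forall>n\<ge>N. (LINT x|dom. \<bar>\<phi> (r m) x - \<phi> (r n) x\<bar> powr q) < e"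
    thus ?thesis by (intro exI[of _ r] conjI allI impI)
  qed
  then obtain r0 where r0: "strict_mono (r0 :: nat \<Rightarrow> nat)" and
    Cau: "\<And>e. e > 0 \<Longrightarrow> \<exists>N. \<forall>m\<ge>N. \<forall>n\<ge>N. (LINT x|dom. \<bar>\<phi> (r0 m) x - \<phi> (r0 n) x\<bar> powr q) < e"
    by metis
  define \<psi> where "\<psi> n = \<phi> (r0 n)" for n
  have \<psi>: "test_function \<Omega> (\<psi> n)" for n using \<phi> by (simp add: \<psi>_def)
  have "\<exists>N\<ge>j. \<forall>m\<ge>N. \<forall>n\<ge>N. (LINT x|dom. \<bar>\<psi> m x - \<psi> n x\<bar> powr q) < (1/2)^j" for j
  proof -
    obtain N where "\<forall>m\<ge>N. \<forall>n\<ge>N. (LINT x|dom. \<bar>\<psi> m x - \<psi> n x\<bar> powr q) < (1/2)^j"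
      using Cau[of "(1/2)^j"] unfolding \<psi>_def by fastforce
    thus ?thesis by (intro exI[of _ "max N j"] conjI allI impI) (simp_all del: power_divide)
  qed
  then obtain M where M: "\<And>j. M j \<ge> j" "\<And>j m n. m \<ge> M j \<Longrightarrow> n \<ge> M j \<Longrightarrow> (LINT x|dom. \<bar>\<psi> m x - \<psi> n x\<bar> powr q) < (1/2)^j"
    by metis
  \<comment> \<open>Midpoints of \<open>C n\<close> stay in \<open>C n\<close> by convexity of the power \<open>q\<close>.\<close>
  define C where "C n = {w. test_function \<Omega> w \<and> L2_norm (gradient w) \<le> b n \<and>
      (\<forall>j\<le>n. (LINT x|dom. \<bar>w x - \<psi> (M j) x\<bar> powr q) \<le> (1/2)^j)}" for n
  have C_ne: "C n \<noteq> {}" for n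
  proof -
    define m where "m = max n (Max (M ` {..n}))"
    have "M j \<le> m" if "j \<le> n" for j unfolding m_def using that by (intro max.coboundedI2 Max_ge) auto
    moreover have "L2_norm (gradient (\<psi> m)) \<le> b n"
    proof -
      have "n \<le> r0 m" using seq_suble[OF r0, of m] by (auto simp: m_def)
      thus ?thesis using b[of "r0 m"] dec unfolding decseq_def \<psi>_def by (meson order_trans)
    qed
    ultimately have "\<psi> m \<in> C n" using M(2) \<psi> by (auto simp: C_def less_imp_le)
    thus ?thesis by blast
  qed
  have C_mono: "C m \<subseteq> C n" if "n \<le> m" for m n
    using that dec unfolding C_def decseq_def by (auto intro: order_trans)
  have C_mid: "(\<lambda>x. 1/2 * v x + 1/2 * w x) \<in> C n" if v: "v \<in> C n" and w: "w \<in> C n" for v w n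
  proof -
    have t: "test_function \<Omega> v" "test_function \<Omega> w" using v w by (auto simp: C_def)
    have "L2_norm (gradient (\<lambda>x. 1/2 * v x + 1/2 * w x)) \<le> b n"
    proof -
      have "L2_norm (gradient (\<lambda>x. 1/2 * v x + 1/2 * w x)) = L2_norm (\<lambda>x. (1/2) *\<^sub>R gradient v x + (1/2) *\<^sub>R gradient w x)"
        by (rule arg_cong[where f=L2_norm], rule ext, rule gradient_lincomb[OF t])
      also have "\<dots> \<le> L2_norm (\<lambda>x. (1/2) *\<^sub>R gradient v x) + L2_norm (\<lambda>x. (1/2) *\<^sub>R gradient w x)"
        by (intro L2_norm_triangle L2_scaleR test_L2 t)
      also have "\<dots> \<le> b n" using v w by (simp add: L2_norm_scaleR C_def)
      finally show ?thesis .
    qed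
    moreover have "(LINT x|dom. \<bar>(1/2 * v x + 1/2 * w x) - \<psi> (M j) x\<bar> powr q) \<le> (1/2)^j" if "j \<le> n" for j
    proof -
      have i: "integrable dom (\<lambda>x. \<bar>v x - \<psi> (M j) x\<bar> powr q)" "integrable dom (\<lambda>x. \<bar>w x - \<psi> (M j) x\<bar> powr q)"
        using q by (auto intro!: test_powr_integrable test_diff t \<psi>)
      have "(LINT x|dom. \<bar>(1/2 * v x + 1/2 * w x) - \<psi> (M j) x\<bar> powr q) \<le>
         (LINT x|dom. (\<bar>v x - \<psi> (M j) x\<bar> powr q + \<bar>w x - \<psi> (M j) x\<bar> powr q) / 2)"
      proof (rule integral_mono)
        show "integrable dom (\<lambda>x. \<bar>(1/2 * v x + 1/2 * w x) - \<psi> (M j) x\<bar> powr q)"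
          using q by (intro test_powr_integrable test_diff test_function_lincomb t \<psi>) auto
        fix x
        have e: "(1/2 * v x + 1/2 * w x) - \<psi> (M j) x = ((v x - \<psi> (M j) x) + (w x - \<psi> (M j) x)) / 2" by (simp add: field_simps)
        show "\<bar>(1/2 * v x + 1/2 * w x) - \<psi> (M j) x\<bar> powr q \<le> (\<bar>v x - \<psi> (M j) x\<bar> powr q + \<bar>w x - \<psi> (M j) x\<bar> powr q) / 2"
          unfolding e by (rule abs_powr_midpoint_le) (use q in simp)
      qed (use i in auto)
      also have "\<dots> = ((LINT x|dom. \<bar>v x - \<psi> (M j) x\<bar> powr q) + (LINT x|dom. \<bar>w x - \<psi> (M j) x\<bar> powr q)) / 2"
        using i by simp
      also have "\<dots> \<le> (1/2)^j"
      proof -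
        have "(LINT x|dom. \<bar>v x - \<psi> (M j) x\<bar> powr q) \<le> (1/2)^j" "(LINT x|dom. \<bar>w x - \<psi> (M j) x\<bar> powr q) \<le> (1/2)^j"
          using v w that unfolding C_def by blast+
        moreover have "(A + B) / 2 \<le> c" if "A \<le> c" "B \<le> c" for A B c :: real
          using add_mono[OF that] by (simp only: divide_le_eq_numeral1 mult_2_right)
        ultimately show ?thesis by blast
      qed
      finally show ?thesis .
    qed
    ultimately show ?thesis using test_function_lincomb[OF t, of "1/2" "1/2"] unfolding C_def by blast
  qed
  \<comment> \<open>The distance of the set \<open>C n\<close> from zero in the gradient norm; it increases to \<open>L\<close>.\<close>
  define \<delta> where "\<delta> n = Inf ((\<lambda>w. L2_norm (gradient w)) ` C n)" for n
  have bdd: "bdd_below ((\<lambda>w. L2_norm (gradient w)) ` C n)" for n by (rule bdd_belowI[of _ 0]) auto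
  have \<delta>_le: "\<delta> n \<le> L2_norm (gradient w)" if "w \<in> C n" for w n
    unfolding \<delta>_def using that bdd by (intro cInf_lower) auto
  have \<delta>0: "\<delta> n \<ge> 0" for n unfolding \<delta>_def using C_ne by (intro cInf_greatest) auto
  have \<delta>_mono: "incseq \<delta>"
    unfolding \<delta>_def by (intro monoI cInf_superset_mono image_mono C_mono bdd) (use C_ne in auto)
  have \<delta>_b: "\<delta> n \<le> b 0" for n
  proof -
    obtain w where w: "w \<in> C n" using C_ne by blast
    have "\<delta> n \<le> L2_norm (gradient w)" by (rule \<delta>_le[OF w])
    also have "\<dots> \<le> b n" using w by (simp add: C_def)
    also have "\<dots> \<le> b 0" using dec by (simp add: decseq_def)
    finally show ?thesis .
  qed
  obtain L where L: "\<delta> \<longlonglongrightarrow> L" using incseq_convergent[OF \<delta>_mono] \<delta>_b by blast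
  have \<delta>L: "\<delta> n \<le> L" for n by (rule incseq_le[OF \<delta>_mono L])
  have "\<exists>w\<in>C n. L2_norm (gradient w) < \<delta> n + inverse (real (Suc n))" for n
  proof -
    have "Inf ((\<lambda>w. L2_norm (gradient w)) ` C n) < \<delta> n + inverse (real (Suc n))" by (simp add: \<delta>_def)
    thus ?thesis using cInf_lessD[of "(\<lambda>w. L2_norm (gradient w)) ` C n"] C_ne by auto
  qed
  then obtain w where w: "\<And>n. w n \<in> C n" "\<And>n. L2_norm (gradient (w n)) < \<delta> n + inverse (real (Suc n))" by metis
  have wt: "test_function \<Omega> (w n)" for n using w(1) by (simp add: C_def)
  define \<eta> where "\<eta> n = 4 * (L + inverse (real (Suc n)))\<^sup>2 - 4 * (\<delta> n)\<^sup>2" for n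
  have \<eta>: "(L2_norm (\<lambda>x. gradient (w m) x - gradient (w n) x))\<^sup>2 \<le> \<eta> n" if "n \<le> m" for m n
  proof -
    have up: "(L2_norm (gradient (w k)))\<^sup>2 \<le> (L + inverse (real (Suc n)))\<^sup>2" if "n \<le> k" for k
    proof (rule power_mono)
      have "inverse (real (Suc k)) \<le> inverse (real (Suc n))" using that by (intro le_imp_inverse_le) auto
      thus "L2_norm (gradient (w k)) \<le> L + inverse (real (Suc n))" using w(2)[of k] \<delta>L[of k] by linarith
    qed simp
    have mid: "\<delta> n \<le> L2_norm (\<lambda>x. (1/2) *\<^sub>R gradient (w m) x + (1/2) *\<^sub>R gradient (w n) x)"
    proof -
      have "(\<lambda>x. 1/2 * w m x + 1/2 * w n x) \<in> C n" using C_mid w(1) C_mono[OF that] by blast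
      moreover have "gradient (\<lambda>x. 1/2 * w m x + 1/2 * w n x) = (\<lambda>x. (1/2) *\<^sub>R gradient (w m) x + (1/2) *\<^sub>R gradient (w n) x)"
        by (rule ext, rule gradient_lincomb[OF wt wt])
      ultimately show ?thesis using \<delta>_le by metis
    qed
    have "(\<delta> n)\<^sup>2 \<le> (L2_norm (\<lambda>x. (1/2) *\<^sub>R gradient (w m) x + (1/2) *\<^sub>R gradient (w n) x))\<^sup>2"
      by (rule power_mono[OF mid \<delta>0])
    thus ?thesis using L2_norm_parallelogram[OF test_L2(2)[OF wt[of m]] test_L2(2)[OF wt[of n]]] up[OF that] up[of n]
      by (simp add: \<eta>_def)
  qed
  have \<eta>0: "\<eta> \<longlonglongrightarrow> 0"
  proof -
    have "\<eta> \<longlonglongrightarrow> 4 * (L + 0)\<^sup>2 - 4 * L\<^sup>2"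
      unfolding \<eta>_def by (intro tendsto_intros L LIMSEQ_inverse_real_of_nat)
    thus ?thesis by simp
  qed
  have "\<exists>N. \<forall>m\<ge>N. \<forall>n\<ge>N. L2_norm (\<lambda>x. gradient (w m) x - gradient (w n) x) < e" if "e > 0" for e
  proof -
    have "\<forall>\<^sub>F n in sequentially. \<eta> n < e\<^sup>2" using order_tendstoD(2)[OF \<eta>0] that by simp
    then obtain N where N: "\<And>n. n \<ge> N \<Longrightarrow> \<eta> n < e\<^sup>2" by (auto simp: eventually_sequentially)
    have *: "L2_norm (\<lambda>x. gradient (w m) x - gradient (w n) x) < e" if "n \<le> m" "N \<le> n" for m n
      by (rule power2_less_imp_less) (use \<eta>[OF that(1)] N[OF that(2)] \<open>e > 0\<close> in auto)
    have "L2_norm (\<lambda>x. gradient (w m) x - gradient (w n) x) < e" if "N \<le> m" "N \<le> n" for m n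
      using *[of n m] *[of m n] that L2_norm_minus[of "gradient (w m)"] by (cases "n \<le> m") auto
    thus ?thesis by blast
  qed
  then obtain u where u: "u \<in> H10 \<Omega>" "(\<lambda>n. L2_norm (\<lambda>x. wg u x - gradient (w n) x)) \<longlonglongrightarrow> 0"
    by (rule H10_complete[OF wt])
  obtain K where K: "K > 0" "\<And>u. u \<in> H10 \<Omega> \<Longrightarrow> integrable dom (\<lambda>x. \<bar>u x\<bar> powr q)"
    "\<And>u. u \<in> H10 \<Omega> \<Longrightarrow> (LINT x|dom. \<bar>u x\<bar> powr q) \<le> K * L2_norm (wg u) powr q"
    using Sobolev_H10[OF q d] by blast
  have H10d: "(\<lambda>x. f x - g x) \<in> H10 \<Omega>" "AE x in dom. wg (\<lambda>x. f x - g x) x = wg f x - wg g x" if "f \<in> H10 \<Omega>" "g \<in> H10 \<Omega>" for f g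
    using H10_lincomb[OF that, of 1 "-1"] by auto
  have Lq: "(\<lambda>n. LINT x|dom. \<bar>u x - w n x\<bar> powr q) \<longlonglongrightarrow> 0"
  proof (rule tendsto_sandwich[OF _ _ tendsto_const])
    have "(LINT x|dom. \<bar>u x - w n x\<bar> powr q) \<le> K * L2_norm (\<lambda>x. wg u x - gradient (w n) x) powr q" for n
    proof -
      note h = H10d[OF u(1) test_H10(1)[OF wt[of n]]]
      have "L2_norm (wg (\<lambda>x. u x - w n x)) = L2_norm (\<lambda>x. wg u x - gradient (w n) x)"
      proof (rule L2_norm_cong)
        show "AE x in dom. norm (wg (\<lambda>x. u x - w n x) x) = norm (wg u x - gradient (w n) x)"
          using h(2) test_H10(2)[OF wt[of n]] by eventually_elim simp
      qed (intro H10D(2) h L2_diff u test_L2 wt)+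
      thus ?thesis using K(3)[OF h(1)] by simp
    qed
    thus "\<forall>\<^sub>F n in sequentially. (LINT x|dom. \<bar>u x - w n x\<bar> powr q) \<le> K * L2_norm (\<lambda>x. wg u x - gradient (w n) x) powr q" by simp
    have "(\<lambda>n. K * L2_norm (\<lambda>x. wg u x - gradient (w n) x) powr q) \<longlonglongrightarrow> K * 0 powr q"
      using q by (intro tendsto_mult tendsto_const tendsto_powr' u) auto
    thus "(\<lambda>n. K * L2_norm (\<lambda>x. wg u x - gradient (w n) x) powr q) \<longlonglongrightarrow> 0" using q by simp
  qed simp
  have final: "(LINT x|dom. \<bar>u x - \<psi> (M j) x\<bar> powr q) \<le> 2 powr q * (1/2)^j" for j
  proof (rule LIMSEQ_le_const)
    have "(\<lambda>n. 2 powr q * ((LINT x|dom. \<bar>u x - w n x\<bar> powr q) + (1/2)^j)) \<longlonglongrightarrow> 2 powr q * (0 + (1/2)^j)"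
      by (intro tendsto_intros Lq)
    thus "(\<lambda>n. 2 powr q * ((LINT x|dom. \<bar>u x - w n x\<bar> powr q) + (1/2)^j)) \<longlonglongrightarrow> 2 powr q * (1/2)^j" by simp
    have "(LINT x|dom. \<bar>u x - \<psi> (M j) x\<bar> powr q) \<le> 2 powr q * ((LINT x|dom. \<bar>u x - w n x\<bar> powr q) + (1/2)^j)" if "n \<ge> j" for n
    proof -
      have i: "integrable dom (\<lambda>x. \<bar>u x - w n x\<bar> powr q)" "integrable dom (\<lambda>x. \<bar>w n x - \<psi> (M j) x\<bar> powr q)"
        "integrable dom (\<lambda>x. \<bar>u x - \<psi> (M j) x\<bar> powr q)"
        by (intro K(2) H10d(1) u test_H10(1) wt \<psi>)+
      have "(LINT x|dom. \<bar>u x - \<psi> (M j) x\<bar> powr q) \<le>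
          (LINT x|dom. 2 powr q * (\<bar>u x - w n x\<bar> powr q + \<bar>w n x - \<psi> (M j) x\<bar> powr q))"
      proof (rule integral_mono[OF i(3)])
        show "\<bar>u x - \<psi> (M j) x\<bar> powr q \<le> 2 powr q * (\<bar>u x - w n x\<bar> powr q + \<bar>w n x - \<psi> (M j) x\<bar> powr q)" for x
          using abs_powr_add_le[of q "u x - w n x" "w n x - \<psi> (M j) x"] q by simp
      qed (use i in auto)
      also have "\<dots> = 2 powr q * ((LINT x|dom. \<bar>u x - w n x\<bar> powr q) + (LINT x|dom. \<bar>w n x - \<psi> (M j) x\<bar> powr q))"
        using i by simp
      also have "\<dots> \<le> 2 powr q * ((LINT x|dom. \<bar>u x - w n x\<bar> powr q) + (1/2)^j)"
        using w(1)[of n] that by (intro mult_left_mono add_left_mono) (auto simp: C_def)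
      finally show ?thesis .
    qed
    thus "\<exists>N. \<forall>n\<ge>N. (LINT x|dom. \<bar>u x - \<psi> (M j) x\<bar> powr q) \<le> 2 powr q * ((LINT x|dom. \<bar>u x - w n x\<bar> powr q) + (1/2)^j)" by blast
  qed
  show ?thesis
  proof (rule that[of "\<lambda>j. r0 (M j)" u])
    show "r0 (M n) \<ge> n" for n using M(1)[of n] seq_suble[OF r0, of "M n"] by linarith
    show "u \<in> H10 \<Omega>" by (rule u(1))
    show "(\<lambda>n. LINT x|dom. \<bar>u x - \<phi> (r0 (M n)) x\<bar> powr q) \<longlonglongrightarrow> 0"
    proof (rule tendsto_sandwich[OF _ _ tendsto_const])
      show "\<forall>\<^sub>F n in sequentially. (LINT x|dom. \<bar>u x - \<phi> (r0 (M n)) x\<bar> powr q) \<le> 2 powr q * (1/2)^n"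
        using final by (simp add: \<psi>_def)
      show "(\<lambda>n. 2 powr q * (1/2)^n :: real) \<longlonglongrightarrow> 0"
        by (intro tendsto_mult_right_zero LIMSEQ_power_zero) auto
    qed simp
    show "L2_norm (wg u) \<le> \<beta>"
    proof (rule LIMSEQ_le_const)
      have "(\<lambda>n. L2_norm (\<lambda>x. wg u x - gradient (w n) x) + b n) \<longlonglongrightarrow> 0 + \<beta>" by (intro tendsto_add u lim)
      thus "(\<lambda>n. L2_norm (\<lambda>x. wg u x - gradient (w n) x) + b n) \<longlonglongrightarrow> \<beta>" by simp
      have "L2_norm (wg u) \<le> L2_norm (\<lambda>x. wg u x - gradient (w n) x) + b n" for n
      proof -
        have "L2_norm (wg u) \<le> L2_norm (\<lambda>x. wg u x - gradient (w n) x) + L2_norm (gradient (w n))"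
          using L2_norm_triangle[OF L2_diff[OF H10D(2)[OF u(1)] test_L2(2)[OF wt[of n]]] test_L2(2)[OF wt[of n]]] by simp
        thus ?thesis using w(1)[of n] by (simp add: C_def)
      qed
      thus "\<exists>N. \<forall>n\<ge>N. L2_norm (wg u) \<le> L2_norm (\<lambda>x. wg u x - gradient (w n) x) + b n" by blast
    qed
  qed
qed

end

section \<open>The radial nonlinearity\<close>

lemma norm_pair_zero: "norm (s, 0 :: real) = \<bar>s :: real\<bar>"
  by (simp add: norm_Pair)

text \<open>The conditions at the points of \<open>\<Omega>\<close>, over which all integrals are taken. The uniform limits at
  zero and at infinity appear as quadratic bounds, the form in which they enter the estimates.\<close>

locale nonlinearity = bounded_open \<Omega> for \<Omega> :: "'a::euclidean_space set" +
  fixes F :: "'a \<Rightarrow> real \<times> real \<Rightarrow> real" and a p :: real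
  assumes C1: "C1_up_to_boundary (\<Omega> \<times> UNIV) (\<lambda>(x, u). F x u)"
    and F_zero: "\<And>x. x \<in> \<Omega> \<Longrightarrow> F x 0 = 0"
    and a_pos: "a > 0" and p_gt: "2 < p" and p_sub: "sobolev_defect TYPE('a) p < 1"
    and growth: "\<And>x u. x \<in> \<Omega> \<Longrightarrow> norm (gradient (F x) u) \<le> a * (1 + norm u powr (p - 1))"
    and small: "\<And>e. e > 0 \<Longrightarrow> \<exists>d>0. \<forall>x\<in>\<Omega>. \<forall>u. norm u < d \<longrightarrow> F x u \<le> e * (norm u)\<^sup>2"
    and large: "\<And>K. \<exists>C. \<forall>x\<in>\<Omega>. \<forall>u. F x u \<ge> K * (norm u)\<^sup>2 - C"
    and F_pos: "\<And>x u. x \<in> \<Omega> \<Longrightarrow> u \<noteq> 0 \<Longrightarrow> F x u > 0"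
    and superquadratic: "\<And>x u. x \<in> \<Omega> \<Longrightarrow> u \<noteq> 0 \<Longrightarrow> u \<bullet> gradient (F x) u > 2 * F x u"
    and sign: "\<And>x u v. x \<in> \<Omega> \<Longrightarrow> (v \<bullet> gradient (F x) u) * (u \<bullet> v) \<ge> 0"
    and radial: "\<And>x u v. x \<in> \<Omega> \<Longrightarrow> norm u = norm v \<Longrightarrow> F x u = F x v"
    and asymmetric: "\<And>x u v. x \<in> \<Omega> \<Longrightarrow> norm u \<noteq> norm v \<Longrightarrow> u \<bullet> v \<noteq> 0 \<Longrightarrow>
                       v \<bullet> gradient (F x) u \<noteq> u \<bullet> gradient (F x) v"
begin

lemma F_continuous: "continuous_on (\<Omega> \<times> UNIV) (\<lambda>(x, u). F x u)"
  using C1 closure_subset unfolding C1_up_to_boundary_def by (metis continuous_on_subset)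

text \<open>The derivative in \<open>(x, u)\<close> extends continuously to \<open>closure \<Omega>\<close>; its second component is the
  gradient in \<open>u\<close>.\<close>

lemma gradient_extension:
  obtains D where "continuous_on (closure \<Omega> \<times> UNIV) D"
    "\<And>x u. x \<in> \<Omega> \<Longrightarrow> gradient (F x) u = D (x, u)" "\<And>x u. x \<in> \<Omega> \<Longrightarrow> GDERIV (F x) u :> D (x, u)"
proof -
  obtain E where E: "continuous_on (closure (\<Omega> \<times> UNIV)) E"
      "\<And>q. q \<in> \<Omega> \<times> UNIV \<Longrightarrow> GDERIV (\<lambda>(x, u). F x u) q :> E q"
    using C1 unfolding C1_up_to_boundary_def by blast
  have gd: "GDERIV (F x) u :> snd (E (x, u))" if "x \<in> \<Omega>" for x u
  proof -
    have 1: "((\<lambda>(x, u). F x u) has_derivative (\<lambda>h. h \<bullet> E (x, u))) (at (x, u))"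
      using E(2)[of "(x, u)"] that by (simp add: gderiv_def)
    have 2: "((\<lambda>u. (x, u)) has_derivative (\<lambda>h. (0, h))) (at u)"
      by (auto intro!: derivative_eq_intros)
    have "((\<lambda>u. (\<lambda>(x, u). F x u) (x, u)) has_derivative (\<lambda>h. (0, h) \<bullet> E (x, u))) (at u)"
      by (rule has_derivative_compose[OF 2 1])
    thus ?thesis by (simp add: gderiv_def inner_prod_def)
  qed
  show ?thesis
  proof (rule that[of "\<lambda>q. snd (E q)"])
    show "continuous_on (closure \<Omega> \<times> UNIV) (\<lambda>q. snd (E q))"
      using E(1) by (auto simp: closure_Times intro: continuous_intros)
    show "gradient (F x) u = snd (E (x, u))" if "x \<in> \<Omega>" for x u by (rule gradient_eqI[OF gd[OF that]])
    show "GDERIV (F x) u :> snd (E (x, u))" if "x \<in> \<Omega>" for x u by (rule gd[OF that])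
  qed
qed

lemma F_has_derivative:
  assumes "x \<in> \<Omega>" shows "(F x has_derivative (\<lambda>h. h \<bullet> gradient (F x) u)) (at u)"
proof -
  obtain D where D: "continuous_on (closure \<Omega> \<times> UNIV) D"
    "\<And>x u. x \<in> \<Omega> \<Longrightarrow> gradient (F x) u = D (x, u)" "\<And>x u. x \<in> \<Omega> \<Longrightarrow> GDERIV (F x) u :> D (x, u)"
    using gradient_extension by metis
  show ?thesis using D(2,3)[OF assms] by (simp add: gderiv_def)
qed

lemma gradient_continuous: "continuous_on (\<Omega> \<times> UNIV) (\<lambda>(x, u). gradient (F x) u)"
proof -
  obtain D where D: "continuous_on (closure \<Omega> \<times> UNIV) D"
    "\<And>x u. x \<in> \<Omega> \<Longrightarrow> gradient (F x) u = D (x, u)" "\<And>x u. x \<in> \<Omega> \<Longrightarrow> GDERIV (F x) u :> D (x, u)"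
    using gradient_extension by metis
  have "continuous_on (\<Omega> \<times> UNIV) D" using D(1) closure_subset by (rule continuous_on_subset[OF _ Sigma_mono]) auto
  thus ?thesis by (rule continuous_on_eq) (use D(2) in auto)
qed

text \<open>Uniform continuity of the extended gradient on a compact set.\<close>

lemma gradient_uniform:
  assumes "\<eta> > 0" "M \<ge> 0"
  shows "\<exists>d>0. \<forall>x\<in>\<Omega>. \<forall>u k. norm u \<le> M \<longrightarrow> norm k \<le> d \<longrightarrow> norm (gradient (F x) (u + k) - gradient (F x) u) \<le> \<eta>"
proof -
  obtain D where D: "continuous_on (closure \<Omega> \<times> UNIV) D"
    "\<And>x u. x \<in> \<Omega> \<Longrightarrow> gradient (F x) u = D (x, u)" "\<And>x u. x \<in> \<Omega> \<Longrightarrow> GDERIV (F x) u :> D (x, u)"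
    using gradient_extension by metis
  let ?S = "closure \<Omega> \<times> cball (0 :: real \<times> real) (M + 1)"
  have "compact ?S" using bounded_dom by (intro compact_Times) (auto simp: compact_closure)
  moreover have "continuous_on ?S D" using D(1) by (rule continuous_on_subset) auto
  ultimately have "uniformly_continuous_on ?S D" by (rule compact_uniformly_continuous[rotated])
  then obtain d where d: "d > 0" "\<And>q q'. q \<in> ?S \<Longrightarrow> q' \<in> ?S \<Longrightarrow> dist q' q < d \<Longrightarrow> dist (D q') (D q) < \<eta>"
    using assms(1) unfolding uniformly_continuous_on_def by metis
  have "norm (gradient (F x) (u + k) - gradient (F x) u) \<le> \<eta>"
    if x: "x \<in> \<Omega>" and u: "norm u \<le> M" and k: "norm k \<le> min (d/2) 1" for x u k
  proof -
    have "dist (D (x, u + k)) (D (x, u)) < \<eta>"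
    proof (rule d(2))
      show "(x, u) \<in> ?S" using x u closure_subset by auto
      show "(x, u + k) \<in> ?S" using x u k closure_subset norm_triangle_ineq[of u k] by auto
      show "dist (x, u + k) (x, u) < d" using k d(1) by (simp add: dist_Pair_Pair dist_norm)
    qed
    thus ?thesis using D(2)[OF x] by (simp add: dist_norm)
  qed
  thus ?thesis using d(1) by (intro exI[of _ "min (d/2) 1"]) auto
qed

definition G :: "'a \<Rightarrow> real \<Rightarrow> real" where "G x s = F x (s, 0)"

definition g :: "'a \<Rightarrow> real \<Rightarrow> real" where "g x s = fst (gradient (F x) (s, 0))"

context
  fixes x assumes x: "x \<in> \<Omega>"
begin

lemma G_deriv: "(G x has_real_derivative g x s) (at s)"
proof -
  have "((\<lambda>s. (s, 0 :: real)) has_derivative (\<lambda>h. (h, 0))) (at s)" by (auto intro!: derivative_eq_intros)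
  from has_derivative_compose[OF this F_has_derivative[OF x]]
  show ?thesis by (simp add: has_field_derivative_def inner_prod_def G_def[abs_def] g_def mult_commute_abs)
qed

lemma G_even: "G x \<bar>s\<bar> = G x s"
  unfolding G_def by (rule radial[OF x]) (simp add: norm_pair_zero)

lemma G_zero: "G x 0 = 0" using F_zero[OF x] by (simp add: G_def zero_prod_def)

lemma G_nonneg: "G x s \<ge> 0"
  using F_pos[OF x, of "(s, 0)"] G_zero by (cases "s = 0") (auto simp: G_def zero_prod_def)

text \<open>By radial symmetry \<open>F x (s, b)\<close> is even in \<open>b\<close>, so its derivative in \<open>b\<close> vanishes at \<open>b = 0\<close>.\<close>

lemma gradient_on_axis: "gradient (F x) (s, 0) = (g x s, 0)"
proof -
  have "((\<lambda>b. (s, b)) has_derivative (\<lambda>h. (0, h))) (at 0)" by (auto intro!: derivative_eq_intros)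
  from has_derivative_compose[OF this F_has_derivative[OF x]]
  have d: "((\<lambda>b. F x (s, b)) has_real_derivative (snd (gradient (F x) (s, 0)))) (at 0)"
    by (simp add: has_field_derivative_def inner_prod_def mult_commute_abs)
  hence d': "((\<lambda>b. F x (s, b)) has_real_derivative (snd (gradient (F x) (s, 0)))) (at (- 0))" by simp
  have "((\<lambda>b. F x (s, - b)) has_real_derivative (snd (gradient (F x) (s, 0)) * (- 1))) (at 0)"
    by (rule DERIV_chain2[where f="\<lambda>b. F x (s, b)" and g=uminus, OF d']) (auto intro!: derivative_eq_intros)
  moreover have "(\<lambda>b. F x (s, - b)) = (\<lambda>b. F x (s, b))"
    by (intro ext radial[OF x]) (simp add: norm_Pair)
  ultimately have "snd (gradient (F x) (s, 0)) * (- 1) = snd (gradient (F x) (s, 0))"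
    using d DERIV_unique by metis
  hence "snd (gradient (F x) (s, 0)) = 0" by simp
  thus ?thesis by (simp add: g_def prod_eq_iff)
qed

lemma g_odd: "g x (- s) = - g x s"
proof -
  have "((\<lambda>s. G x (- s)) has_real_derivative (g x (- s) * (- 1))) (at s)"
    by (rule DERIV_chain2[OF G_deriv]) (auto intro!: derivative_eq_intros)
  moreover have "(\<lambda>s. G x (- s)) = G x" using G_even abs_minus_cancel by (metis ext)
  ultimately have "g x (- s) * (- 1) = g x s" using G_deriv DERIV_unique by metis
  thus ?thesis by simp
qed

lemma g_zero: "g x 0 = 0" using g_odd[of 0] by simp

lemma g_superquadratic: "s \<noteq> 0 \<Longrightarrow> s * g x s > 2 * G x s"
  using superquadratic[OF x, of "(s, 0)"] by (simp add: gradient_on_axis G_def zero_prod_def)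

lemma g_pos: "s > 0 \<Longrightarrow> g x s > 0"
  using g_superquadratic[of s] G_nonneg[of s] by (smt (verit) mult_nonneg_nonpos)

lemma g_continuous: "continuous_on S (g x)"
proof -
  have "continuous_on UNIV (\<lambda>s. (\<lambda>(x, u). gradient (F x) u) (x, (s, 0 :: real)))"
    by (rule continuous_on_compose2[OF gradient_continuous]) (use x in \<open>auto intro!: continuous_intros\<close>)
  hence "continuous_on UNIV (\<lambda>s. fst (gradient (F x) (s, 0)))" by (auto intro: continuous_intros)
  thus ?thesis unfolding g_def[abs_def] by (rule continuous_on_subset) simp
qed

lemma quotient_deriv:
  "((\<lambda>r. G x r - r\<^sup>2 * c / 2) has_real_derivative (g x r - r * c)) (at r)"
  by (auto intro!: derivative_eq_intros G_deriv)

lemma quotient_continuous: "continuous_on S (\<lambda>r. G x r - r\<^sup>2 * c / 2)"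
  by (intro continuous_at_imp_continuous_on ballI DERIV_isCont[OF quotient_deriv])

text \<open>By asymmetry the quotient is injective, so it is strictly monotone. If it decreased, then
  \<open>g x r > r g x s / s\<close> for \<open>0 < r < s\<close>, and integrating would give \<open>2 G x s > s g x s\<close>, against
  superquadraticity.\<close>

lemma g_quotient_strict_mono:
  assumes "0 < s" "s < t" shows "g x s / s < g x t / t"
proof (rule ccontr)
  let ?h = "\<lambda>s. g x s / s"
  assume neg: "\<not> ?h s < ?h t"
  have inj: "?h s \<noteq> ?h t" if "s > 0" "t > 0" "s \<noteq> t" for s t
    using asymmetric[OF x, of "(s, 0)" "(t, 0)"] that
    by (auto simp: norm_pair_zero gradient_on_axis field_simps)
  have gt: "?h s > ?h t" using inj[of s t] assms neg by force
  \<comment> \<open>The middle point of \<open>r < s < t\<close> must take the middle value.\<close>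
  have dec: "?h r > ?h s" if r: "0 < r" "r < s" for r
  proof -
    have "continuous_on {r..t} ?h" using r by (intro continuous_intros g_continuous) auto
    moreover have "inj_on ?h {r..t}" using inj r by (intro inj_onI) (metis atLeastAtMost_iff less_le_trans)
    ultimately have "?h r < ?h s \<and> ?h s < ?h t \<or> ?h t < ?h s \<and> ?h s < ?h r"
      using continuous_inj_imp_mono[of r s t ?h] r assms by auto
    thus ?thesis using gt by auto
  qed
  have "G x 0 - 0\<^sup>2 * ?h s / 2 < G x s - s\<^sup>2 * ?h s / 2"
  proof (rule DERIV_pos_imp_increasing_open[OF assms(1)])
    fix r assume r: "0 < r" "r < s"
    have "g x r - r * ?h s > 0" using dec[OF r] r by (simp add: field_simps)
    thus "\<exists>y. ((\<lambda>r. G x r - r\<^sup>2 * ?h s / 2) has_real_derivative y) (at r) \<and> 0 < y" using quotient_deriv by blast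
  qed (rule quotient_continuous)
  hence "G x s > s * g x s / 2" using assms by (simp add: G_zero power2_eq_square)
  thus False using g_superquadratic[of s] assms by simp
qed

text \<open>The function \<open>\<tau> \<mapsto> G x (sqrt \<tau>)\<close> is strictly convex, with derivative \<open>g x s / (2 s)\<close> at
  \<open>\<tau> = s\<^sup>2\<close>: subtracting the tangent leaves a function of \<open>r\<close> that decreases up to \<open>s\<close> and increases
  afterwards.\<close>

lemma G_subgradient_strict:
  assumes "r \<ge> 0" "s > 0" "r \<noteq> s"
  shows "G x r > G x s + (r\<^sup>2 - s\<^sup>2) * (g x s / (2 * s))"
proof -
  let ?c = "g x s / s"
  have "G x s - s\<^sup>2 * ?c / 2 < G x r - r\<^sup>2 * ?c / 2"
  proof (cases "r < s")
    case True
    show ?thesis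
    proof (rule DERIV_neg_imp_decreasing_open[OF True])
      fix t assume t: "r < t" "t < s"
      have "g x t - t * ?c < 0" using g_quotient_strict_mono[of t s] t assms by (simp add: field_simps)
      thus "\<exists>y. ((\<lambda>r. G x r - r\<^sup>2 * ?c / 2) has_real_derivative y) (at t) \<and> y < 0" using quotient_deriv by blast
    qed (rule quotient_continuous)
  next
    case False
    hence sr: "s < r" using assms by simp
    show ?thesis
    proof (rule DERIV_pos_imp_increasing_open[OF sr])
      fix t assume t: "s < t" "t < r"
      have "g x t - t * ?c > 0" using g_quotient_strict_mono[of s t] t assms by (simp add: field_simps)
      thus "\<exists>y. ((\<lambda>r. G x r - r\<^sup>2 * ?c / 2) has_real_derivative y) (at t) \<and> 0 < y" using quotient_deriv by blast
    qed (rule quotient_continuous)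
  qed
  thus ?thesis by (simp add: algebra_simps)
qed

lemma G_subgradient:
  assumes "r \<ge> 0" "s > 0"
  shows "G x r \<ge> G x s + (r\<^sup>2 - s\<^sup>2) * (g x s / (2 * s))"
  using G_subgradient_strict[OF assms] by (cases "r = s") auto

lemma G_scaling: 
  assumes "\<tau> \<ge> 0" shows "G x (sqrt \<tau> * s) \<ge> G x s + (\<tau> - 1) * (g x s * s / 2)"
    "s \<noteq> 0 \<Longrightarrow> \<tau> \<noteq> 1 \<Longrightarrow> G x (sqrt \<tau> * s) > G x s + (\<tau> - 1) * (g x s * s / 2)"
proof -
  have e: "((sqrt \<tau> * \<bar>s\<bar>)\<^sup>2 - \<bar>s\<bar>\<^sup>2) * (g x \<bar>s\<bar> / (2 * \<bar>s\<bar>)) = (\<tau> - 1) * (g x s * s / 2)" if "s \<noteq> 0"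
    using that assms g_odd[of s] by (cases "s > 0") (simp_all add: power_mult_distrib field_simps power2_eq_square)
  have e2: "G x (sqrt \<tau> * \<bar>s\<bar>) = G x (sqrt \<tau> * s)" "G x \<bar>s\<bar> = G x s"
    using G_even[of "sqrt \<tau> * s"] G_even[of s] assms by (auto simp: abs_mult)
  show "G x (sqrt \<tau> * s) \<ge> G x s + (\<tau> - 1) * (g x s * s / 2)"
    using G_subgradient[of "sqrt \<tau> * \<bar>s\<bar>" "\<bar>s\<bar>"] e e2 assms by (cases "s = 0") auto
  show "G x (sqrt \<tau> * s) > G x s + (\<tau> - 1) * (g x s * s / 2)" if "s \<noteq> 0" "\<tau> \<noteq> 1"
    using G_subgradient_strict[of "sqrt \<tau> * \<bar>s\<bar>" "\<bar>s\<bar>"] e e2 assms that by auto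
qed

lemma G_convex: "G x t \<ge> G x s + g x s * (t - s)"
proof -
  have pos: "G x t \<ge> G x s + g x s * (t - s)" if "s > 0" for s t
  proof -
    have "G x t \<ge> G x s + (t\<^sup>2 - s\<^sup>2) * (g x s / (2 * s))"
      using G_subgradient[of "\<bar>t\<bar>" s] G_even[of t] that by simp
    moreover have "(t\<^sup>2 - s\<^sup>2) * (g x s / (2 * s)) - g x s * (t - s) = (t - s)\<^sup>2 * (g x s / (2 * s))"
      using that by (simp add: field_simps power2_eq_square)
    moreover have "(t - s)\<^sup>2 * (g x s / (2 * s)) \<ge> 0" using g_pos[OF that] that by simp
    ultimately show ?thesis by linarith
  qed
  consider "s > 0" | "s = 0" | "s < 0" by linarith
  thus ?thesis
  proof cases
    case 1 thus ?thesis by (rule pos)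
  next
    case 2 thus ?thesis using g_zero G_zero G_nonneg by simp
  next
    case 3
    thus ?thesis using pos[of "- s" "- t"] g_odd[of s] G_even[of s] G_even[of t] G_even[of "- s"] G_even[of "- t"]
      by (simp add: algebra_simps)
  qed
qed

lemma G_scaling_convex:
  assumes "\<tau>1 \<ge> 0" "\<tau>2 \<ge> 0" "0 \<le> l" "l \<le> 1"
  shows "G x (sqrt ((1 - l) * \<tau>1 + l * \<tau>2) * r) \<le> (1 - l) * G x (sqrt \<tau>1 * r) + l * G x (sqrt \<tau>2 * r)"
proof -
  define \<tau> where "\<tau> = (1 - l) * \<tau>1 + l * \<tau>2"
  have \<tau>: "\<tau> \<ge> 0" using assms by (simp add: \<tau>_def)
  show ?thesis
  proof (cases "\<tau> = 0 \<or> r = 0")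
    case True
    thus ?thesis using G_nonneg assms by (auto simp: \<tau>_def[symmetric] G_zero)
  next
    case False
    define s where "s = sqrt \<tau> * \<bar>r\<bar>"
    have s: "s > 0" using False \<tau> by (simp add: s_def)
    have e: "G x (sqrt t * \<bar>r\<bar>) = G x (sqrt t * r)" if "t \<ge> 0" for t
      using G_even[of "sqrt t * r"] that by (simp add: abs_mult)
    have i: "G x (sqrt t * r) \<ge> G x s + (t * r\<^sup>2 - \<tau> * r\<^sup>2) * (g x s / (2 * s))" if "t \<ge> 0" for t
      using G_subgradient[of "sqrt t * \<bar>r\<bar>" s] s that \<tau> e[OF that] by (simp add: s_def power_mult_distrib)
    have "(1 - l) * G x (sqrt \<tau>1 * r) + l * G x (sqrt \<tau>2 * r) \<ge>
       (1 - l) * (G x s + (\<tau>1 * r\<^sup>2 - \<tau> * r\<^sup>2) * (g x s / (2 * s))) + l * (G x s + (\<tau>2 * r\<^sup>2 - \<tau> * r\<^sup>2) * (g x s / (2 * s)))"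
      using assms by (intro add_mono mult_left_mono i) auto
    moreover have "(1 - l) * (A + (\<tau>1 * R - \<tau> * R) * k) + l * (A + (\<tau>2 * R - \<tau> * R) * k) =
        A + (((1 - l) * \<tau>1 + l * \<tau>2) - \<tau>) * R * k" for A R k :: real
      by (simp add: algebra_simps)
    ultimately have "G x s \<le> (1 - l) * G x (sqrt \<tau>1 * r) + l * G x (sqrt \<tau>2 * r)"
      by (simp only: \<tau>_def[symmetric] diff_self mult_zero_left add_0_right)
    thus ?thesis using e[OF \<tau>] by (simp add: \<tau>_def[symmetric] s_def)
  qed
qed

lemma F_mean_value:
  assumes "\<And>t. 0 \<le> t \<Longrightarrow> t \<le> 1 \<Longrightarrow> norm (gradient (F x) (u + t *\<^sub>R k) - c) \<le> B"
  shows "\<bar>F x (u + k) - F x u - k \<bullet> c\<bar> \<le> B * norm k"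
proof -
  have "norm ((\<lambda>t. F x (u + t *\<^sub>R k) - t * (k \<bullet> c)) 1 - (\<lambda>t. F x (u + t *\<^sub>R k) - t * (k \<bullet> c)) 0) \<le> (B * norm k) * norm (1 - 0 :: real)"
  proof (rule differentiable_bound[where S="{0..1}"])
    fix t :: real assume t: "t \<in> {0..1}"
    have "((\<lambda>t. F x (u + t *\<^sub>R k)) has_derivative (\<lambda>h. (h *\<^sub>R k) \<bullet> gradient (F x) (u + t *\<^sub>R k))) (at t within {0..1})"
      by (rule has_derivative_at_withinI, rule has_derivative_compose[where f="\<lambda>t. u + t *\<^sub>R k"])
         (auto intro!: derivative_eq_intros F_has_derivative x)
    thus "((\<lambda>t. F x (u + t *\<^sub>R k) - t * (k \<bullet> c)) has_derivative (\<lambda>h. h * (k \<bullet> (gradient (F x) (u + t *\<^sub>R k) - c)))) (at t within {0..1})"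
      by (auto intro!: derivative_eq_intros simp: inner_diff_right algebra_simps)
    have "\<bar>k \<bullet> (gradient (F x) (u + t *\<^sub>R k) - c)\<bar> \<le> norm k * norm (gradient (F x) (u + t *\<^sub>R k) - c)"
      by (rule Cauchy_Schwarz_ineq2)
    also have "\<dots> \<le> norm k * B" using assms t by (intro mult_left_mono) auto
    finally have b: "\<bar>k \<bullet> (gradient (F x) (u + t *\<^sub>R k) - c)\<bar> \<le> B * norm k" by (simp add: mult.commute)
    show "onorm (\<lambda>h. h * (k \<bullet> (gradient (F x) (u + t *\<^sub>R k) - c))) \<le> B * norm k"
      by (rule onorm_le) (use b in \<open>auto simp: abs_mult mult.commute intro: mult_left_mono\<close>)
  qed auto
  thus ?thesis by simp
qed

text \<open>The growth bound on the gradient along the segment from \<open>v\<close> to \<open>u\<close>.\<close>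

lemma F_Lipschitz: "\<bar>F x u - F x v\<bar> \<le> a * (1 + (norm u + norm v) powr (p - 1)) * norm (u - v)"
proof -
  have "\<bar>F x (v + (u - v)) - F x v - (u - v) \<bullet> 0\<bar> \<le> (a * (1 + (norm u + norm v) powr (p - 1))) * norm (u - v)"
  proof (rule F_mean_value)
    fix t :: real assume t: "0 \<le> t" "t \<le> 1"
    have "v + t *\<^sub>R (u - v) = (1 - t) *\<^sub>R v + t *\<^sub>R u" by (simp add: algebra_simps)
    hence "norm (v + t *\<^sub>R (u - v)) \<le> norm ((1 - t) *\<^sub>R v) + norm (t *\<^sub>R u)" by (metis norm_triangle_ineq)
    also have "\<dots> \<le> norm v + norm u" using t by (intro add_mono) (auto intro!: mult_left_le_one_le)
    finally have "norm (v + t *\<^sub>R (u - v)) powr (p - 1) \<le> (norm u + norm v) powr (p - 1)"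
      using p_gt by (intro powr_mono2) auto
    hence "a * (1 + norm (v + t *\<^sub>R (u - v)) powr (p - 1)) \<le> a * (1 + (norm u + norm v) powr (p - 1))"
      using a_pos by (intro mult_left_mono) auto
    thus "norm (gradient (F x) (v + t *\<^sub>R (u - v)) - 0) \<le> a * (1 + (norm u + norm v) powr (p - 1))"
      using growth[OF x, of "v + t *\<^sub>R (u - v)"] by simp
  qed
  thus ?thesis by simp
qed

end

lemma measurable_compose_dom:
  fixes f :: "'a \<times> (real \<times> real) \<Rightarrow> 'c::euclidean_space"
  assumes f: "continuous_on (\<Omega> \<times> UNIV) f" and z: "z \<in> borel_measurable dom"
  shows "(\<lambda>x. f (x, z x)) \<in> borel_measurable dom"
proof -
  have o: "open (\<Omega> \<times> (UNIV :: (real \<times> real) set))" by (intro open_Times open_dom open_UNIV)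
  have f': "(\<lambda>q. indicator (\<Omega> \<times> UNIV) q *\<^sub>R f q) \<in> borel_measurable borel"
    by (rule borel_measurable_continuous_on_indicator[OF _ f]) (use o in auto)
  have "(\<lambda>x. x) \<in> borel_measurable dom" by (intro measurable_domI) simp
  hence "(\<lambda>x. (x, z x)) \<in> borel_measurable dom" using z by (rule borel_measurable_Pair)
  from measurable_compose[OF this f']
  have "(\<lambda>x. indicator (\<Omega> \<times> UNIV) (x, z x) *\<^sub>R f (x, z x)) \<in> borel_measurable dom" .
  thus ?thesis by (subst measurable_cong[where g="\<lambda>x. indicator (\<Omega> \<times> UNIV) (x, z x) *\<^sub>R f (x, z x)"]) auto
qed

lemma F_measurable: "z \<in> borel_measurable dom \<Longrightarrow> (\<lambda>x. F x (z x)) \<in> borel_measurable dom"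
  using measurable_compose_dom[OF F_continuous] by simp

lemma gradient_measurable: "z \<in> borel_measurable dom \<Longrightarrow> (\<lambda>x. gradient (F x) (z x)) \<in> borel_measurable dom"
  using measurable_compose_dom[OF gradient_continuous] by simp

end

section \<open>The superposition functional\<close>

context nonlinearity
begin

definition in_Lp :: "('a \<Rightarrow> real \<times> real) \<Rightarrow> bool" where
  "in_Lp z \<longleftrightarrow> z \<in> borel_measurable dom \<and> integrable dom (\<lambda>x. norm (z x) powr p)"

definition Lp_norm :: "('a \<Rightarrow> real \<times> real) \<Rightarrow> real" where
  "Lp_norm z = (LINT x|dom. norm (z x) powr p) powr (1/p)"

definition p' :: real where "p' = p / (p - 1)"

definition potential :: "('a \<Rightarrow> real \<times> real) \<Rightarrow> real" where "potential z = (LINT x|dom. F x (z x))"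

lemma p'_props: "p > 1" "p' > 1" "1/p + 1/p' = 1" "1/p' + 1/p = 1" "(p - 1) * p' = p"
  using p_gt by (auto simp: p'_def field_simps)

lemma Lp_norm_nonneg[simp]: "Lp_norm z \<ge> 0" by (simp add: Lp_norm_def)

lemma Lp_norm_powr: "Lp_norm z powr p = (LINT x|dom. norm (z x) powr p)"
  using p_gt by (simp add: Lp_norm_def powr_powr)

lemma in_LpD: "in_Lp z \<Longrightarrow> z \<in> borel_measurable dom" "in_Lp z \<Longrightarrow> integrable dom (\<lambda>x. norm (z x) powr p)"
  by (auto simp: in_Lp_def)

lemma norm_powr_add_le: "norm (u + v) powr p \<le> 2 powr p * (norm u powr p + norm v powr p)" for u v :: "'b::real_normed_vector"
proof -
  have "norm (u + v) powr p \<le> (norm u + norm v) powr p"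
    using p_gt by (intro powr_mono2 norm_triangle_ineq) auto
  also have "\<dots> \<le> 2 powr p * (norm u powr p + norm v powr p)"
    using p_gt by (intro powr_sum_le) auto
  finally show ?thesis .
qed

lemma in_Lp_add: assumes "in_Lp z" "in_Lp w" shows "in_Lp (\<lambda>x. z x + w x)"
proof -
  note [measurable] = in_LpD(1)[OF assms(1)] in_LpD(1)[OF assms(2)]
  have "integrable dom (\<lambda>x. norm (z x + w x) powr p)"
    by (rule Bochner_Integration.integrable_bound[of _ "\<lambda>x. 2 powr p * (norm (z x) powr p + norm (w x) powr p)"])
       (use in_LpD(2)[OF assms(1)] in_LpD(2)[OF assms(2)] norm_powr_add_le in auto)
  thus ?thesis by (simp add: in_Lp_def)
qed

lemma in_Lp_scaleR: assumes "in_Lp z" shows "in_Lp (\<lambda>x. c *\<^sub>R z x)"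
proof -
  note [measurable] = in_LpD(1)[OF assms]
  show ?thesis using in_LpD(2)[OF assms] by (simp add: in_Lp_def powr_mult)
qed

lemma in_Lp_diff: "in_Lp z \<Longrightarrow> in_Lp w \<Longrightarrow> in_Lp (\<lambda>x. z x - w x)"
  using in_Lp_add[of z "\<lambda>x. (-1) *\<^sub>R w x"] in_Lp_scaleR[of w "-1"] by simp

lemma potential_integrable: assumes z: "in_Lp z" shows "integrable dom (\<lambda>x. F x (z x))"
proof (rule Bochner_Integration.integrable_bound[of _ "\<lambda>x. a * (1 + 2 * norm (z x) powr p)"])
  show "integrable dom (\<lambda>x. a * (1 + 2 * norm (z x) powr p))" using in_LpD(2)[OF z] by simp
  show "(\<lambda>x. F x (z x)) \<in> borel_measurable dom" by (rule F_measurable[OF in_LpD(1)[OF z]])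
  show "AE x in dom. norm (F x (z x)) \<le> norm (a * (1 + 2 * norm (z x) powr p))"
  proof (rule AE_I2)
    fix x assume "x \<in> space dom"
    hence x: "x \<in> \<Omega>" by simp
    let ?n = "norm (z x)"
    have "\<bar>F x (z x)\<bar> \<le> a * (1 + ?n powr (p - 1)) * ?n"
      using F_Lipschitz[OF x, of "z x" 0] F_zero[OF x] by simp
    also have "\<dots> = a * (?n + ?n powr p)"
      using powr_mult_base[of ?n "p - 1"] by (simp add: algebra_simps)
    also have "\<dots> \<le> a * (1 + 2 * ?n powr p)"
    proof -
      have "?n \<le> 1 + ?n powr p"
      proof (cases "?n \<le> 1")
        case False
        hence "?n powr 1 \<le> ?n powr p" using p_gt by (intro powr_mono) auto
        thus ?thesis using False by simp
      qed (simp add: add_increasing2)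
      thus ?thesis using a_pos by simp
    qed
    finally show "norm (F x (z x)) \<le> norm (a * (1 + 2 * ?n powr p))" by simp
  qed
qed

text \<open>Gradients grow like the power \<open>p - 1\<close>, and \<open>(p - 1) p' = p\<close>; hence they pair with
  functions in \<open>L\<^sup>p\<close>.\<close>

lemma one_plus_powr_le:
  assumes "t \<ge> 0" shows "(1 + t powr (p - 1)) powr p' \<le> 2 powr p' * (1 + t powr p)"
  using powr_sum_le[of p' 1 "t powr (p - 1)"] p'_props assms by (simp add: powr_powr)

lemma weight_integrable:
  assumes m: "t \<in> borel_measurable dom" and "\<And>x. t x \<ge> 0" and i: "integrable dom (\<lambda>x. t x powr p)"
  shows "integrable dom (\<lambda>x. (1 + t x powr (p - 1)) powr p')"
proof (rule Bochner_Integration.integrable_bound[of _ "\<lambda>x. 2 powr p' * (1 + t x powr p)"])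
  show "AE x in dom. norm ((1 + t x powr (p - 1)) powr p') \<le> norm (2 powr p' * (1 + t x powr p))"
    using one_plus_powr_le[OF assms(2)] by auto
qed (use i m in auto)

lemma Holder_weight:
  assumes h: "in_Lp h" and m: "A \<in> borel_measurable dom" and A0: "\<And>x. A x \<ge> 0" and i: "integrable dom (\<lambda>x. A x powr p')"
  shows "integrable dom (\<lambda>x. A x * norm (h x))"
    "(LINT x|dom. A x * norm (h x)) \<le> (LINT x|dom. A x powr p') powr (1/p') * Lp_norm h"
proof -
  have [measurable]: "(\<lambda>x. norm (h x)) \<in> borel_measurable dom" using in_LpD(1)[OF h] by measurable
  have AA: "\<bar>A x\<bar> = A x" for x using A0[of x] by simp
  note H = Holder_integral[of p' p A dom "\<lambda>x. norm (h x)"]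
  show "integrable dom (\<lambda>x. A x * norm (h x))"
    by (rule H(1)) (use p'_props m i in_LpD(2)[OF h] in \<open>auto simp: AA\<close>)
  have "(LINT x|dom. \<bar>A x * norm (h x)\<bar>) \<le> (LINT x|dom. \<bar>A x\<bar> powr p') powr (1/p') * (LINT x|dom. \<bar>norm (h x)\<bar> powr p) powr (1/p)"
    by (rule H(2)) (use p'_props m i in_LpD(2)[OF h] in \<open>auto simp: AA\<close>)
  thus "(LINT x|dom. A x * norm (h x)) \<le> (LINT x|dom. A x powr p') powr (1/p') * Lp_norm h"
    by (simp add: AA abs_mult Lp_norm_def)
qed

lemma gradient_pairing_integrable:
  assumes z: "in_Lp z" and h: "in_Lp h"
  shows "integrable dom (\<lambda>x. h x \<bullet> gradient (F x) (z x))"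
proof (rule Bochner_Integration.integrable_bound)
  have [measurable]: "z \<in> borel_measurable dom" "h \<in> borel_measurable dom" using z h by (auto intro: in_LpD)
  have [measurable]: "(\<lambda>x. gradient (F x) (z x)) \<in> borel_measurable dom" by (rule gradient_measurable) simp
  show "integrable dom (\<lambda>x. a * ((1 + norm (z x) powr (p - 1)) * norm (h x)))"
    by (intro integrable_mult_right Holder_weight(1)[OF h] weight_integrable) (use in_LpD(2)[OF z] in auto)
  show "(\<lambda>x. h x \<bullet> gradient (F x) (z x)) \<in> borel_measurable dom" by measurable
  show "AE x in dom. norm (h x \<bullet> gradient (F x) (z x)) \<le> norm (a * ((1 + norm (z x) powr (p - 1)) * norm (h x)))"
  proof (rule AE_I2)
    fix x assume "x \<in> space dom" hence x: "x \<in> \<Omega>" by simp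
    have "\<bar>h x \<bullet> gradient (F x) (z x)\<bar> \<le> norm (h x) * norm (gradient (F x) (z x))" by (rule Cauchy_Schwarz_ineq2)
    also have "\<dots> \<le> norm (h x) * (a * (1 + norm (z x) powr (p - 1)))" by (intro mult_left_mono growth x) auto
    finally show "norm (h x \<bullet> gradient (F x) (z x)) \<le> norm (a * ((1 + norm (z x) powr (p - 1)) * norm (h x)))"
      using a_pos by (simp add: abs_mult mult_ac)
  qed
qed

text \<open>Holder's inequality applied to \<open>F_Lipschitz\<close>; the weight stays bounded in \<open>L\<^bsup>p'\<^esup>\<close> because the
  functions stay bounded in \<open>L\<^sup>p\<close>.\<close>

theorem potential_tendsto:
  assumes z: "in_Lp z" and w: "\<And>n. in_Lp (w n)" and lim: "(\<lambda>n. LINT x|dom. norm (w n x - z x) powr p) \<longlonglongrightarrow> 0"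
  shows "(\<lambda>n. potential (w n)) \<longlonglongrightarrow> potential z"
proof -
  have m[measurable]: "z \<in> borel_measurable dom" "w n \<in> borel_measurable dom" for n using z w by (auto intro: in_LpD)
  define t where "t n x = norm (w n x) + norm (z x)" for n x
  define err where "err n = (LINT x|dom. norm (w n x - z x) powr p)" for n
  define C where "C = 2 powr p' * (measure dom (space dom) + 2 powr p * (1 + 2 powr p * (LINT x|dom. norm (z x) powr p)))"
  have [measurable]: "t n \<in> borel_measurable dom" for n unfolding t_def by measurable
  have t0: "t n x \<ge> 0" for n x by (simp add: t_def)
  have dL: "in_Lp (\<lambda>x. w n x - z x)" for n by (rule in_Lp_diff[OF w z])
  have tp: "t n x powr p \<le> 2 powr p * (norm (w n x - z x) powr p + 2 powr p * norm (z x) powr p)" for n x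
  proof -
    have "t n x \<le> norm (w n x - z x) + 2 * norm (z x)"
      using norm_triangle_sub[of "w n x" "z x"] by (simp add: t_def)
    hence "t n x powr p \<le> (norm (w n x - z x) + 2 * norm (z x)) powr p" using p_gt t0 by (intro powr_mono2) auto
    also have "\<dots> \<le> 2 powr p * (norm (w n x - z x) powr p + (2 * norm (z x)) powr p)"
      using p_gt by (intro powr_sum_le) auto
    finally show ?thesis by (simp add: powr_mult)
  qed
  have ti: "integrable dom (\<lambda>x. t n x powr p)" for n
    by (rule Bochner_Integration.integrable_bound[of _ "\<lambda>x. 2 powr p * (norm (w n x - z x) powr p + 2 powr p * norm (z x) powr p)"])
       (use in_LpD(2)[OF dL] in_LpD(2)[OF z] tp in auto)
  note wi = weight_integrable[OF _ t0 ti]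
  have bnd: "(LINT x|dom. (1 + t n x powr (p - 1)) powr p') \<le> C" if "err n \<le> 1" for n
  proof -
    have "(LINT x|dom. (1 + t n x powr (p - 1)) powr p') \<le>
       (LINT x|dom. 2 powr p' * (1 + 2 powr p * (norm (w n x - z x) powr p + 2 powr p * norm (z x) powr p)))"
    proof (rule integral_mono)
      fix x
      have "(1 + t n x powr (p - 1)) powr p' \<le> 2 powr p' * (1 + t n x powr p)" by (rule one_plus_powr_le[OF t0])
      also have "\<dots> \<le> 2 powr p' * (1 + 2 powr p * (norm (w n x - z x) powr p + 2 powr p * norm (z x) powr p))"
        by (intro mult_left_mono add_left_mono tp) auto
      finally show "(1 + t n x powr (p - 1)) powr p' \<le> 2 powr p' * (1 + 2 powr p * (norm (w n x - z x) powr p + 2 powr p * norm (z x) powr p))" .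
    qed (use in_LpD(2)[OF dL] in_LpD(2)[OF z] wi in auto)
    also have "\<dots> = 2 powr p' * (measure dom (space dom) + 2 powr p * (err n + 2 powr p * (LINT x|dom. norm (z x) powr p)))"
      using in_LpD(2)[OF dL, of n] in_LpD(2)[OF z] by (simp add: err_def)
    also have "\<dots> \<le> C" unfolding C_def using that by (intro mult_left_mono add_left_mono add_right_mono) auto
    finally show ?thesis .
  qed
  have est: "\<bar>potential (w n) - potential z\<bar> \<le> a * (C powr (1/p') * err n powr (1/p))" if "err n \<le> 1" for n
  proof -
    have "potential (w n) - potential z = (LINT x|dom. F x (w n x) - F x (z x))"
      using potential_integrable[OF w] potential_integrable[OF z] by (simp add: potential_def)
    also have "\<bar>\<dots>\<bar> \<le> (LINT x|dom. \<bar>F x (w n x) - F x (z x)\<bar>)" by (rule integral_abs_bound)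
    also have "\<dots> \<le> (LINT x|dom. a * ((1 + t n x powr (p - 1)) * norm (w n x - z x)))"
    proof (rule integral_mono)
      show "integrable dom (\<lambda>x. \<bar>F x (w n x) - F x (z x)\<bar>)" using potential_integrable[OF w] potential_integrable[OF z] by simp
      show "integrable dom (\<lambda>x. a * ((1 + t n x powr (p - 1)) * norm (w n x - z x)))"
        by (intro integrable_mult_right Holder_weight(1)[OF dL] wi) auto
      fix x assume "x \<in> space dom" hence x: "x \<in> \<Omega>" by simp
      show "\<bar>F x (w n x) - F x (z x)\<bar> \<le> a * ((1 + t n x powr (p - 1)) * norm (w n x - z x))"
        using F_Lipschitz[OF x, of "w n x" "z x"] by (simp add: t_def mult_ac)
    qed
    also have "\<dots> = a * (LINT x|dom. (1 + t n x powr (p - 1)) * norm (w n x - z x))" by simp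
    also have "\<dots> \<le> a * ((LINT x|dom. (1 + t n x powr (p - 1)) powr p') powr (1/p') * Lp_norm (\<lambda>x. w n x - z x))"
      using a_pos by (intro mult_left_mono Holder_weight(2)[OF dL] wi) auto
    also have "\<dots> \<le> a * (C powr (1/p') * Lp_norm (\<lambda>x. w n x - z x))"
      using a_pos p'_props bnd[OF that] by (intro mult_left_mono mult_right_mono powr_mono2) auto
    finally show ?thesis by (simp add: Lp_norm_def err_def)
  qed
  have err0: "err \<longlonglongrightarrow> 0" using lim by (simp add: err_def[abs_def])
  show ?thesis
  proof (rule LIM_zero_cancel, rule Lim_null_comparison)
    have "\<forall>\<^sub>F n in sequentially. err n < 1" using order_tendstoD(2)[OF err0] by simp
    thus "\<forall>\<^sub>F n in sequentially. norm (potential (w n) - potential z) \<le> a * (C powr (1/p') * err n powr (1/p))"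
      by eventually_elim (use est in auto)
    have "(\<lambda>n. a * (C powr (1/p') * err n powr (1/p))) \<longlonglongrightarrow> a * (C powr (1/p') * 0 powr (1/p))"
      using p_gt by (intro tendsto_mult tendsto_const tendsto_powr' err0) (auto simp: err_def)
    thus "(\<lambda>n. a * (C powr (1/p') * err n powr (1/p))) \<longlonglongrightarrow> 0" by simp
  qed
qed

text \<open>Where \<open>u\<close> is bounded by \<open>M\<close> and \<open>k\<close> is small, uniform continuity gives \<open>\<eta>\<close>. Where \<open>u\<close> is
  bounded and \<open>k\<close> is not small, the growth bound is dominated by a power of \<open>|k|\<close> alone. The remaining
  set \<open>|u| > M\<close> contributes a weight that is small in integral mean for large \<open>M\<close>.\<close>

lemma remainder_pointwise:
  assumes M: "M \<ge> 0" and \<eta>: "\<eta> > 0"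
  defines "c \<equiv> a * (2 + 2 powr (p - 1))"
  shows "\<exists>B>0. \<forall>x\<in>\<Omega>. \<forall>u k. \<bar>F x (u + k) - F x u - k \<bullet> gradient (F x) u\<bar> \<le>
     ((\<eta> + (if norm u > M then c * (1 + norm u powr (p - 1)) else 0)) + B * norm k powr (p - 1)) * norm k"
proof -
  obtain d where d: "d > 0" "\<And>x u k. x \<in> \<Omega> \<Longrightarrow> norm u \<le> M \<Longrightarrow> norm k \<le> d \<Longrightarrow> norm (gradient (F x) (u + k) - gradient (F x) u) \<le> \<eta>"
    using gradient_uniform[OF \<eta> M] by blast
  have c: "c > 0" using a_pos by (simp add: c_def add_pos_pos)
  define e where "e = p - 1"
  have e: "e > 0" using p_gt by (simp add: e_def)
  define B where "B = a * (2 * (1/d) powr e + (M/d + 1) powr e + (M/d) powr e) + c"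
  have B: "B \<ge> c" using a_pos by (auto simp: B_def)
  show ?thesis
  proof (intro exI[of _ B] conjI ballI allI)
    show "B > 0" using B c by linarith
    fix x and u k :: "real \<times> real" assume x: "x \<in> \<Omega>"
    let ?Q = "(\<eta> + (if norm u > M then c * (1 + norm u powr (p - 1)) else 0)) + B * norm k powr (p - 1)"
    show "\<bar>F x (u + k) - F x u - k \<bullet> gradient (F x) u\<bar> \<le> ?Q * norm k"
    proof (rule F_mean_value[OF x])
      fix t :: real assume t: "0 \<le> t" "t \<le> 1"
      have tk: "norm (t *\<^sub>R k) \<le> norm k" using t by (auto intro: mult_left_le_one_le)
      have "norm (gradient (F x) (u + t *\<^sub>R k) - gradient (F x) u) \<le> norm (gradient (F x) (u + t *\<^sub>R k)) + norm (gradient (F x) u)"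
        by (rule norm_triangle_ineq4)
      also have "\<dots> \<le> a * (1 + norm (u + t *\<^sub>R k) powr e) + a * (1 + norm u powr e)"
        unfolding e_def by (intro add_mono growth x)
      also have "\<dots> \<le> a * (1 + (norm u + norm k) powr e) + a * (1 + norm u powr e)"
        using a_pos e tk norm_triangle_ineq[of u "t *\<^sub>R k"]
        by (intro add_right_mono mult_left_mono add_left_mono powr_mono2) auto
      finally have gen: "norm (gradient (F x) (u + t *\<^sub>R k) - gradient (F x) u) \<le> a * (2 + (norm u + norm k) powr e + norm u powr e)"
        by (simp add: algebra_simps)
      have Bk: "B * norm k powr e \<ge> 0" "c * norm k powr e \<le> B * norm k powr e" using B c by (auto intro: mult_right_mono)
      consider "norm u \<le> M" "norm k \<le> d" | "norm u \<le> M" "norm k > d" | "norm u > M" by linarith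
      thus "norm (gradient (F x) (u + t *\<^sub>R k) - gradient (F x) u) \<le> ?Q"
      proof cases
        case 1
        have "norm (gradient (F x) (u + t *\<^sub>R k) - gradient (F x) u) \<le> \<eta>"
          by (rule d(2)[OF x 1(1)]) (rule order_trans[OF tk 1(2)])
        thus ?thesis using 1 Bk by (simp add: e_def[symmetric])
      next
        case 2
        let ?n = "norm k"
        have n: "?n > 0" using 2 d by linarith
        have "1 powr e \<le> (?n * (1/d)) powr e" using 2 d e by (intro powr_mono2) (auto simp: field_simps)
        hence 3: "1 \<le> ?n powr e * (1/d) powr e" using d n by (simp add: powr_mult[symmetric])
        have Md: "M \<le> ?n * (M/d)" using 2 d M mult_right_mono[of d ?n M] by (simp add: field_simps)
        have "(norm u + ?n) powr e \<le> (?n * (M/d + 1)) powr e" using 2 Md e by (intro powr_mono2) (auto simp: distrib_left)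
        moreover have "(?n * (M/d + 1)) powr e = ?n powr e * (M/d + 1) powr e" by (rule powr_mult)
        ultimately have 4: "(norm u + ?n) powr e \<le> ?n powr e * (M/d + 1) powr e" by linarith
        have "norm u powr e \<le> (?n * (M/d)) powr e" using 2 Md e by (intro powr_mono2) auto
        moreover have "(?n * (M/d)) powr e = ?n powr e * (M/d) powr e" by (rule powr_mult)
        ultimately have 5: "norm u powr e \<le> ?n powr e * (M/d) powr e" by linarith
        have "2 + (norm u + ?n) powr e + norm u powr e \<le> 2 * (?n powr e * (1/d) powr e) + ?n powr e * (M/d + 1) powr e + ?n powr e * (M/d) powr e"
          using 3 4 5 by linarith
        also have "\<dots> = (2 * (1/d) powr e + (M/d + 1) powr e + (M/d) powr e) * ?n powr e" by (simp add: algebra_simps)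
        finally have "a * (2 + (norm u + ?n) powr e + norm u powr e) \<le> a * ((2 * (1/d) powr e + (M/d + 1) powr e + (M/d) powr e) * ?n powr e)"
          using a_pos by (intro mult_left_mono) auto
        also have "\<dots> \<le> B * ?n powr e" using c by (simp add: B_def algebra_simps)
        finally have "norm (gradient (F x) (u + t *\<^sub>R k) - gradient (F x) u) \<le> B * ?n powr e" using gen by linarith
        thus ?thesis using 2 \<eta> by (simp add: e_def[symmetric])
      next
        case 3
        have "(norm u + norm k) powr e \<le> 2 powr e * (norm u powr e + norm k powr e)" using e by (intro powr_sum_le) auto
        moreover have "(2 + 2 powr e) * (1 + norm u powr e) + (2 + 2 powr e) * norm k powr e =
            2 + 2 powr e * (norm u powr e + norm k powr e) + norm u powr e + (2 powr e + norm u powr e + 2 * norm k powr e)"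
          by (simp add: algebra_simps)
        moreover have "2 powr e + norm u powr e + 2 * norm k powr e \<ge> 0" by simp
        ultimately have "2 + (norm u + norm k) powr e + norm u powr e \<le> (2 + 2 powr e) * (1 + norm u powr e) + (2 + 2 powr e) * norm k powr e"
          by linarith
        hence "a * (2 + (norm u + norm k) powr e + norm u powr e) \<le> a * ((2 + 2 powr e) * (1 + norm u powr e) + (2 + 2 powr e) * norm k powr e)"
          using a_pos by (intro mult_left_mono) auto
        also have "\<dots> = c * (1 + norm u powr e) + c * norm k powr e" by (simp add: c_def e_def algebra_simps)
        finally show ?thesis using gen Bk 3 \<eta> by (simp add: e_def[symmetric])
      qed
    qed
  qed
qed

text \<open>Integrate \<open>remainder_pointwise\<close>. First \<open>\<eta>\<close> and \<open>M\<close> are chosen so that the weight has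
  \<open>L\<^bsup>p'\<^esup>\<close> norm at most \<open>\<epsilon>/2\<close>; this fixes the coefficient \<open>B\<close> of the superlinear term, and \<open>\<delta>\<close> then makes
  that term small as well.\<close>

theorem potential_Frechet:
  assumes z: "in_Lp z" and \<epsilon>: "\<epsilon> > 0"
  shows "\<exists>\<delta>>0. \<forall>h. in_Lp h \<and> Lp_norm h < \<delta> \<longrightarrow>
    \<bar>potential (\<lambda>x. z x + h x) - potential z - (LINT x|dom. h x \<bullet> gradient (F x) (z x))\<bar> \<le> \<epsilon> * Lp_norm h"
proof -
  have zm[measurable]: "z \<in> borel_measurable dom" using z by (rule in_LpD)
  define c where "c = a * (2 + 2 powr (p - 1))"
  have c: "c > 0" using a_pos by (simp add: c_def add_pos_pos)
  define T where "T M x = (if norm (z x) > M then c * (1 + norm (z x) powr (p - 1)) else 0)" for M x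
  have Tm[measurable]: "T M \<in> borel_measurable dom" for M unfolding T_def by measurable
  have T0: "T M x \<ge> 0" for M x using c by (simp add: T_def)
  have Tle: "T M x powr p' \<le> c powr p' * (1 + norm (z x) powr (p - 1)) powr p'" for M x
    using c by (simp add: T_def powr_mult)
  have wi: "integrable dom (\<lambda>x. (1 + norm (z x) powr (p - 1)) powr p')"
    by (rule weight_integrable) (use in_LpD(2)[OF z] in auto)
  have Ti: "integrable dom (\<lambda>x. T M x powr p')" for M
    by (rule Bochner_Integration.integrable_bound[of _ "\<lambda>x. c powr p' * (1 + norm (z x) powr (p - 1)) powr p'"])
       (use wi Tle in auto)
  have Tlim: "(\<lambda>n. LINT x|dom. T (real n) x powr p') \<longlonglongrightarrow> 0"
  proof -
    have "(\<lambda>n. LINT x|dom. T (real n) x powr p') \<longlonglongrightarrow> (LINT x|dom. 0)"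
    proof (rule integral_dominated_convergence[where w="\<lambda>x. c powr p' * (1 + norm (z x) powr (p - 1)) powr p'"])
      show "AE x in dom. (\<lambda>n. T (real n) x powr p') \<longlonglongrightarrow> 0"
      proof (rule AE_I2, rule tendsto_eventually)
        fix x
        obtain N where "norm (z x) \<le> real N" using real_arch_simple by blast
        hence "T (real n) x powr p' = 0" if "n \<ge> N" for n using that by (simp add: T_def)
        thus "\<forall>\<^sub>F n in sequentially. T (real n) x powr p' = 0" by (auto simp: eventually_sequentially)
      qed
    qed (use wi Tle in auto)
    thus ?thesis by simp
  qed
  define m where "m = measure dom (space dom)"
  have m0: "m \<ge> 0" by (simp add: m_def)
  \<comment> \<open>Two contributions of size \<open>\<kappa>\<close>, times the convexity constant \<open>2 powr p'\<close>, add up to \<open>(\<epsilon>/2) powr p'\<close>.\<close>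
  define \<kappa> where "\<kappa> = (\<epsilon>/2) powr p' / 2 powr p' / 2"
  have \<kappa>: "\<kappa> > 0" using \<epsilon> by (simp add: \<kappa>_def)
  define \<eta> where "\<eta> = (\<kappa> / (m + 1)) powr (1/p')"
  have \<eta>: "\<eta> > 0" using \<kappa> m0 by (simp add: \<eta>_def)
  have \<eta>m: "\<eta> powr p' * m \<le> \<kappa>"
  proof -
    have "\<eta> powr p' = \<kappa> / (m + 1)" using \<kappa> m0 p'_props by (simp add: \<eta>_def powr_powr)
    hence "\<eta> powr p' * m = \<kappa> * (m / (m + 1))" by simp
    also have "\<dots> \<le> \<kappa> * 1" using \<kappa> m0 by (intro mult_left_mono) auto
    finally show ?thesis by simp
  qed
  have "\<forall>\<^sub>F n in sequentially. (LINT x|dom. T (real n) x powr p') < \<kappa>" using order_tendstoD(2)[OF Tlim] \<kappa> by simp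
  then obtain n where n: "(LINT x|dom. T (real n) x powr p') < \<kappa>" by (auto simp: eventually_sequentially)
  define Q where "Q x = \<eta> + T (real n) x" for x
  have Qm[measurable]: "Q \<in> borel_measurable dom" unfolding Q_def by measurable
  have Q0: "Q x \<ge> 0" for x using \<eta> T0 by (simp add: Q_def add_nonneg_nonneg)
  have Qle: "Q x powr p' \<le> 2 powr p' * (\<eta> powr p' + T (real n) x powr p')" for x
    unfolding Q_def using \<eta> T0 p'_props by (intro powr_sum_le) auto
  have Qi: "integrable dom (\<lambda>x. Q x powr p')"
    by (rule Bochner_Integration.integrable_bound[of _ "\<lambda>x. 2 powr p' * (\<eta> powr p' + T (real n) x powr p')"])
       (use Ti Qle in auto)
  have Qn: "(LINT x|dom. Q x powr p') powr (1/p') \<le> \<epsilon>/2"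
  proof -
    have "(LINT x|dom. Q x powr p') \<le> (LINT x|dom. 2 powr p' * (\<eta> powr p' + T (real n) x powr p'))"
      by (intro integral_mono Qi Qle) (use Ti in auto)
    also have "\<dots> = 2 powr p' * (\<eta> powr p' * m + (LINT x|dom. T (real n) x powr p'))"
      using Ti by (simp add: m_def mult.commute)
    also have "\<dots> \<le> 2 powr p' * (\<kappa> + \<kappa>)" using \<eta>m n by (intro mult_left_mono add_mono) auto
    also have "\<dots> = (\<epsilon>/2) powr p'" by (simp add: \<kappa>_def)
    finally have "(LINT x|dom. Q x powr p') powr (1/p') \<le> ((\<epsilon>/2) powr p') powr (1/p')"
      using p'_props by (intro powr_mono2) auto
    also have "\<dots> = \<epsilon>/2" using \<epsilon> p'_props by (simp add: powr_powr)
    finally show ?thesis .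
  qed
  obtain B where B: "B > 0" "\<And>x u k. x \<in> \<Omega> \<Longrightarrow> \<bar>F x (u + k) - F x u - k \<bullet> gradient (F x) u\<bar> \<le>
     ((\<eta> + (if norm u > real n then c * (1 + norm u powr (p - 1)) else 0)) + B * norm k powr (p - 1)) * norm k"
    using remainder_pointwise[of "real n" \<eta>] \<eta> unfolding c_def by auto
  \<comment> \<open>Solves \<open>B \<delta> powr (p - 1) = \<epsilon>/2\<close>.\<close>
  define \<delta> where "\<delta> = (\<epsilon> / (2 * B)) powr (1 / (p - 1))"
  have \<delta>: "\<delta> > 0" using \<epsilon> B by (simp add: \<delta>_def)
  show ?thesis
  proof (intro exI[of _ \<delta>] conjI allI impI \<delta>)
    fix h assume "in_Lp h \<and> Lp_norm h < \<delta>"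
    hence h: "in_Lp h" and hd: "Lp_norm h < \<delta>" by auto
    note hi = in_LpD(2)[OF h]
    note Hw = Holder_weight[OF h Qm Q0 Qi]
    have i: "integrable dom (\<lambda>x. F x (z x + h x))" "integrable dom (\<lambda>x. F x (z x))" "integrable dom (\<lambda>x. h x \<bullet> gradient (F x) (z x))"
      using potential_integrable[OF in_Lp_add[OF z h]] potential_integrable[OF z] gradient_pairing_integrable[OF z h] by auto
    have "potential (\<lambda>x. z x + h x) - potential z - (LINT x|dom. h x \<bullet> gradient (F x) (z x)) =
        (LINT x|dom. F x (z x + h x) - F x (z x) - h x \<bullet> gradient (F x) (z x))"
      using i by (simp add: potential_def)
    also have "\<bar>\<dots>\<bar> \<le> (LINT x|dom. \<bar>F x (z x + h x) - F x (z x) - h x \<bullet> gradient (F x) (z x)\<bar>)"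
      by (rule integral_abs_bound)
    also have "\<dots> \<le> (LINT x|dom. Q x * norm (h x) + B * norm (h x) powr p)"
    proof (rule integral_mono)
      show "integrable dom (\<lambda>x. \<bar>F x (z x + h x) - F x (z x) - h x \<bullet> gradient (F x) (z x)\<bar>)" using i by simp
      show "integrable dom (\<lambda>x. Q x * norm (h x) + B * norm (h x) powr p)" using Hw(1) hi by simp
      fix x assume "x \<in> space dom" hence x: "x \<in> \<Omega>" by simp
      have "\<bar>F x (z x + h x) - F x (z x) - h x \<bullet> gradient (F x) (z x)\<bar> \<le> (Q x + B * norm (h x) powr (p - 1)) * norm (h x)"
        using B(2)[OF x, of "z x" "h x"] by (simp add: Q_def T_def)
      also have "\<dots> = Q x * norm (h x) + B * norm (h x) powr p"
        using powr_mult_base[of "norm (h x)" "p - 1"] by (simp add: algebra_simps)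
      finally show "\<bar>F x (z x + h x) - F x (z x) - h x \<bullet> gradient (F x) (z x)\<bar> \<le> Q x * norm (h x) + B * norm (h x) powr p" .
    qed
    also have "\<dots> = (LINT x|dom. Q x * norm (h x)) + B * Lp_norm h powr p"
      using Hw(1) hi by (simp add: Lp_norm_powr)
    also have "\<dots> \<le> \<epsilon>/2 * Lp_norm h + \<epsilon>/2 * Lp_norm h"
    proof (rule add_mono)
      show "(LINT x|dom. Q x * norm (h x)) \<le> \<epsilon>/2 * Lp_norm h"
        using Hw(2) mult_right_mono[OF Qn Lp_norm_nonneg[of h]] by linarith
      have "Lp_norm h powr (p - 1) \<le> \<delta> powr (p - 1)" using hd p_gt by (intro powr_mono2) auto
      also have "\<dots> = \<epsilon> / (2 * B)" using \<epsilon> B p_gt by (simp add: \<delta>_def powr_powr)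
      finally have "B * Lp_norm h powr (p - 1) \<le> \<epsilon>/2" using B by (simp add: field_simps)
      hence "B * Lp_norm h powr (p - 1) * Lp_norm h \<le> \<epsilon>/2 * Lp_norm h" by (intro mult_right_mono) auto
      thus "B * Lp_norm h powr p \<le> \<epsilon>/2 * Lp_norm h" using powr_mult_base[of "Lp_norm h" "p - 1"] by (simp add: mult_ac)
    qed
    finally show "\<bar>potential (\<lambda>x. z x + h x) - potential z - (LINT x|dom. h x \<bullet> gradient (F x) (z x))\<bar> \<le> \<epsilon> * Lp_norm h" by simp
  qed
qed

end

section \<open>The energy functional and its derivative\<close>

context bounded_open
begin

abbreviation grad_norm :: "('a \<Rightarrow> real) \<Rightarrow> real" where "grad_norm u \<equiv> L2_norm (wg u)"

definition dirichlet_form :: "('a \<Rightarrow> real) \<Rightarrow> ('a \<Rightarrow> real) \<Rightarrow> real" where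
  "dirichlet_form u v = (LINT x|dom. wg u x \<bullet> wg v x)"

lemma H10_add:
  assumes u: "u \<in> H10 \<Omega>" and v: "v \<in> H10 \<Omega>"
  shows "(\<lambda>x. u x + v x) \<in> H10 \<Omega>" "AE x in dom. wg (\<lambda>x. u x + v x) x = wg u x + wg v x"
  using H10_lincomb[OF u v, of 1 1] by auto

lemma H10_scale:
  assumes u: "u \<in> H10 \<Omega>"
  shows "(\<lambda>x. c * u x) \<in> H10 \<Omega>" "AE x in dom. wg (\<lambda>x. c * u x) x = c *\<^sub>R wg u x"
  using H10_lincomb[OF u u, of c 0] by auto

lemma grad_norm_scale: assumes u: "u \<in> H10 \<Omega>" shows "grad_norm (\<lambda>x. c * u x) = \<bar>c\<bar> * grad_norm u"
proof -
  have "grad_norm (\<lambda>x. c * u x) = L2_norm (\<lambda>x. c *\<^sub>R wg u x)"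
  proof (rule L2_norm_cong)
    show "AE x in dom. norm (wg (\<lambda>x. c * u x) x) = norm (c *\<^sub>R wg u x)"
      using H10_scale(2)[OF u, of c] by eventually_elim simp
  qed (intro H10D(2) H10_scale(1) L2_scaleR u)+
  thus ?thesis by (simp add: L2_norm_scaleR)
qed

lemma H10_zero: "(\<lambda>x. 0) \<in> H10 \<Omega>" "grad_norm (\<lambda>x. 0) = 0"
proof -
  have "test_function \<Omega> (\<lambda>x. 0 :: real)"
    using flat_algebra_smooth[OF flat_algebra.const[of 0]] by (simp add: test_function_def)
  thus "(\<lambda>x. 0) \<in> H10 \<Omega>" by (rule test_H10(1))
  from grad_norm_scale[OF this, of 0] show "grad_norm (\<lambda>x. 0) = 0" by simp
qed

lemma dirichlet_form_bound: "u \<in> H10 \<Omega> \<Longrightarrow> v \<in> H10 \<Omega> \<Longrightarrow> \<bar>dirichlet_form u v\<bar> \<le> grad_norm u * grad_norm v"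
  unfolding dirichlet_form_def by (intro L2_inner(2) H10D(2))

lemma dirichlet_form_scale:
  assumes u: "u \<in> H10 \<Omega>" and v: "v \<in> H10 \<Omega>"
  shows "dirichlet_form u (\<lambda>x. c * v x) = c * dirichlet_form u v"
proof -
  have "dirichlet_form u (\<lambda>x. c * v x) = (LINT x|dom. wg u x \<bullet> (c *\<^sub>R wg v x))"
    unfolding dirichlet_form_def
  proof (rule integral_cong_AE)
    show "AE x in dom. wg u x \<bullet> wg (\<lambda>x. c * v x) x = wg u x \<bullet> c *\<^sub>R wg v x"
      using H10_scale(2)[OF v, of c] by eventually_elim simp
    have "wg u \<in> borel_measurable dom" "wg v \<in> borel_measurable dom" "wg (\<lambda>x. c * v x) \<in> borel_measurable dom"
      using L2D(1)[OF H10D(2)] H10_scale(1) u v by auto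
    thus "(\<lambda>x. wg u x \<bullet> wg (\<lambda>x. c * v x) x) \<in> borel_measurable dom" "(\<lambda>x. wg u x \<bullet> c *\<^sub>R wg v x) \<in> borel_measurable dom"
      by auto
  qed
  thus ?thesis by (simp add: dirichlet_form_def)
qed

lemma dirichlet_form_self: "dirichlet_form u u = (grad_norm u)\<^sup>2"
  by (simp add: dirichlet_form_def L2_norm_sq power2_norm_eq_inner)

lemma grad_norm_add_sq:
  assumes u: "u \<in> H10 \<Omega>" and v: "v \<in> H10 \<Omega>"
  shows "(grad_norm (\<lambda>x. u x + v x))\<^sup>2 = (grad_norm u)\<^sup>2 + 2 * dirichlet_form u v + (grad_norm v)\<^sup>2"
proof -
  have "grad_norm (\<lambda>x. u x + v x) = L2_norm (\<lambda>x. wg u x + wg v x)"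
  proof (rule L2_norm_cong)
    show "AE x in dom. norm (wg (\<lambda>x. u x + v x) x) = norm (wg u x + wg v x)"
      using H10_add(2)[OF u v] by eventually_elim simp
  qed (intro H10D(2) H10_add(1) L2_add u v)+
  thus ?thesis using L2_norm_add_sq[OF H10D(2)[OF u] H10D(2)[OF v]] by (simp add: dirichlet_form_def)
qed

lemma grad_norm_zero_imp: assumes "u \<in> H10 \<Omega>" "grad_norm u = 0" shows "AE x in dom. u x = 0"
proof -
  obtain C where "\<And>u. u \<in> H10 \<Omega> \<Longrightarrow> L2_norm u \<le> C * grad_norm u" using Poincare_H10 by blast
  from this[OF assms(1)] have "L2_norm u = 0" using assms(2) L2_norm_nonneg[of u] by simp
  thus ?thesis by (rule L2_norm_zero_AE[OF H10D(1)[OF assms(1)]])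
qed

lemma AE_zero_imp_grad_norm_zero: assumes u: "u \<in> H10 \<Omega>" and z: "AE x in dom. u x = 0" shows "grad_norm u = 0"
proof -
  have "(LINT x|dom. u x *\<^sub>R gradient \<phi> x) = 0" if "test_function \<Omega> \<phi>" for \<phi>
  proof -
    have "(LINT x|dom. u x *\<^sub>R gradient \<phi> x) = (LINT x|dom. 0)"
    proof (rule integral_cong_AE)
      show "(\<lambda>x. u x *\<^sub>R gradient \<phi> x) \<in> borel_measurable dom"
        using L2_scaleR_product(1)[OF H10D(1)[OF u] test_L2(2)[OF that]] by (rule borel_measurable_integrable)
      show "AE x in dom. u x *\<^sub>R gradient \<phi> x = 0" using z by eventually_elim simp
    qed simp
    thus ?thesis by simp
  qed
  hence "has_weak_gradient \<Omega> u (\<lambda>x. 0)"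
    using H10D(1)[OF u] by (simp add: has_weak_gradient_def L2_def)
  from weak_gradient_eq(2)[OF this] have "AE x in dom. norm (wg u x) = norm (0::'a)" by eventually_elim simp
  hence "grad_norm u = L2_norm (\<lambda>x. 0::'a)" by (rule L2_norm_cong) (use H10D(2)[OF u] in \<open>auto simp: L2_def\<close>)
  thus ?thesis by (simp add: L2_norm_def)
qed

lemma grad_norm_le_H1_norm: "u \<in> H10 \<Omega> \<Longrightarrow> grad_norm u \<le> H1_norm \<Omega> u"
  by (rule power2_le_imp_le) (use H1_norm_sq[OF H10D(1,2)] in auto)

lemma pair_norm_bounds:
  assumes h: "h \<in> H10_pair \<Omega>"
  shows "grad_norm (\<lambda>x. fst (h x)) \<le> H10_pair_norm \<Omega> h" "grad_norm (\<lambda>x. snd (h x)) \<le> H10_pair_norm \<Omega> h"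
    "(grad_norm (\<lambda>x. fst (h x)))\<^sup>2 \<le> (H10_pair_norm \<Omega> h)\<^sup>2" "(grad_norm (\<lambda>x. snd (h x)))\<^sup>2 \<le> (H10_pair_norm \<Omega> h)\<^sup>2"
    "H10_pair_norm \<Omega> h \<ge> 0"
proof -
  have u: "(\<lambda>x. fst (h x)) \<in> H10 \<Omega>" "(\<lambda>x. snd (h x)) \<in> H10 \<Omega>" using h by (auto simp: H10_pair_def)
  show N: "H10_pair_norm \<Omega> h \<ge> 0" by (simp add: H10_pair_norm_def)
  have "H1_norm \<Omega> (\<lambda>x. fst (h x)) \<le> H10_pair_norm \<Omega> h" "H1_norm \<Omega> (\<lambda>x. snd (h x)) \<le> H10_pair_norm \<Omega> h"
    by (auto simp: H10_pair_norm_def intro!: real_le_rsqrt)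
  with grad_norm_le_H1_norm[OF u(1)] grad_norm_le_H1_norm[OF u(2)]
  show 1: "grad_norm (\<lambda>x. fst (h x)) \<le> H10_pair_norm \<Omega> h" "grad_norm (\<lambda>x. snd (h x)) \<le> H10_pair_norm \<Omega> h" by auto
  show "(grad_norm (\<lambda>x. fst (h x)))\<^sup>2 \<le> (H10_pair_norm \<Omega> h)\<^sup>2" "(grad_norm (\<lambda>x. snd (h x)))\<^sup>2 \<le> (H10_pair_norm \<Omega> h)\<^sup>2"
    using 1 by (auto intro: power_mono)
qed

lemma H10_pairD:
  assumes "h \<in> H10_pair \<Omega>" shows "(\<lambda>x. fst (h x)) \<in> H10 \<Omega>" "(\<lambda>x. snd (h x)) \<in> H10 \<Omega>"
  using assms by (auto simp: H10_pair_def)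

lemma H10_pair_add: "z \<in> H10_pair \<Omega> \<Longrightarrow> h \<in> H10_pair \<Omega> \<Longrightarrow> (\<lambda>x. z x + h x) \<in> H10_pair \<Omega>"
  by (simp add: H10_pair_def H10_add)

lemma H10_pair_scale: "h \<in> H10_pair \<Omega> \<Longrightarrow> (\<lambda>x. c *\<^sub>R h x) \<in> H10_pair \<Omega>"
  by (simp add: H10_pair_def H10_scale)

lemma H1_norm_scale: assumes "u \<in> H10 \<Omega>" shows "H1_norm \<Omega> (\<lambda>x. c * u x) = \<bar>c\<bar> * H1_norm \<Omega> u"
proof (rule power2_eq_imp_eq)
  note u = H10D(1,2)[OF assms] and cu = H10D(1,2)[OF H10_scale(1)[OF assms, of c]]
  have "L2_norm (\<lambda>x. c * u x) = \<bar>c\<bar> * L2_norm u" using L2_norm_scaleR[of c u] by simp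
  thus "(H1_norm \<Omega> (\<lambda>x. c * u x))\<^sup>2 = (\<bar>c\<bar> * H1_norm \<Omega> u)\<^sup>2"
    by (simp add: H1_norm_sq[OF u] H1_norm_sq[OF cu] grad_norm_scale[OF assms] power_mult_distrib algebra_simps)
qed auto

lemma H10_pair_norm_scale:
  assumes "h \<in> H10_pair \<Omega>" shows "H10_pair_norm \<Omega> (\<lambda>x. c *\<^sub>R h x) = \<bar>c\<bar> * H10_pair_norm \<Omega> h"
proof -
  have "(H10_pair_norm \<Omega> (\<lambda>x. c *\<^sub>R h x)) = sqrt (c\<^sup>2 * ((H1_norm \<Omega> (\<lambda>x. fst (h x)))\<^sup>2 + (H1_norm \<Omega> (\<lambda>x. snd (h x)))\<^sup>2))"
    using H1_norm_scale[OF H10_pairD(1)[OF assms], of c] H1_norm_scale[OF H10_pairD(2)[OF assms], of c]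
    by (simp add: H10_pair_norm_def power_mult_distrib distrib_left)
  thus ?thesis by (simp add: real_sqrt_mult H10_pair_norm_def)
qed

end

context nonlinearity
begin

abbreviation emb :: "('a \<Rightarrow> real) \<Rightarrow> 'a \<Rightarrow> real \<times> real" where "emb u \<equiv> (\<lambda>x. (u x, 0))"

lemma emb_pair: "u \<in> H10 \<Omega> \<Longrightarrow> emb u \<in> H10_pair \<Omega>"
  by (simp add: H10_pair_def H10_zero)

lemma Sobolev_pair:
  obtains C where "C > 0" "\<And>h. h \<in> H10_pair \<Omega> \<Longrightarrow> in_Lp h" "\<And>h. h \<in> H10_pair \<Omega> \<Longrightarrow> Lp_norm h \<le> C * H10_pair_norm \<Omega> h"
proof -
  obtain K where K: "K > 0" "\<And>u. u \<in> H10 \<Omega> \<Longrightarrow> integrable dom (\<lambda>x. \<bar>u x\<bar> powr p)"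
    "\<And>u. u \<in> H10 \<Omega> \<Longrightarrow> (LINT x|dom. \<bar>u x\<bar> powr p) \<le> K * grad_norm u powr p"
    using Sobolev_H10[OF p_gt p_sub] by blast
  define C where "C = (2 powr p * (K + K)) powr (1/p)"
  have p0: "p > 0" using p_gt by simp
  have L: "in_Lp h \<and> Lp_norm h \<le> C * H10_pair_norm \<Omega> h" if h: "h \<in> H10_pair \<Omega>" for h
  proof -
    let ?u = "\<lambda>x. fst (h x)" and ?v = "\<lambda>x. snd (h x)"
    note uv = H10_pairD[OF h]
    have m[measurable]: "?u \<in> borel_measurable dom" "?v \<in> borel_measurable dom"
      using L2D(1)[OF H10D(1)[OF uv(1)]] L2D(1)[OF H10D(1)[OF uv(2)]] by auto
    have hm[measurable]: "h \<in> borel_measurable dom"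
      using borel_measurable_Pair[OF m] by simp
    have le: "norm (h x) powr p \<le> 2 powr p * (\<bar>?u x\<bar> powr p + \<bar>?v x\<bar> powr p)" for x
    proof -
      have "norm (h x) \<le> \<bar>?u x\<bar> + \<bar>?v x\<bar>"
        using norm_Pair_le[of "?u x" "?v x"] by simp
      hence "norm (h x) powr p \<le> (\<bar>?u x\<bar> + \<bar>?v x\<bar>) powr p" using p0 by (intro powr_mono2) auto
      also have "\<dots> \<le> 2 powr p * (\<bar>?u x\<bar> powr p + \<bar>?v x\<bar> powr p)" using p0 by (intro powr_sum_le) auto
      finally show ?thesis .
    qed
    have i: "integrable dom (\<lambda>x. norm (h x) powr p)"
      by (rule Bochner_Integration.integrable_bound[of _ "\<lambda>x. 2 powr p * (\<bar>?u x\<bar> powr p + \<bar>?v x\<bar> powr p)"])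
         (use K(2)[OF uv(1)] K(2)[OF uv(2)] le in auto)
    have "(LINT x|dom. norm (h x) powr p) \<le> (LINT x|dom. 2 powr p * (\<bar>?u x\<bar> powr p + \<bar>?v x\<bar> powr p))"
      by (rule integral_mono[OF i _ le]) (use K(2)[OF uv(1)] K(2)[OF uv(2)] in auto)
    also have "\<dots> = 2 powr p * ((LINT x|dom. \<bar>?u x\<bar> powr p) + (LINT x|dom. \<bar>?v x\<bar> powr p))"
      using K(2)[OF uv(1)] K(2)[OF uv(2)] by simp
    also have "\<dots> \<le> 2 powr p * (K * H10_pair_norm \<Omega> h powr p + K * H10_pair_norm \<Omega> h powr p)"
    proof (intro mult_left_mono add_mono)
      show "(LINT x|dom. \<bar>?u x\<bar> powr p) \<le> K * H10_pair_norm \<Omega> h powr p"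
        using K(1) p0 pair_norm_bounds[OF h] by (intro order_trans[OF K(3)[OF uv(1)]] mult_left_mono powr_mono2) auto
      show "(LINT x|dom. \<bar>?v x\<bar> powr p) \<le> K * H10_pair_norm \<Omega> h powr p"
        using K(1) p0 pair_norm_bounds[OF h] by (intro order_trans[OF K(3)[OF uv(2)]] mult_left_mono powr_mono2) auto
    qed simp
    also have "\<dots> = (2 powr p * (K + K)) * H10_pair_norm \<Omega> h powr p" by (simp add: algebra_simps)
    finally have "Lp_norm h \<le> ((2 powr p * (K + K)) * H10_pair_norm \<Omega> h powr p) powr (1/p)"
      unfolding Lp_norm_def using p0 by (intro powr_mono2) auto
    also have "\<dots> = C * H10_pair_norm \<Omega> h"
      using K(1) p0 pair_norm_bounds(5)[OF h] by (simp add: C_def powr_mult powr_powr)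
    finally show ?thesis using i hm by (simp add: in_Lp_def)
  qed
  have "C > 0" using K(1) by (simp add: C_def)
  thus ?thesis using L that by blast
qed

lemma H10_pair_in_Lp: "h \<in> H10_pair \<Omega> \<Longrightarrow> in_Lp h"
  using Sobolev_pair by metis

lemma energy_eq:
  assumes z: "z \<in> H10_pair \<Omega>"
  shows "energy \<Omega> F z = (grad_norm (\<lambda>x. fst (z x)))\<^sup>2 / 2 - (grad_norm (\<lambda>x. snd (z x)))\<^sup>2 / 2 - potential z"
  using L2D(2)[OF H10D(2)[OF H10_pairD(1)[OF z]]] L2D(2)[OF H10D(2)[OF H10_pairD(2)[OF z]]] potential_integrable[OF H10_pair_in_Lp[OF z]]
  by (simp add: energy_def potential_def L2_norm_sq)

definition energy_derivative :: "('a \<Rightarrow> real \<times> real) \<Rightarrow> ('a \<Rightarrow> real \<times> real) \<Rightarrow> real" where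
  "energy_derivative z h = dirichlet_form (\<lambda>x. fst (z x)) (\<lambda>x. fst (h x)) - dirichlet_form (\<lambda>x. snd (z x)) (\<lambda>x. snd (h x))
     - (LINT x|dom. h x \<bullet> gradient (F x) (z x))"

lemma energy_derivative_scale:
  assumes "z \<in> H10_pair \<Omega>" "h \<in> H10_pair \<Omega>" shows "energy_derivative z (\<lambda>x. c *\<^sub>R h x) = c * energy_derivative z h"
  using dirichlet_form_scale[OF H10_pairD(1)[OF assms(1)] H10_pairD(1)[OF assms(2)], of c]
    dirichlet_form_scale[OF H10_pairD(2)[OF assms(1)] H10_pairD(2)[OF assms(2)], of c]
  by (simp add: energy_derivative_def right_diff_distrib)

theorem energy_Frechet:
  assumes z: "z \<in> H10_pair \<Omega>" and \<epsilon>: "\<epsilon> > 0"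
  shows "\<exists>\<delta>>0. \<forall>h\<in>H10_pair \<Omega>. H10_pair_norm \<Omega> h < \<delta> \<longrightarrow>
    \<bar>energy \<Omega> F (\<lambda>x. z x + h x) - energy \<Omega> F z - energy_derivative z h\<bar> \<le> \<epsilon> * H10_pair_norm \<Omega> h"
proof -
  obtain C where C: "C > 0" "\<And>h. h \<in> H10_pair \<Omega> \<Longrightarrow> in_Lp h" "\<And>h. h \<in> H10_pair \<Omega> \<Longrightarrow> Lp_norm h \<le> C * H10_pair_norm \<Omega> h"
    using Sobolev_pair by metis
  have "\<epsilon> / (2 * C) > 0" using \<epsilon> C by simp
  from potential_Frechet[OF C(2)[OF z] this] obtain \<delta> where \<delta>: "\<delta> > 0"
    "\<And>h. in_Lp h \<Longrightarrow> Lp_norm h < \<delta> \<Longrightarrow> \<bar>potential (\<lambda>x. z x + h x) - potential z - (LINT x|dom. h x \<bullet> gradient (F x) (z x))\<bar> \<le> \<epsilon> / (2 * C) * Lp_norm h"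
    by blast
  show ?thesis
  proof (intro exI[of _ "min (\<delta> / C) \<epsilon>"] conjI ballI impI)
    show "min (\<delta> / C) \<epsilon> > 0" using \<delta> C \<epsilon> by simp
    fix h assume h: "h \<in> H10_pair \<Omega>" and N: "H10_pair_norm \<Omega> h < min (\<delta> / C) \<epsilon>"
    let ?N = "H10_pair_norm \<Omega> h" and ?u = "\<lambda>x. fst (h x)" and ?v = "\<lambda>x. snd (h x)"
    let ?R = "potential (\<lambda>x. z x + h x) - potential z - (LINT x|dom. h x \<bullet> gradient (F x) (z x))"
    note b = pair_norm_bounds[OF h]
    have "C * ?N < \<delta>" using N C by (simp add: field_simps)
    hence "Lp_norm h < \<delta>" using C(3)[OF h] by linarith
    from \<delta>(2)[OF C(2)[OF h] this] have "\<bar>?R\<bar> \<le> \<epsilon> / (2 * C) * Lp_norm h" .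
    also have "\<dots> \<le> \<epsilon> / (2 * C) * (C * ?N)" using \<epsilon> C by (intro mult_left_mono C(3)[OF h]) auto
    also have "\<dots> = \<epsilon> * ?N / 2" using C by simp
    finally have R: "\<bar>?R\<bar> \<le> \<epsilon> * ?N / 2" .
    have "energy \<Omega> F (\<lambda>x. z x + h x) - energy \<Omega> F z - energy_derivative z h = (grad_norm ?u)\<^sup>2 / 2 - (grad_norm ?v)\<^sup>2 / 2 - ?R"
      using grad_norm_add_sq[OF H10_pairD(1)[OF z] H10_pairD(1)[OF h]] grad_norm_add_sq[OF H10_pairD(2)[OF z] H10_pairD(2)[OF h]]
      by (simp add: energy_eq[OF z] energy_eq[OF H10_pair_add[OF z h]] energy_derivative_def add_divide_distrib)
    moreover have "\<bar>(grad_norm ?u)\<^sup>2 / 2 - (grad_norm ?v)\<^sup>2 / 2\<bar> \<le> \<epsilon> * ?N / 2"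
    proof -
      have "?N\<^sup>2 \<le> \<epsilon> * ?N" using N b(5) by (simp add: power2_eq_square mult_right_mono)
      moreover have "(grad_norm ?u)\<^sup>2 \<ge> 0" "(grad_norm ?v)\<^sup>2 \<ge> 0" by auto
      ultimately show ?thesis using b(3,4) by linarith
    qed
    ultimately show "\<bar>energy \<Omega> F (\<lambda>x. z x + h x) - energy \<Omega> F z - energy_derivative z h\<bar> \<le> \<epsilon> * ?N" using R by linarith
  qed
qed

lemma solutionI:
  assumes z: "z \<in> H10_pair \<Omega>" and "\<And>h. h \<in> H10_pair \<Omega> \<Longrightarrow> energy_derivative z h = 0"
  shows "solution \<Omega> F z"
  unfolding solution_def has_frechet_derivative_in_def
proof (intro conjI z ballI allI impI)
  show "\<exists>C. \<forall>h\<in>H10_pair \<Omega>. \<bar>0::real\<bar> \<le> C * H10_pair_norm \<Omega> h" by (rule exI[of _ 0]) simp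
  fix \<epsilon> :: real assume "\<epsilon> > 0"
  from energy_Frechet[OF z this] show "\<exists>\<delta>>0. \<forall>h\<in>H10_pair \<Omega>. H10_pair_norm \<Omega> h < \<delta> \<longrightarrow>
     \<bar>energy \<Omega> F (\<lambda>x. z x + h x) - energy \<Omega> F z - 0\<bar> \<le> \<epsilon> * H10_pair_norm \<Omega> h"
    using assms(2) by (metis diff_zero)
qed auto

text \<open>To bound a directional derivative from above it suffices to bound the increments of the
  energy for small positive steps. This serves both maxima along rays and vanishing derivatives.\<close>

lemma one_sided_derivative:
  assumes z: "z \<in> H10_pair \<Omega>" and h: "h \<in> H10_pair \<Omega>"
    and up: "\<And>e. e > 0 \<Longrightarrow> \<exists>d>0. \<forall>s. 0 < s \<and> s < d \<longrightarrow> energy \<Omega> F (\<lambda>x. z x + s *\<^sub>R h x) - energy \<Omega> F z \<le> e * s"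
  shows "energy_derivative z h \<le> 0"
proof (rule field_le_epsilon)
  fix e :: real assume e: "e > 0"
  let ?N = "H10_pair_norm \<Omega> h"
  have N: "?N \<ge> 0" by (rule pair_norm_bounds(5)[OF h])
  define \<epsilon> where "\<epsilon> = e / 2 / (?N + 1)"
  have \<epsilon>: "\<epsilon> > 0" "\<epsilon> * ?N \<le> e / 2"
  proof -
    show "\<epsilon> > 0" using e N by (simp add: \<epsilon>_def)
    have "\<epsilon> * ?N \<le> \<epsilon> * (?N + 1)" using \<open>\<epsilon> > 0\<close> by (intro mult_left_mono) auto
    also have "\<dots> = e / 2" using N unfolding \<epsilon>_def by (intro nonzero_eq_divide_eq[THEN iffD1]) auto
    finally show "\<epsilon> * ?N \<le> e / 2" .
  qed
  obtain \<delta> where \<delta>: "\<delta> > 0" "\<And>h. h \<in> H10_pair \<Omega> \<Longrightarrow> H10_pair_norm \<Omega> h < \<delta> \<Longrightarrow>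
    \<bar>energy \<Omega> F (\<lambda>x. z x + h x) - energy \<Omega> F z - energy_derivative z h\<bar> \<le> \<epsilon> * H10_pair_norm \<Omega> h"
    using energy_Frechet[OF z \<epsilon>(1)] by blast
  obtain d where d: "d > 0" "\<And>s. 0 < s \<Longrightarrow> s < d \<Longrightarrow> energy \<Omega> F (\<lambda>x. z x + s *\<^sub>R h x) - energy \<Omega> F z \<le> e / 2 * s"
    using up[of "e / 2"] e by auto
  define s where "s = min (d / 2) (\<delta> / 2 / (?N + 1))"
  have s: "s > 0" "s < d" using d(1) \<delta>(1) N by (auto simp: s_def min_less_iff_disj)
  have "s * ?N < \<delta>"
  proof -
    have "s * ?N \<le> \<delta> / 2 / (?N + 1) * (?N + 1)" using N \<delta>(1) s(1) by (intro mult_mono) (auto simp: s_def)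
    also have "\<dots> = \<delta> / 2" using N by (intro nonzero_eq_divide_eq[THEN iffD1]) auto
    finally show ?thesis using \<delta>(1) by linarith
  qed
  hence "\<bar>energy \<Omega> F (\<lambda>x. z x + s *\<^sub>R h x) - energy \<Omega> F z - s * energy_derivative z h\<bar> \<le> \<epsilon> * (s * ?N)"
    using \<delta>(2)[OF H10_pair_scale[OF h, of s]] s(1) by (simp add: energy_derivative_scale[OF z h] H10_pair_norm_scale[OF h])
  moreover have "\<epsilon> * (s * ?N) \<le> s * (e / 2)" using mult_left_mono[OF \<epsilon>(2), of s] s(1) by (simp add: mult_ac)
  ultimately have "s * energy_derivative z h \<le> s * e" using d(2)[OF s] by (simp add: algebra_simps abs_le_iff)
  thus "energy_derivative z h \<le> 0 + e" using s(1) by simp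
qed

lemma solution_energy_derivative:
  assumes sol: "solution \<Omega> F z" and h: "h \<in> H10_pair \<Omega>"
  shows "energy_derivative z h = 0"
proof -
  have z: "z \<in> H10_pair \<Omega>" using sol by (simp add: solution_def)
  have le: "energy_derivative z h \<le> 0" if h: "h \<in> H10_pair \<Omega>" for h
  proof (rule one_sided_derivative[OF z h])
    fix e :: real assume e: "e > 0"
    let ?N = "H10_pair_norm \<Omega> h"
    have N: "?N \<ge> 0" by (rule pair_norm_bounds(5)[OF h])
    have e': "e / (?N + 1) > 0" using e N by simp
    obtain \<delta> where \<delta>: "\<delta> > 0" "\<And>h. h \<in> H10_pair \<Omega> \<Longrightarrow> H10_pair_norm \<Omega> h < \<delta> \<Longrightarrow>
      \<bar>energy \<Omega> F (\<lambda>x. z x + h x) - energy \<Omega> F z - 0\<bar> \<le> e / (?N + 1) * H10_pair_norm \<Omega> h"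
      using sol e' unfolding solution_def has_frechet_derivative_in_def by blast
    show "\<exists>d>0. \<forall>s. 0 < s \<and> s < d \<longrightarrow> energy \<Omega> F (\<lambda>x. z x + s *\<^sub>R h x) - energy \<Omega> F z \<le> e * s"
    proof (intro exI[of _ "\<delta> / (?N + 1)"] conjI allI impI)
      show "\<delta> / (?N + 1) > 0" using \<delta>(1) N by simp
      fix s assume s: "0 < s \<and> s < \<delta> / (?N + 1)"
      have "s * ?N \<le> s * (?N + 1)" using s by (intro mult_left_mono) auto
      also have "\<dots> < \<delta>" using s N by (simp add: pos_less_divide_eq)
      finally have "\<bar>energy \<Omega> F (\<lambda>x. z x + s *\<^sub>R h x) - energy \<Omega> F z\<bar> \<le> e / (?N + 1) * (s * ?N)"
        using \<delta>(2)[OF H10_pair_scale[OF h, of s]] s by (simp add: H10_pair_norm_scale[OF h])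
      also have "e / (?N + 1) * (s * ?N) \<le> e / (?N + 1) * (s * (?N + 1))"
        using e' s by (intro mult_left_mono) auto
      also have "\<dots> = e * s" using N by simp
      finally show "energy \<Omega> F (\<lambda>x. z x + s *\<^sub>R h x) - energy \<Omega> F z \<le> e * s" by linarith
    qed
  qed
  have "energy_derivative z (\<lambda>x. (-1) *\<^sub>R h x) \<le> 0" by (rule le[OF H10_pair_scale[OF h]])
  hence "energy_derivative z h \<ge> 0" using energy_derivative_scale[OF z h, of "-1"] by simp
  thus ?thesis using le[OF h] by linarith
qed

end

section \<open>Minimisation on the Nehari set\<close>

context nonlinearity
begin

definition scalar_energy :: "('a \<Rightarrow> real) \<Rightarrow> real" where "scalar_energy u = (grad_norm u)\<^sup>2 / 2 - potential (emb u)"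

lemma energy_emb: "u \<in> H10 \<Omega> \<Longrightarrow> energy \<Omega> F (emb u) = scalar_energy u"
  using energy_eq[OF emb_pair, of u] H10_zero(2) by (simp add: scalar_energy_def)

lemma potential_emb: "potential (emb u) = (LINT x|dom. G x (u x))"
  by (simp add: potential_def G_def)

lemma G_integrable: "u \<in> H10 \<Omega> \<Longrightarrow> integrable dom (\<lambda>x. G x (u x))"
  using potential_integrable[OF H10_pair_in_Lp[OF emb_pair]] by (simp add: G_def)

lemma g_integral_eq:
  "(LINT x|dom. h x \<bullet> gradient (F x) (u x, 0)) = (LINT x|dom. fst (h x) * g x (u x))"
  by (rule Bochner_Integration.integral_cong) (auto simp: gradient_on_axis inner_prod_def)

lemma g_integrable:
  assumes "u \<in> H10 \<Omega>" "\<phi> \<in> H10 \<Omega>" shows "integrable dom (\<lambda>x. \<phi> x * g x (u x))"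
proof -
  have "integrable dom (\<lambda>x. emb \<phi> x \<bullet> gradient (F x) (emb u x))"
    by (intro gradient_pairing_integrable H10_pair_in_Lp emb_pair assms)
  thus ?thesis by (rule Bochner_Integration.integrable_cong[THEN iffD1, rotated 2])
    (auto simp: gradient_on_axis inner_prod_def)
qed

lemma dirichlet_form_zero_left: "v \<in> H10 \<Omega> \<Longrightarrow> dirichlet_form (\<lambda>x. 0) v = 0"
  using dirichlet_form_bound[OF H10_zero(1), of v] H10_zero(2) by simp

lemma energy_derivative_emb:
  assumes "u \<in> H10 \<Omega>" "h \<in> H10_pair \<Omega>"
  shows "energy_derivative (emb u) h = dirichlet_form u (\<lambda>x. fst (h x)) - (LINT x|dom. fst (h x) * g x (u x))"
  using dirichlet_form_zero_left[OF H10_pairD(2)[OF assms(2)]] by (simp add: energy_derivative_def g_integral_eq)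

lemma H10_powr_integrable: assumes "u \<in> H10 \<Omega>" shows "integrable dom (\<lambda>x. \<bar>u x\<bar> powr p)"
  using in_LpD(2)[OF H10_pair_in_Lp[OF emb_pair[OF assms]]] by (simp add: norm_pair_zero)

lemma potential_emb_tendsto:
  assumes u: "u \<in> H10 \<Omega>" and w: "\<And>n. w n \<in> H10 \<Omega>" and lim: "(\<lambda>n. LINT x|dom. \<bar>w n x - u x\<bar> powr p) \<longlonglongrightarrow> 0"
  shows "(\<lambda>n. potential (emb (w n))) \<longlonglongrightarrow> potential (emb u)"
  by (rule potential_tendsto) (use lim in \<open>auto intro!: H10_pair_in_Lp emb_pair u w simp: norm_pair_zero\<close>)

lemma grad_norm_path_sq:
  assumes u: "u \<in> H10 \<Omega>" and \<phi>: "\<phi> \<in> H10 \<Omega>"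
  shows "(grad_norm (\<lambda>x. u x + s * \<phi> x))\<^sup>2 = (grad_norm u)\<^sup>2 + 2 * s * dirichlet_form u \<phi> + s\<^sup>2 * (grad_norm \<phi>)\<^sup>2"
  using grad_norm_add_sq[OF u H10_scale(1)[OF \<phi>, of s]] by (simp add: dirichlet_form_scale[OF u \<phi>] grad_norm_scale[OF \<phi>] power_mult_distrib)

lemma H10_path: "u \<in> H10 \<Omega> \<Longrightarrow> \<phi> \<in> H10 \<Omega> \<Longrightarrow> (\<lambda>x. u x + s * \<phi> x) \<in> H10 \<Omega>"
  using H10_lincomb(1)[of u \<phi> 1 s] by simp

lemma grad_norm_path_tendsto:
  assumes u: "u \<in> H10 \<Omega>" and \<phi>: "\<phi> \<in> H10 \<Omega>" and s: "s \<longlonglongrightarrow> 0"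
  shows "(\<lambda>n. (grad_norm (\<lambda>x. u x + s n * \<phi> x))\<^sup>2) \<longlonglongrightarrow> (grad_norm u)\<^sup>2"
proof -
  have "(\<lambda>n. (grad_norm u)\<^sup>2 + 2 * s n * dirichlet_form u \<phi> + (s n)\<^sup>2 * (grad_norm \<phi>)\<^sup>2) \<longlonglongrightarrow> (grad_norm u)\<^sup>2 + 2 * 0 * dirichlet_form u \<phi> + 0\<^sup>2 * (grad_norm \<phi>)\<^sup>2"
    by (intro tendsto_intros s)
  thus ?thesis by (simp add: grad_norm_path_sq[OF u \<phi>])
qed

lemma scalar_energy_path_tendsto:
  assumes u: "u \<in> H10 \<Omega>" and \<phi>: "\<phi> \<in> H10 \<Omega>" and s: "s \<longlonglongrightarrow> 0"
  shows "(\<lambda>n. scalar_energy (\<lambda>x. u x + s n * \<phi> x)) \<longlonglongrightarrow> scalar_energy u"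
  unfolding scalar_energy_def
proof (intro tendsto_diff tendsto_divide tendsto_const grad_norm_path_tendsto[OF u \<phi> s] potential_emb_tendsto u H10_path \<phi>)
  have "(\<lambda>n. \<bar>s n\<bar> powr p * (LINT x|dom. \<bar>\<phi> x\<bar> powr p)) \<longlonglongrightarrow> \<bar>0\<bar> powr p * (LINT x|dom. \<bar>\<phi> x\<bar> powr p)"
    using p_gt by (intro tendsto_mult tendsto_const tendsto_powr' tendsto_rabs s) auto
  thus "(\<lambda>n. LINT x|dom. \<bar>u x + s n * \<phi> x - u x\<bar> powr p) \<longlonglongrightarrow> 0"
    by (simp add: abs_mult powr_mult)
qed simp

text \<open>Along a ray the energy is concave in the square \<open>\<tau>\<close> of the scaling factor: the Dirichlet
  part is linear in \<open>\<tau>\<close> and the potential is convex.\<close>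

lemma scalar_energy_concave:
  assumes u: "u \<in> H10 \<Omega>" and t: "\<tau>1 \<ge> 0" "\<tau>2 \<ge> 0" "0 \<le> l" "l \<le> 1"
  shows "(1 - l) * scalar_energy (\<lambda>x. sqrt \<tau>1 * u x) + l * scalar_energy (\<lambda>x. sqrt \<tau>2 * u x) \<le> scalar_energy (\<lambda>x. sqrt ((1 - l) * \<tau>1 + l * \<tau>2) * u x)"
proof -
  define \<tau> where "\<tau> = (1 - l) * \<tau>1 + l * \<tau>2"
  have \<tau>: "\<tau> \<ge> 0" using t by (simp add: \<tau>_def)
  have i: "integrable dom (\<lambda>x. G x (c * u x))" for c by (rule G_integrable[OF H10_scale(1)[OF u]])
  have "(LINT x|dom. G x (sqrt \<tau> * u x)) \<le> (LINT x|dom. (1 - l) * G x (sqrt \<tau>1 * u x) + l * G x (sqrt \<tau>2 * u x))"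
    by (rule integral_mono) (use i t in \<open>auto simp: \<tau>_def intro!: G_scaling_convex\<close>)
  also have "\<dots> = (1 - l) * potential (emb (\<lambda>x. sqrt \<tau>1 * u x)) + l * potential (emb (\<lambda>x. sqrt \<tau>2 * u x))"
    using i by (simp add: potential_emb)
  finally have "potential (emb (\<lambda>x. sqrt \<tau> * u x)) \<le> (1 - l) * potential (emb (\<lambda>x. sqrt \<tau>1 * u x)) + l * potential (emb (\<lambda>x. sqrt \<tau>2 * u x))"
    by (simp add: potential_emb)
  moreover have Is: "scalar_energy (\<lambda>x. sqrt c * u x) = c * (grad_norm u)\<^sup>2 / 2 - potential (emb (\<lambda>x. sqrt c * u x))" if "c \<ge> 0" for c
    using that by (simp add: scalar_energy_def grad_norm_scale[OF u] power_mult_distrib)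
  moreover have "\<tau> * (grad_norm u)\<^sup>2 / 2 = (1 - l) * (\<tau>1 * (grad_norm u)\<^sup>2 / 2) + l * (\<tau>2 * (grad_norm u)\<^sup>2 / 2)"
    by (simp add: \<tau>_def field_simps)
  ultimately show ?thesis
    unfolding \<tau>_def[symmetric] Is[OF t(1)] Is[OF t(2)] Is[OF \<tau>] right_diff_distrib by linarith
qed

lemma potential_zero: "potential (emb (\<lambda>x. 0)) = 0"
proof -
  have "(LINT x|dom. G x 0) = (LINT x|dom. 0)" by (rule Bochner_Integration.integral_cong) (auto simp: G_zero)
  thus ?thesis by (simp add: potential_emb)
qed

lemma scalar_energy_zero: "scalar_energy (\<lambda>x. 0) = 0"
  using H10_zero(2) potential_zero by (simp add: scalar_energy_def)

lemma grad_norm_pos_imp_L2_norm_pos: assumes "u \<in> H10 \<Omega>" "grad_norm u > 0" shows "L2_norm u > 0"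
proof (rule ccontr)
  assume "\<not> L2_norm u > 0"
  hence "L2_norm u = 0" using L2_norm_nonneg[of u] by linarith
  hence "grad_norm u = 0" by (intro AE_zero_imp_grad_norm_zero[OF assms(1)] L2_norm_zero_AE[OF H10D(1)[OF assms(1)]])
  thus False using assms(2) by simp
qed

text \<open>The potential dominates any multiple of \<open>t\<^sup>2\<close>, so \<open>K\<close> can be chosen to beat the Dirichlet
  part by \<open>t\<^sup>2\<close>.\<close>

lemma scalar_energy_upper_bound:
  assumes u: "u \<in> H10 \<Omega>" and d: "grad_norm u > 0"
  shows "\<exists>C. \<forall>t. scalar_energy (\<lambda>x. t * u x) \<le> C - t\<^sup>2"
proof -
  have L: "L2_norm u > 0" by (rule grad_norm_pos_imp_L2_norm_pos[OF assms])
  \<comment> \<open>With this \<open>K\<close> the quadratic lower bound exceeds the Dirichlet part by \<open>t\<^sup>2\<close>.\<close>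
  define K where "K = ((grad_norm u)\<^sup>2 / 2 + 1) / (L2_norm u)\<^sup>2"
  have K: "K * (L2_norm u)\<^sup>2 = (grad_norm u)\<^sup>2 / 2 + 1" using L by (simp add: K_def)
  obtain C where C: "\<And>x u. x \<in> \<Omega> \<Longrightarrow> F x u \<ge> K * (norm u)\<^sup>2 - C" using large[of K] by blast
  define m where "m = measure dom (space dom)"
  note u2 = L2D(2)[OF H10D(1)[OF u]]
  have "scalar_energy (\<lambda>x. t * u x) \<le> C * m - t\<^sup>2" for t
  proof -
    have "(LINT x|dom. K * (t\<^sup>2 * (norm (u x))\<^sup>2) - C) \<le> (LINT x|dom. G x (t * u x))"
    proof (rule integral_mono)
      show "integrable dom (\<lambda>x. K * (t\<^sup>2 * (norm (u x))\<^sup>2) - C)" using u2 by simp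
      show "integrable dom (\<lambda>x. G x (t * u x))" by (rule G_integrable[OF H10_scale(1)[OF u]])
      fix x assume "x \<in> space dom"
      thus "K * (t\<^sup>2 * (norm (u x))\<^sup>2) - C \<le> G x (t * u x)"
        using C[of x "(t * u x, 0)"] by (simp add: G_def norm_pair_zero power_mult_distrib)
    qed
    moreover have "(LINT x|dom. K * (t\<^sup>2 * (norm (u x))\<^sup>2) - C) = K * (t\<^sup>2 * (L2_norm u)\<^sup>2) - C * m"
      using u2 by (simp add: L2_norm_sq m_def mult.commute)
    moreover have "K * (t\<^sup>2 * (L2_norm u)\<^sup>2) = t\<^sup>2 * (grad_norm u)\<^sup>2 / 2 + t\<^sup>2"
      using arg_cong[OF K, of "\<lambda>y. t\<^sup>2 * y"] by (simp add: algebra_simps)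
    ultimately show ?thesis by (simp add: scalar_energy_def potential_emb grad_norm_scale[OF u] power_mult_distrib)
  qed
  thus ?thesis by blast
qed

text \<open>Near zero the quadratic term suffices; away from zero the growth bound is dominated by the
  power \<open>p\<close>.\<close>

lemma G_upper:
  assumes "e > 0" shows "\<exists>C\<ge>0. \<forall>x\<in>\<Omega>. \<forall>s. G x s \<le> e * s\<^sup>2 + C * \<bar>s\<bar> powr p"
proof -
  obtain d where d: "d > 0" "\<And>x u. x \<in> \<Omega> \<Longrightarrow> norm u < d \<Longrightarrow> F x u \<le> e * (norm u)\<^sup>2" using small[OF assms] by blast
  define C where "C = a * (d powr (1 - p) + 1)"
  have C: "C \<ge> 0" using a_pos by (simp add: C_def)
  have "G x s \<le> e * s\<^sup>2 + C * \<bar>s\<bar> powr p" if x: "x \<in> \<Omega>" for x s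
  proof (cases "\<bar>s\<bar> < d")
    case True
    hence "G x s \<le> e * s\<^sup>2" using d(2)[OF x, of "(s, 0)"] by (simp add: G_def norm_pair_zero)
    thus ?thesis using C by (simp add: add_increasing2)
  next
    case False
    let ?s = "\<bar>s\<bar>"
    have s: "?s > 0" using False d(1) by linarith
    have "G x s \<le> a * (1 + ?s powr (p - 1)) * ?s"
      using F_Lipschitz[OF x, of "(s, 0)" 0] F_zero[OF x] by (simp add: G_def norm_pair_zero abs_le_iff)
    also have "\<dots> = a * (?s + ?s powr p)" using powr_mult_base[of ?s "p - 1"] by (simp add: algebra_simps)
    also have "\<dots> \<le> a * (d powr (1 - p) * ?s powr p + ?s powr p)"
    proof -
      have "?s = ?s powr (1 - p) * ?s powr p" using s by (simp add: powr_add[symmetric])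
      also have "\<dots> \<le> d powr (1 - p) * ?s powr p"
        using False d(1) p_gt by (intro mult_right_mono powr_mono2') auto
      finally show ?thesis using a_pos by simp
    qed
    also have "\<dots> = C * ?s powr p" by (simp add: C_def algebra_simps)
    also have "\<dots> \<le> e * s\<^sup>2 + C * ?s powr p" using assms by simp
    finally show ?thesis .
  qed
  thus ?thesis using C by blast
qed

text \<open>For small \<open>t\<close> the quadratic Dirichlet part dominates: half of it absorbs the quadratic term of
  \<open>G_upper\<close>, and the power \<open>p > 2\<close> is of higher order.\<close>

lemma scalar_energy_positive:
  assumes u: "u \<in> H10 \<Omega>" and d: "grad_norm u > 0"
  shows "\<exists>t>0. scalar_energy (\<lambda>x. t * u x) > 0"
proof -
  define e where "e = (grad_norm u)\<^sup>2 / 4 / ((L2_norm u)\<^sup>2 + 1)"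
  have L1: "(L2_norm u)\<^sup>2 + 1 > 0" by (simp add: add_nonneg_pos)
  have e: "e > 0" using d L1 by (simp add: e_def)
  have eL: "e * (L2_norm u)\<^sup>2 \<le> (grad_norm u)\<^sup>2 / 4"
  proof -
    have "e * (L2_norm u)\<^sup>2 \<le> e * ((L2_norm u)\<^sup>2 + 1)" using e by (intro mult_left_mono) auto
    also have "\<dots> = (grad_norm u)\<^sup>2 / 4" unfolding e_def using L1 by (intro nonzero_eq_divide_eq[THEN iffD1]) auto
    finally show ?thesis .
  qed
  obtain C where C: "C \<ge> 0" "\<And>x s. x \<in> \<Omega> \<Longrightarrow> G x s \<le> e * s\<^sup>2 + C * \<bar>s\<bar> powr p" using G_upper[OF e] by blast
  define B where "B = C * (LINT x|dom. \<bar>u x\<bar> powr p)"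
  have B: "B \<ge> 0" using C by (simp add: B_def)
  \<comment> \<open>Solves \<open>(B + 1) t powr (p - 2) = (grad_norm u)\<^sup>2 / 8\<close>.\<close>
  define t where "t = ((grad_norm u)\<^sup>2 / 8 / (B + 1)) powr (1 / (p - 2))"
  have t: "t > 0" using d B by (simp add: t_def)
  have tp: "t powr (p - 2) = (grad_norm u)\<^sup>2 / 8 / (B + 1)" using p_gt d B by (simp add: t_def powr_powr)
  have Bt: "B * t powr (p - 2) \<le> (grad_norm u)\<^sup>2 / 8"
  proof -
    have "B * t powr (p - 2) \<le> (B + 1) * t powr (p - 2)" by (intro mult_right_mono) auto
    also have "\<dots> = (grad_norm u)\<^sup>2 / 8"
      unfolding tp mult.commute[of "B + 1"] using B by (intro nonzero_eq_divide_eq[THEN iffD1]) auto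
    finally show ?thesis .
  qed
  note u2 = L2D(2)[OF H10D(1)[OF u]] and up = H10_powr_integrable[OF u]
  have "(LINT x|dom. G x (t * u x)) \<le> (LINT x|dom. e * (t\<^sup>2 * (norm (u x))\<^sup>2) + C * (t powr p * \<bar>u x\<bar> powr p))"
  proof (rule integral_mono)
    show "integrable dom (\<lambda>x. G x (t * u x))" by (rule G_integrable[OF H10_scale(1)[OF u]])
    show "integrable dom (\<lambda>x. e * (t\<^sup>2 * (norm (u x))\<^sup>2) + C * (t powr p * \<bar>u x\<bar> powr p))" using u2 up by simp
    fix x assume "x \<in> space dom"
    thus "G x (t * u x) \<le> e * (t\<^sup>2 * (norm (u x))\<^sup>2) + C * (t powr p * \<bar>u x\<bar> powr p)"
      using C(2)[of x "t * u x"] t by (simp add: power_mult_distrib abs_mult powr_mult)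
  qed
  also have "\<dots> = t\<^sup>2 * (e * (L2_norm u)\<^sup>2) + t powr p * B"
    using u2 up by (simp add: L2_norm_sq B_def mult_ac)
  also have "t powr p = t\<^sup>2 * t powr (p - 2)"
    using t powr_add[of t 2 "p - 2"] by (simp add: powr_numeral)
  also have "t\<^sup>2 * (e * (L2_norm u)\<^sup>2) + t\<^sup>2 * t powr (p - 2) * B = t\<^sup>2 * (e * (L2_norm u)\<^sup>2 + B * t powr (p - 2))"
    by (simp add: algebra_simps)
  also have "\<dots> \<le> t\<^sup>2 * ((grad_norm u)\<^sup>2 / 4 + (grad_norm u)\<^sup>2 / 8)" by (intro mult_left_mono add_mono eL Bt) auto
  finally have "potential (emb (\<lambda>x. t * u x)) \<le> t\<^sup>2 * ((grad_norm u)\<^sup>2 / 4 + (grad_norm u)\<^sup>2 / 8)" by (simp add: potential_emb)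
  moreover have "t\<^sup>2 * (grad_norm u)\<^sup>2 > 0" using t d by simp
  moreover have "(grad_norm (\<lambda>x. t * u x))\<^sup>2 = t\<^sup>2 * (grad_norm u)\<^sup>2" by (simp add: grad_norm_scale[OF u] power_mult_distrib)
  ultimately have "scalar_energy (\<lambda>x. t * u x) > 0" unfolding scalar_energy_def distrib_left by simp
  thus ?thesis using t by blast
qed

lemma scalar_energy_scale_continuous:
  assumes u: "u \<in> H10 \<Omega>" shows "continuous_on S (\<lambda>t. scalar_energy (\<lambda>x. t * u x))"
proof (rule continuous_on_sequentiallyI)
  fix t :: "nat \<Rightarrow> real" and b assume t: "t \<longlonglongrightarrow> b"
  have "(\<lambda>n. t n - b) \<longlonglongrightarrow> 0" using tendsto_diff[OF t tendsto_const[of b]] by simp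
  from scalar_energy_path_tendsto[OF H10_scale(1)[OF u, of b] u this]
  show "(\<lambda>n. scalar_energy (\<lambda>x. t n * u x)) \<longlonglongrightarrow> scalar_energy (\<lambda>x. b * u x)" by (simp add: algebra_simps)
qed

text \<open>The points at which \<open>scalar_energy\<close> is maximal on their own ray. For \<open>u \<noteq> 0\<close> this agrees with the
  usual description by \<open>\<integral> |\<nabla>u|\<^sup>2 = \<integral> u g(x,u)\<close>; see \<open>Nehari_identity\<close> and
  \<open>scalar_energy_max_of_identity\<close>.\<close>

definition Nehari :: "('a \<Rightarrow> real) set" where
  "Nehari = {u \<in> H10 \<Omega>. grad_norm u > 0 \<and> (\<forall>t\<ge>0. scalar_energy (\<lambda>x. t * u x) \<le> scalar_energy u)}"

lemma Nehari_projection: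
  assumes u: "u \<in> H10 \<Omega>" and d: "grad_norm u > 0"
  obtains t where "t > 0" "(\<lambda>x. t * u x) \<in> Nehari"
proof -
  obtain C where C: "\<And>t. scalar_energy (\<lambda>x. t * u x) \<le> C - t\<^sup>2" using scalar_energy_upper_bound[OF assms] by blast
  obtain t1 where t1: "t1 > 0" "scalar_energy (\<lambda>x. t1 * u x) > 0" using scalar_energy_positive[OF assms] by blast
  define T where "T = max t1 (sqrt \<bar>C\<bar>)"
  have T: "T > 0" "t1 \<le> T" using t1 by (auto simp: T_def)
  obtain t where t: "t \<in> {0..T}" "\<And>s. s \<in> {0..T} \<Longrightarrow> scalar_energy (\<lambda>x. s * u x) \<le> scalar_energy (\<lambda>x. t * u x)"
    using continuous_attains_sup[of "{0..T}" "\<lambda>t. scalar_energy (\<lambda>x. t * u x)"] scalar_energy_scale_continuous[OF u] T by auto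
  have It: "scalar_energy (\<lambda>x. t * u x) > 0" using t(2)[of t1] t1 T by auto
  hence t0: "t > 0" using t(1) scalar_energy_zero by (cases "t = 0") auto
  have max: "scalar_energy (\<lambda>x. s * u x) \<le> scalar_energy (\<lambda>x. t * u x)" if "s \<ge> 0" for s
  proof (cases "s \<le> T")
    case False
    have "\<bar>C\<bar> = (sqrt \<bar>C\<bar>)\<^sup>2" by simp
    also have "\<dots> \<le> s\<^sup>2" using False by (intro power_mono) (auto simp: T_def)
    finally have "scalar_energy (\<lambda>x. s * u x) \<le> 0" using C[of s] by linarith
    thus ?thesis using It by linarith
  qed (use t(2) that in auto)
  have "(\<lambda>x. t * u x) \<in> Nehari"
    unfolding Nehari_def
  proof (intro CollectI conjI allI impI H10_scale(1)[OF u])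
    show "grad_norm (\<lambda>x. t * u x) > 0" using d t0 by (simp add: grad_norm_scale[OF u])
    fix s :: real assume "s \<ge> 0"
    thus "scalar_energy (\<lambda>x. s * (t * u x)) \<le> scalar_energy (\<lambda>x. t * u x)" using max[of "s * t"] t0 by (simp add: mult.assoc)
  qed
  thus ?thesis using that t0 by blast
qed

lemma Nehari_nonneg: assumes "u \<in> Nehari" shows "scalar_energy u \<ge> 0"
proof -
  have "scalar_energy (\<lambda>x. 0 * u x) \<le> scalar_energy u" using assms unfolding Nehari_def by blast
  thus ?thesis by (simp add: scalar_energy_zero)
qed

definition ground_level :: real where "ground_level = Inf (scalar_energy ` Nehari)"

lemma ground_level_le: "u \<in> Nehari \<Longrightarrow> ground_level \<le> scalar_energy u"
  unfolding ground_level_def by (rule cInf_lower) (auto intro!: bdd_belowI[of _ 0] Nehari_nonneg)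

lemma ground_level_scaling:
  assumes "u \<in> H10 \<Omega>" "grad_norm u > 0" obtains \<tau> where "\<tau> > 0" "scalar_energy (\<lambda>x. sqrt \<tau> * u x) \<ge> ground_level"
proof -
  obtain t where t: "t > 0" "(\<lambda>x. t * u x) \<in> Nehari" using Nehari_projection[OF assms] by blast
  show ?thesis using that[of "t\<^sup>2"] t ground_level_le[OF t(2)] by simp
qed

text \<open>If every test function vanished almost everywhere, the constant \<open>1\<close> would be orthogonal to
  all of them, and \<open>\<Omega>\<close> would be a null set.\<close>

lemma Nehari_nonempty:
  assumes "\<Omega> \<noteq> {}" shows "Nehari \<noteq> {}"
proof -
  have "\<exists>\<phi>. test_function \<Omega> \<phi> \<and> L2_norm \<phi> \<noteq> 0"
  proof (rule ccontr)
    assume "\<not> ?thesis"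
    hence z: "AE x in dom. \<phi> x = 0" if "test_function \<Omega> \<phi>" for \<phi>
      using that L2_norm_zero_AE[OF test_L2(1)[OF that]] by blast
    have "AE x in dom. (1::real) = 0"
    proof (rule AE_zero_if_test_orthogonal)
      fix \<phi> assume \<phi>: "test_function \<Omega> \<phi>"
      have "(LINT x|dom. \<phi> x *\<^sub>R (1::real)) = (LINT x|dom. 0)"
        by (rule integral_cong_AE) (use z[OF \<phi>] L2D(1)[OF test_L2(1)[OF \<phi>]] in auto)
      thus "(LINT x|dom. \<phi> x *\<^sub>R (1::real)) = 0" by simp
    qed simp
    hence "AE x in lebesgue. x \<notin> \<Omega>" by (simp add: AE_restrict_space_iff dom_sets)
    hence "\<Omega> \<in> null_sets lebesgue" using AE_iff_null_sets[OF dom_sets] by blast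
    hence "negligible \<Omega>" by (simp add: negligible_iff_null_sets)
    thus False using open_not_negligible[OF open_dom assms] by blast
  qed
  then obtain \<phi> where \<phi>: "test_function \<Omega> \<phi>" "L2_norm \<phi> \<noteq> 0" by blast
  note h = test_H10(1)[OF \<phi>(1)]
  obtain C where "C > 0" "\<And>u. u \<in> H10 \<Omega> \<Longrightarrow> L2_norm u \<le> C * grad_norm u" using Poincare_H10 by blast
  from this(2)[OF h] have "L2_norm \<phi> = 0" if "grad_norm \<phi> = 0" using that by (intro antisym) auto
  hence "grad_norm \<phi> \<noteq> 0" using \<phi>(2) by blast
  hence "grad_norm \<phi> > 0" using L2_norm_nonneg[of "wg \<phi>"] by linarith
  from Nehari_projection[OF h this] show ?thesis by blast
qed

text \<open>The sequence is scaled to gradient norm \<open>1\<close>, which makes compactness available from the start;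
  the scaling is undone only for the limit, by projecting it to the Nehari set.\<close>

theorem minimiser_exists:
  assumes "\<Omega> \<noteq> {}"
  obtains v where "v \<in> Nehari" "scalar_energy v = ground_level"
proof -
  obtain K where K: "K > 0" "\<And>u. u \<in> H10 \<Omega> \<Longrightarrow> integrable dom (\<lambda>x. \<bar>u x\<bar> powr p)"
    "\<And>u. u \<in> H10 \<Omega> \<Longrightarrow> (LINT x|dom. \<bar>u x\<bar> powr p) \<le> K * grad_norm u powr p"
    using Sobolev_H10[OF p_gt p_sub] by blast
  define e where "e n = inverse (real (Suc n))" for n
  have e: "e n > 0" for n by (simp add: e_def)
  have e0: "e \<longlonglongrightarrow> 0" unfolding e_def by (rule LIMSEQ_inverse_real_of_nat)
  have e_dec: "e m \<le> e n" if "n \<le> m" for m n unfolding e_def using that by (intro le_imp_inverse_le) auto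
  have "\<exists>v\<in>Nehari. scalar_energy v < ground_level + e n" for n
    using cInf_lessD[of "scalar_energy ` Nehari" "ground_level + e n"] Nehari_nonempty[OF assms] e[of n] by (auto simp: ground_level_def)
  then obtain v where v: "\<And>n. v n \<in> Nehari" "\<And>n. scalar_energy (v n) < ground_level + e n" by metis
  have vH: "v n \<in> H10 \<Omega>" "grad_norm (v n) > 0" for n using v(1)[of n] by (auto simp: Nehari_def)
  define u where "u n x = inverse (grad_norm (v n)) * v n x" for n x
  have uH: "u n \<in> H10 \<Omega>" for n unfolding u_def by (rule H10_scale(1)[OF vH(1)])
  have ud: "grad_norm (u n) = 1" for n
    unfolding u_def using grad_norm_scale[OF vH(1)[of n]] vH(2)[of n] by simp
  have uI: "scalar_energy (\<lambda>x. t * u n x) \<le> ground_level + e n" if "t \<ge> 0" for t n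
  proof -
    have "t * inverse (grad_norm (v n)) \<ge> 0" using that vH(2)[of n] by simp
    hence "scalar_energy (\<lambda>x. (t * inverse (grad_norm (v n))) * v n x) \<le> scalar_energy (v n)" using v(1)[of n] unfolding Nehari_def by blast
    thus ?thesis using v(2)[of n] by (simp add: u_def mult.assoc)
  qed
  have "\<exists>\<phi>. test_function \<Omega> \<phi> \<and> L2_norm (\<lambda>x. wg (u n) x - gradient \<phi> x) < e n" for n
  proof -
    obtain \<phi> where \<phi>: "\<And>k. test_function \<Omega> (\<phi> k)" "(\<lambda>k. L2_norm (\<lambda>x. wg (u n) x - gradient (\<phi> k) x)) \<longlonglongrightarrow> 0"
      using H10_approx[OF uH[of n]] by metis
    have "\<forall>\<^sub>F k in sequentially. L2_norm (\<lambda>x. wg (u n) x - gradient (\<phi> k) x) < e n"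
      using order_tendstoD(2)[OF \<phi>(2)] e by simp
    thus ?thesis using \<phi>(1) by (auto simp: eventually_sequentially)
  qed
  then obtain \<phi> where \<phi>: "\<And>n. test_function \<Omega> (\<phi> n)" "\<And>n. L2_norm (\<lambda>x. wg (u n) x - gradient (\<phi> n) x) < e n" by metis
  have \<phi>b: "L2_norm (gradient (\<phi> n)) \<le> 1 + e n" for n
    using L2_norm_triangle[OF L2_diff[OF test_L2(2)[OF \<phi>(1)[of n]] H10D(2)[OF uH[of n]]] H10D(2)[OF uH[of n]]] \<phi>(2)[of n]
      L2_norm_minus[of "wg (u n)" "gradient (\<phi> n)"] ud[of n] by simp
  have dec: "decseq (\<lambda>n. 1 + e n)" unfolding decseq_def using e_dec by simp
  have lim1: "(\<lambda>n. 1 + e n) \<longlonglongrightarrow> 1" using tendsto_add[OF tendsto_const[of 1] e0] by simp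
  have "\<exists>r w. (\<forall>n. r n \<ge> (n :: nat)) \<and> w \<in> H10 \<Omega> \<and> grad_norm w \<le> 1 \<and>
    (\<lambda>n. LINT x|dom. \<bar>w x - \<phi> (r n) x\<bar> powr p) \<longlonglongrightarrow> 0"
  proof (rule weak_limit[OF p_gt p_sub, of \<phi> "\<lambda>n. 1 + e n" 1, OF \<phi>(1) \<phi>b dec lim1])
    fix r w assume "\<And>n. r n \<ge> (n :: nat)" "w \<in> H10 \<Omega>" "grad_norm w \<le> 1"
      "(\<lambda>n. LINT x|dom. \<bar>w x - \<phi> (r n) x\<bar> powr p) \<longlonglongrightarrow> 0"
    thus ?thesis by (intro exI[of _ r] exI[of _ w] conjI allI)
  qed
  then obtain r w where r: "\<And>n. r n \<ge> (n :: nat)" and w: "w \<in> H10 \<Omega>" "grad_norm w \<le> 1"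
    and lim: "(\<lambda>n. LINT x|dom. \<bar>w x - \<phi> (r n) x\<bar> powr p) \<longlonglongrightarrow> 0"
    by blast
  have close: "(LINT x|dom. \<bar>u n x - \<phi> n x\<bar> powr p) \<le> K * e n powr p" for n
  proof -
    have H: "(\<lambda>x. u n x - \<phi> n x) \<in> H10 \<Omega>" "AE x in dom. wg (\<lambda>x. u n x - \<phi> n x) x = wg (u n) x - wg (\<phi> n) x"
      using H10_lincomb[OF uH[of n] test_H10(1)[OF \<phi>(1)[of n]], of 1 "-1"] by auto
    have "grad_norm (\<lambda>x. u n x - \<phi> n x) = L2_norm (\<lambda>x. wg (u n) x - gradient (\<phi> n) x)"
    proof (rule L2_norm_cong)
      show "AE x in dom. norm (wg (\<lambda>x. u n x - \<phi> n x) x) = norm (wg (u n) x - gradient (\<phi> n) x)"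
        using H(2) test_H10(2)[OF \<phi>(1)[of n]] by eventually_elim simp
    qed (intro H10D(2) H(1) L2_diff uH test_L2 \<phi>)+
    hence "grad_norm (\<lambda>x. u n x - \<phi> n x) powr p \<le> e n powr p" using \<phi>(2)[of n] p_gt by (intro powr_mono2) auto
    thus ?thesis using K(3)[OF H(1)] K(1) mult_left_mono[of _ "e n powr p" K] by (meson less_imp_le order_trans)
  qed
  have limu: "(\<lambda>n. LINT x|dom. \<bar>u (r n) x - w x\<bar> powr p) \<longlonglongrightarrow> 0"
  proof (rule tendsto_sandwich[OF _ _ tendsto_const])
    have "(LINT x|dom. \<bar>u (r n) x - w x\<bar> powr p) \<le> 2 powr p * (K * e n powr p + (LINT x|dom. \<bar>w x - \<phi> (r n) x\<bar> powr p))" for n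
    proof -
      have i: "integrable dom (\<lambda>x. \<bar>u (r n) x - w x\<bar> powr p)" "integrable dom (\<lambda>x. \<bar>u (r n) x - \<phi> (r n) x\<bar> powr p)"
        "integrable dom (\<lambda>x. \<bar>w x - \<phi> (r n) x\<bar> powr p)"
        using K(2)[OF H10_lincomb(1)[OF uH w(1), of 1 _ "-1"]] K(2)[OF H10_lincomb(1)[OF uH test_H10(1)[OF \<phi>(1)], of 1 _ "-1"]]
          K(2)[OF H10_lincomb(1)[OF w(1) test_H10(1)[OF \<phi>(1)], of 1 "-1"]] by simp_all
      have "(LINT x|dom. \<bar>u (r n) x - w x\<bar> powr p) \<le>
        (LINT x|dom. 2 powr p * (\<bar>u (r n) x - \<phi> (r n) x\<bar> powr p + \<bar>w x - \<phi> (r n) x\<bar> powr p))"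
      proof (rule integral_mono[OF i(1)])
        show "\<bar>u (r n) x - w x\<bar> powr p \<le> 2 powr p * (\<bar>u (r n) x - \<phi> (r n) x\<bar> powr p + \<bar>w x - \<phi> (r n) x\<bar> powr p)" for x
          using abs_powr_add_le[of p "u (r n) x - \<phi> (r n) x" "\<phi> (r n) x - w x"] p_gt by (simp add: abs_minus_commute)
      qed (use i in auto)
      also have "\<dots> = 2 powr p * ((LINT x|dom. \<bar>u (r n) x - \<phi> (r n) x\<bar> powr p) + (LINT x|dom. \<bar>w x - \<phi> (r n) x\<bar> powr p))"
        using i by simp
      also have "\<dots> \<le> 2 powr p * (K * e n powr p + (LINT x|dom. \<bar>w x - \<phi> (r n) x\<bar> powr p))"
      proof (intro mult_left_mono add_right_mono)
        have "e (r n) powr p \<le> e n powr p" using e_dec[OF r[of n]] e[of "r n"] p_gt by (intro powr_mono2) auto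
        thus "(LINT x|dom. \<bar>u (r n) x - \<phi> (r n) x\<bar> powr p) \<le> K * e n powr p"
          using close[of "r n"] K(1) mult_left_mono[of "e (r n) powr p" "e n powr p" K] by linarith
      qed simp
      finally show ?thesis .
    qed
    thus "\<forall>\<^sub>F n in sequentially. (LINT x|dom. \<bar>u (r n) x - w x\<bar> powr p) \<le>
       2 powr p * (K * e n powr p + (LINT x|dom. \<bar>w x - \<phi> (r n) x\<bar> powr p))" by simp
    have "(\<lambda>n. 2 powr p * (K * e n powr p + (LINT x|dom. \<bar>w x - \<phi> (r n) x\<bar> powr p))) \<longlonglongrightarrow> 2 powr p * (K * 0 powr p + 0)"
      using p_gt e by (intro tendsto_mult tendsto_add tendsto_const tendsto_powr' e0 lim) (auto simp: less_imp_le)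
    thus "(\<lambda>n. 2 powr p * (K * e n powr p + (LINT x|dom. \<bar>w x - \<phi> (r n) x\<bar> powr p))) \<longlonglongrightarrow> 0" by simp
  qed simp
  have bound: "t\<^sup>2 / 2 - potential (emb (\<lambda>x. t * w x)) \<le> ground_level" if t: "t \<ge> 0" for t
  proof (rule LIMSEQ_le)
    have "(\<lambda>n. potential (emb (\<lambda>x. t * u (r n) x))) \<longlonglongrightarrow> potential (emb (\<lambda>x. t * w x))"
    proof (rule potential_emb_tendsto)
      have "(\<lambda>n. \<bar>t\<bar> powr p * (LINT x|dom. \<bar>u (r n) x - w x\<bar> powr p)) \<longlonglongrightarrow> \<bar>t\<bar> powr p * 0"
        by (intro tendsto_mult tendsto_const limu)
      thus "(\<lambda>n. LINT x|dom. \<bar>t * u (r n) x - t * w x\<bar> powr p) \<longlonglongrightarrow> 0"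
        by (simp add: right_diff_distrib[symmetric] abs_mult powr_mult)
    qed (intro H10_scale(1) w uH)+
    thus "(\<lambda>n. t\<^sup>2 / 2 - potential (emb (\<lambda>x. t * u (r n) x))) \<longlonglongrightarrow> t\<^sup>2 / 2 - potential (emb (\<lambda>x. t * w x))"
      by (intro tendsto_diff tendsto_const)
    show "(\<lambda>n. ground_level + e n) \<longlonglongrightarrow> ground_level" using tendsto_add[OF tendsto_const[of ground_level] e0] by simp
    have "t\<^sup>2 / 2 - potential (emb (\<lambda>x. t * u (r n) x)) \<le> ground_level + e n" for n
    proof -
      have "scalar_energy (\<lambda>x. t * u (r n) x) = t\<^sup>2 / 2 - potential (emb (\<lambda>x. t * u (r n) x))"
        using ud[of "r n"] by (simp add: scalar_energy_def grad_norm_scale[OF uH])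
      thus ?thesis using uI[OF t, of "r n"] e_dec[OF r[of n]] by linarith
    qed
    thus "\<exists>N. \<forall>n\<ge>N. t\<^sup>2 / 2 - potential (emb (\<lambda>x. t * u (r n) x)) \<le> ground_level + e n" by blast
  qed
  have wpos: "grad_norm w > 0"
  proof (rule ccontr)
    assume "\<not> grad_norm w > 0"
    hence "grad_norm w = 0" using L2_norm_nonneg[of "wg w"] by linarith
    hence w0: "AE x in dom. w x = 0" by (rule grad_norm_zero_imp[OF w(1)])
    have "potential (emb (\<lambda>x. t * w x)) = potential (emb (\<lambda>x. 0))" for t
      unfolding potential_emb
    proof (rule integral_cong_AE)
      show "AE x in dom. G x (t * w x) = G x 0" using w0 by eventually_elim simp
      show "(\<lambda>x. G x (t * w x)) \<in> borel_measurable dom"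
        by (rule borel_measurable_integrable[OF G_integrable[OF H10_scale(1)[OF w(1)]]])
      show "(\<lambda>x. G x 0) \<in> borel_measurable dom" by (rule borel_measurable_integrable[OF G_integrable[OF H10_zero(1)]])
    qed
    hence "t\<^sup>2 / 2 \<le> ground_level" if "t \<ge> 0" for t using bound[OF that] potential_zero by simp
    \<comment> \<open>A value of \<open>t\<close> with \<open>t\<^sup>2/2 > ground_level\<close>.\<close>
    from this[of "sqrt (2 * \<bar>ground_level\<bar> + 2)"] show False by simp
  qed
  obtain t where t: "t > 0" "(\<lambda>x. t * w x) \<in> Nehari" using Nehari_projection[OF w(1) wpos] by blast
  have "scalar_energy (\<lambda>x. t * w x) \<le> t\<^sup>2 / 2 - potential (emb (\<lambda>x. t * w x))"
  proof -
    have "(grad_norm w)\<^sup>2 \<le> 1" using w(2) by (simp add: power_le_one)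
    hence "t\<^sup>2 * (grad_norm w)\<^sup>2 \<le> t\<^sup>2 * 1" by (intro mult_left_mono) auto
    thus ?thesis by (simp add: scalar_energy_def grad_norm_scale[OF w(1)] power_mult_distrib)
  qed
  also have "\<dots> \<le> ground_level" using bound t by simp
  finally have "scalar_energy (\<lambda>x. t * w x) = ground_level" using ground_level_le[OF t(2)] by linarith
  thus ?thesis using that t(2) by blast
qed

end

section \<open>Minimisers are critical points\<close>

context nonlinearity
begin

lemma NehariD:
  assumes "v \<in> Nehari"
  shows "v \<in> H10 \<Omega>" "grad_norm v > 0" "\<And>t. t \<ge> 0 \<Longrightarrow> scalar_energy (\<lambda>x. t * v x) \<le> scalar_energy v"
  using assms by (auto simp: Nehari_def)

text \<open>At a maximum along the ray the derivative in the direction of the ray vanishes.\<close>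

lemma Nehari_identity:
  assumes v: "v \<in> Nehari"
  shows "(grad_norm v)\<^sup>2 = (LINT x|dom. v x * g x (v x))"
proof -
  note vH = NehariD(1)[OF v]
  have le: "energy_derivative (emb v) (\<lambda>x. c *\<^sub>R emb v x) \<le> 0" if c: "\<bar>c\<bar> \<le> 1" for c
  proof (rule one_sided_derivative[OF emb_pair[OF vH] H10_pair_scale[OF emb_pair[OF vH]]])
    fix e :: real assume e: "e > 0"
    show "\<exists>d>0. \<forall>s. 0 < s \<and> s < d \<longrightarrow> energy \<Omega> F (\<lambda>x. emb v x + s *\<^sub>R c *\<^sub>R emb v x) - energy \<Omega> F (emb v) \<le> e * s"
    proof (intro exI[of _ "1::real"] conjI allI impI)
      fix s :: real assume s: "0 < s \<and> s < 1"
      have "\<bar>s * c\<bar> \<le> 1" using s c by (simp add: abs_mult mult_le_one)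
      hence "1 + s * c \<ge> 0" by (simp add: abs_le_iff)
      hence "scalar_energy (\<lambda>x. (1 + s * c) * v x) \<le> scalar_energy v" by (rule NehariD(3)[OF v])
      moreover have "(\<lambda>x. emb v x + s *\<^sub>R c *\<^sub>R emb v x) = emb (\<lambda>x. (1 + s * c) * v x)"
        by (simp add: algebra_simps)
      ultimately have "energy \<Omega> F (\<lambda>x. emb v x + s *\<^sub>R c *\<^sub>R emb v x) - energy \<Omega> F (emb v) \<le> 0"
        using energy_emb[OF vH] energy_emb[OF H10_scale(1)[OF vH]] by simp
      also have "0 \<le> e * s" using e s by simp
      finally show "energy \<Omega> F (\<lambda>x. emb v x + s *\<^sub>R c *\<^sub>R emb v x) - energy \<Omega> F (emb v) \<le> e * s" .
    qed simp
  qed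
  have "energy_derivative (emb v) (emb v) = 0"
    using le[of 1] le[of "-1"] energy_derivative_scale[OF emb_pair[OF vH] emb_pair[OF vH], of 1] energy_derivative_scale[OF emb_pair[OF vH] emb_pair[OF vH], of "-1"]
    by linarith
  thus ?thesis using energy_derivative_emb[OF vH emb_pair[OF vH]] by (simp add: dirichlet_form_self)
qed

text \<open>The converse of the preceding lemma: integrate \<open>G_scaling\<close>, whose linear term is
  exactly what the identity cancels. The inequality is strict because the integrand is positive
  wherever \<open>v\<close> is not zero.\<close>

lemma scalar_energy_max_of_identity:
  assumes v: "v \<in> H10 \<Omega>" and id: "(grad_norm v)\<^sup>2 = (LINT x|dom. v x * g x (v x))" and \<tau>: "\<tau> \<ge> 0"
  shows "scalar_energy (\<lambda>x. sqrt \<tau> * v x) \<le> scalar_energy v"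
    "grad_norm v > 0 \<Longrightarrow> \<tau> \<noteq> 1 \<Longrightarrow> scalar_energy (\<lambda>x. sqrt \<tau> * v x) < scalar_energy v"
proof -
  define R where "R x = G x (sqrt \<tau> * v x) - (G x (v x) + (\<tau> - 1) * (v x * g x (v x) / 2))" for x
  note i = G_integrable[OF H10_scale(1)[OF v, of "sqrt \<tau>"]] G_integrable[OF v] g_integrable[OF v v]
  have Ri: "integrable dom R" unfolding R_def using i by simp
  have R0: "AE x in dom. R x \<ge> 0"
  proof (rule AE_I2)
    fix x assume "x \<in> space dom" hence x: "x \<in> \<Omega>" by simp
    show "R x \<ge> 0" using G_scaling(1)[OF x \<tau>, of "v x"] by (simp add: R_def mult.commute[of "g x (v x)"])
  qed
  have LR: "(LINT x|dom. R x) = scalar_energy v - scalar_energy (\<lambda>x. sqrt \<tau> * v x)"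
  proof -
    have "(LINT x|dom. R x) = (LINT x|dom. G x (sqrt \<tau> * v x)) - ((LINT x|dom. G x (v x)) + (\<tau> - 1) * ((LINT x|dom. v x * g x (v x)) / 2))"
      unfolding R_def using i by simp
    also have "\<dots> = scalar_energy v - scalar_energy (\<lambda>x. sqrt \<tau> * v x)"
      using \<tau> by (simp add: scalar_energy_def potential_emb grad_norm_scale[OF v] power_mult_distrib id[symmetric] field_simps)
    finally show ?thesis .
  qed
  have "(LINT x|dom. R x) \<ge> 0" by (rule integral_nonneg_AE[OF R0])
  thus "scalar_energy (\<lambda>x. sqrt \<tau> * v x) \<le> scalar_energy v" using LR by linarith
  assume d: "grad_norm v > 0" and t1: "\<tau> \<noteq> 1"
  show "scalar_energy (\<lambda>x. sqrt \<tau> * v x) < scalar_energy v"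
  proof (rule ccontr)
    assume "\<not> ?thesis"
    hence "(LINT x|dom. R x) = 0" using LR \<open>(LINT x|dom. R x) \<ge> 0\<close> by linarith
    hence "AE x in dom. R x = 0" using integral_nonneg_eq_0_iff_AE[OF Ri R0] by simp
    moreover have "AE x in dom. x \<in> \<Omega>" using AE_space[of dom] by simp
    ultimately have "AE x in dom. v x = 0"
    proof eventually_elim
      case (elim x)
      show ?case using G_scaling(2)[OF elim(2) \<tau>, of "v x"] t1 elim(1) by (cases "v x = 0") (auto simp: R_def mult.commute)
    qed
    hence "grad_norm v = 0" by (rule AE_zero_imp_grad_norm_zero[OF v])
    thus False using d by simp
  qed
qed

text \<open>At the scalings \<open>1 - \<delta>\<close> and \<open>1 + \<delta>\<close> the energy on the ray of \<open>v\<close> is strictly below the level, and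
  this persists for nearby rays, as does a value close to the level at scaling \<open>1\<close>. By concavity the
  nearby ray can reach the level only between the two.\<close>

lemma perturbed_maximum:
  assumes v: "v \<in> Nehari" and min: "scalar_energy v = ground_level" and \<phi>: "\<phi> \<in> H10 \<Omega>" and \<delta>: "0 < \<delta>" "\<delta> < 1"
  shows "\<exists>\<tau> \<sigma>. \<bar>\<tau> - 1\<bar> \<le> \<delta> \<and> 0 < \<sigma> \<and> \<sigma> \<le> \<delta> \<and> scalar_energy (\<lambda>x. sqrt \<tau> * (v x + \<sigma> * \<phi> x)) \<ge> ground_level"
proof -
  note vH = NehariD[OF v] and id = Nehari_identity[OF v]
  have lt: "scalar_energy (\<lambda>x. sqrt \<tau> * v x) < ground_level" if "\<tau> \<ge> 0" "\<tau> \<noteq> 1" for \<tau>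
    using scalar_energy_max_of_identity(2)[OF vH(1) id that(1) vH(2) that(2)] min by simp
  define m where "m = max (scalar_energy (\<lambda>x. sqrt (1 - \<delta>) * v x)) (scalar_energy (\<lambda>x. sqrt (1 + \<delta>) * v x))"
  \<comment> \<open>A value separating the energies at \<open>1 - \<delta>\<close> and \<open>1 + \<delta>\<close> from the level.\<close>
  define k where "k = (m + ground_level) / 2"
  have m: "m < ground_level" using lt[of "1 - \<delta>"] lt[of "1 + \<delta>"] \<delta> by (simp add: m_def)
  have k: "m < k" "k < ground_level" using m by (auto simp: k_def)
  define s where "s n = \<delta> * inverse (real (Suc n))" for n
  have s0: "s \<longlonglongrightarrow> 0" unfolding s_def by (rule tendsto_mult_right_zero[OF LIMSEQ_inverse_real_of_nat])
  have s: "0 < s n" "s n \<le> \<delta>" for n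
  proof -
    show "0 < s n" using \<delta> by (simp add: s_def)
    have "inverse (real (Suc n)) \<le> 1" by (simp add: inverse_le_1_iff)
    thus "s n \<le> \<delta>" unfolding s_def using \<delta> by (intro mult_left_le) auto
  qed
  have Ilim: "(\<lambda>n. scalar_energy (\<lambda>x. sqrt \<tau> * (v x + s n * \<phi> x))) \<longlonglongrightarrow> scalar_energy (\<lambda>x. sqrt \<tau> * v x)" for \<tau>
    using scalar_energy_path_tendsto[OF H10_scale(1)[OF vH(1), of "sqrt \<tau>"] H10_scale(1)[OF \<phi>, of "sqrt \<tau>"] s0]
    by (simp add: algebra_simps)
  have ev1: "\<forall>\<^sub>F n in sequentially. scalar_energy (\<lambda>x. sqrt (1 - \<delta>) * (v x + s n * \<phi> x)) < k"
    using k by (intro order_tendstoD(2)[OF Ilim]) (simp add: m_def)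
  have ev2: "\<forall>\<^sub>F n in sequentially. scalar_energy (\<lambda>x. sqrt (1 + \<delta>) * (v x + s n * \<phi> x)) < k"
    using k by (intro order_tendstoD(2)[OF Ilim]) (simp add: m_def)
  have ev3: "\<forall>\<^sub>F n in sequentially. k < scalar_energy (\<lambda>x. sqrt 1 * (v x + s n * \<phi> x))"
    using k min by (intro order_tendstoD(1)[OF Ilim]) simp
  have ev4: "\<forall>\<^sub>F n in sequentially. 0 < (grad_norm (\<lambda>x. v x + s n * \<phi> x))\<^sup>2"
    using vH(2) by (intro order_tendstoD(1)[OF grad_norm_path_tendsto[OF vH(1) \<phi> s0]]) simp
  obtain n where n: "scalar_energy (\<lambda>x. sqrt (1 - \<delta>) * (v x + s n * \<phi> x)) < k" "scalar_energy (\<lambda>x. sqrt (1 + \<delta>) * (v x + s n * \<phi> x)) < k"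
    "k < scalar_energy (\<lambda>x. sqrt 1 * (v x + s n * \<phi> x))" "0 < (grad_norm (\<lambda>x. v x + s n * \<phi> x))\<^sup>2"
    using eventually_happens'[OF _ eventually_conj[OF ev1 eventually_conj[OF ev2 eventually_conj[OF ev3 ev4]]]] by auto
  define w where "w x = v x + s n * \<phi> x" for x
  have wH: "w \<in> H10 \<Omega>" unfolding w_def by (rule H10_path[OF vH(1) \<phi>])
  have "grad_norm w \<noteq> 0" using n(4) by (auto simp: w_def[abs_def])
  hence "grad_norm w > 0" using L2_norm_nonneg[of "wg w"] by linarith
  then obtain \<tau> where \<tau>: "\<tau> > 0" "scalar_energy (\<lambda>x. sqrt \<tau> * w x) \<ge> ground_level" using ground_level_scaling[OF wH] by blast
  have conc: "k < scalar_energy (\<lambda>x. sqrt ((1 - l) * 1 + l * \<tau>) * w x)" if l: "0 \<le> l" "l \<le> 1" for l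
  proof -
    have "k = (1 - l) * k + l * k" by (simp add: algebra_simps)
    also have "\<dots> < (1 - l) * scalar_energy (\<lambda>x. sqrt 1 * w x) + l * scalar_energy (\<lambda>x. sqrt \<tau> * w x)"
    proof (cases "l = 0")
      case True thus ?thesis using n(3) by (simp add: w_def)
    next
      case False
      have "(1 - l) * k \<le> (1 - l) * scalar_energy (\<lambda>x. sqrt 1 * w x)" using l n(3) by (intro mult_left_mono) (auto simp: w_def)
      moreover have "l * k < l * scalar_energy (\<lambda>x. sqrt \<tau> * w x)" using False l \<tau> k by (intro mult_strict_left_mono) auto
      ultimately show ?thesis by linarith
    qed
    also have "\<dots> \<le> scalar_energy (\<lambda>x. sqrt ((1 - l) * 1 + l * \<tau>) * w x)" using l \<tau> by (intro scalar_energy_concave[OF wH]) auto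
    finally show ?thesis .
  qed
  have "\<tau> \<le> 1 + \<delta>"
  proof (rule ccontr)
    assume c: "\<not> \<tau> \<le> 1 + \<delta>"
    \<comment> \<open>This weight makes \<open>1 + \<delta>\<close> a convex combination of \<open>1\<close> and \<open>\<tau>\<close>.\<close>
    define l where "l = \<delta> / (\<tau> - 1)"
    have l: "0 \<le> l" "l \<le> 1" "l * (\<tau> - 1) = \<delta>" using c \<delta> by (auto simp: l_def)
    have eq: "(1 - l) * 1 + l * \<tau> = 1 + \<delta>" using l(3) by (simp add: algebra_simps)
    show False using conc[OF l(1,2)] n(2) unfolding eq w_def by linarith
  qed
  moreover have "1 - \<delta> \<le> \<tau>"
  proof (rule ccontr)
    assume c: "\<not> 1 - \<delta> \<le> \<tau>"
    define l where "l = \<delta> / (1 - \<tau>)"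
    have l: "0 \<le> l" "l \<le> 1" "l * (1 - \<tau>) = \<delta>" using c \<delta> by (auto simp: l_def)
    have eq: "(1 - l) * 1 + l * \<tau> = 1 - \<delta>" using l(3) by (simp add: algebra_simps)
    show False using conc[OF l(1,2)] n(1) unfolding eq w_def by linarith
  qed
  ultimately have "\<bar>\<tau> - 1\<bar> \<le> \<delta>" by (simp add: abs_le_iff)
  thus ?thesis using \<tau> s by (intro exI[of _ \<tau>] exI[of _ "s n"]) (simp add: w_def)
qed

text \<open>Since \<open>sqrt \<tau> v\<close> has energy at most the level, the energy does not decrease from there to
  \<open>sqrt \<tau> (v + \<sigma> \<phi>)\<close>. Convexity of \<open>G x\<close> bounds the increment from above by its linear part plus the
  quadratic Dirichlet term.\<close>

lemma perturbation_inequality: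
  assumes v: "v \<in> Nehari" and min: "scalar_energy v = ground_level" and \<phi>: "\<phi> \<in> H10 \<Omega>"
    and \<tau>: "\<tau> > 0" and \<sigma>: "\<sigma> > 0" and ge: "scalar_energy (\<lambda>x. sqrt \<tau> * (v x + \<sigma> * \<phi> x)) \<ge> ground_level"
  shows "0 \<le> sqrt \<tau> * (dirichlet_form v \<phi> + \<sigma> * (grad_norm \<phi>)\<^sup>2 / 2) - (LINT x|dom. \<phi> x * g x (sqrt \<tau> * v x))"
proof -
  note vH = NehariD[OF v]
  let ?t = "sqrt \<tau>" and ?J = "LINT x|dom. \<phi> x * g x (sqrt \<tau> * v x)"
  have t: "?t > 0" "?t * ?t = \<tau>" using \<tau> by auto
  have tvH: "(\<lambda>x. ?t * v x) \<in> H10 \<Omega>" by (rule H10_scale(1)[OF vH(1)])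
  note wH = H10_path[OF vH(1) \<phi>, of \<sigma>]
  have "(LINT x|dom. G x (?t * v x) + ?t * \<sigma> * (\<phi> x * g x (?t * v x))) \<le> (LINT x|dom. G x (?t * (v x + \<sigma> * \<phi> x)))"
  proof (rule integral_mono)
    show "integrable dom (\<lambda>x. G x (?t * v x) + ?t * \<sigma> * (\<phi> x * g x (?t * v x)))"
      using G_integrable[OF tvH] g_integrable[OF tvH \<phi>] by simp
    show "integrable dom (\<lambda>x. G x (?t * (v x + \<sigma> * \<phi> x)))" by (rule G_integrable[OF H10_scale(1)[OF wH]])
    fix x assume "x \<in> space dom"
    thus "G x (?t * v x) + ?t * \<sigma> * (\<phi> x * g x (?t * v x)) \<le> G x (?t * (v x + \<sigma> * \<phi> x))"
      using G_convex[of x "?t * v x" "?t * (v x + \<sigma> * \<phi> x)"] by (simp add: algebra_simps)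
  qed
  hence Vle: "potential (emb (\<lambda>x. ?t * v x)) + ?t * \<sigma> * ?J \<le> potential (emb (\<lambda>x. ?t * (v x + \<sigma> * \<phi> x)))"
    using G_integrable[OF tvH] g_integrable[OF tvH \<phi>] by (simp add: potential_emb)
  have d1: "(grad_norm (\<lambda>x. ?t * (v x + \<sigma> * \<phi> x)))\<^sup>2 = \<tau> * ((grad_norm v)\<^sup>2 + 2 * \<sigma> * dirichlet_form v \<phi> + \<sigma>\<^sup>2 * (grad_norm \<phi>)\<^sup>2)"
    using \<tau> by (simp add: grad_norm_scale[OF wH] power_mult_distrib grad_norm_path_sq[OF vH(1) \<phi>])
  have d2: "(grad_norm (\<lambda>x. ?t * v x))\<^sup>2 = \<tau> * (grad_norm v)\<^sup>2"
    using \<tau> by (simp add: grad_norm_scale[OF vH(1)] power_mult_distrib)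
  have "scalar_energy (\<lambda>x. ?t * v x) \<le> ground_level" using vH(3)[of ?t] min t by simp
  hence "0 \<le> scalar_energy (\<lambda>x. ?t * (v x + \<sigma> * \<phi> x)) - scalar_energy (\<lambda>x. ?t * v x)" using ge by linarith
  also have "\<dots> \<le> \<tau> * \<sigma> * dirichlet_form v \<phi> + \<tau> * \<sigma>\<^sup>2 * (grad_norm \<phi>)\<^sup>2 / 2 - ?t * \<sigma> * ?J"
  proof -
    have "\<tau> * ((grad_norm v)\<^sup>2 + 2 * \<sigma> * dirichlet_form v \<phi> + \<sigma>\<^sup>2 * (grad_norm \<phi>)\<^sup>2) / 2 =
        \<tau> * (grad_norm v)\<^sup>2 / 2 + \<tau> * \<sigma> * dirichlet_form v \<phi> + \<tau> * \<sigma>\<^sup>2 * (grad_norm \<phi>)\<^sup>2 / 2"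
      by (simp add: field_simps)
    thus ?thesis using Vle unfolding scalar_energy_def d1 d2 by linarith
  qed
  also have "\<dots> = \<tau> * \<sigma> * (dirichlet_form v \<phi> + \<sigma> * (grad_norm \<phi>)\<^sup>2 / 2) - ?t * \<sigma> * ?J"
    by (simp add: algebra_simps power2_eq_square)
  also have "\<dots> = (?t * ?t) * \<sigma> * (dirichlet_form v \<phi> + \<sigma> * (grad_norm \<phi>)\<^sup>2 / 2) - ?t * \<sigma> * ?J"
    by (simp only: t(2))
  also have "\<dots> = (?t * \<sigma>) * (?t * (dirichlet_form v \<phi> + \<sigma> * (grad_norm \<phi>)\<^sup>2 / 2) - ?J)"
  proof -
    have "s * s * \<sigma> * X - s * \<sigma> * Y = (s * \<sigma>) * (s * X - Y)" for s X Y :: real by (simp add: algebra_simps)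
    thus ?thesis .
  qed
  finally have "0 \<le> (?t * \<sigma>) * (?t * (dirichlet_form v \<phi> + \<sigma> * (grad_norm \<phi>)\<^sup>2 / 2) - ?J)" .
  moreover have "?t * \<sigma> > 0" using t \<sigma> by simp
  ultimately show ?thesis by (metis linorder_not_less mult_pos_neg)
qed

text \<open>Let \<open>\<delta>\<close>, and with it \<open>\<sigma>\<close> and \<open>\<tau> - 1\<close>, tend to zero in \<open>perturbation_inequality\<close>.\<close>

lemma minimiser_one_sided:
  assumes v: "v \<in> Nehari" and min: "scalar_energy v = ground_level" and \<phi>: "\<phi> \<in> H10 \<Omega>"
  shows "(LINT x|dom. \<phi> x * g x (v x)) \<le> dirichlet_form v \<phi>"
proof -
  note vH = NehariD[OF v]
  define d where "d n = inverse (real (Suc (Suc n)))" for n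
  have d: "0 < d n" "d n < 1" "d n \<le> 1/2" for n by (auto simp: d_def field_simps)
  have d0: "d \<longlonglongrightarrow> 0" unfolding d_def using LIMSEQ_Suc[OF LIMSEQ_inverse_real_of_nat] by simp
  have "\<forall>n. \<exists>\<tau> \<sigma>. \<bar>\<tau> - 1\<bar> \<le> d n \<and> 0 < \<sigma> \<and> \<sigma> \<le> d n \<and> scalar_energy (\<lambda>x. sqrt \<tau> * (v x + \<sigma> * \<phi> x)) \<ge> ground_level"
    using perturbed_maximum[OF v min \<phi> d(1,2)] by blast
  from choice[OF this] obtain \<tau> where
    "\<forall>n. \<exists>\<sigma>. \<bar>\<tau> n - 1\<bar> \<le> d n \<and> 0 < \<sigma> \<and> \<sigma> \<le> d n \<and> scalar_energy (\<lambda>x. sqrt (\<tau> n) * (v x + \<sigma> * \<phi> x)) \<ge> ground_level" by blast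
  from choice[OF this] obtain \<sigma> where ts: "\<And>n. \<bar>\<tau> n - 1\<bar> \<le> d n" "\<And>n. 0 < \<sigma> n" "\<And>n. \<sigma> n \<le> d n"
    "\<And>n. scalar_energy (\<lambda>x. sqrt (\<tau> n) * (v x + \<sigma> n * \<phi> x)) \<ge> ground_level" by blast
  have \<tau>b: "\<tau> n > 0" "\<tau> n \<le> 4" for n using ts(1)[of n] d(3)[of n] by (auto simp: abs_le_iff)
  have \<sigma>0: "\<sigma> \<longlonglongrightarrow> 0"
    by (rule tendsto_sandwich[OF _ _ tendsto_const d0]) (use ts in \<open>auto simp: less_imp_le\<close>)
  have \<tau>1: "\<tau> \<longlonglongrightarrow> 1"
    by (rule LIM_zero_cancel, rule Lim_null_comparison[OF _ d0]) (use ts(1) in auto)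
  have sq: "(\<lambda>n. sqrt (\<tau> n)) \<longlonglongrightarrow> 1" using tendsto_real_sqrt[OF \<tau>1] by simp
  have sq2: "sqrt (\<tau> n) \<le> 2" for n using \<tau>b(2)[of n] by (intro real_le_lsqrt) auto
  have m: "v \<in> borel_measurable dom" "\<phi> \<in> borel_measurable dom" using L2D(1)[OF H10D(1)] vH(1) \<phi> by auto
  have "(\<lambda>n. LINT x|dom. \<phi> x * g x (sqrt (\<tau> n) * v x)) \<longlonglongrightarrow> (LINT x|dom. \<phi> x * g x (v x))"
  proof (rule integral_dominated_convergence[where w="\<lambda>x. a * ((1 + norm (2 *\<^sub>R emb v x) powr (p - 1)) * norm (emb \<phi> x))"])
    have L: "in_Lp (\<lambda>x. 2 *\<^sub>R emb v x)" by (intro in_Lp_scaleR H10_pair_in_Lp emb_pair vH(1))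
    have M[measurable]: "(\<lambda>x. norm (2 *\<^sub>R emb v x)) \<in> borel_measurable dom"
      using in_LpD(1)[OF L] by measurable
    have W: "integrable dom (\<lambda>x. (1 + norm (2 *\<^sub>R emb v x) powr (p - 1)) powr p')"
      by (rule weight_integrable[OF M _ in_LpD(2)[OF L]]) simp
    have A: "(\<lambda>x. 1 + norm (2 *\<^sub>R emb v x) powr (p - 1)) \<in> borel_measurable dom" by measurable
    show "integrable dom (\<lambda>x. a * ((1 + norm (2 *\<^sub>R emb v x) powr (p - 1)) * norm (emb \<phi> x)))"
      by (intro integrable_mult_right Holder_weight(1)[OF H10_pair_in_Lp[OF emb_pair[OF \<phi>]] A _ W]) simp
    show "(\<lambda>x. \<phi> x * g x (v x)) \<in> borel_measurable dom"
      by (rule borel_measurable_integrable[OF g_integrable[OF vH(1) \<phi>]])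
    show "(\<lambda>x. \<phi> x * g x (sqrt (\<tau> n) * v x)) \<in> borel_measurable dom" for n
      by (rule borel_measurable_integrable[OF g_integrable[OF H10_scale(1)[OF vH(1)] \<phi>]])
    show "AE x in dom. (\<lambda>n. \<phi> x * g x (sqrt (\<tau> n) * v x)) \<longlonglongrightarrow> \<phi> x * g x (v x)"
    proof (rule AE_I2)
      fix x assume "x \<in> space dom" hence x: "x \<in> \<Omega>" by simp
      have "isCont (g x) (v x)"
        by (rule continuous_on_interior[OF g_continuous[OF x, of UNIV]]) simp
      moreover have "(\<lambda>n. sqrt (\<tau> n) * v x) \<longlonglongrightarrow> v x" using tendsto_mult[OF sq tendsto_const[of "v x"]] by simp
      ultimately have "(\<lambda>n. g x (sqrt (\<tau> n) * v x)) \<longlonglongrightarrow> g x (v x)" by (rule isCont_tendsto_compose)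
      thus "(\<lambda>n. \<phi> x * g x (sqrt (\<tau> n) * v x)) \<longlonglongrightarrow> \<phi> x * g x (v x)" by (intro tendsto_mult tendsto_const)
    qed
    show "AE x in dom. norm (\<phi> x * g x (sqrt (\<tau> n) * v x)) \<le> a * ((1 + norm (2 *\<^sub>R emb v x) powr (p - 1)) * norm (emb \<phi> x))" for n
    proof (rule AE_I2)
      fix x assume "x \<in> space dom" hence x: "x \<in> \<Omega>" by simp
      have "\<bar>g x (sqrt (\<tau> n) * v x)\<bar> = norm (gradient (F x) (sqrt (\<tau> n) * v x, 0))"
        by (simp add: gradient_on_axis[OF x] norm_pair_zero)
      also have "\<dots> \<le> a * (1 + \<bar>sqrt (\<tau> n) * v x\<bar> powr (p - 1))"
        using growth[OF x, of "(sqrt (\<tau> n) * v x, 0)"] by (simp add: norm_pair_zero)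
      also have "\<dots> \<le> a * (1 + \<bar>2 * v x\<bar> powr (p - 1))"
        using a_pos p_gt sq2[of n] \<tau>b(1)[of n]
        by (intro mult_left_mono add_left_mono powr_mono2) (auto simp: abs_mult intro!: mult_right_mono)
      finally have "\<bar>\<phi> x\<bar> * \<bar>g x (sqrt (\<tau> n) * v x)\<bar> \<le> \<bar>\<phi> x\<bar> * (a * (1 + \<bar>2 * v x\<bar> powr (p - 1)))"
        by (rule mult_left_mono) simp
      thus "norm (\<phi> x * g x (sqrt (\<tau> n) * v x)) \<le> a * ((1 + norm (2 *\<^sub>R emb v x) powr (p - 1)) * norm (emb \<phi> x))"
        by (simp add: norm_pair_zero abs_mult mult_ac)
    qed
  qed
  hence "(\<lambda>n. sqrt (\<tau> n) * (dirichlet_form v \<phi> + \<sigma> n * (grad_norm \<phi>)\<^sup>2 / 2) - (LINT x|dom. \<phi> x * g x (sqrt (\<tau> n) * v x)))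
     \<longlonglongrightarrow> 1 * (dirichlet_form v \<phi> + 0 * (grad_norm \<phi>)\<^sup>2 / 2) - (LINT x|dom. \<phi> x * g x (v x))"
    by (intro tendsto_intros sq \<sigma>0) auto
  moreover have "0 \<le> sqrt (\<tau> n) * (dirichlet_form v \<phi> + \<sigma> n * (grad_norm \<phi>)\<^sup>2 / 2) - (LINT x|dom. \<phi> x * g x (sqrt (\<tau> n) * v x))" for n
    by (rule perturbation_inequality[OF v min \<phi> \<tau>b(1) ts(2) ts(4)])
  ultimately have "0 \<le> 1 * (dirichlet_form v \<phi> + 0 * (grad_norm \<phi>)\<^sup>2 / 2) - (LINT x|dom. \<phi> x * g x (v x))"
    by (intro LIMSEQ_le_const) auto
  thus ?thesis by simp
qed

theorem minimiser_solution:
  assumes v: "v \<in> Nehari" and min: "scalar_energy v = ground_level"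
  shows "nontrivial_solution \<Omega> F (emb v)"
proof -
  note vH = NehariD[OF v]
  have eq: "(LINT x|dom. \<phi> x * g x (v x)) = dirichlet_form v \<phi>" if \<phi>: "\<phi> \<in> H10 \<Omega>" for \<phi>
  proof (rule antisym)
    show "(LINT x|dom. \<phi> x * g x (v x)) \<le> dirichlet_form v \<phi>" by (rule minimiser_one_sided[OF assms \<phi>])
    show "dirichlet_form v \<phi> \<le> (LINT x|dom. \<phi> x * g x (v x))"
      using minimiser_one_sided[OF assms H10_scale(1)[OF \<phi>, of "-1"]] dirichlet_form_scale[OF vH(1) \<phi>, of "-1"] by simp
  qed
  have "solution \<Omega> F (emb v)"
    by (rule solutionI[OF emb_pair[OF vH(1)]]) (simp add: energy_derivative_emb[OF vH(1)] eq[OF H10_pairD(1)])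
  moreover have "\<not> (AE x in dom. emb v x = 0)"
  proof
    assume "AE x in dom. emb v x = 0"
    hence "AE x in dom. v x = 0" by eventually_elim (simp add: zero_prod_def)
    thus False using AE_zero_imp_grad_norm_zero[OF vH(1)] vH(2) by simp
  qed
  ultimately show ?thesis by (simp add: nontrivial_solution_def)
qed

section \<open>Comparison with all solutions\<close>

text \<open>Testing with the second component shows that it vanishes; testing with the first component
  gives the identity that makes it the maximum of its ray, and every ray reaches the level.\<close>

theorem solution_energy_ge_ground_level:
  assumes w: "nontrivial_solution \<Omega> F w"
  shows "ground_level \<le> energy \<Omega> F w"
proof -
  have sol: "solution \<Omega> F w" and nt: "\<not> (AE x in dom. w x = 0)" using w by (auto simp: nontrivial_solution_def)
  have wp: "w \<in> H10_pair \<Omega>" using sol by (simp add: solution_def)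
  define w1 where "w1 x = fst (w x)" for x
  define w2 where "w2 x = snd (w x)" for x
  have H: "w1 \<in> H10 \<Omega>" "w2 \<in> H10 \<Omega>" using H10_pairD[OF wp] by (auto simp: w1_def[abs_def] w2_def[abs_def])
  have h2: "(\<lambda>x. (0, w2 x)) \<in> H10_pair \<Omega>" using H H10_zero by (simp add: H10_pair_def)
  have "energy_derivative w (\<lambda>x. (0, w2 x)) = 0" by (rule solution_energy_derivative[OF sol h2])
  moreover have "dirichlet_form w1 (\<lambda>x. 0) = 0" using dirichlet_form_bound[OF H(1) H10_zero(1)] H10_zero(2) by simp
  ultimately have "(grad_norm w2)\<^sup>2 + (LINT x|dom. (0, w2 x) \<bullet> gradient (F x) (w x)) = 0"
    by (simp add: energy_derivative_def w1_def[abs_def, symmetric] w2_def[abs_def, symmetric] dirichlet_form_self)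
  moreover have "(LINT x|dom. (0, w2 x) \<bullet> gradient (F x) (w x)) \<ge> 0"
  proof (rule Bochner_Integration.integral_nonneg)
    fix x assume "x \<in> space dom" hence x: "x \<in> \<Omega>" by simp
    \<comment> \<open>The sign condition for the vectors \<open>w x\<close> and \<open>(0, w2 x)\<close>, whose inner product is \<open>(w2 x)\<^sup>2\<close>.\<close>
    have "((0, w2 x) \<bullet> gradient (F x) (w x)) * (w2 x)\<^sup>2 \<ge> 0"
      using sign[OF x, of "(0, w2 x)" "w x"] by (simp add: inner_prod_def w2_def power2_eq_square)
    thus "(0, w2 x) \<bullet> gradient (F x) (w x) \<ge> 0" by (cases "w2 x = 0") (auto simp: zero_le_mult_iff inner_prod_def)
  qed
  ultimately have dn2: "grad_norm w2 = 0" using zero_le_power2[of "grad_norm w2"] by (simp add: add_nonneg_eq_0_iff)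
  hence w20: "AE x in dom. w2 x = 0" by (rule grad_norm_zero_imp[OF H(2)])
  hence we: "AE x in dom. w x = emb w1 x" by eventually_elim (simp add: w1_def w2_def prod_eq_iff)
  have wm: "w \<in> borel_measurable dom" by (rule in_LpD(1)[OF H10_pair_in_Lp[OF wp]])
  have em: "emb w1 \<in> borel_measurable dom" by (rule in_LpD(1)[OF H10_pair_in_Lp[OF emb_pair[OF H(1)]]])
  have "potential w = potential (emb w1)"
    unfolding potential_def
  proof (rule integral_cong_AE)
    show "AE x in dom. F x (w x) = F x (emb w1 x)" using we by eventually_elim simp
  qed (intro F_measurable wm em)+
  hence E: "energy \<Omega> F w = scalar_energy w1"
    using energy_eq[OF wp] dn2 by (simp add: scalar_energy_def w1_def[abs_def, symmetric] w2_def[abs_def, symmetric])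
  have "energy_derivative w (emb w1) = 0" by (rule solution_energy_derivative[OF sol emb_pair[OF H(1)]])
  moreover have "dirichlet_form w2 (\<lambda>x. 0) = 0" using dirichlet_form_bound[OF H(2) H10_zero(1)] H10_zero(2) by simp
  ultimately have "(grad_norm w1)\<^sup>2 = (LINT x|dom. emb w1 x \<bullet> gradient (F x) (w x))"
    by (simp add: energy_derivative_def w1_def[abs_def, symmetric] w2_def[abs_def, symmetric] dirichlet_form_self)
  also have "\<dots> = (LINT x|dom. emb w1 x \<bullet> gradient (F x) (emb w1 x))"
  proof (rule integral_cong_AE)
    show "AE x in dom. emb w1 x \<bullet> gradient (F x) (w x) = emb w1 x \<bullet> gradient (F x) (emb w1 x)"
      using we by eventually_elim simp
  qed (intro borel_measurable_inner em gradient_measurable wm)+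
  also have "\<dots> = (LINT x|dom. w1 x * g x (w1 x))" by (simp add: g_integral_eq)
  finally have id: "(grad_norm w1)\<^sup>2 = (LINT x|dom. w1 x * g x (w1 x))" .
  have "grad_norm w1 \<noteq> 0"
  proof
    assume "grad_norm w1 = 0"
    hence "AE x in dom. w1 x = 0" by (rule grad_norm_zero_imp[OF H(1)])
    with we have "AE x in dom. w x = 0" by eventually_elim (simp add: zero_prod_def)
    thus False using nt by blast
  qed
  hence "grad_norm w1 > 0" using L2_norm_nonneg[of "wg w1"] by linarith
  then obtain \<tau> where "\<tau> > 0" "scalar_energy (\<lambda>x. sqrt \<tau> * w1 x) \<ge> ground_level" using ground_level_scaling[OF H(1)] by blast
  thus ?thesis using scalar_energy_max_of_identity(1)[OF H(1) id, of \<tau>] E by simp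
qed

theorem ground_state_exists:
  assumes "\<Omega> \<noteq> {}" shows "\<exists>z. ground_state_solution \<Omega> F z"
proof -
  obtain v where v: "v \<in> Nehari" "scalar_energy v = ground_level" using minimiser_exists[OF assms] by blast
  have "energy \<Omega> F (emb v) = ground_level" using energy_emb[OF NehariD(1)[OF v(1)]] v(2) by simp
  hence "ground_state_solution \<Omega> F (emb v)"
    using minimiser_solution[OF v] solution_energy_ge_ground_level by (simp add: ground_state_solution_def)
  thus ?thesis by blast
qed

end

section \<open>The ground state theorem\<close>

text \<open>For \<open>DIM \<le> 2\<close> the defect is at most \<open>1 - 2/p\<close>.\<close>

lemma subcritical_defect:
  assumes "2 < p" "ereal p < critical_exponent DIM('a::euclidean_space)"
  shows "sobolev_defect TYPE('a) p < 1"
proof (cases "DIM('a) \<ge> 3")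
  case True
  let ?N = "real DIM('a)"
  have N: "?N > 2" using True by simp
  have "p < 2 * ?N / (?N - 2)" using assms(2) True by (simp add: critical_exponent_def)
  hence "p * (?N - 2) < 2 * ?N" using N by (simp add: pos_less_divide_eq)
  thus ?thesis using assms(1) by (simp add: sobolev_defect_def field_simps)
next
  case False
  let ?N = "real DIM('a)"
  have "?N \<le> 2" using False by simp
  hence "?N * (1/2 - 1/p) \<le> 2 * (1/2 - 1/p)" using assms(1) by (intro mult_right_mono) (auto simp: field_simps)
  also have "\<dots> < 1" using assms(1) by simp
  finally show ?thesis by (simp add: sobolev_defect_def)
qed

theorem theorem1:
  fixes \<Omega> :: "'a::euclidean_space set"
    and F :: "'a \<Rightarrow> real \<times> real \<Rightarrow> real"
  assumes domain: "bounded_smooth_domain \<Omega>"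
    and F1: "C1_up_to_boundary (\<Omega> \<times> UNIV) (\<lambda>(x, u). F x u)"
            "\<forall>x\<in>closure \<Omega>. F x 0 = 0"
    and F2: "\<exists>a p. a > 0 \<and> 2 < p \<and> ereal p < critical_exponent DIM('a) \<and>
               (\<forall>x\<in>\<Omega>. \<forall>u. norm (gradient (F x) u) \<le> a * (1 + norm u powr (p - 1)))"
    and F3: "uniform_limit (closure \<Omega>) (\<lambda>u x. F x u / (norm u)\<^sup>2) (\<lambda>x. 0) (at 0)"
    and F4: "\<forall>K. \<forall>\<^sub>F u in at_infinity. \<forall>x\<in>closure \<Omega>. F x u / (norm u)\<^sup>2 \<ge> K"
    and F5: "\<forall>x\<in>closure \<Omega>. \<forall>u. u \<noteq> 0 \<longrightarrow> F x u > 0 \<and> u \<bullet> gradient (F x) u > 2 * F x u"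
    and F6: "\<forall>x\<in>closure \<Omega>. \<forall>u v. (v \<bullet> gradient (F x) u) * (u \<bullet> v) \<ge> 0"
    and F7: "\<forall>x\<in>closure \<Omega>. \<forall>u v. norm u = norm v \<longrightarrow>
               F x u = F x v \<and> v \<bullet> gradient (F x) u \<le> u \<bullet> gradient (F x) u \<and>
               (u \<noteq> v \<longrightarrow> v \<bullet> gradient (F x) u < u \<bullet> gradient (F x) u)"
    and F8: "\<forall>x\<in>closure \<Omega>. \<forall>u v. norm u \<noteq> norm v \<and> u \<bullet> v \<noteq> 0 \<longrightarrow>
               v \<bullet> gradient (F x) u \<noteq> u \<bullet> gradient (F x) v"
  shows "\<exists>z. ground_state_solution \<Omega> F z"
proof -
  have cl: "x \<in> closure \<Omega>" if "x \<in> \<Omega>" for x using that closure_subset by blast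
  have \<Omega>: "open \<Omega>" "bounded \<Omega>" "\<Omega> \<noteq> {}" using domain by (auto simp: bounded_smooth_domain_def)
  obtain a p where ap: "a > 0" "2 < p" "ereal p < critical_exponent DIM('a)"
    "\<And>x u. x \<in> \<Omega> \<Longrightarrow> norm (gradient (F x) u) \<le> a * (1 + norm u powr (p - 1))" using F2 by blast
  have zero: "F x 0 = 0" if "x \<in> \<Omega>" for x using F1(2) cl[OF that] by blast
  have pos: "F x u \<ge> 0" if "x \<in> \<Omega>" for x u
  proof (cases "u = 0")
    case False
    hence "F x u > 0" using F5 cl[OF that] by blast
    thus ?thesis by simp
  qed (simp add: zero[OF that])
  have small: "\<exists>d>0. \<forall>x\<in>\<Omega>. \<forall>u. norm u < d \<longrightarrow> F x u \<le> e * (norm u)\<^sup>2" if e: "e > 0" for e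
  proof -
    have "\<forall>\<^sub>F u in at 0. \<forall>x\<in>closure \<Omega>. dist (F x u / (norm u)\<^sup>2) 0 < e"
      using F3 e by (simp add: uniform_limit_iff)
    then obtain d where d: "d > 0" "\<And>u x. u \<noteq> 0 \<Longrightarrow> norm u < d \<Longrightarrow> x \<in> closure \<Omega> \<Longrightarrow> dist (F x u / (norm u)\<^sup>2) 0 < e"
      unfolding eventually_at by auto
    have "F x u \<le> e * (norm u)\<^sup>2" if "x \<in> \<Omega>" "norm u < d" for x u
    proof (cases "u = 0")
      case False
      have "\<bar>F x u / (norm u)\<^sup>2\<bar> < e"
        using d(2)[OF False that(2) cl[OF that(1)]] by (simp only: dist_real_def diff_zero)
      hence "F x u / (norm u)\<^sup>2 < e" by linarith
      thus ?thesis using False by (simp add: pos_divide_less_eq less_imp_le)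
    qed (simp add: zero[OF that(1)])
    thus ?thesis using d(1) by blast
  qed
  have large: "\<exists>C. \<forall>x\<in>\<Omega>. \<forall>u. F x u \<ge> K * (norm u)\<^sup>2 - C" for K
  proof -
    obtain b where b: "\<And>u x. b \<le> norm u \<Longrightarrow> x \<in> closure \<Omega> \<Longrightarrow> F x u / (norm u)\<^sup>2 \<ge> K"
      using F4 unfolding eventually_at_infinity by blast
    have "F x u \<ge> K * (norm u)\<^sup>2 - \<bar>K\<bar> * b\<^sup>2" if x: "x \<in> \<Omega>" for x u
    proof (cases "b \<le> norm u")
      case True
      have "K * (norm u)\<^sup>2 \<le> F x u"
        using b[OF True cl[OF x]] zero[OF x] by (cases "u = 0") (auto simp: pos_le_divide_eq)
      moreover have "\<bar>K\<bar> * b\<^sup>2 \<ge> 0" by simp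
      ultimately show ?thesis by linarith
    next
      case False
      have "(norm u)\<^sup>2 \<le> b\<^sup>2" using False by (intro power_mono) auto
      hence "K * (norm u)\<^sup>2 \<le> \<bar>K\<bar> * b\<^sup>2" by (intro mult_mono) auto
      thus ?thesis using pos[OF x, of u] by linarith
    qed
    thus ?thesis by blast
  qed
  interpret nonlinearity \<Omega> F a p
  proof
    show "open \<Omega>" "bounded \<Omega>" by (rule \<Omega>)+
    show "C1_up_to_boundary (\<Omega> \<times> UNIV) (\<lambda>(x, u). F x u)" by (rule F1(1))
    show "0 < a" "2 < p" by (rule ap)+
    show "sobolev_defect TYPE('a) p < 1" by (rule subcritical_defect[OF ap(2,3)])
    fix x u v K assume x: "x \<in> \<Omega>"
    show "F x 0 = 0" by (rule zero[OF x])
    show "norm (gradient (F x) u) \<le> a * (1 + norm u powr (p - 1))" by (rule ap(4)[OF x])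
    show "F x u > 0" "u \<bullet> gradient (F x) u > 2 * F x u" if "u \<noteq> 0" using F5 cl[OF x] that by blast+
    show "(v \<bullet> gradient (F x) u) * (u \<bullet> v) \<ge> 0" using F6 cl[OF x] by blast
    show "F x u = F x v" if "norm u = norm v" using F7 cl[OF x] that by blast
    show "v \<bullet> gradient (F x) u \<noteq> u \<bullet> gradient (F x) v" if "norm u \<noteq> norm v" "u \<bullet> v \<noteq> 0"
      using F8 cl[OF x] that by blast
  qed (rule small large, assumption?)+
  show ?thesis by (rule ground_state_exists[OF \<Omega>(3)])
qed

end
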